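(* Let $k$ be a field, let $S = k[[x,y,z]]$ and $R = k[[x,y,z]]/(z^2-xy)$, and let $M$ be the $R$-module that is the cokernel of the map $R^4 \to R^2$ given by the matrix \[ \begin{pmatrix} x & 0 & z & y \\ y & x & y & 0 \end{pmatrix}. \] Then $M$ is Serre liftable to $S$ (along the quotient map $S \to R$), but $M$ does not lift to any regular ring; that is, for every regular local ring $Q$ and every surjective ring homomorphism $Q \to R$, there is no $Q$-module that is a lift of $M$ along $Q\to R$.
   Context: All rings are (commutative) noetherian local rings. Let $Q$ be a regular local ring with a surjection $Q \to R$ onto a local ring $R$. Lift: a $Q$-module $L$ is a lift of an $R$-module $M$ if $L\otimes_Q R \cong M$ as $R$-modules and $\mathrm{Tor}_i^Q(L,R)=0$ for all $i>0$. Serre lift: a finitely generated $Q$-module $L$ is a Serre lift of an $R$-module $M$ if $M \cong L\otimes_Q R$ and $\dim Q - \dim L = \dim R - \dim M$. An $R$-module admitting a Serre lift over $Q$ is said to be Serre liftable to $Q$. *)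

theory Defs
  imports
    "HOL-Algebra.Module"
    "HOL-Algebra.QuotRing"
    "HOL-Algebra.Ring_Divisibility"
    "HOL-Algebra.Algebraic_Closure_Type"
    "HOL-Library.Extended_Real"
    "HOL-Computational_Algebra.Formal_Power_Series"
begin

section \<open>Modules\<close>

text \<open>
  The record type \<open>('a, 'b) module\<close> extends \<open>'b ring\<close>, so a module carries two fields
  (\<open>mult\<close> and \<open>one\<close>) without meaning; the locale \<open>module\<close> ignores them, and they are left
  undefined below.
\<close>

definition ring_module :: "('a, 'm) ring_scheme \<Rightarrow> ('a, 'a) module" where
  "ring_module R =
     \<lparr>carrier = carrier R, monoid.mult = undefined, one = undefined,
      zero = \<zero>\<^bsub>R\<^esub>, add = (\<lambda>x y. x \<oplus>\<^bsub>R\<^esub> y), module.smult = (\<lambda>a x. a \<otimes>\<^bsub>R\<^esub> x)\<rparr>"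

definition module_span ::
    "('a, 'm) ring_scheme \<Rightarrow> ('a, 'b, 'n) module_scheme \<Rightarrow> 'b set \<Rightarrow> 'b set" where
  "module_span R M A = \<Inter>{H. submodule H R M \<and> A \<subseteq> H}"

definition fin_gen_module ::
    "('a, 'm) ring_scheme \<Rightarrow> ('a, 'b, 'n) module_scheme \<Rightarrow> bool" where
  "fin_gen_module R M \<longleftrightarrow> (\<exists>A \<subseteq> carrier M. finite A \<and> module_span R M A = carrier M)"

text \<open>The scalar multiple of a coset is enlarged by \<open>H\<close>, since elementwise multiplication need
  not give a full coset (for instance \<open>0 (x + H)\<close> must be \<open>H\<close>).\<close>

definition quot_module :: "('a, 'b, 'n) module_scheme \<Rightarrow> 'b set \<Rightarrow> ('a, 'b set) module" where
  "quot_module M H =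
     \<lparr>carrier = a_rcosets\<^bsub>M\<^esub> H, monoid.mult = undefined, one = undefined,
      zero = H, add = set_add M, module.smult = (\<lambda>a C. \<Union>x\<in>C. H +>\<^bsub>M\<^esub> (a \<odot>\<^bsub>M\<^esub> x))\<rparr>"

definition module_hom ::
    "('a, 'm) ring_scheme \<Rightarrow> ('a, 'b, 'n) module_scheme \<Rightarrow> ('a, 'c, 'p) module_scheme \<Rightarrow>
      ('b \<Rightarrow> 'c) set" where
  "module_hom R M N =
     {f \<in> carrier M \<rightarrow> carrier N.
        (\<forall>x \<in> carrier M. \<forall>y \<in> carrier M. f (x \<oplus>\<^bsub>M\<^esub> y) = f x \<oplus>\<^bsub>N\<^esub> f y) \<and>
        (\<forall>a \<in> carrier R. \<forall>x \<in> carrier M. f (a \<odot>\<^bsub>M\<^esub> x) = a \<odot>\<^bsub>N\<^esub> f x)}"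

definition module_isomorphic ::
    "('a, 'm) ring_scheme \<Rightarrow> ('a, 'b, 'n) module_scheme \<Rightarrow> ('a, 'c, 'p) module_scheme \<Rightarrow>
      bool" where
  "module_isomorphic R M N \<longleftrightarrow> (\<exists>f \<in> module_hom R M N. bij_betw f (carrier M) (carrier N))"

text \<open>The free module on a set \<open>B\<close>: finitely supported functions, equal to zero off \<open>B\<close>.\<close>

definition free_module :: "('a, 'm) ring_scheme \<Rightarrow> 'b set \<Rightarrow> ('a, 'b \<Rightarrow> 'a) module" where
  "free_module R B =
     \<lparr>carrier = {f. range f \<subseteq> carrier R \<and> finite {b. f b \<noteq> \<zero>\<^bsub>R\<^esub>} \<and> {b. f b \<noteq> \<zero>\<^bsub>R\<^esub>} \<subseteq> B},
      monoid.mult = undefined, one = undefined,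
      zero = (\<lambda>_. \<zero>\<^bsub>R\<^esub>), add = (\<lambda>f g b. f b \<oplus>\<^bsub>R\<^esub> g b), module.smult = (\<lambda>a f b. a \<otimes>\<^bsub>R\<^esub> f b)\<rparr>"

definition basis_vec :: "('a, 'm) ring_scheme \<Rightarrow> 'b \<Rightarrow> 'b \<Rightarrow> 'a" where
  "basis_vec R b = (\<lambda>c. if c = b then \<one>\<^bsub>R\<^esub> else \<zero>\<^bsub>R\<^esub>)"

text \<open>The linear map out of a free module over \<open>R\<close> that sends the basis element \<open>b\<close> to \<open>h b\<close>.\<close>

definition lin_ext ::
    "('a, 'm) ring_scheme \<Rightarrow> ('a, 'c, 'n) module_scheme \<Rightarrow> ('b \<Rightarrow> 'c) \<Rightarrow> ('b \<Rightarrow> 'a) \<Rightarrow> 'c" where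
  "lin_ext R M h f = (\<Oplus>\<^bsub>M\<^esub> b \<in> {b. f b \<noteq> \<zero>\<^bsub>R\<^esub>}. f b \<odot>\<^bsub>M\<^esub> h b)"

text \<open>The cokernel of the map \<open>R\<^sup>n \<rightarrow> R\<^sup>m\<close>, \<open>v \<mapsto> A v\<close>, for an \<open>m\<close> by \<open>n\<close> matrix \<open>A\<close>.\<close>

definition matrix_coker ::
    "('a, 'm) ring_scheme \<Rightarrow> nat \<Rightarrow> nat \<Rightarrow> (nat \<Rightarrow> nat \<Rightarrow> 'a) \<Rightarrow> ('a, (nat \<Rightarrow> 'a) set) module" where
  "matrix_coker R m n A =
     quot_module (free_module R {..<m})
       ((\<lambda>v i. if i < m then \<Oplus>\<^bsub>R\<^esub> j \<in> {..<n}. A i j \<otimes>\<^bsub>R\<^esub> v j else \<zero>\<^bsub>R\<^esub>)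
          ` carrier (free_module R {..<n}))"


section \<open>Krull dimension and regular local rings\<close>

text \<open>The value lies in \<open>ereal\<close>, so that the zero ring and the zero module have dimension
  \<open>-\<infinity>\<close> (the supremum of the empty set) and differences of dimensions are not truncated.\<close>

definition krull_dim :: "('a, 'm) ring_scheme \<Rightarrow> ereal" where
  "krull_dim R =
     Sup {ereal (real n) | n. \<exists>P. (\<forall>i\<le>n. primeideal (P i) R) \<and> (\<forall>i<n. P i \<subset> P (Suc i))}"

definition annihilator ::
    "('a, 'm) ring_scheme \<Rightarrow> ('a, 'b, 'n) module_scheme \<Rightarrow> 'a set" where
  "annihilator R M = {a \<in> carrier R. \<forall>x \<in> carrier M. a \<odot>\<^bsub>M\<^esub> x = \<zero>\<^bsub>M\<^esub>}"

definition module_dim ::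
    "('a, 'm) ring_scheme \<Rightarrow> ('a, 'b, 'n) module_scheme \<Rightarrow> ereal" where
  "module_dim R M = krull_dim (R Quot annihilator R M)"

definition noetherian_local_ring :: "('a, 'm) ring_scheme \<Rightarrow> bool" where
  "noetherian_local_ring R \<longleftrightarrow> cring R \<and> noetherian_ring R \<and> (\<exists>!I. maximalideal I R)"

definition regular_local_ring :: "('a, 'm) ring_scheme \<Rightarrow> bool" where
  "regular_local_ring R \<longleftrightarrow> noetherian_local_ring R \<and>
     (\<exists>A \<subseteq> carrier R. finite A \<and> maximalideal (Idl\<^bsub>R\<^esub> A) R \<and> ereal (real (card A)) = krull_dim R)"


section \<open>Tensor products\<close>

text \<open>
  Let \<open>\<phi> : Q \<rightarrow> R\<close> be a homomorphism of commutative rings, \<open>L\<close> a \<open>Q\<close>-module and \<open>N\<close> an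
  \<open>R\<close>-module, also viewed as a \<open>Q\<close>-module along \<open>\<phi>\<close>. The tensor product \<open>L \<otimes>\<^sub>Q N\<close> with
  its \<open>R\<close>-module structure coming from \<open>N\<close> is the free \<open>R\<close>-module on symbols \<open>[l, n]\<close>
  modulo biadditivity, \<open>Q\<close>-balancedness \<open>[q l, n] = [l, \<phi>(q) n]\<close> and
  \<open>[l, r n] = r [l, n]\<close>. For \<open>R = Q\<close> and \<open>\<phi> = id\<close> this is the usual tensor product of
  \<open>Q\<close>-modules, and for \<open>N = R\<close> it is the base change of \<open>L\<close> along \<open>\<phi>\<close>.
\<close>

definition tensor_free ::
    "('r, 'm) ring_scheme \<Rightarrow> ('q, 'l, 'n) module_scheme \<Rightarrow> ('r, 'b, 'p) module_scheme \<Rightarrow>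
      ('r, 'l \<times> 'b \<Rightarrow> 'r) module" where
  "tensor_free R L N = free_module R (carrier L \<times> carrier N)"

definition tensor_relators ::
    "('q, 'h) ring_scheme \<Rightarrow> ('r, 'm) ring_scheme \<Rightarrow> ('q \<Rightarrow> 'r) \<Rightarrow>
      ('q, 'l, 'n) module_scheme \<Rightarrow> ('r, 'b, 'p) module_scheme \<Rightarrow> ('l \<times> 'b \<Rightarrow> 'r) set" where
  "tensor_relators Q R \<phi> L N =
     (let F = tensor_free R L N; e = (\<lambda>l n. basis_vec R (l, n)) in
       {e (l \<oplus>\<^bsub>L\<^esub> l') n \<ominus>\<^bsub>F\<^esub> (e l n \<oplus>\<^bsub>F\<^esub> e l' n) | l l' n.
          l \<in> carrier L \<and> l' \<in> carrier L \<and> n \<in> carrier N} \<union>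
       {e l (n \<oplus>\<^bsub>N\<^esub> n') \<ominus>\<^bsub>F\<^esub> (e l n \<oplus>\<^bsub>F\<^esub> e l n') | l n n'.
          l \<in> carrier L \<and> n \<in> carrier N \<and> n' \<in> carrier N} \<union>
       {e (q \<odot>\<^bsub>L\<^esub> l) n \<ominus>\<^bsub>F\<^esub> e l (\<phi> q \<odot>\<^bsub>N\<^esub> n) | q l n.
          q \<in> carrier Q \<and> l \<in> carrier L \<and> n \<in> carrier N} \<union>
       {e l (r \<odot>\<^bsub>N\<^esub> n) \<ominus>\<^bsub>F\<^esub> r \<odot>\<^bsub>F\<^esub> e l n | r l n.
          r \<in> carrier R \<and> l \<in> carrier L \<and> n \<in> carrier N})"

definition tensor_kernel ::
    "('q, 'h) ring_scheme \<Rightarrow> ('r, 'm) ring_scheme \<Rightarrow> ('q \<Rightarrow> 'r) \<Rightarrow>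
      ('q, 'l, 'n) module_scheme \<Rightarrow> ('r, 'b, 'p) module_scheme \<Rightarrow> ('l \<times> 'b \<Rightarrow> 'r) set" where
  "tensor_kernel Q R \<phi> L N = module_span R (tensor_free R L N) (tensor_relators Q R \<phi> L N)"

definition tensor ::
    "('q, 'h) ring_scheme \<Rightarrow> ('r, 'm) ring_scheme \<Rightarrow> ('q \<Rightarrow> 'r) \<Rightarrow>
      ('q, 'l, 'n) module_scheme \<Rightarrow> ('r, 'b, 'p) module_scheme \<Rightarrow>
      ('r, ('l \<times> 'b \<Rightarrow> 'r) set) module" where
  "tensor Q R \<phi> L N = quot_module (tensor_free R L N) (tensor_kernel Q R \<phi> L N)"

text \<open>The map \<open>h \<otimes> N : L \<otimes>\<^sub>Q N \<rightarrow> L' \<otimes>\<^sub>Q N\<close> induced by a \<open>Q\<close>-linear map \<open>h : L \<rightarrow> L'\<close>: push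
  representatives forward along \<open>[l, n] \<mapsto> [h l, n]\<close>. All representatives give the same coset,
  so the union is over a constant family.\<close>

definition tensor_map ::
    "('q, 'h) ring_scheme \<Rightarrow> ('r, 'm) ring_scheme \<Rightarrow> ('q \<Rightarrow> 'r) \<Rightarrow>
      ('q, 'l2, 'n) module_scheme \<Rightarrow> ('r, 'b, 'p) module_scheme \<Rightarrow> ('l1 \<Rightarrow> 'l2) \<Rightarrow>
      ('l1 \<times> 'b \<Rightarrow> 'r) set \<Rightarrow> ('l2 \<times> 'b \<Rightarrow> 'r) set" where
  "tensor_map Q R \<phi> L' N h C =
     (\<Union>c\<in>C. tensor_kernel Q R \<phi> L' N +>\<^bsub>tensor_free R L' N\<^esub>
        lin_ext R (tensor_free R L' N) (\<lambda>(l, n). basis_vec R (h l, n)) c)"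


section \<open>Tor\<close>

text \<open>
  A functorial free resolution \<open>\<dots> \<rightarrow> F\<^sub>2 \<rightarrow> F\<^sub>1 \<rightarrow> F\<^sub>0 \<rightarrow> L \<rightarrow> 0\<close> whose terms all live in one type:
  \<open>F\<^sub>0\<close> is free on the symbols \<open>Gen l\<close> for \<open>l \<in> L\<close>, and \<open>F\<^sub>n\<^sub>+\<^sub>1\<close> is free on the symbols
  \<open>Syz [(b\<^sub>1, q\<^sub>1), \<dots>]\<close> for all lists of (basis element of \<open>F\<^sub>n\<close>, scalar) pairs such that
  \<open>q\<^sub>1 b\<^sub>1 + \<dots>\<close> is a cycle of \<open>F\<^sub>n\<close>; such a symbol is mapped to that cycle.
\<close>

datatype ('l, 'q) syz = Gen 'l | Syz "(('l, 'q) syz \<times> 'q) list"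

definition lin_comb ::
    "('q, 'm) ring_scheme \<Rightarrow> ('b \<times> 'q) list \<Rightarrow> 'b \<Rightarrow> 'q" where
  "lin_comb Q xs =
     foldr (\<lambda>(b, q) v. (q \<odot>\<^bsub>free_module Q UNIV\<^esub> basis_vec Q b) \<oplus>\<^bsub>free_module Q UNIV\<^esub> v) xs
       \<zero>\<^bsub>free_module Q UNIV\<^esub>"

definition res_aug ::
    "('q, 'm) ring_scheme \<Rightarrow> ('q, 'l, 'n) module_scheme \<Rightarrow> (('l, 'q) syz \<Rightarrow> 'q) \<Rightarrow> 'l" where
  "res_aug Q L = lin_ext Q L (\<lambda>g. case g of Gen l \<Rightarrow> l | Syz xs \<Rightarrow> \<zero>\<^bsub>L\<^esub>)"

definition res_diff ::
    "('q, 'm) ring_scheme \<Rightarrow> (('l, 'q) syz \<Rightarrow> 'q) \<Rightarrow> ('l, 'q) syz \<Rightarrow> 'q" where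
  "res_diff Q = lin_ext Q (free_module Q UNIV)
     (\<lambda>g. case g of Gen l \<Rightarrow> \<zero>\<^bsub>free_module Q UNIV\<^esub> | Syz xs \<Rightarrow> lin_comb Q xs)"

primrec res_basis ::
    "('q, 'm) ring_scheme \<Rightarrow> ('q, 'l, 'n) module_scheme \<Rightarrow> nat \<Rightarrow> ('l, 'q) syz set" where
  "res_basis Q L 0 = Gen ` carrier L"
| "res_basis Q L (Suc n) =
     {Syz xs | xs. set xs \<subseteq> res_basis Q L n \<times> carrier Q \<and>
        (if n = 0 then res_aug Q L (lin_comb Q xs) = \<zero>\<^bsub>L\<^esub>
         else res_diff Q (lin_comb Q xs) = \<zero>\<^bsub>free_module Q UNIV\<^esub>)}"

definition res_module ::
    "('q, 'm) ring_scheme \<Rightarrow> ('q, 'l, 'n) module_scheme \<Rightarrow> nat \<Rightarrow>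
      ('q, ('l, 'q) syz \<Rightarrow> 'q) module" where
  "res_module Q L n = free_module Q (res_basis Q L n)"

text \<open>\<open>Tor\<^sub>n\<^sup>Q(L, N)\<close> for a \<open>Q\<close>-module \<open>L\<close> and an \<open>R\<close>-module \<open>N\<close>, viewed as a \<open>Q\<close>-module along
  \<open>\<phi>\<close>: the \<open>n\<close>-th homology of the complex \<open>F\<^sub>\<bullet> \<otimes>\<^sub>Q N\<close>.\<close>

definition Tor_chain ::
    "('q, 'h) ring_scheme \<Rightarrow> ('r, 'm) ring_scheme \<Rightarrow> ('q \<Rightarrow> 'r) \<Rightarrow>
      ('q, 'l, 'n) module_scheme \<Rightarrow> ('r, 'b, 'p) module_scheme \<Rightarrow> nat \<Rightarrow>
      ('r, ((('l, 'q) syz \<Rightarrow> 'q) \<times> 'b \<Rightarrow> 'r) set) module" where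
  "Tor_chain Q R \<phi> L N n = tensor Q R \<phi> (res_module Q L n) N"

text \<open>The differential from degree \<open>Suc n\<close> to degree \<open>n\<close>.\<close>

definition Tor_diff ::
    "('q, 'h) ring_scheme \<Rightarrow> ('r, 'm) ring_scheme \<Rightarrow> ('q \<Rightarrow> 'r) \<Rightarrow>
      ('q, 'l, 'n) module_scheme \<Rightarrow> ('r, 'b, 'p) module_scheme \<Rightarrow> nat \<Rightarrow>
      ((('l, 'q) syz \<Rightarrow> 'q) \<times> 'b \<Rightarrow> 'r) set \<Rightarrow> ((('l, 'q) syz \<Rightarrow> 'q) \<times> 'b \<Rightarrow> 'r) set" where
  "Tor_diff Q R \<phi> L N n = tensor_map Q R \<phi> (res_module Q L n) N (res_diff Q)"

definition Tor_cycles ::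
    "('q, 'h) ring_scheme \<Rightarrow> ('r, 'm) ring_scheme \<Rightarrow> ('q \<Rightarrow> 'r) \<Rightarrow>
      ('q, 'l, 'n) module_scheme \<Rightarrow> ('r, 'b, 'p) module_scheme \<Rightarrow> nat \<Rightarrow>
      ((('l, 'q) syz \<Rightarrow> 'q) \<times> 'b \<Rightarrow> 'r) set set" where
  "Tor_cycles Q R \<phi> L N n =
     (case n of
        0 \<Rightarrow> carrier (Tor_chain Q R \<phi> L N 0)
      | Suc k \<Rightarrow> {C \<in> carrier (Tor_chain Q R \<phi> L N (Suc k)).
                   Tor_diff Q R \<phi> L N k C = \<zero>\<^bsub>Tor_chain Q R \<phi> L N k\<^esub>})"

definition Tor ::
    "('q, 'h) ring_scheme \<Rightarrow> ('r, 'm) ring_scheme \<Rightarrow> ('q \<Rightarrow> 'r) \<Rightarrow>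
      ('q, 'l, 'n) module_scheme \<Rightarrow> ('r, 'b, 'p) module_scheme \<Rightarrow> nat \<Rightarrow>
      ('r, ((('l, 'q) syz \<Rightarrow> 'q) \<times> 'b \<Rightarrow> 'r) set set) module" where
  "Tor Q R \<phi> L N n =
     quot_module ((Tor_chain Q R \<phi> L N n)\<lparr>carrier := Tor_cycles Q R \<phi> L N n\<rparr>)
       (Tor_diff Q R \<phi> L N n ` carrier (Tor_chain Q R \<phi> L N (Suc n)))"


section \<open>Lifts and Serre lifts\<close>

definition is_lift ::
    "('q, 'h) ring_scheme \<Rightarrow> ('r, 'm) ring_scheme \<Rightarrow> ('q \<Rightarrow> 'r) \<Rightarrow>
      ('r, 'b, 'p) module_scheme \<Rightarrow> ('q, 'l, 'n) module_scheme \<Rightarrow> bool" where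
  "is_lift Q R \<phi> M L \<longleftrightarrow>
     Module.module Q L \<and>
     module_isomorphic R (tensor Q R \<phi> L (ring_module R)) M \<and>
     (\<forall>i>0. carrier (Tor Q R \<phi> L (ring_module R) i) = {\<zero>\<^bsub>Tor Q R \<phi> L (ring_module R) i\<^esub>})"

definition is_Serre_lift ::
    "('q, 'h) ring_scheme \<Rightarrow> ('r, 'm) ring_scheme \<Rightarrow> ('q \<Rightarrow> 'r) \<Rightarrow>
      ('r, 'b, 'p) module_scheme \<Rightarrow> ('q, 'l, 'n) module_scheme \<Rightarrow> bool" where
  "is_Serre_lift Q R \<phi> M L \<longleftrightarrow>
     Module.module Q L \<and> fin_gen_module Q L \<and>
     module_isomorphic R M (tensor Q R \<phi> L (ring_module R)) \<and>
     krull_dim Q - module_dim Q L = krull_dim R - module_dim R M"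

text \<open>Every finitely generated \<open>Q\<close>-module is isomorphic to a quotient of some \<open>Q\<^sup>n\<close>, whose
  elements are cosets of type \<open>(nat \<Rightarrow> 'q) set\<close>; hence it is no restriction to let the
  existentially quantified module range over carriers of that type.\<close>

definition Serre_liftable ::
    "('q, 'h) ring_scheme \<Rightarrow> ('r, 'm) ring_scheme \<Rightarrow> ('q \<Rightarrow> 'r) \<Rightarrow>
      ('r, 'b, 'p) module_scheme \<Rightarrow> bool" where
  "Serre_liftable Q R \<phi> M \<longleftrightarrow>
     (\<exists>L :: ('q, (nat \<Rightarrow> 'q) set) module. is_Serre_lift Q R \<phi> M L)"


section \<open>The rings and the module of the example\<close>

text \<open>The ring \<open>k[[x,y,z]]\<close> is represented as \<open>k[[x]][[y]][[z]]\<close>.\<close>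

type_synonym 'k fps3 = "'k fps fps fps"

definition var_x :: "'k::field fps3" where "var_x = fps_const (fps_const fps_X)"
definition var_y :: "'k::field fps3" where "var_y = fps_const fps_X"
definition var_z :: "'k::field fps3" where "var_z = fps_X"

definition S_ring :: "'k::field fps3 ring" where
  "S_ring = ring_of_type_algebra"

definition R_ideal :: "'k::field fps3 set" where
  "R_ideal = Idl\<^bsub>S_ring\<^esub> {var_z ^ 2 - var_x * var_y}"

definition R_ring :: "'k::field fps3 set ring" where
  "R_ring = S_ring Quot R_ideal"

definition R_proj :: "'k::field fps3 \<Rightarrow> 'k fps3 set" where
  "R_proj s = R_ideal +>\<^bsub>S_ring\<^esub> s"

definition M_matrix :: "nat \<Rightarrow> nat \<Rightarrow> 'k::field fps3 set" where
  "M_matrix i j =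
     R_proj ([[var_x, 0,     var_z, var_y],
              [var_y, var_x, var_y, 0]] ! i ! j)"

definition M_module :: "('k::field fps3 set, (nat \<Rightarrow> 'k fps3 set) set) module" where
  "M_module = matrix_coker R_ring 2 4 M_matrix"

end

theory Submission
  imports Defs
begin

text \<open>
  The cokernel \<open>L\<close> of the same matrix over \<open>S\<close> is a Serre lift: its annihilator contains \<open>x\<^sup>2\<close>
  and \<open>y\<^sup>2\<close> and lies in \<open>(x, y)\<close>, so \<open>dim L = 1\<close>, while \<open>M\<close> has dimension \<open>0\<close> and Krull's
  principal ideal theorem gives \<open>dim S = dim R + 1\<close>.

  For the second claim let \<open>Q \<rightarrow> R\<close> be surjective with \<open>Q\<close> regular local, with kernel \<open>I\<close> and
  maximal ideal \<open>m\<close>, and lift \<open>x, y, z\<close> to \<open>Q\<close>. The matrix \<open>A\<close> presenting \<open>M\<close> satisfies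
  \<open>A b = (z\<^sup>2 - x y, 0)\<close> for the vector \<open>b = (- z, - y, x + z, - x)\<close> with entries in \<open>m\<close>. If a lift
  \<open>L\<close> existed, the relations \<open>A\<close> would lift to \<open>L\<close> modulo \<open>I L\<close>, and \<open>Tor\<^sub>1(L, R) = 0\<close> would turn this
  identity into \<open>z\<^sup>2 - x y \<in> m I\<close>; this is the obstruction in \<open>Ext\<^sup>2(M, M) \<otimes> I / m I\<close>, which is
  nonzero because \<open>(z\<^sup>2 - x y, 0)\<close> has a unit coefficient. But \<open>m\<close> is generated by \<open>x, y, z\<close>
  and \<open>dim Q - 3\<close> elements of \<open>I\<close>. Modulo those elements, \<open>x\<close> and \<open>y\<close>, membership in \<open>m I\<close> would make
  \<open>z\<^sup>2\<close> a multiple of \<open>z\<^sup>3\<close>, hence \<open>z\<close> nilpotent, and \<open>m\<close> would be minimal over an ideal with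
  \<open>dim Q - 1\<close> generators, contradicting the height theorem.
\<close>

section \<open>Krull's principal ideal theorem\<close>

text \<open>\<open>Q\<close> is only assumed regular and \<open>L\<close> only to satisfy the
  lifting conditions: \<open>Q\<close> may be incomplete or of mixed characteristic, and
  \<open>L\<close> need not be finitely generated. So neither a presentation of \<open>Q\<close>
  over k nor a minimal resolution of \<open>L\<close> can be used. Instead everything is measured by
  k-valued functions. The residue and the linear coefficients of a power series descend from S to R
  and are pulled back to \<open>Q\<close>, and a functional M -> k with value 1 on the first
  generator lifts to a \<open>Q\<close>-linear map \<open>rho\<close> from F_0 to \<open>Q\<close>.
  Since \<open>rho\<close> sends boundaries into m, it sends the boundaries of I F_1 into m I, which
  turns exactness into a statement about ideals of \<open>Q\<close>.

  The vector b is a syzygy of the columns over R with entries in m; over \<open>Q\<close> its second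
  coordinate still cancels and its first becomes - z x + (x + z) z - x y.

  The coordinate z is singled out because z^2 has a unit coefficient in z^2 - x y, whereas an
  element of I has no linear term in z. Modulo x, y and the remaining generators, a product from m I
  is therefore a multiple of z^3.\<close>

text \<open>The contraction to \<open>R\<close> of the extension of \<open>J\<close> to the localization at \<open>p\<close>; saturated
  ideals of \<open>R\<close> replace the ideals of the localization throughout.\<close>

definition saturate :: "('a, 'm) ring_scheme \<Rightarrow> 'a set \<Rightarrow> 'a set \<Rightarrow> 'a set" where
  "saturate R p J = {a \<in> carrier R. \<exists>s \<in> carrier R - p. s \<otimes>\<^bsub>R\<^esub> a \<in> J}"

text \<open>Zorn's lemma applies because a nonempty chain of ideals in a noetherian ring contains
  its own union.\<close>

lemma (in noetherian_ring) ideal_set_has_maximal: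
  assumes "S \<noteq> {}" "\<And>I. I \<in> S \<Longrightarrow> ideal I R"
  obtains M where "M \<in> S" "\<And>J. J \<in> S \<Longrightarrow> M \<subseteq> J \<Longrightarrow> J = M"
proof -
  have "\<exists>M\<in>S. \<forall>J\<in>S. M \<subseteq> J \<longrightarrow> J = M"
  proof (rule subset_Zorn)
    fix C assume C: "subset.chain S C"
    show "\<exists>U\<in>S. \<forall>V\<in>C. V \<subseteq> U"
    proof (cases "C = {}")
      case True
      then show ?thesis using assms(1) by blast
    next
      case False
      have "subset.chain {I. ideal I R} C"
        using C assms(2) unfolding pred_on.chain_def by blast
      then have "\<Union>C \<in> C" using ideal_chain_is_trivial False by blast
      moreover have "C \<subseteq> S" using C by (simp add: pred_on.chain_def)
      ultimately show ?thesis by (meson Union_upper subsetD)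
    qed
  qed
  then show ?thesis using that by blast
qed

context cring
begin

lemma cring_idealI:
  assumes "I \<subseteq> carrier R" "\<zero> \<in> I" "\<And>a b. a \<in> I \<Longrightarrow> b \<in> I \<Longrightarrow> a \<oplus> b \<in> I"
    "\<And>r a. r \<in> carrier R \<Longrightarrow> a \<in> I \<Longrightarrow> r \<otimes> a \<in> I"
  shows "ideal I R"
proof (rule idealI)
  show "subgroup I (add_monoid R)"
  proof (rule add.subgroupI)
    fix a assume "a \<in> I"
    then have "(\<ominus> \<one>) \<otimes> a \<in> I" "a \<in> carrier R" using assms by auto
    then show "\<ominus> a \<in> I" by (simp add: l_minus)
  qed (use assms in auto)
  show "a \<otimes> x \<in> I" if "a \<in> I" "x \<in> carrier R" for a x
    using that assms m_comm by (metis subsetD)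
qed (use assms in \<open>auto intro: ring_axioms\<close>)

lemma ideal_closed:
  assumes "ideal I R"
  shows "a \<in> I \<Longrightarrow> a \<in> carrier R" "\<zero> \<in> I" "a \<in> I \<Longrightarrow> b \<in> I \<Longrightarrow> a \<oplus> b \<in> I"
    "r \<in> carrier R \<Longrightarrow> a \<in> I \<Longrightarrow> r \<otimes> a \<in> I" "r \<in> carrier R \<Longrightarrow> a \<in> I \<Longrightarrow> a \<otimes> r \<in> I"
    "a \<in> I \<Longrightarrow> \<ominus> a \<in> I" "a \<in> I \<Longrightarrow> b \<in> I \<Longrightarrow> a \<ominus> b \<in> I"
proof -
  interpret ideal I R by fact
  show "a \<in> I \<Longrightarrow> a \<in> carrier R" "\<zero> \<in> I" "a \<in> I \<Longrightarrow> b \<in> I \<Longrightarrow> a \<oplus> b \<in> I"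
    "r \<in> carrier R \<Longrightarrow> a \<in> I \<Longrightarrow> r \<otimes> a \<in> I" "r \<in> carrier R \<Longrightarrow> a \<in> I \<Longrightarrow> a \<otimes> r \<in> I"
    "a \<in> I \<Longrightarrow> \<ominus> a \<in> I" "a \<in> I \<Longrightarrow> b \<in> I \<Longrightarrow> a \<ominus> b \<in> I"
    by (auto simp: I_l_closed I_r_closed a_minus_def Icarr)
qed

lemma ideal_add_cancel:
  assumes "ideal I R" "a \<in> carrier R" "b \<in> I" "a \<oplus> b \<in> I"
  shows "a \<in> I"
proof -
  have "a = (a \<oplus> b) \<ominus> b" using assms ideal_closed(1)[OF assms(1)] by algebra
  then show ?thesis using ideal_closed(7)[OF assms(1,4,3)] by simp
qed

lemma prime_mult_notin:
  assumes "primeideal p R" "s \<in> carrier R - p" "t \<in> carrier R - p"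
  shows "s \<otimes> t \<in> carrier R - p"
  using primeideal.I_prime[OF assms(1), of s t] assms by auto

lemma one_notin_prime: "primeideal p R \<Longrightarrow> \<one> \<in> carrier R - p"
  using ideal.one_imp_carrier primeideal.I_notcarr primeideal.axioms(1) by blast

lemma saturate_ideal:
  assumes "primeideal p R" "ideal J R"
  shows "ideal (saturate R p J) R"
proof (rule cring_idealI)
  note J = ideal_closed[OF assms(2)]
  show "\<zero> \<in> saturate R p J"
    using one_notin_prime[OF assms(1)] J(2) by (auto simp: saturate_def intro!: bexI[of _ \<one>])
  show "a \<oplus> b \<in> saturate R p J" if "a \<in> saturate R p J" "b \<in> saturate R p J" for a b
  proof -
    obtain s t where st: "s \<in> carrier R - p" "t \<in> carrier R - p" "s \<otimes> a \<in> J" "t \<otimes> b \<in> J"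
      and ab: "a \<in> carrier R" "b \<in> carrier R"
      using \<open>a \<in> saturate R p J\<close> \<open>b \<in> saturate R p J\<close> by (auto simp: saturate_def)
    have "t \<otimes> (s \<otimes> a) \<oplus> s \<otimes> (t \<otimes> b) \<in> J" using st J by auto
    moreover have "t \<otimes> (s \<otimes> a) \<oplus> s \<otimes> (t \<otimes> b) = (s \<otimes> t) \<otimes> (a \<oplus> b)"
      using st ab by (auto, algebra)
    ultimately show ?thesis using prime_mult_notin[OF assms(1) st(1,2)] ab
      unfolding saturate_def by auto
  qed
  show "r \<otimes> a \<in> saturate R p J" if "r \<in> carrier R" "a \<in> saturate R p J" for a r
  proof -
    obtain s where s: "s \<in> carrier R - p" "s \<otimes> a \<in> J" "a \<in> carrier R"
      using \<open>a \<in> saturate R p J\<close> by (auto simp: saturate_def)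
    have "r \<otimes> (s \<otimes> a) \<in> J" using J s that by auto
    moreover have "r \<otimes> (s \<otimes> a) = s \<otimes> (r \<otimes> a)" using s that by (auto, algebra)
    ultimately show ?thesis using s that by (auto simp: saturate_def)
  qed
qed (auto simp: saturate_def)

lemma subset_saturate:
  assumes "primeideal p R" "ideal J R"
  shows "J \<subseteq> saturate R p J"
  using one_notin_prime[OF assms(1)] ideal_closed(1)[OF assms(2)]
  by (auto simp: saturate_def intro!: bexI[of _ \<one>])

lemma saturate_mono: "J \<subseteq> J' \<Longrightarrow> saturate R p J \<subseteq> saturate R p J'"
  by (auto simp: saturate_def)

lemma saturateD:
  "saturate R p J \<subseteq> J \<Longrightarrow> s \<in> carrier R - p \<Longrightarrow> a \<in> carrier R \<Longrightarrow> s \<otimes> a \<in> J \<Longrightarrow> a \<in> J"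
  by (auto simp: saturate_def)

lemma saturate_saturate:
  assumes "primeideal p R"
  shows "saturate R p (saturate R p J) \<subseteq> saturate R p J"
proof
  fix a assume "a \<in> saturate R p (saturate R p J)"
  then obtain s t where "s \<in> carrier R - p" "t \<in> carrier R - p" "t \<otimes> (s \<otimes> a) \<in> J" "a \<in> carrier R"
    by (auto simp: saturate_def)
  then show "a \<in> saturate R p J"
    using prime_mult_notin[OF assms, of t s] by (auto simp: saturate_def m_assoc intro!: bexI[of _ "t \<otimes> s"])
qed

lemma saturate_prime:
  assumes "primeideal P R" "P \<subseteq> p"
  shows "saturate R p P \<subseteq> P"
  using primeideal.I_prime[OF assms(1)] assms(2) by (auto simp: saturate_def)

lemma ideal_scale:
  assumes "ideal H R" "a \<in> carrier R"
  shows "ideal {h \<otimes> a | h. h \<in> H} R"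
proof (rule cring_idealI)
  note H = ideal_closed[OF assms(1)]
  show "{h \<otimes> a | h. h \<in> H} \<subseteq> carrier R" using H assms by auto
  show "\<zero> \<in> {h \<otimes> a | h. h \<in> H}" using H(2) assms by (auto intro!: exI[of _ \<zero>])
  show "x \<oplus> y \<in> {h \<otimes> a | h. h \<in> H}" if xy: "x \<in> {h \<otimes> a | h. h \<in> H}" "y \<in> {h \<otimes> a | h. h \<in> H}" for x y
  proof -
    obtain h k where "h \<in> H" "k \<in> H" "x = h \<otimes> a" "y = k \<otimes> a" using xy by auto
    then show ?thesis using H assms by (auto intro!: exI[of _ "h \<oplus> k"] simp: l_distr)
  qed
  show "r \<otimes> x \<in> {h \<otimes> a | h. h \<in> H}" if rx: "r \<in> carrier R" "x \<in> {h \<otimes> a | h. h \<in> H}" for r x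
  proof -
    obtain h where "h \<in> H" "x = h \<otimes> a" using rx by auto
    then show ?thesis using H assms rx by (auto intro!: exI[of _ "r \<otimes> h"] simp: m_assoc)
  qed
qed

lemma set_addE:
  assumes "x \<in> I <+>\<^bsub>R\<^esub> J" obtains a b where "a \<in> I" "b \<in> J" "x = a \<oplus> b"
  using assms by (auto simp: set_add_def')

lemma set_addI: "a \<in> I \<Longrightarrow> b \<in> J \<Longrightarrow> a \<oplus> b \<in> I <+>\<^bsub>R\<^esub> J"
  by (auto simp: set_add_def')

lemma ideal_subset_add:
  assumes "ideal I R" "ideal J R"
  shows "I \<subseteq> I <+>\<^bsub>R\<^esub> J" "J \<subseteq> I <+>\<^bsub>R\<^esub> J"
proof -
  note I = ideal_closed[OF assms(1)] and J = ideal_closed[OF assms(2)]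
  show "I \<subseteq> I <+>\<^bsub>R\<^esub> J"
  proof
    fix a assume "a \<in> I"
    then have "a \<oplus> \<zero> \<in> I <+>\<^bsub>R\<^esub> J" using J(2) by (intro set_addI)
    then show "a \<in> I <+>\<^bsub>R\<^esub> J" using I(1)[OF \<open>a \<in> I\<close>] by simp
  qed
  show "J \<subseteq> I <+>\<^bsub>R\<^esub> J"
  proof
    fix a assume "a \<in> J"
    then have "\<zero> \<oplus> a \<in> I <+>\<^bsub>R\<^esub> J" using I(2) by (intro set_addI)
    then show "a \<in> I <+>\<^bsub>R\<^esub> J" using J(1)[OF \<open>a \<in> J\<close>] by simp
  qed
qed

lemma colon_ideal:
  assumes "ideal I R" "a \<in> carrier R"
  shows "ideal {r \<in> carrier R. a \<otimes> r \<in> I} R"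
  by (rule ideal.helper_max_prime[OF assms(1) is_cring assms(2)])

text \<open>Nakayama's lemma in the localization at \<open>p\<close>. In place of a generating set
  of \<open>N\<close>, the proof takes \<open>N1\<close> maximal among the saturated ideals that
  contain \<open>N'\<close> and lie properly in \<open>N\<close>; any \<open>a\<close> in
  \<open>N\<close> outside \<open>N1\<close> then generates \<open>N\<close> over \<open>N1\<close>
  after localization. The hypothesis on \<open>H\<close> yields t a = c + k a with \<open>t\<close>
  outside \<open>p\<close>, \<open>c\<close> in \<open>N1\<close> and \<open>k\<close> in
  \<open>H\<close>.\<close>

lemma saturated_nakayama:
  assumes noeth: "noetherian_ring R" and p: "primeideal p R"
    and N: "ideal N R" "saturate R p N \<subseteq> N" and N': "ideal N' R" "saturate R p N' \<subseteq> N'" "N' \<subseteq> N"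
    and H: "ideal H R" "H \<subseteq> p"
    and le: "N \<subseteq> saturate R p (Idl (N' \<union> {h \<otimes> b | h b. h \<in> H \<and> b \<in> N}))"
  shows "N \<subseteq> N'"
proof (rule ccontr)
  assume nle: "\<not> N \<subseteq> N'"
  define S where "S = {I. ideal I R \<and> saturate R p I \<subseteq> I \<and> N' \<subseteq> I \<and> I \<subseteq> N \<and> I \<noteq> N}"
  have "S \<noteq> {}" "\<And>I. I \<in> S \<Longrightarrow> ideal I R" using N' nle by (auto simp: S_def)
  then obtain N1 where N1: "N1 \<in> S" "\<And>J. J \<in> S \<Longrightarrow> N1 \<subseteq> J \<Longrightarrow> J = N1"
    using noetherian_ring.ideal_set_has_maximal[OF noeth, of S] by metis
  then have N1_id: "ideal N1 R" and N1_sat: "saturate R p N1 \<subseteq> N1" and "N' \<subseteq> N1" "N1 \<subseteq> N"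
    by (auto simp: S_def)
  obtain a where a: "a \<in> N" "a \<notin> N1" using N1 by (auto simp: S_def)
  have ac: "a \<in> carrier R" using ideal_closed(1)[OF N(1)] a by auto
  note n1 = ideal_closed[OF N1_id] and h = ideal_closed[OF H(1)]
  define U where "U = saturate R p (N1 <+>\<^bsub>R\<^esub> {h \<otimes> a | h. h \<in> H})"
  have Ua: "ideal {h \<otimes> a | h. h \<in> H} R" by (rule ideal_scale[OF H(1) ac])
  have U: "ideal U R" unfolding U_def by (intro saturate_ideal add_ideals p N1_id Ua)
  define V where "V = saturate R p (N1 <+>\<^bsub>R\<^esub> PIdl a)"
  have Va: "ideal (PIdl a) R" by (rule cgenideal_ideal[OF ac])
  have V: "ideal V R" unfolding V_def by (intro saturate_ideal add_ideals p N1_id Va)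
  have "N1 \<subseteq> N1 <+>\<^bsub>R\<^esub> PIdl a" "a \<in> N1 <+>\<^bsub>R\<^esub> PIdl a"
    using ideal_subset_add[OF N1_id Va] cgenideal_self[OF ac] by auto
  then have "N1 \<subseteq> V" "a \<in> V"
    using subset_saturate[OF p add_ideals[OF N1_id Va]] by (auto simp: V_def)
  have "N1 <+>\<^bsub>R\<^esub> PIdl a \<subseteq> N"
    using \<open>N1 \<subseteq> N\<close> cgenideal_minimal[OF N(1) a(1)] ideal_closed(3)[OF N(1)] by (auto elim!: set_addE)
  then have "V \<subseteq> N" unfolding V_def using saturate_mono N(2) by blast
  then have "V = N"
    using N1(2)[of V] V saturate_saturate[OF p] \<open>N1 \<subseteq> V\<close> \<open>N' \<subseteq> N1\<close> a \<open>a \<in> V\<close>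
    unfolding S_def V_def by blast
  have "{h \<otimes> b | h b. h \<in> H \<and> b \<in> N} \<subseteq> U"
  proof clarify
    fix k b assume k: "k \<in> H" and "b \<in> N"
    then obtain t where t: "t \<in> carrier R - p" "t \<otimes> b \<in> N1 <+>\<^bsub>R\<^esub> PIdl a" "b \<in> carrier R"
      using \<open>V = N\<close> unfolding V_def saturate_def by blast
    then obtain c r where c: "c \<in> N1" "r \<in> carrier R" "t \<otimes> b = c \<oplus> r \<otimes> a"
      by (auto elim!: set_addE simp: cgenideal_def)
    have kc: "k \<in> carrier R" using h k by auto
    have "t \<otimes> (k \<otimes> b) = k \<otimes> (t \<otimes> b)" using t kc by (auto, algebra)
    also have "\<dots> = k \<otimes> c \<oplus> (r \<otimes> k) \<otimes> a" unfolding c(3) using kc ac c n1(1)[OF c(1)] by algebra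
    also have "\<dots> \<in> N1 <+>\<^bsub>R\<^esub> {h \<otimes> a | h. h \<in> H}" using n1(4)[OF kc c(1)] h(4)[OF c(2) k] by (intro set_addI) auto
    finally show "k \<otimes> b \<in> U" unfolding U_def saturate_def using t kc by auto
  qed
  moreover have "N1 \<subseteq> U" unfolding U_def
    using subset_saturate[OF p add_ideals[OF N1_id Ua]] ideal_subset_add(1)[OF N1_id Ua] by blast
  ultimately have "Idl (N' \<union> {h \<otimes> b | h b. h \<in> H \<and> b \<in> N}) \<subseteq> U"
    using \<open>N' \<subseteq> N1\<close> by (intro genideal_minimal[OF U]) auto
  then have "N \<subseteq> U" using le saturate_mono saturate_saturate[OF p] unfolding U_def by blast
  then obtain t where t: "t \<in> carrier R - p" "t \<otimes> a \<in> N1 <+>\<^bsub>R\<^esub> {h \<otimes> a | h. h \<in> H}"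
    using a unfolding U_def saturate_def by blast
  then obtain c k where c: "c \<in> N1" "k \<in> H" "t \<otimes> a = c \<oplus> k \<otimes> a" by (auto elim!: set_addE)
  have kc: "k \<in> carrier R" using h c by auto
  \<comment> \<open>As \<open>k\<close> lies in \<open>p\<close> and \<open>t\<close> does not, t -
    k is outside \<open>p\<close> and can be cancelled modulo the saturated ideal
    \<open>N1\<close>.\<close>
  have "(t \<ominus> k) \<otimes> a = t \<otimes> a \<ominus> k \<otimes> a" using t kc ac by (auto, algebra)
  also have "\<dots> = c" unfolding c(3) using n1(1)[OF c(1)] kc ac by algebra
  finally have "(t \<ominus> k) \<otimes> a \<in> N1" using c by simp
  moreover have "t \<ominus> k \<notin> p"
  proof
    assume *: "t \<ominus> k \<in> p"
    have pp: "ideal p R" using p by (rule primeideal.axioms)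
    have "(t \<ominus> k) \<oplus> k \<in> p" using ideal_closed(3)[OF pp *] H(2) c by auto
    moreover have "(t \<ominus> k) \<oplus> k = t" using t kc by (auto, algebra)
    ultimately show False using t by auto
  qed
  ultimately have "a \<in> N1" using saturateD[OF N1_sat, of "t \<ominus> k" a] t kc ac by auto
  then show False using a by simp
qed

text \<open>The localization of \<open>R / I0\<close> at \<open>p\<close> has \<open>p\<close> as its only prime and is artinian. By noetherian
  induction it suffices to stabilize chains after enlarging them by an element \<open>a\<close> of the socle.\<close>

lemma saturated_dcc:
  assumes noeth: "noetherian_ring R" and p: "primeideal p R" and I0: "ideal I0 R"
    and minp: "\<And>P. primeideal P R \<Longrightarrow> I0 \<subseteq> P \<Longrightarrow> P \<subseteq> p \<Longrightarrow> P = p"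
    and J: "\<And>n. ideal (J n) R" "\<And>n. saturate R p (J n) \<subseteq> J n" "\<And>n. I0 \<subseteq> J n" "\<And>n. J (Suc n) \<subseteq> J n"
  shows "\<exists>n::nat. \<forall>m\<ge>n. J m = J n"
proof (rule ccontr)
  assume unstable: "\<not> ?thesis"
  define Ch where "Ch I J \<longleftrightarrow> (\<forall>n. ideal (J n) R \<and> saturate R p (J n) \<subseteq> J n \<and> I \<subseteq> J n \<and> J (Suc n) \<subseteq> J n)
     \<and> \<not> (\<exists>n::nat. \<forall>m\<ge>n. J m = J n)" for I and J :: "nat \<Rightarrow> 'a set"
  \<comment> \<open>A maximal counterexample is taken: \<open>I\<close> is maximal among the
    saturated ideals over \<open>I0\<close> that lie below some chain which never becomes
    stationary.\<close>
  define S where "S = {I. ideal I R \<and> saturate R p I \<subseteq> I \<and> I0 \<subseteq> I \<and> (\<exists>J. Ch I J)}"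
  have "saturate R p I0 \<in> S"
  proof -
    have "saturate R p I0 \<subseteq> J n" for n using saturate_mono[OF J(3)[of n]] J(2)[of n] by blast
    then have "Ch (saturate R p I0) J" unfolding Ch_def using J unstable by auto
    then show ?thesis
      using saturate_ideal[OF p I0] saturate_saturate[OF p] subset_saturate[OF p I0] unfolding S_def by blast
  qed
  then have "S \<noteq> {}" "\<And>I. I \<in> S \<Longrightarrow> ideal I R" by (auto simp: S_def)
  then obtain I where I: "I \<in> S" "\<And>K. K \<in> S \<Longrightarrow> I \<subseteq> K \<Longrightarrow> K = I"
    using noetherian_ring.ideal_set_has_maximal[OF noeth, of S] by metis
  then obtain J where J: "Ch I J" and I_id: "ideal I R" and I_sat: "saturate R p I \<subseteq> I" and "I0 \<subseteq> I"
    by (auto simp: S_def)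
  note i = ideal_closed[OF I_id]
  have J1: "\<forall>n. ideal (J n) R \<and> saturate R p (J n) \<subseteq> J n \<and> I \<subseteq> J n \<and> J (Suc n) \<subseteq> J n"
    and J2: "\<not> (\<exists>n. \<forall>m\<ge>n. J m = J n)"
    using J unfolding Ch_def by (rule conjunct1, rule conjunct2)
  have Jid: "ideal (J n) R" and Jsat: "saturate R p (J n) \<subseteq> J n" and IJ: "I \<subseteq> J n"
    and JS: "J (Suc n) \<subseteq> J n" for n
    using J1 by simp_all
  have Jdec: "m \<le> n \<Longrightarrow> J n \<subseteq> J m" for m n
    by (rule lift_Suc_antimono_le[of J, OF JS])
  have "I \<noteq> carrier R"
  proof
    assume "I = carrier R"
    then have "J n = carrier R" for n using IJ[of n] ideal_closed(1)[OF Jid[of n]] by blast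
    then show False using J2 by simp
  qed
  then obtain a0 where a0: "a0 \<in> carrier R" "a0 \<notin> I" using i(1) by blast
  \<comment> \<open>These are the annihilators of the nonzero classes modulo \<open>I\<close>. A
    maximal one is prime, contains \<open>I0\<close> and lies in \<open>p\<close> because
    \<open>I\<close> is saturated, so it is \<open>p\<close> itself; this provides \<open>a\<close>
    outside \<open>I\<close> with p a contained in \<open>I\<close>.\<close>
  define T where "T = {{r \<in> carrier R. a \<otimes> r \<in> I} | a. a \<in> carrier R - I}"
  have "T \<noteq> {}" using a0 by (auto simp: T_def)
  moreover have "ideal K R" if "K \<in> T" for K using that colon_ideal[OF I_id] by (auto simp: T_def)
  ultimately obtain K where K: "K \<in> T" "\<And>L. L \<in> T \<Longrightarrow> K \<subseteq> L \<Longrightarrow> L = K"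
    using noetherian_ring.ideal_set_has_maximal[OF noeth, of T] by metis
  then obtain a where a: "a \<in> carrier R" "a \<notin> I" and Ka: "K = {r \<in> carrier R. a \<otimes> r \<in> I}"
    by (auto simp: T_def)
  have "primeideal K R"
  proof (rule primeidealI)
    show "ideal K R" unfolding Ka by (rule colon_ideal[OF I_id a(1)])
    show "carrier R \<noteq> K" using a by (auto simp: Ka set_eq_iff intro!: exI[of _ \<one>])
    fix b c assume bc: "b \<in> carrier R" "c \<in> carrier R" "b \<otimes> c \<in> K"
    show "b \<in> K \<or> c \<in> K"
    proof (rule disjCI)
      assume "c \<notin> K"
      then have "a \<otimes> c \<in> carrier R - I" using a bc by (auto simp: Ka)
      then have "{r \<in> carrier R. (a \<otimes> c) \<otimes> r \<in> I} \<in> T" by (auto simp: T_def)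
      moreover have "K \<subseteq> {r \<in> carrier R. (a \<otimes> c) \<otimes> r \<in> I}"
      proof
        fix r assume r: "r \<in> K"
        then have "(a \<otimes> r) \<otimes> c \<in> I" using i(5) bc by (auto simp: Ka)
        moreover have "(a \<otimes> r) \<otimes> c = (a \<otimes> c) \<otimes> r" using r a bc by (auto simp: Ka, algebra)
        ultimately show "r \<in> {r \<in> carrier R. (a \<otimes> c) \<otimes> r \<in> I}" using r by (auto simp: Ka)
      qed
      ultimately have eq: "{r \<in> carrier R. (a \<otimes> c) \<otimes> r \<in> I} = K" by (rule K(2))
      have "(a \<otimes> c) \<otimes> b = a \<otimes> (b \<otimes> c)" using bc a by algebra
      then have "(a \<otimes> c) \<otimes> b \<in> I" using bc by (simp add: Ka)
      then show "b \<in> K" using eq bc by blast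
    qed
  qed (rule is_cring)
  moreover have "I0 \<subseteq> K" using \<open>I0 \<subseteq> I\<close> i(1) i(4)[OF a(1)] by (auto simp: Ka)
  moreover have "K \<subseteq> p"
  proof
    fix t assume t: "t \<in> K"
    show "t \<in> p"
    proof (rule ccontr)
      assume "t \<notin> p"
      moreover have "t \<otimes> a \<in> I" "t \<in> carrier R" using t a by (auto simp: Ka m_comm)
      ultimately show False using saturateD[OF I_sat, of t a] a by auto
    qed
  qed
  ultimately have Kp: "K = p" by (rule minp)
  have Pa: "ideal (PIdl a) R" by (rule cgenideal_ideal[OF a(1)])
  have aP: "a \<in> PIdl a" by (rule cgenideal_self[OF a(1)])
  \<comment> \<open>\<open>G\<close> adjoins \<open>a\<close> and saturates. Since
    \<open>G I\<close> is strictly larger than \<open>I\<close>, maximality of \<open>I\<close>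
    makes the chain of the ideals \<open>G (J n)\<close> stationary.\<close>
  define G where "G B = saturate R p (B <+>\<^bsub>R\<^esub> PIdl a)" for B
  have G: "ideal (G B) R" "saturate R p (G B) \<subseteq> G B" "B \<subseteq> G B" "a \<in> G B" if "ideal B R" for B
    using saturate_ideal[OF p add_ideals[OF that Pa]] saturate_saturate[OF p, of "B <+>\<^bsub>R\<^esub> PIdl a"]
      subset_saturate[OF p add_ideals[OF that Pa]] ideal_subset_add[OF that Pa] aP
    unfolding G_def by blast+
  have Gmono: "G B \<subseteq> G D" if "B \<subseteq> D" for B D
    unfolding G_def using that by (intro saturate_mono) (auto elim!: set_addE intro: set_addI)
  have "G I \<notin> S" using I(2)[of "G I"] G[OF I_id] a by blast
  then have "\<not> Ch (G I) (\<lambda>n. G (J n))" using G[OF I_id] \<open>I0 \<subseteq> I\<close> unfolding S_def by blast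
  then obtain n1 where n1: "\<And>m. m \<ge> n1 \<Longrightarrow> G (J m) = G (J n1)"
    using G[OF Jid] Gmono IJ Jdec[OF le_SucI[OF order_refl]] unfolding Ch_def by blast
  \<comment> \<open>The chain decreases, so \<open>a\<close> either stays in it forever or leaves it
    for good. In the second case r a in \<open>J n\<close> forces \<open>r\<close> into
    \<open>p\<close>, and then r a lies in \<open>I\<close> and hence in every
    \<open>J m\<close>.\<close>
  obtain n0 where n0: "(\<forall>m. a \<in> J m) \<or> (\<forall>m\<ge>n0. a \<notin> J m)"
    using Jdec by blast
  define n where "n = max n0 n1"
  have "J m = J n" if m: "m \<ge> n" for m
  proof
    show "J m \<subseteq> J n" using Jdec m by blast
    show "J n \<subseteq> J m"
    proof
      fix b assume b: "b \<in> J n"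
      have "G (J n) = G (J m)" using n1[of n] n1[of m] m by (auto simp: n_def)
      then have "b \<in> G (J m)" using b G(3)[OF Jid] by blast
      then obtain s where s: "s \<in> carrier R - p" "s \<otimes> b \<in> J m <+>\<^bsub>R\<^esub> PIdl a" "b \<in> carrier R"
        unfolding G_def saturate_def by blast
      then obtain c r where c: "c \<in> J m" "r \<in> carrier R" "s \<otimes> b = c \<oplus> r \<otimes> a"
        by (auto elim!: set_addE simp: cgenideal_def)
      have "r \<otimes> a \<in> J m"
      proof (cases "a \<in> J m")
        case True then show ?thesis using ideal_closed(4)[OF Jid] c by blast
      next
        case False
        then have "a \<notin> J n" using n0 by (auto simp: n_def)
        have "s \<otimes> b \<in> J n" using ideal_closed(4)[OF Jid] s b by blast
        moreover have "c \<in> J n" using c Jdec[OF m] by blast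
        ultimately have "s \<otimes> b \<ominus> c \<in> J n" by (rule ideal_closed(7)[OF Jid])
        moreover have "s \<otimes> b \<ominus> c = r \<otimes> a" unfolding c(3) using c a ideal_closed(1)[OF Jid c(1)] by algebra
        ultimately have "r \<otimes> a \<in> J n" by simp
        then have "r \<in> p" using saturateD[OF Jsat, of r a n] \<open>a \<notin> J n\<close> a c by auto
        then have "a \<otimes> r \<in> I" using Kp Ka by auto
        then show ?thesis using IJ a c by (auto simp: m_comm)
      qed
      then have "s \<otimes> b \<in> J m" unfolding c(3) using ideal_closed(3)[OF Jid c(1)] by blast
      then show "b \<in> J m" using saturateD[OF Jsat] s by blast
    qed
  qed
  then show False using J2 by metis
qed

text \<open>Otherwise \<open>p\<close> is minimal over \<open>P + (x)\<close>, and the symbolic powers \<open>N n\<close> of \<open>q\<close> modulo \<open>P\<close>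
  become stationary, which forces \<open>q \<subseteq> P\<close> by Nakayama's lemma.\<close>

theorem prime_between:
  assumes noeth: "noetherian_ring R"
    and P: "primeideal P R" and q: "primeideal q R" and p: "primeideal p R"
    and Pq: "P \<subset> q" and qp: "q \<subset> p" and x: "x \<in> p"
  shows "\<exists>P'. primeideal P' R \<and> P \<subset> P' \<and> P' \<subset> p \<and> x \<in> P'"
proof (rule ccontr)
  assume none: "\<not> ?thesis"
  have Pid: "ideal P R" and qid: "ideal q R" and pid: "ideal p R"
    using P q p by (auto intro: primeideal.axioms)
  have xq: "x \<notin> q" using none q Pq qp by blast
  have xc: "x \<in> carrier R" using ideal_closed(1)[OF pid x] .
  \<comment> \<open>\<open>F N\<close> is the contraction of P + q N from the localization at
    \<open>q\<close>, so iterating it from the whole ring gives the symbolic powers of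
    \<open>q\<close> modulo \<open>P\<close>.\<close>
  define F where "F N = saturate R q (Idl (P \<union> {h \<otimes> b | h b. h \<in> q \<and> b \<in> N}))" for N
  define N where "N n = (F ^^ n) (carrier R)" for n
  have N0: "N 0 = carrier R" and NS: "N (Suc n) = F (N n)" for n by (auto simp: N_def)
  have gen_sub: "P \<union> {h \<otimes> b | h b. h \<in> q \<and> b \<in> I} \<subseteq> carrier R" if "I \<subseteq> carrier R" for I
    using that ideal_closed(1)[OF Pid] ideal_closed(1)[OF qid] by auto
  have Fid: "ideal (F I) R" "saturate R q (F I) \<subseteq> F I" "P \<subseteq> F I"
    "h \<in> q \<Longrightarrow> b \<in> I \<Longrightarrow> h \<otimes> b \<in> F I" if "I \<subseteq> carrier R" for I h b
    using saturate_ideal[OF q genideal_ideal[OF gen_sub[OF that]]] saturate_saturate[OF q]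
      subset_saturate[OF q genideal_ideal[OF gen_sub[OF that]]] genideal_self[OF gen_sub[OF that]]
    unfolding F_def by blast+
  have Fmono: "F I \<subseteq> F I'" if "I \<subseteq> I'" "I' \<subseteq> carrier R" for I I'
    unfolding F_def using that by (intro saturate_mono subset_Idl_subset gen_sub) blast+
  have Nid: "ideal (N n) R" for n
    by (induction n) (auto simp: N0 NS oneideal intro!: Fid(1) dest: ideal_closed(1))
  have Nc: "N n \<subseteq> carrier R" for n using ideal_closed(1)[OF Nid] by blast
  have Nsat: "saturate R q (N n) \<subseteq> N n" for n
    using Fid(2)[OF Nc] by (cases n) (auto simp: N0 NS saturate_def[of _ _ "carrier R"])
  have PN: "P \<subseteq> N n" for n
    using Fid(3)[OF Nc] ideal_closed(1)[OF Pid] by (cases n) (auto simp: N0 NS)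
  have Ndec: "N (Suc n) \<subseteq> N n" for n
  proof (induction n)
    case 0 show ?case using Nc[of "Suc 0"] by (simp only: N0)
  next
    case (Suc n) then show ?case unfolding NS[of "Suc n"] NS[of n] using Fmono Nc NS by metis
  qed
  have satp: "saturate R p (N n) \<subseteq> N n" for n
    using Nsat[of n] qp unfolding saturate_def by blast
  have Px: "ideal (PIdl x) R" by (rule cgenideal_ideal[OF xc])
  \<comment> \<open>The chain condition applies to these ideals because, by \<open>none\<close>, the
    only prime inside \<open>p\<close> that contains \<open>P\<close> and \<open>x\<close> is
    \<open>p\<close>.\<close>
  define J where "J n = saturate R p (N n <+>\<^bsub>R\<^esub> PIdl x)" for n
  have Jid: "ideal (J n) R" "N n \<subseteq> J n" "PIdl x \<subseteq> J n" for n
    unfolding J_def using saturate_ideal[OF p add_ideals[OF Nid Px]]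
      subset_saturate[OF p add_ideals[OF Nid Px]] ideal_subset_add[OF Nid Px] by blast+
  have I0: "ideal (P <+>\<^bsub>R\<^esub> PIdl x) R" by (rule add_ideals[OF Pid Px])
  have "\<exists>n::nat. \<forall>m\<ge>n. J m = J n"
  proof (rule saturated_dcc[OF noeth p I0])
    fix P' assume P': "primeideal P' R" "P <+>\<^bsub>R\<^esub> PIdl x \<subseteq> P'" "P' \<subseteq> p"
    have "P \<subseteq> P'" "x \<in> P'"
      using ideal_subset_add[OF Pid Px] P' cgenideal_self[OF xc] by auto
    then show "P' = p" using none P' Pq xq by blast
  next
    show "P <+>\<^bsub>R\<^esub> PIdl x \<subseteq> J n" for n
    proof
      fix c assume "c \<in> P <+>\<^bsub>R\<^esub> PIdl x"
      then obtain a b where "a \<in> P" "b \<in> PIdl x" "c = a \<oplus> b" by (rule set_addE)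
      then show "c \<in> J n"
        using PN[of n] Jid(2,3)[of n] ideal_closed(3)[OF Jid(1)[of n], of a b] by auto
    qed
    show "J (Suc n) \<subseteq> J n" for n
      unfolding J_def using Ndec by (intro saturate_mono) (auto elim!: set_addE intro: set_addI)
    show "saturate R p (J n) \<subseteq> J n" for n unfolding J_def by (rule saturate_saturate[OF p])
  qed (rule Jid)
  then obtain n where n: "\<And>m. m \<ge> n \<Longrightarrow> J m = J n" by blast
  have Jn: "J (Suc n) = J n" by (rule n) simp
  have "N n \<subseteq> N (Suc n)"
  proof (rule saturated_nakayama[OF noeth p Nid satp Nid satp Ndec Px])
    show "PIdl x \<subseteq> p" by (rule cgenideal_minimal[OF pid x])
    show "N n \<subseteq> saturate R p (Idl (N (Suc n) \<union> {h \<otimes> b |h b. h \<in> PIdl x \<and> b \<in> N n}))"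
    proof
      fix a assume a: "a \<in> N n"
      then have "a \<in> J (Suc n)" using Jid(2) Jn by blast
      then obtain s where s: "s \<in> carrier R - p" "s \<otimes> a \<in> N (Suc n) <+>\<^bsub>R\<^esub> PIdl x" "a \<in> carrier R"
        unfolding J_def saturate_def by blast
      then obtain c r where c: "c \<in> N (Suc n)" "r \<in> carrier R" "s \<otimes> a = c \<oplus> r \<otimes> x"
        by (auto elim!: set_addE simp: cgenideal_def)
      have cn: "c \<in> N n" using c Ndec by blast
      have sn: "s \<otimes> a \<in> N n" using ideal_closed(4)[OF Nid _ a] s by blast
      \<comment> \<open>The product x r lies in \<open>N n\<close> and \<open>x\<close> is outside
        \<open>q\<close>, so saturation at \<open>q\<close> puts \<open>r\<close> into
        \<open>N n\<close>. Thus \<open>N n\<close> agrees with \<open>N (Suc n)\<close> up to x N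
        n, as Nakayama's lemma at \<open>p\<close> requires.\<close>
      have "x \<otimes> r = s \<otimes> a \<ominus> c" unfolding c(3) using xc c(2) ideal_closed(1)[OF Nid c(1)] by algebra
      then have "x \<otimes> r \<in> N n" using ideal_closed(7)[OF Nid sn cn] by simp
      then have rN: "r \<in> N n" using saturateD[OF Nsat, of x r] xc xq c by auto
      have sub: "N (Suc n) \<union> {h \<otimes> b |h b. h \<in> PIdl x \<and> b \<in> N n} \<subseteq> carrier R"
        using Nc ideal_closed(1)[OF Px] by blast
      have "x \<otimes> r \<in> {h \<otimes> b |h b. h \<in> PIdl x \<and> b \<in> N n}" using rN cgenideal_self[OF xc] by blast
      then have "x \<otimes> r \<in> Idl (N (Suc n) \<union> {h \<otimes> b |h b. h \<in> PIdl x \<and> b \<in> N n})"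
        using genideal_self[OF sub] by blast
      moreover have "c \<in> Idl (N (Suc n) \<union> {h \<otimes> b |h b. h \<in> PIdl x \<and> b \<in> N n})"
        using genideal_self[OF sub] c by blast
      ultimately have "s \<otimes> a \<in> Idl (N (Suc n) \<union> {h \<otimes> b |h b. h \<in> PIdl x \<and> b \<in> N n})"
        unfolding c(3) using ideal_closed(3)[OF genideal_ideal[OF sub]] m_comm[OF xc c(2)] by simp
      then show "a \<in> saturate R p (Idl (N (Suc n) \<union> {h \<otimes> b |h b. h \<in> PIdl x \<and> b \<in> N n}))"
        using s by (auto simp: saturate_def)
    qed
  qed
  \<comment> \<open>Now \<open>N n\<close> is contained in the saturation at \<open>q\<close> of P +
    q N n, so a second use of Nakayama's lemma, at \<open>q\<close> and with \<open>H\<close> equal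
    to \<open>q\<close>, leaves only \<open>P\<close>. The n-th power of any element of
    \<open>q\<close> then lies in \<open>P\<close>.\<close>
  have "N n \<subseteq> P"
  proof (rule saturated_nakayama[OF noeth q Nid Nsat Pid _ PN qid])
    show "saturate R q P \<subseteq> P" using saturate_prime[OF P] Pq by blast
    show "N n \<subseteq> saturate R q (Idl (P \<union> {h \<otimes> b |h b. h \<in> q \<and> b \<in> N n}))"
      using \<open>N n \<subseteq> N (Suc n)\<close> unfolding NS F_def .
  qed simp
  obtain b where b: "b \<in> q" "b \<notin> P" using Pq by blast
  have bc: "b \<in> carrier R" using ideal_closed(1)[OF qid b(1)] .
  have "b [^] k \<in> N k" for k :: nat
  proof (induction k)
    case 0 show ?case by (simp add: N0)
  next
    case (Suc k)
    then have "b \<otimes> b [^] k \<in> N (Suc k)" unfolding NS by (intro Fid(4)[OF Nc] b(1))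
    then show ?case using bc by (simp add: m_comm)
  qed
  then have bP: "b [^] n \<in> P" using \<open>N n \<subseteq> P\<close> by blast
  have "b [^] k \<notin> P" for k :: nat
  proof (induction k)
    case 0 show ?case using one_notin_prime[OF P] by simp
  next
    case (Suc k) then show ?case using primeideal.I_prime[OF P, of "b [^] k" b] b bc by auto
  qed
  then show False using bP by blast
qed

end

section \<open>Chains of primes and dimension\<close>

definition prime_chain :: "('a, 'm) ring_scheme \<Rightarrow> nat \<Rightarrow> (nat \<Rightarrow> 'a set) \<Rightarrow> bool" where
  "prime_chain R n P \<longleftrightarrow> (\<forall>i\<le>n. primeideal (P i) R) \<and> (\<forall>i<n. P i \<subset> P (Suc i))"

lemma krull_dim_prime_chain: "krull_dim R = Sup {ereal (real n) | n. \<exists>P. prime_chain R n P}"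
  unfolding krull_dim_def prime_chain_def ..

lemma prime_chain_mono:
  assumes "prime_chain R n P" "i \<le> j" "j \<le> n"
  shows "P i \<subseteq> P j"
  using assms(2,3)
proof (induction j rule: dec_induct)
  case (step j)
  then show ?case using assms(1) unfolding prime_chain_def
    by (meson Suc_le_lessD less_or_eq_imp_le order_trans psubset_imp_subset)
qed simp

lemma prime_chain_snoc:
  assumes "prime_chain R n P" "primeideal q R" "P n \<subset> q"
  shows "prime_chain R (Suc n) (P(Suc n := q))"
  using assms unfolding prime_chain_def by (auto simp: le_Suc_eq less_Suc_eq)

lemma prime_chain_raise_top:
  assumes "prime_chain R n P" "primeideal q R" "P n \<subseteq> q"
  shows "prime_chain R n (P(n := q))"
  using assms unfolding prime_chain_def by (auto simp: less_Suc_eq)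

lemma prime_chain_prefix:
  assumes "prime_chain R n P" "m \<le> n"
  shows "prime_chain R m P"
  using assms unfolding prime_chain_def by auto

text \<open>The element \<open>x\<close> is pushed down from the top: \<open>prime_between\<close>
  replaces the prime just below the top by one that contains \<open>x\<close>, and the argument is
  repeated below that prime. Each replacement needs two steps of the chain, so exactly one step is
  lost, at the bottom.\<close>

lemma (in cring) prime_chain_through:
  assumes noeth: "noetherian_ring R" and "prime_chain R (Suc n) P" "x \<in> P (Suc n)"
  shows "\<exists>P'. prime_chain R n P' \<and> P' n = P (Suc n) \<and> P 0 \<subseteq> P' 0 \<and> x \<in> P' 0"
  using assms(2,3)
proof (induction n arbitrary: P)
  case 0
  then show ?case
    by (intro exI[of _ "\<lambda>_. P 1"]) (auto simp: prime_chain_def)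
next
  case (Suc n)
  have pr: "primeideal (P i) R" if "i \<le> Suc (Suc n)" for i using Suc.prems(1) that by (simp add: prime_chain_def)
  have st: "P i \<subset> P (Suc i)" if "i \<le> Suc n" for i using Suc.prems(1) that by (simp add: prime_chain_def)
  obtain q where q: "primeideal q R" "P n \<subset> q" "q \<subset> P (Suc (Suc n))" "x \<in> q"
    using prime_between[OF noeth pr[of n] pr[of "Suc n"] pr[of "Suc (Suc n)"] st[of n] st[of "Suc n"] Suc.prems(2)]
    by auto
  have "prime_chain R (Suc n) (P(Suc n := q))"
    using prime_chain_snoc[OF prime_chain_prefix[OF Suc.prems(1), of n] q(1,2)] by simp
  from Suc.IH[OF this] q(4) obtain P' where P': "prime_chain R n P'" "P' n = q" "P 0 \<subseteq> P' 0" "x \<in> P' 0"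
    by auto
  have "prime_chain R (Suc n) (P'(Suc n := P (Suc (Suc n))))"
    using prime_chain_snoc[OF P'(1) pr[of "Suc (Suc n)"]] P'(2) q(3) by simp
  then show ?case using P' by (intro exI[of _ "P'(Suc n := P (Suc (Suc n)))"]) (simp del: fun_upd_apply, simp)
qed

text \<open>This is Krull's height theorem. The set \<open>J\<close> records generators that have
  already been forced into the bottom prime; moving one more generator from \<open>A\<close> to
  \<open>J\<close> costs one step of the chain. When \<open>A\<close> is empty, \<open>m\<close> is
  minimal over \<open>J\<close>, so the bottom prime is already \<open>m\<close>.\<close>

lemma (in cring) prime_chain_length_le_card:
  assumes noeth: "noetherian_ring R" and m: "primeideal m R" and "finite A" "A \<subseteq> m"
    and "\<And>P. primeideal P R \<Longrightarrow> J \<union> A \<subseteq> P \<Longrightarrow> P \<subseteq> m \<Longrightarrow> P = m"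
    and "prime_chain R n P" "J \<subseteq> P 0" "P n \<subseteq> m"
  shows "n \<le> card A"
  using assms(3-)
proof (induction A arbitrary: J n P rule: finite_induct)
  case empty
  have "P 0 \<subseteq> P n" by (rule prime_chain_mono[OF empty(3)]) auto
  moreover have "primeideal (P 0) R" using empty by (auto simp: prime_chain_def)
  ultimately have P0: "P 0 = m" using empty(2)[of "P 0"] empty(4,5) by auto
  show ?case
  proof (cases n)
    case (Suc k)
    then have "P 0 \<subset> P 1" "P 1 \<subseteq> P n" using empty(3) prime_chain_mono[OF empty(3), of 1 n]
      by (auto simp: prime_chain_def)
    then show ?thesis using P0 empty(5) by auto
  qed simp
next
  case (insert a A)
  show ?case
  proof (cases n)
    case (Suc k)
    \<comment> \<open>Raising the top to \<open>m\<close> ensures that the top contains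
      \<open>a\<close>.\<close>
    have "prime_chain R (Suc k) (P(Suc k := m))"
      using prime_chain_raise_top[OF _ m] insert.prems Suc by simp
    from prime_chain_through[OF noeth this, of a] insert.prems(1)
    obtain P' where P': "prime_chain R k P'" "P' k = m" "P 0 \<subseteq> P' 0" "a \<in> P' 0" by auto
    have "k \<le> card A"
      by (rule insert.IH[of "insert a J" _ P']) (use P' insert.prems in auto)
    then show ?thesis using insert.hyps Suc by simp
  qed simp
qed

text \<open>A maximal member of the set of proper ideals above \<open>I\<close> is a maximal ideal
  of the ring, and there is only one of those.\<close>

lemma (in cring) proper_ideal_in_local:
  assumes loc: "noetherian_local_ring R" and m: "maximalideal m R" and I: "ideal I R" "\<one> \<notin> I"
  shows "I \<subseteq> m"
proof -
  have noeth: "noetherian_ring R" and uni: "\<And>J. maximalideal J R \<Longrightarrow> J = m"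
    using loc m by (auto simp: noetherian_local_ring_def)
  define S where "S = {J. ideal J R \<and> I \<subseteq> J \<and> \<one> \<notin> J}"
  have "S \<noteq> {}" "\<And>J. J \<in> S \<Longrightarrow> ideal J R" using I by (auto simp: S_def)
  then obtain M where M: "M \<in> S" "\<And>J. J \<in> S \<Longrightarrow> M \<subseteq> J \<Longrightarrow> J = M"
    using noetherian_ring.ideal_set_has_maximal[OF noeth, of S] by metis
  have "maximalideal M R"
  proof (rule maximalidealI)
    show "ideal M R" "carrier R \<noteq> M" using M by (auto simp: S_def)
    fix J assume J: "ideal J R" "M \<subseteq> J" "J \<subseteq> carrier R"
    show "J = M \<or> J = carrier R"
    proof (cases "\<one> \<in> J")
      case True then show ?thesis using ideal.one_imp_carrier[OF J(1)] by simp
    next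
      case False then show ?thesis using M J by (auto simp: S_def)
    qed
  qed
  then show ?thesis using uni M by (auto simp: S_def)
qed

lemma (in cring) local_unit:
  assumes "noetherian_local_ring R" "maximalideal m R" "c \<in> carrier R - m"
  obtains d where "d \<in> carrier R" "d \<otimes> c = \<one>"
proof -
  have c: "c \<in> carrier R" using assms by auto
  have "\<one> \<in> PIdl c"
    using proper_ideal_in_local[OF assms(1,2) cgenideal_ideal[OF c]] cgenideal_self[OF c] assms(3) by auto
  then show ?thesis using that by (auto simp: cgenideal_def)
qed

lemma (in cring) krull_dim_le_card:
  assumes loc: "noetherian_local_ring R" and m: "maximalideal m R" and A: "finite A" "A \<subseteq> m"
    and min: "\<And>P. primeideal P R \<Longrightarrow> A \<subseteq> P \<Longrightarrow> P = m"
  shows "krull_dim R \<le> ereal (real (card A))"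
  unfolding krull_dim_prime_chain
proof (rule Sup_least, clarify)
  fix n P assume P: "prime_chain R n P"
  have noeth: "noetherian_ring R" using loc by (simp add: noetherian_local_ring_def)
  have mp: "primeideal m R" by (rule maximalideal_prime[OF m])
  have "primeideal (P n) R" using P by (simp add: prime_chain_def)
  then have "P n \<subseteq> m"
    using proper_ideal_in_local[OF loc m] one_notin_prime[of "P n"] primeideal.axioms(1) by blast
  then have "n \<le> card A"
    using prime_chain_length_le_card[OF noeth mp A, of "{}" n P] min P by auto
  then show "ereal (real n) \<le> ereal (real (card A))" by simp
qed

section \<open>Primes and dimension along surjective ring homomorphisms\<close>

locale surj_ring_hom = ring_hom_cring R S h for R :: "('a, 'm) ring_scheme" (structure) and S :: "('b, 'n) ring_scheme" (structure) and h +
  assumes surj: "h ` carrier R = carrier S"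
begin

lemma vimage_prime:
  assumes "primeideal P S"
  shows "primeideal {r \<in> carrier R. h r \<in> P} R"
proof (rule primeidealI)
  have P: "ideal P S" using assms by (rule primeideal.axioms)
  show "ideal {r \<in> carrier R. h r \<in> P} R"
    using ring_hom_ring.ideal_vimage[OF ring_hom_ringI2[OF R.ring_axioms S.ring_axioms homh] P] .
  show "carrier R \<noteq> {r \<in> carrier R. h r \<in> P}"
    using S.one_notin_prime[OF assms] by (auto simp: set_eq_iff intro!: exI[of _ "\<one>\<^bsub>R\<^esub>"])
qed (use primeideal.I_prime[OF assms] in \<open>auto intro: R.is_cring\<close>)

lemma image_ideal:
  assumes "ideal P R"
  shows "ideal (h ` P) S"
proof (rule S.cring_idealI)
  note P = R.ideal_closed[OF assms]
  show "h ` P \<subseteq> carrier S" using P(1) by auto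
  show "\<zero>\<^bsub>S\<^esub> \<in> h ` P" using P(2) by (metis hom_zero image_eqI)
  show "a \<oplus>\<^bsub>S\<^esub> b \<in> h ` P" if ab: "a \<in> h ` P" "b \<in> h ` P" for a b
  proof -
    obtain x y where "x \<in> P" "y \<in> P" "a = h x" "b = h y" using ab by auto
    then show ?thesis using P(1,3) by (auto intro!: image_eqI[of _ _ "x \<oplus>\<^bsub>R\<^esub> y"])
  qed
  show "r \<otimes>\<^bsub>S\<^esub> a \<in> h ` P" if ra: "r \<in> carrier S" "a \<in> h ` P" for r a
  proof -
    obtain s x where "s \<in> carrier R" "x \<in> P" "r = h s" "a = h x" using ra surj by blast
    then show ?thesis using P(1,4) by (auto intro!: image_eqI[of _ _ "s \<otimes>\<^bsub>R\<^esub> x"])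
  qed
qed

lemma image_mem_iff:
  assumes "ideal P R" "{r \<in> carrier R. h r = \<zero>\<^bsub>S\<^esub>} \<subseteq> P" "a \<in> carrier R"
  shows "h a \<in> h ` P \<longleftrightarrow> a \<in> P"
proof
  assume "h a \<in> h ` P"
  then obtain b where b: "b \<in> P" "h a = h b" by auto
  have bc: "b \<in> carrier R" using R.ideal_closed(1)[OF assms(1) b(1)] .
  have "h (a \<oplus>\<^bsub>R\<^esub> \<ominus>\<^bsub>R\<^esub> b) = \<zero>\<^bsub>S\<^esub>" using assms(3) bc b(2) by (simp add: S.r_neg)
  then have "a \<oplus>\<^bsub>R\<^esub> \<ominus>\<^bsub>R\<^esub> b \<in> P" using assms bc by auto
  then show "a \<in> P" using R.ideal_add_cancel[OF assms(1,3)] R.ideal_closed(6)[OF assms(1) b(1)] by auto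
qed auto

lemma image_prime:
  assumes "primeideal P R" "{r \<in> carrier R. h r = \<zero>\<^bsub>S\<^esub>} \<subseteq> P"
  shows "primeideal (h ` P) S"
proof (rule primeidealI)
  have P: "ideal P R" using assms by (blast intro: primeideal.axioms)
  note mem = image_mem_iff[OF P assms(2)]
  show "ideal (h ` P) S" by (rule image_ideal[OF P])
  show "carrier S \<noteq> h ` P"
    using R.one_notin_prime[OF assms(1)] mem[of "\<one>\<^bsub>R\<^esub>"] hom_one S.one_closed by auto
  fix a b assume ab: "a \<in> carrier S" "b \<in> carrier S" "a \<otimes>\<^bsub>S\<^esub> b \<in> h ` P"
  obtain x y where xy: "x \<in> carrier R" "y \<in> carrier R" "a = h x" "b = h y" using ab surj by blast
  then have "x \<otimes>\<^bsub>R\<^esub> y \<in> P" using ab mem[of "x \<otimes>\<^bsub>R\<^esub> y"] by simp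
  then show "a \<in> h ` P \<or> b \<in> h ` P" using primeideal.I_prime[OF assms(1)] xy by blast
qed (rule S.is_cring)

lemma prime_chain_image:
  assumes P: "prime_chain R n P" and ker: "{r \<in> carrier R. h r = \<zero>\<^bsub>S\<^esub>} \<subseteq> P 0"
  shows "prime_chain S n (\<lambda>i. h ` P i)"
  unfolding prime_chain_def
proof (intro conjI allI impI)
  have k: "{r \<in> carrier R. h r = \<zero>\<^bsub>S\<^esub>} \<subseteq> P i" if "i \<le> n" for i
    using ker prime_chain_mono[OF P, of 0 i] that by auto
  have pr: "primeideal (P i) R" if "i \<le> n" for i using P that by (simp add: prime_chain_def)
  show "primeideal (h ` P i) S" if "i \<le> n" for i by (rule image_prime[OF pr[OF that] k[OF that]])
  show "h ` P i \<subset> h ` P (Suc i)" if i: "i < n" for i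
  proof -
    have ss: "P i \<subset> P (Suc i)" using P i by (simp add: prime_chain_def)
    then obtain a where a: "a \<in> P (Suc i)" "a \<notin> P i" by auto
    have id: "ideal (P i) R" "ideal (P (Suc i)) R" using pr[of i] pr[of "Suc i"] i by (auto intro: primeideal.axioms)
    then have "a \<in> carrier R" using a R.ideal_closed(1) by blast
    then have "h a \<notin> h ` P i" using image_mem_iff[OF id(1) k] a i by auto
    then show ?thesis using ss a by blast
  qed
qed

lemma prime_chain_vimage:
  assumes P: "prime_chain S n P"
  shows "prime_chain R n (\<lambda>i. {r \<in> carrier R. h r \<in> P i})"
  unfolding prime_chain_def
proof (intro conjI allI impI)
  show "primeideal {r \<in> carrier R. h r \<in> P i} R" if "i \<le> n" for i
    using P that by (intro vimage_prime) (simp add: prime_chain_def)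
  show "{r \<in> carrier R. h r \<in> P i} \<subset> {r \<in> carrier R. h r \<in> P (Suc i)}" if i: "i < n" for i
  proof -
    have ss: "P i \<subset> P (Suc i)" and pr: "primeideal (P (Suc i)) S" using P i by (auto simp: prime_chain_def)
    then obtain a where a: "a \<in> P (Suc i)" "a \<notin> P i" by auto
    have "a \<in> carrier S" using S.ideal_closed(1)[OF primeideal.axioms(1)[OF pr] a(1)] .
    then obtain r where "r \<in> carrier R" "a = h r" using surj by blast
    then show ?thesis using ss a by blast
  qed
qed

text \<open>Dimensions of quotient rings can thereby be counted with primes of the source, so the
  concrete primes of S also serve for R and for the quotients by annihilators.\<close>

lemma krull_dim_image:
  "krull_dim S = Sup {ereal (real n) | n. \<exists>P. prime_chain R n P \<and> {r \<in> carrier R. h r = \<zero>\<^bsub>S\<^esub>} \<subseteq> P 0}"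
  unfolding krull_dim_prime_chain
proof (rule arg_cong[where f = Sup], rule Collect_cong, rule ex_cong1, rule conj_cong[OF refl], rule iffI)
  fix n assume "\<exists>P. prime_chain S n P"
  then obtain P where P: "prime_chain S n P" by blast
  then have "\<zero>\<^bsub>S\<^esub> \<in> P 0"
    using S.ideal_closed(2)[of "P 0"] by (auto simp: prime_chain_def primeideal_def)
  then have "{r \<in> carrier R. h r = \<zero>\<^bsub>S\<^esub>} \<subseteq> {r \<in> carrier R. h r \<in> P 0}" by auto
  then show "\<exists>P. prime_chain R n P \<and> {r \<in> carrier R. h r = \<zero>\<^bsub>S\<^esub>} \<subseteq> P 0"
    using prime_chain_vimage[OF P] by blast
qed (use prime_chain_image in blast)

end

lemma (in cring) surj_ring_hom_quot:
  assumes "ideal I R"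
  shows "surj_ring_hom R (R Quot I) ((+>) I)"
proof -
  have "ring_hom_cring R (R Quot I) ((+>) I)" by (rule ideal.rcos_ring_hom_cring[OF assms is_cring])
  moreover have "(+>) I ` carrier R = carrier (R Quot I)" by (auto simp: FactRing_def A_RCOSETS_def')
  ultimately show ?thesis by (simp add: surj_ring_hom_def surj_ring_hom_axioms_def)
qed

lemma (in cring) coset_eq_self_iff:
  assumes "ideal I R" "a \<in> carrier R"
  shows "I +> a = I \<longleftrightarrow> a \<in> I"
  using quotient_eq_iff_same_a_r_cos[OF assms(1,2) zero_closed] assms(2)
    a_rcos_zero[OF assms(1) ideal_closed(2)[OF assms(1)]] by (simp add: a_minus_def)

lemma (in cring) krull_dim_quot:
  assumes "ideal I R"
  shows "krull_dim (R Quot I) = Sup {ereal (real n) | n. \<exists>P. prime_chain R n P \<and> I \<subseteq> P 0}"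
proof -
  have "{r \<in> carrier R. I +> r = \<zero>\<^bsub>R Quot I\<^esub>} = I"
    using coset_eq_self_iff[OF assms] ideal_closed(1)[OF assms] by (auto simp: FactRing_def)
  then show ?thesis using surj_ring_hom.krull_dim_image[OF surj_ring_hom_quot[OF assms]] by simp
qed

section \<open>Generators of the maximal ideal of a regular local ring\<close>

context cring
begin

lemma Idl_insert:
  assumes "a \<in> carrier R" "A \<subseteq> carrier R"
  shows "Idl (insert a A) = PIdl a <+>\<^bsub>R\<^esub> Idl A"
proof -
  have c: "Idl {a} = PIdl a" using cgenideal_eq_genideal[OF assms(1)] by simp
  have i: "ideal (PIdl a) R" "ideal (Idl A) R" using cgenideal_ideal genideal_ideal assms by auto
  show ?thesis
  proof
    show "Idl (insert a A) \<subseteq> PIdl a <+>\<^bsub>R\<^esub> Idl A"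
      using ideal_subset_add[OF i] genideal_self[OF assms(2)] cgenideal_self[OF assms(1)]
      by (intro genideal_minimal add_ideals i) blast
    have "ideal (Idl (insert a A)) R" using assms by (intro genideal_ideal) auto
    note I = ideal_closed[OF this]
    have "insert a A \<subseteq> Idl (insert a A)" using assms by (intro genideal_self) auto
    then have "PIdl a \<subseteq> Idl (insert a A)" "Idl A \<subseteq> Idl (insert a A)"
      using assms cgenideal_minimal[OF \<open>ideal (Idl (insert a A)) R\<close>]
        genideal_minimal[OF \<open>ideal (Idl (insert a A)) R\<close>] by auto
    then show "PIdl a <+>\<^bsub>R\<^esub> Idl A \<subseteq> Idl (insert a A)"
      using I(3) by (auto elim!: set_addE)
  qed
qed

lemma Idl_insertE:
  assumes "x \<in> Idl (insert a A)" "a \<in> carrier R" "A \<subseteq> carrier R"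
  obtains r y where "r \<in> carrier R" "y \<in> Idl A" "x = r \<otimes> a \<oplus> y"
proof -
  have "x \<in> PIdl a <+>\<^bsub>R\<^esub> Idl A" using assms Idl_insert by simp
  then show ?thesis using that by (auto elim!: set_addE simp: cgenideal_def)
qed

lemma Idl_eqI:
  assumes "A \<subseteq> carrier R" "B \<subseteq> carrier R" "A \<subseteq> Idl B" "B \<subseteq> Idl A"
  shows "Idl A = Idl B"
  using assms by (intro subset_antisym genideal_minimal genideal_ideal)

lemma Idl_mono: "A \<subseteq> B \<Longrightarrow> B \<subseteq> carrier R \<Longrightarrow> Idl A \<subseteq> Idl B"
  by (rule subset_Idl_subset)

lemma Idl_replace:
  assumes A: "A \<subseteq> carrier R" and "a \<in> carrier R" "b \<in> carrier R"
    and "a \<in> Idl (insert b A)" "b \<in> Idl (insert a A)"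
  shows "Idl (insert a A) = Idl (insert b A)"
  using assms genideal_self[of "insert a A"] genideal_self[of "insert b A"]
  by (intro Idl_eqI) auto

lemma Idl_replace_add:
  assumes A: "A \<subseteq> carrier R" and a: "a \<in> carrier R" and c: "c \<in> Idl A"
  shows "Idl (insert (a \<oplus> c) A) = Idl (insert a A)"
proof -
  have cc: "c \<in> carrier R" using ideal_closed(1)[OF genideal_ideal[OF A] c] .
  have ia: "ideal (Idl (insert a A)) R" "ideal (Idl (insert (a \<oplus> c) A)) R"
    using A a cc by (auto intro!: genideal_ideal)
  have ca: "c \<in> Idl (insert a A)" "c \<in> Idl (insert (a \<oplus> c) A)"
    using c A a cc Idl_mono[of A "insert a A"] Idl_mono[of A "insert (a \<oplus> c) A"] by auto
  have sa: "a \<in> Idl (insert a A)" "a \<oplus> c \<in> Idl (insert (a \<oplus> c) A)"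
    using genideal_self[of "insert a A"] genideal_self[of "insert (a \<oplus> c) A"] A a cc by auto
  show ?thesis
    using ideal_closed(3)[OF ia(1) sa(1) ca(1)] ideal_add_cancel[OF ia(2) a ca(2) sa(2)] A a cc
    by (intro Idl_replace) auto
qed

text \<open>Steinitz exchange modulo the square of the maximal ideal, for which \<open>M2\<close> stands.\<close>

lemma local_exchange:
  assumes loc: "noetherian_local_ring R" and m: "maximalideal m R"
    and M2: "ideal M2 R" "\<And>a b. a \<in> m \<Longrightarrow> b \<in> m \<Longrightarrow> a \<otimes> b \<in> M2"
    and S: "finite S" "S \<subseteq> m" and T: "T \<subseteq> m" and v: "v \<in> Idl (S \<union> T)" "v \<notin> Idl T <+>\<^bsub>R\<^esub> M2"
  shows "\<exists>s\<in>S. Idl (S \<union> T) = Idl ((S - {s}) \<union> insert v T)"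
  using S v
proof (induction S arbitrary: v rule: finite_induct)
  case empty
  have "T \<subseteq> carrier R" using T ideal_closed(1)[OF maximalideal.axioms(1)[OF m]] by blast
  then have "Idl T \<subseteq> Idl T <+>\<^bsub>R\<^esub> M2" by (intro ideal_subset_add genideal_ideal M2)
  then show ?case using empty by auto
next
  case (insert s S)
  have mc: "m \<subseteq> carrier R" using ideal_closed(1)[OF maximalideal.axioms(1)[OF m]] by blast
  have sc: "s \<in> carrier R" and STc: "S \<union> T \<subseteq> carrier R" and Tc: "T \<subseteq> carrier R" using insert.prems T mc by auto
  have idT: "ideal (Idl T <+>\<^bsub>R\<^esub> M2) R" using Tc by (intro add_ideals genideal_ideal M2)
  have idST: "ideal (Idl (S \<union> T)) R" using STc by (intro genideal_ideal)
  obtain c w where cw: "c \<in> carrier R" "w \<in> Idl (S \<union> T)" "v = c \<otimes> s \<oplus> w"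
    using insert.prems(2) Idl_insertE[OF _ sc STc, of v] by auto
  have wc: "w \<in> carrier R" using ideal_closed(1)[OF idST cw(2)] .
  have vc: "v \<in> carrier R" using cw sc wc by simp
  show ?case
  proof (cases "c \<in> m")
    \<comment> \<open>With a unit as its coefficient, \<open>s\<close> can be solved for and
      exchanged directly.\<close>
    case False
    then obtain d where d: "d \<in> carrier R" "d \<otimes> c = \<one>" using local_unit[OF loc m] cw by blast
    have iv: "ideal (Idl (insert v (S \<union> T))) R" using STc vc by (intro genideal_ideal) auto
    have isS: "ideal (Idl (insert s (S \<union> T))) R" using STc sc by (intro genideal_ideal) auto
    have vST: "insert v (S \<union> T) \<subseteq> carrier R" using STc vc by simp
    have "v \<in> Idl (insert v (S \<union> T))" using genideal_self[OF vST] by simp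
    moreover have "w \<in> Idl (insert v (S \<union> T))" using Idl_mono[OF subset_insertI vST] cw(2) by (rule subsetD)
    ultimately have "v \<ominus> w \<in> Idl (insert v (S \<union> T))" by (rule ideal_closed(7)[OF iv])
    then have "d \<otimes> (v \<ominus> w) \<in> Idl (insert v (S \<union> T))" by (rule ideal_closed(4)[OF iv d(1)])
    moreover have "d \<otimes> (v \<ominus> w) = (d \<otimes> c) \<otimes> s" unfolding cw(3) using d(1) cw(1) sc wc by algebra
    ultimately have "s \<in> Idl (insert v (S \<union> T))" using d sc by simp
    moreover have "v \<in> Idl (insert s (S \<union> T))" using insert.prems(2) by simp
    ultimately have "Idl (insert s (S \<union> T)) = Idl (insert v (S \<union> T))"
      using STc sc vc by (intro Idl_replace)
    moreover have "insert s S - {s} = S" using insert.hyps by auto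
    ultimately show ?thesis by (intro bexI[of _ s]) auto
  next
    case True
    \<comment> \<open>With its coefficient in \<open>m\<close>, the term c s lies in
      \<open>M2\<close>, so \<open>w\<close> is as independent as \<open>v\<close> and some
      \<open>s'\<close> is exchanged for \<open>w\<close>. Passing from \<open>w\<close> back to
      \<open>v\<close> changes nothing, because \<open>s\<close> stays among the generators.\<close>
    have cs: "c \<otimes> s \<in> M2" using M2(2) True insert.prems by auto
    have csT: "c \<otimes> s \<in> Idl T <+>\<^bsub>R\<^esub> M2"
      using cs ideal_subset_add(2)[OF genideal_ideal[OF Tc] M2(1)] by auto
    have "w \<notin> Idl T <+>\<^bsub>R\<^esub> M2" using insert.prems(3) ideal_closed(3)[OF idT csT] cw(3) by auto
    then obtain s' where s': "s' \<in> S" "Idl (S \<union> T) = Idl ((S - {s'}) \<union> insert w T)"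
      using insert.IH[of w] insert.prems cw by auto
    define B where "B = insert s ((S - {s'}) \<union> T)"
    have Bc: "B \<subseteq> carrier R" using STc sc by (auto simp: B_def)
    have "c \<otimes> s \<in> Idl B" using genideal_self[OF Bc] ideal_closed(4)[OF genideal_ideal[OF Bc] cw(1)]
      by (auto simp: B_def)
    then have "Idl (insert (w \<oplus> c \<otimes> s) B) = Idl (insert w B)" by (rule Idl_replace_add[OF Bc wc])
    moreover have "w \<oplus> c \<otimes> s = v" using cw sc wc by (simp add: a_comm)
    moreover have "Idl (insert w B) = Idl (insert s (S \<union> T))"
    proof -
      have e: "insert w B = insert s ((S - {s'}) \<union> insert w T)" by (auto simp: B_def)
      have c1: "(S - {s'}) \<union> insert w T \<subseteq> carrier R" using STc wc by auto
      show ?thesis unfolding e Idl_insert[OF sc c1] Idl_insert[OF sc STc] s'(2) ..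
    qed
    moreover have "insert v B = (insert s S - {s'}) \<union> insert v T"
      using s'(1) insert.hyps by (auto simp: B_def)
    ultimately show ?thesis using s'(1) by (intro bexI[of _ s']) auto
  qed
qed

end

text \<open>The functions \<open>eps\<close>, \<open>lx\<close>, \<open>ly\<close>, \<open>lz\<close> play the roles of the residue map and of the
  coordinates of \<open>m / (m\<^sup>2 + I)\<close> with respect to the classes of \<open>X\<close>, \<open>Y\<close>, \<open>Z\<close>.\<close>

lemma (in cring) quadric_notin_mult:
  fixes eps lx ly lz :: "'a \<Rightarrow> 'k::field"
  assumes reg: "regular_local_ring R" and m: "maximalideal m R"
    and m_eq: "m = {a \<in> carrier R. eps a = 0}"
    and eps_mult: "\<And>a b. a \<in> carrier R \<Longrightarrow> b \<in> carrier R \<Longrightarrow> eps (a \<otimes> b) = eps a * eps b"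
    and l_add: "\<And>l a b. l \<in> {lx, ly, lz} \<Longrightarrow> a \<in> carrier R \<Longrightarrow> b \<in> carrier R \<Longrightarrow> l (a \<oplus> b) = l a + l b"
    and l_mult: "\<And>l a b. l \<in> {lx, ly, lz} \<Longrightarrow> a \<in> carrier R \<Longrightarrow> b \<in> carrier R \<Longrightarrow>
      l (a \<otimes> b) = eps a * l b + eps b * l a"
    and xyz: "x \<in> m" "y \<in> m" "z \<in> m"
    and dual: "lx x = 1" "lx y = 0" "lx z = 0" "ly x = 0" "ly y = 1" "ly z = 0" "lz x = 0" "lz y = 0" "lz z = 1"
    and I: "ideal I R" "I \<subseteq> m" "\<And>l i. l \<in> {lx, ly, lz} \<Longrightarrow> i \<in> I \<Longrightarrow> l i = 0"
    and m_gen: "\<And>a. a \<in> m \<Longrightarrow> \<exists>u\<in>carrier R. \<exists>v\<in>carrier R. \<exists>w\<in>carrier R. \<exists>i\<in>I. a = u \<otimes> x \<oplus> v \<otimes> y \<oplus> w \<otimes> z \<oplus> i"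
  shows "z \<otimes> z \<ominus> x \<otimes> y \<notin> Idl {a \<otimes> i | a i. a \<in> m \<and> i \<in> I}"
proof
  assume asm: "z \<otimes> z \<ominus> x \<otimes> y \<in> Idl {a \<otimes> i | a i. a \<in> m \<and> i \<in> I}"
  have loc: "noetherian_local_ring R" using reg by (simp add: regular_local_ring_def)
  have mid: "ideal m R" using m by (rule maximalideal.axioms)
  note mD = ideal_closed[OF mid] and ID = ideal_closed[OF I(1)]
  have mc: "m \<subseteq> carrier R" using mD(1) by blast
  have xyzc: "x \<in> carrier R" "y \<in> carrier R" "z \<in> carrier R" using xyz mD(1) by auto
  have mI: "a \<in> m" if "a \<in> carrier R" "eps a = 0" for a using that m_eq by simp
  have eps_m: "a \<in> m \<Longrightarrow> eps a = 0" for a using m_eq by simp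
  have l_zero: "l \<zero> = 0" if l: "l \<in> {lx, ly, lz}" for l
  proof -
    have "l \<zero> + 0 = l (\<zero> \<oplus> \<zero>)" by simp
    also have "\<dots> = l \<zero> + l \<zero>" using l by (rule l_add) simp_all
    finally show ?thesis using add_left_imp_eq by metis
  qed
  have ker: "ideal {q \<in> m. l q = 0} R" if l: "l \<in> {lx, ly, lz}" for l
    by (rule cring_idealI) (use l_add[OF l] l_mult[OF l] l_zero[OF l] eps_m mc mD in auto)
  \<comment> \<open>\<open>K\<close> stands for m^2 + I: it contains all products of elements of
    \<open>m\<close>, and all of \<open>I\<close>, and it takes the place of \<open>M2\<close> in
    the exchange lemma.\<close>
  define K where "K = {q \<in> m. lx q = 0} \<inter> {q \<in> m. ly q = 0} \<inter> {q \<in> m. lz q = 0}"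
  have K: "ideal K R" unfolding K_def by (intro i_intersect ker) auto
  have mmK: "a \<otimes> b \<in> K" if "a \<in> m" "b \<in> m" for a b
  proof -
    have "l (a \<otimes> b) = 0" if "l \<in> {lx, ly, lz}" for l
      using l_mult[OF that, of a b] eps_m \<open>a \<in> m\<close> \<open>b \<in> m\<close> mc by auto
    moreover have "a \<otimes> b \<in> m" using mD(4) mc that by auto
    ultimately show ?thesis unfolding K_def by simp
  qed
  \<comment> \<open>A coordinate that vanishes on \<open>T\<close> and on \<open>K\<close> but not
    at \<open>v\<close> separates \<open>v\<close> from their sum. With the coordinates dual to
    \<open>x\<close>, \<open>y\<close>, \<open>z\<close> this licenses the three exchanges in
    turn.\<close>
  have indep: "v \<notin> Idl T <+>\<^bsub>R\<^esub> K" if l: "l \<in> {lx, ly, lz}" and v: "l v \<noteq> 0" and T: "T \<subseteq> {q \<in> m. l q = 0}" for l v T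
  proof
    assume "v \<in> Idl T <+>\<^bsub>R\<^esub> K"
    then obtain t k where tk: "t \<in> Idl T" "k \<in> K" "v = t \<oplus> k" by (rule set_addE)
    have "t \<in> {q \<in> m. l q = 0}" using genideal_minimal[OF ker[OF l] T] tk(1) by blast
    moreover have "k \<in> {q \<in> m. l q = 0}" using tk(2) l by (auto simp: K_def)
    ultimately have "v \<in> {q \<in> m. l q = 0}" unfolding tk(3) by (rule ideal_closed(3)[OF ker[OF l]])
    then show False using v by simp
  qed
  obtain A where A: "A \<subseteq> carrier R" "finite A" "maximalideal (Idl A) R" "ereal (real (card A)) = krull_dim R"
    using reg unfolding regular_local_ring_def by blast
  have Am: "Idl A = m" using A(3) m loc by (auto simp: noetherian_local_ring_def)
  have "A \<subseteq> m" using genideal_self[OF A(1)] Am by simp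
  have "\<exists>s\<in>A. Idl (A \<union> {}) = Idl ((A - {s}) \<union> {x})"
    by (rule local_exchange[OF loc m K mmK A(2) \<open>A \<subseteq> m\<close>]) (simp_all add: Am xyz indep[of lx] dual)
  then obtain s1 where s1: "s1 \<in> A" "Idl ((A - {s1}) \<union> {x}) = m" unfolding Un_empty_right Am by metis
  define A1 where "A1 = A - {s1}"
  note s1' = s1(2)[folded A1_def]
  have A1: "finite A1" "A1 \<subseteq> m" "card A = Suc (card A1)"
    using A(2) \<open>A \<subseteq> m\<close> card.remove[OF A(2) s1(1)] by (auto simp: A1_def)
  have "\<exists>s\<in>A1. Idl (A1 \<union> {x}) = Idl ((A1 - {s}) \<union> {y, x})"
    by (rule local_exchange[OF loc m K mmK A1(1,2)]) (simp_all add: s1'[simplified] xyz indep[of ly] dual)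
  then obtain s2 where s2: "s2 \<in> A1" "Idl ((A1 - {s2}) \<union> {y, x}) = m" unfolding s1' by metis
  define A2 where "A2 = A1 - {s2}"
  note s2' = s2(2)[folded A2_def]
  have A2: "finite A2" "A2 \<subseteq> m" "card A1 = Suc (card A2)"
    using A1(1,2) card.remove[OF A1(1) s2(1)] by (auto simp: A2_def)
  have "\<exists>s\<in>A2. Idl (A2 \<union> {y, x}) = Idl ((A2 - {s}) \<union> {z, y, x})"
    by (rule local_exchange[OF loc m K mmK A2(1,2)]) (simp_all add: s2'[simplified] xyz indep[of lz] dual)
  then obtain s3 where s3: "s3 \<in> A2" "Idl ((A2 - {s3}) \<union> {z, y, x}) = m" unfolding s2' by metis
  define A3 where "A3 = A2 - {s3}"
  have A3: "finite A3" "A3 \<subseteq> m" "card A2 = Suc (card A3)"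
    using A2(1,2) card.remove[OF A2(1) s3(1)] by (auto simp: A3_def)
  \<comment> \<open>The generators that survive the three exchanges are moved into \<open>I\<close>
    by subtracting multiples of \<open>x\<close>, \<open>y\<close>, \<open>z\<close>.\<close>
  have "\<forall>a\<in>A3. \<exists>i\<in>I. \<exists>u\<in>carrier R. \<exists>v\<in>carrier R. \<exists>w\<in>carrier R. a = u \<otimes> x \<oplus> v \<otimes> y \<oplus> w \<otimes> z \<oplus> i"
    using m_gen A3(2) by blast
  then obtain j where j: "\<And>a. a \<in> A3 \<Longrightarrow> j a \<in> I"
    "\<And>a. a \<in> A3 \<Longrightarrow> \<exists>u\<in>carrier R. \<exists>v\<in>carrier R. \<exists>w\<in>carrier R. a = u \<otimes> x \<oplus> v \<otimes> y \<oplus> w \<otimes> z \<oplus> j a"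
    by metis
  define B where "B = j ` A3"
  have BI: "B \<subseteq> I" using j(1) by (auto simp: B_def)
  have Bc: "B \<subseteq> carrier R" using BI ID(1) by auto
  \<comment> \<open>Together with \<open>z\<close> this set generates \<open>m\<close>, yet it has
    at most dim R - 1 elements: \<open>A3\<close> has three elements fewer than \<open>A\<close>,
    and only \<open>x\<close> and \<open>y\<close> are put back.\<close>
  define C where "C = insert x (insert y B)"
  have Cm: "C \<subseteq> m" using BI I(2) xyz by (auto simp: C_def)
  then have Cc: "C \<subseteq> carrier R" using mc by auto
  define N where "N = Idl C"
  have N: "ideal N R" unfolding N_def by (rule genideal_ideal[OF Cc])
  note ND = ideal_closed[OF N]
  have CN: "C \<subseteq> N" unfolding N_def by (rule genideal_self[OF Cc])
  have zCc: "insert z C \<subseteq> carrier R" using Cc xyzc by auto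
  have m_eq': "m = Idl (insert z C)"
  proof
    show "Idl (insert z C) \<subseteq> m" using Cm xyz by (intro genideal_minimal mid) auto
    note zC = ideal_closed[OF genideal_ideal[OF zCc]]
    have sub: "insert z C \<subseteq> Idl (insert z C)" by (rule genideal_self[OF zCc])
    have "a \<in> Idl (insert z C)" if a: "a \<in> A3" for a
    proof -
      obtain u v w where "u \<in> carrier R" "v \<in> carrier R" "w \<in> carrier R"
        and e: "a = u \<otimes> x \<oplus> v \<otimes> y \<oplus> w \<otimes> z \<oplus> j a"
        using j(2)[OF a] by blast
      moreover have "x \<in> Idl (insert z C)" "y \<in> Idl (insert z C)" "z \<in> Idl (insert z C)" "j a \<in> Idl (insert z C)"
        using sub a by (auto simp: C_def B_def)
      ultimately have "u \<otimes> x \<oplus> v \<otimes> y \<oplus> w \<otimes> z \<oplus> j a \<in> Idl (insert z C)" by (intro zC(3) zC(4))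
      then show ?thesis by (simp only: e[symmetric])
    qed
    then have "(A2 - {s3}) \<union> {z, y, x} \<subseteq> Idl (insert z C)" using sub by (auto simp: A3_def C_def)
    then show "m \<subseteq> Idl (insert z C)"
      unfolding s3(2)[symmetric] by (intro genideal_minimal genideal_ideal[OF zCc])
  qed
  have decomp: "\<exists>c\<in>carrier R. \<exists>n\<in>N. a = c \<otimes> z \<oplus> n" if "a \<in> m" for a
    using Idl_insertE[OF _ xyzc(3) Cc, of a] that m_eq' unfolding N_def by metis
  define z3 where "z3 = z \<otimes> (z \<otimes> z)"
  have z3c: "z3 \<in> carrier R" using xyzc by (simp add: z3_def)
  have Pz: "ideal (PIdl z3) R" by (rule cgenideal_ideal[OF z3c])
  \<comment> \<open>The exponent 3 counts one factor z from an element of \<open>m\<close> and two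
    from an element of \<open>I\<close>: modulo \<open>N\<close> both are multiples of
    \<open>z\<close>, and the factor in front of \<open>z\<close> in the latter lies in
    \<open>m\<close> again.\<close>
  define U where "U = PIdl z3 <+>\<^bsub>R\<^esub> N"
  have U: "ideal U R" unfolding U_def by (rule add_ideals[OF Pz N])
  have NU: "N \<subseteq> U" unfolding U_def by (rule ideal_subset_add(2)[OF Pz N])
  have UI: "c \<otimes> z3 \<oplus> n \<in> U" if "c \<in> carrier R" "n \<in> N" for c n
    using that unfolding U_def cgenideal_def by (intro set_addI) auto
  have "{a \<otimes> i | a i. a \<in> m \<and> i \<in> I} \<subseteq> U"
  proof clarify
    fix a i assume a: "a \<in> m" and i: "i \<in> I"
    have im: "i \<in> m" using i I(2) by auto
    have yBc: "insert y B \<subseteq> carrier R" using Bc xyzc by simp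
    obtain w n where w: "w \<in> carrier R" "n \<in> Idl C" "i = w \<otimes> z \<oplus> n"
      using Idl_insertE[OF _ xyzc(3) Cc, of i] im m_eq' by metis
    obtain u n' where u: "u \<in> carrier R" "n' \<in> Idl (insert y B)" "n = u \<otimes> x \<oplus> n'"
      using Idl_insertE[OF _ xyzc(1) yBc, of n] w(2) unfolding C_def by metis
    obtain v b where v: "v \<in> carrier R" "b \<in> Idl B" "n' = v \<otimes> y \<oplus> b"
      using Idl_insertE[OF u(2) xyzc(2) Bc] by metis
    have bI: "b \<in> I" using genideal_minimal[OF I(1) BI] v(2) by blast
    have bc: "b \<in> carrier R" using bI ID(1) by blast
    \<comment> \<open>Only the term w z contributes to the \<open>z\<close> coordinate of
      \<open>i\<close>, and that coordinate is zero because \<open>i\<close> lies in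
      \<open>I\<close>.\<close>
    have "lz i = eps w"
      unfolding w(3) u(3) v(3) using w(1) u(1) v(1) bc xyzc l_add[of lz] l_mult[of lz] dual
        eps_m[OF xyz(1)] eps_m[OF xyz(2)] eps_m[OF xyz(3)] I(3)[of lz b] bI by simp
    then have wm: "w \<in> m" using I(3)[of lz i] i mI w(1) by simp
    obtain c1 n1 where c1: "c1 \<in> carrier R" "n1 \<in> N" "a = c1 \<otimes> z \<oplus> n1" using decomp[OF a] by blast
    obtain c2 n2 where c2: "c2 \<in> carrier R" "n2 \<in> N" "w = c2 \<otimes> z \<oplus> n2" using decomp[OF wm] by blast
    have nN: "n \<in> N" using w(2) by (simp add: N_def)
    have nc: "n \<in> carrier R" "n1 \<in> carrier R" "n2 \<in> carrier R" using ND(1) nN c1 c2 by auto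
    have ac: "a \<in> carrier R" using a mc by auto
    have "a \<otimes> i = a \<otimes> (w \<otimes> z) \<oplus> a \<otimes> n" unfolding w(3) using ac w(1) xyzc nc by algebra
    also have "a \<otimes> (w \<otimes> z) = (c1 \<otimes> c2) \<otimes> z3 \<oplus> ((z \<otimes> (c2 \<otimes> z \<oplus> n2)) \<otimes> n1 \<oplus> (c1 \<otimes> (z \<otimes> z)) \<otimes> n2)"
      unfolding c1(3) c2(3) z3_def using c1(1) c2(1) nc xyzc by algebra
    finally have e: "a \<otimes> i = (c1 \<otimes> c2) \<otimes> z3 \<oplus> ((z \<otimes> (c2 \<otimes> z \<oplus> n2)) \<otimes> n1 \<oplus> (c1 \<otimes> (z \<otimes> z)) \<otimes> n2) \<oplus> a \<otimes> n" .
    have "(z \<otimes> (c2 \<otimes> z \<oplus> n2)) \<otimes> n1 \<oplus> (c1 \<otimes> (z \<otimes> z)) \<otimes> n2 \<in> N"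
      using c1 c2 nc xyzc by (intro ND(3) ND(4)) auto
    then have "(c1 \<otimes> c2) \<otimes> z3 \<oplus> ((z \<otimes> (c2 \<otimes> z \<oplus> n2)) \<otimes> n1 \<oplus> (c1 \<otimes> (z \<otimes> z)) \<otimes> n2) \<in> U"
      using c1 c2 by (intro UI) auto
    moreover have "a \<otimes> n \<in> U" using ND(4)[OF ac nN] NU by blast
    ultimately show "a \<otimes> i \<in> U" unfolding e by (rule ideal_closed(3)[OF U])
  qed
  then have "Idl {a \<otimes> i | a i. a \<in> m \<and> i \<in> I} \<subseteq> U" by (rule genideal_minimal[OF U])
  then have "z \<otimes> z \<ominus> x \<otimes> y \<in> U" using asm by blast
  then have "z \<otimes> z \<oplus> \<ominus> (x \<otimes> y) \<in> U" by (simp add: a_minus_def)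
  moreover have "x \<in> U" using NU CN by (auto simp: C_def)
  then have "\<ominus> (x \<otimes> y) \<in> U" by (intro ideal_closed(6)[OF U] ideal_closed(5)[OF U] xyzc(2))
  moreover have "z \<otimes> z \<in> carrier R" using xyzc by simp
  ultimately have "z \<otimes> z \<in> U" using ideal_add_cancel[OF U] by blast
  then obtain c n where c: "c \<in> carrier R" "n \<in> N" "z \<otimes> z = c \<otimes> z3 \<oplus> n"
    unfolding U_def by (auto elim!: set_addE simp: cgenideal_def)
  have nc: "n \<in> carrier R" using ND(1) c(2) .
  \<comment> \<open>Since 1 - c z lies outside \<open>m\<close>, every prime over \<open>C\<close>
    contains z^2 and hence \<open>z\<close>, so it is \<open>m\<close>.\<close>
  have "(\<one> \<ominus> c \<otimes> z) \<otimes> (z \<otimes> z) = z \<otimes> z \<ominus> c \<otimes> z3" unfolding z3_def using c(1) xyzc by algebra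
  also have "\<dots> = n" unfolding c(3) using c(1) nc z3c by algebra
  finally have zz: "(\<one> \<ominus> c \<otimes> z) \<otimes> (z \<otimes> z) \<in> N" using c(2) by simp
  have unit: "\<one> \<ominus> c \<otimes> z \<notin> m"
  proof
    assume "\<one> \<ominus> c \<otimes> z \<in> m"
    then have "\<one> \<oplus> \<ominus> (c \<otimes> z) \<in> m" by (simp add: a_minus_def)
    then have "\<one> \<in> m" using ideal_add_cancel[OF mid one_closed] mD(4,6) c(1) xyz by blast
    then show False using one_notin_prime[OF maximalideal_prime[OF m]] by simp
  qed
  have "krull_dim R \<le> ereal (real (card C))"
  proof (rule krull_dim_le_card[OF loc m _ Cm])
    show "finite C" using A3(1) by (simp add: C_def B_def)
    fix P assume P: "primeideal P R" "C \<subseteq> P"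
    have Pid: "ideal P R" using P(1) by (rule primeideal.axioms)
    have NP: "N \<subseteq> P" unfolding N_def by (rule genideal_minimal[OF Pid P(2)])
    have Pm: "P \<subseteq> m" using proper_ideal_in_local[OF loc m Pid] one_notin_prime[OF P(1)] by blast
    have "z \<in> P"
      using primeideal.I_prime[OF P(1), of "\<one> \<ominus> c \<otimes> z" "z \<otimes> z"] primeideal.I_prime[OF P(1), of z z]
        zz NP Pm unit c(1) xyzc by auto
    then have "m \<subseteq> P" unfolding m_eq' using P(2) by (intro genideal_minimal Pid) auto
    then show "P = m" using Pm by auto
  qed
  also have "card C \<le> Suc (Suc (card B))"
    unfolding C_def using A3(1) by (auto simp: B_def card_insert_if)
  also have "card B \<le> card A3" unfolding B_def by (rule card_image_le[OF A3(1)])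
  finally have "krull_dim R \<le> ereal (real (card A3 + 2))" by simp
  then have "ereal (real (card A)) \<le> ereal (real (card A3 + 2))" unfolding A(4) .
  then show False using A1(3) A2(3) A3(3) by auto
qed

section \<open>Power series over a noetherian ring\<close>

text \<open>Ideals of a ring given by a type class, so that the class-based arithmetic of power
  series and finite sums applies to them; \<open>type_ideal_iff\<close> translates back to
  \<open>ideal\<close>.\<close>

definition type_ideal :: "'a::comm_ring_1 set \<Rightarrow> bool" where
  "type_ideal I \<longleftrightarrow> 0 \<in> I \<and> (\<forall>a\<in>I. \<forall>b\<in>I. a + b \<in> I) \<and> (\<forall>r. \<forall>a\<in>I. r * a \<in> I)"

definition type_noetherian :: "'a::comm_ring_1 itself \<Rightarrow> bool" where
  "type_noetherian _ \<longleftrightarrow>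
     (\<forall>I::'a set. type_ideal I \<longrightarrow> (\<exists>G. finite G \<and> G \<subseteq> I \<and> (\<forall>c\<in>I. \<exists>a. c = (\<Sum>g\<in>G. a g * g))))"

lemma type_noetherianD:
  assumes "type_noetherian TYPE('a::comm_ring_1)" "type_ideal (I :: 'a set)"
  shows "\<exists>G. finite G \<and> G \<subseteq> I \<and> (\<forall>c\<in>I. \<exists>a. c = (\<Sum>g\<in>G. a g * g))"
  using assms(1)[unfolded type_noetherian_def, THEN spec, THEN mp, OF assms(2)] .

lemma type_ideal_sum:
  assumes "type_ideal I" "\<And>g. g \<in> G \<Longrightarrow> f g \<in> I"
  shows "(\<Sum>g\<in>G. f g) \<in> I"
proof (cases "finite G")
  case True
  then show ?thesis using assms(2)
    by (induction G rule: finite_induct) (use assms(1) in \<open>auto simp: type_ideal_def\<close>)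
next
  case False
  then show ?thesis using assms(1) by (simp add: type_ideal_def)
qed

lemma type_ideal_mult: "type_ideal I \<Longrightarrow> a \<in> I \<Longrightarrow> r * a \<in> I"
  by (simp add: type_ideal_def)

lemma type_ideal_add: "type_ideal I \<Longrightarrow> a \<in> I \<Longrightarrow> b \<in> I \<Longrightarrow> a + b \<in> I"
  by (simp add: type_ideal_def)

lemma type_ideal_zero: "type_ideal I \<Longrightarrow> 0 \<in> I"
  by (simp add: type_ideal_def)

lemma type_ideal_diff:
  assumes "type_ideal I" "a \<in> I" "b \<in> I"
  shows "a - b \<in> I"
proof -
  have "a + (-1) * b \<in> I" using assms unfolding type_ideal_def by blast
  then show ?thesis by simp
qed

lemma type_noetherian_field: "type_noetherian TYPE('k::field)"
  unfolding type_noetherian_def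
proof (intro allI impI)
  fix I :: "'k set" assume I: "type_ideal I"
  show "\<exists>G. finite G \<and> G \<subseteq> I \<and> (\<forall>c\<in>I. \<exists>a. c = (\<Sum>g\<in>G. a g * g))"
  proof (cases "I \<subseteq> {0}")
    case True
    then show ?thesis by (intro exI[of _ "{}"]) auto
  next
    case False
    then obtain b where b: "b \<in> I" "b \<noteq> 0" by auto
    then have "\<exists>a. c = (\<Sum>g\<in>{b}. a g * g)" for c by (intro exI[of _ "\<lambda>_. c / b"]) simp
    then show ?thesis using b by (intro exI[of _ "{b}"]) auto
  qed
qed

text \<open>The union of the chain is an ideal, and its finitely many generators already lie in one
  member.\<close>

lemma type_noetherian_acc:
  fixes L :: "nat \<Rightarrow> 'a::comm_ring_1 set"
  assumes noeth: "type_noetherian TYPE('a)" and L: "\<And>n. type_ideal (L n)" "\<And>n. L n \<subseteq> L (Suc n)"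
  shows "\<exists>N. \<forall>n. L n \<subseteq> L N"
proof -
  have mono: "m \<le> n \<Longrightarrow> L m \<subseteq> L n" for m n by (rule lift_Suc_mono_le[of L, OF L(2)])
  have "type_ideal (\<Union>n. L n)"
    unfolding type_ideal_def
  proof (intro conjI ballI allI)
    show "0 \<in> (\<Union>n. L n)" using type_ideal_zero[OF L(1)] by blast
    show "r * a \<in> (\<Union>n. L n)" if "a \<in> (\<Union>n. L n)" for r a
      using that type_ideal_mult[OF L(1)] by auto
    fix a b assume "a \<in> (\<Union>n. L n)" "b \<in> (\<Union>n. L n)"
    then obtain m n where "a \<in> L m" "b \<in> L n" by auto
    then have "a \<in> L (max m n)" "b \<in> L (max m n)" using mono[of m "max m n"] mono[of n "max m n"] by auto
    then have "a + b \<in> L (max m n)" by (rule type_ideal_add[OF L(1)])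
    then show "a + b \<in> (\<Union>n. L n)" by blast
  qed
  from type_noetherianD[OF noeth this] obtain G
    where G: "finite G" "G \<subseteq> (\<Union>n. L n)" "\<forall>c\<in>(\<Union>n. L n). \<exists>a. c = (\<Sum>g\<in>G. a g * g)"
    by (elim exE conjE)
  have "\<exists>N. G \<subseteq> L N" using G(1,2)
  proof (induction G rule: finite_induct)
    case (insert g G)
    then obtain N n where "G \<subseteq> L N" "g \<in> L n" by auto
    then have "insert g G \<subseteq> L (max N n)" using mono[of N "max N n"] mono[of n "max N n"] by auto
    then show ?case by blast
  qed simp
  then obtain N where N: "G \<subseteq> L N" ..
  have "c \<in> L N" if "c \<in> L n" for c n
  proof -
    have "c \<in> (\<Union>n. L n)" using that by blast
    then obtain a where a: "c = (\<Sum>g\<in>G. a g * g)" using G(3) by metis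
    show ?thesis unfolding a using N by (intro type_ideal_sum type_ideal_mult L(1)) (rule subsetD)
  qed
  then show ?thesis by (intro exI[of _ N] allI subsetI)
qed

lemma fps_nth_mult_order:
  fixes f g :: "'a::comm_ring_1 fps"
  assumes "\<And>i. i < m \<Longrightarrow> fps_nth f i = 0" "\<And>i. i < n \<Longrightarrow> fps_nth g i = 0"
  shows "i < m + n \<Longrightarrow> fps_nth (f * g) i = 0" "fps_nth (f * g) (m + n) = fps_nth f m * fps_nth g n"
proof -
  show "fps_nth (f * g) i = 0" if "i < m + n"
    unfolding fps_mult_nth
  proof (intro sum.neutral ballI)
    fix j assume "j \<in> {0..i}"
    then show "fps_nth f j * fps_nth g (i - j) = 0" using that assms by (cases "j < m") auto
  qed
  have "fps_nth (f * g) (m + n) = (\<Sum>j\<in>{0..m+n}. if j = m then fps_nth f m * fps_nth g n else 0)"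
    unfolding fps_mult_nth
  proof (rule sum.cong[OF refl])
    fix j assume "j \<in> {0..m+n}"
    then show "fps_nth f j * fps_nth g (m + n - j) = (if j = m then fps_nth f m * fps_nth g n else 0)"
      using assms by (cases j m rule: linorder_cases) auto
  qed
  then show "fps_nth (f * g) (m + n) = fps_nth f m * fps_nth g n" by simp
qed

text \<open>Hilbert's basis argument with lowest in place of leading coefficients. Multiplication by
  \<open>fps_X\<close> makes the ideals \<open>L n\<close> ascend, so they stop at some
  \<open>N\<close>, and lifts of generators of \<open>L 0\<close>, ..., \<open>L N\<close> generate
  \<open>I\<close>. For an element of order at least \<open>N\<close>, the lifts from
  \<open>L N\<close> suffice, at the price of infinitely many corrections that sum to power series.
  The coefficients below \<open>N\<close> are cleared one at a time.\<close>

lemma type_noetherian_fps: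
  assumes noeth: "type_noetherian TYPE('a::comm_ring_1)"
  shows "type_noetherian TYPE('a fps)"
  unfolding type_noetherian_def
proof (intro allI impI)
  fix I :: "'a fps set" assume I: "type_ideal I"
  define ord where "ord n f \<longleftrightarrow> (\<forall>i<n. fps_nth f i = 0)" for n and f :: "'a fps"
  have ord_add: "ord n f \<Longrightarrow> ord n g \<Longrightarrow> ord n (f + g)" and ord_diff: "ord n f \<Longrightarrow> ord n g \<Longrightarrow> ord n (f - g)"
    and ord_mult: "ord n g \<Longrightarrow> ord n (f * g)" for n f g
    using fps_nth_mult_order(1)[of 0 f n g] by (auto simp: ord_def)
  have ord_sum: "ord n (\<Sum>g\<in>G. f g)" if "\<And>g. g \<in> G \<Longrightarrow> ord n (f g)" for n G and f :: "'a \<Rightarrow> 'a fps"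
    using that by (auto simp: ord_def fps_sum_nth intro!: sum.neutral)
  have ordS: "ord (Suc n) f \<longleftrightarrow> ord n f \<and> fps_nth f n = 0" for n f by (auto simp: ord_def less_Suc_eq)
  define L where "L n = {c. \<exists>f\<in>I. ord n f \<and> fps_nth f n = c}" for n
  have L: "type_ideal (L n)" for n
    unfolding type_ideal_def
  proof (intro conjI ballI allI)
    show "0 \<in> L n" using type_ideal_zero[OF I] by (auto simp: L_def ord_def intro!: bexI[of _ 0])
    show "a + b \<in> L n" if ab: "a \<in> L n" "b \<in> L n" for a b
    proof -
      obtain f g where "f \<in> I" "ord n f" "fps_nth f n = a" "g \<in> I" "ord n g" "fps_nth g n = b"
        using ab unfolding L_def by blast
      then show ?thesis using type_ideal_add[OF I] ord_add by (auto simp: L_def intro!: bexI[of _ "f + g"])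
    qed
    show "r * a \<in> L n" if aL: "a \<in> L n" for r a
    proof -
      obtain f where "f \<in> I" "ord n f" "fps_nth f n = a" using aL unfolding L_def by blast
      then show ?thesis using type_ideal_mult[OF I] ord_mult
        by (auto simp: L_def intro!: bexI[of _ "fps_const r * f"])
    qed
  qed
  have "L n \<subseteq> L (Suc n)" for n
  proof
    fix c assume "c \<in> L n"
    then obtain f where f: "f \<in> I" "ord n f" "fps_nth f n = c" by (auto simp: L_def)
    have "ord (Suc n) (fps_X * f)" "fps_nth (fps_X * f) (Suc n) = c"
      using f(2,3) by (auto simp: ord_def)
    then show "c \<in> L (Suc n)" using type_ideal_mult[OF I f(1)] by (auto simp: L_def)
  qed
  from type_noetherian_acc[of L, OF noeth L this] obtain N where N: "\<And>n. L n \<subseteq> L N" by metis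
  have "\<forall>n. \<exists>G. finite G \<and> G \<subseteq> L n \<and> (\<forall>c\<in>L n. \<exists>a. c = (\<Sum>g\<in>G. a g * g))"
    using type_noetherianD[OF noeth L] by simp
  then obtain G where G: "\<And>n. finite (G n)" "\<And>n. G n \<subseteq> L n"
    "\<And>n c. c \<in> L n \<Longrightarrow> \<exists>a. c = (\<Sum>g\<in>G n. a g * g)" by metis
  have "\<forall>n. \<forall>g\<in>G n. \<exists>f\<in>I. ord n f \<and> fps_nth f n = g" using G(2) by (auto simp: L_def)
  then obtain F where F: "\<And>n g. g \<in> G n \<Longrightarrow> F n g \<in> I" "\<And>n g. g \<in> G n \<Longrightarrow> ord n (F n g)"
    "\<And>n g. g \<in> G n \<Longrightarrow> fps_nth (F n g) n = g" by metis
  define B where "B = (\<Union>n\<le>N. F n ` G n)"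
  define Sp where "Sp = {f. \<exists>a. f = (\<Sum>b\<in>B. a b * b)}"
  have finB: "finite B" using G(1) by (auto simp: B_def)
  have BI: "B \<subseteq> I" using F(1) by (auto simp: B_def)
  have Sp: "type_ideal Sp"
    unfolding type_ideal_def
  proof (intro conjI ballI allI)
    show "0 \<in> Sp" unfolding Sp_def by (auto intro!: exI[of _ "\<lambda>_. 0"])
    fix f g assume "f \<in> Sp" "g \<in> Sp"
    then obtain a b where "f = (\<Sum>c\<in>B. a c * c)" "g = (\<Sum>c\<in>B. b c * c)" by (auto simp: Sp_def)
    then have "f + g = (\<Sum>c\<in>B. (a c + b c) * c)" by (simp add: sum.distrib algebra_simps)
    then show "f + g \<in> Sp" unfolding Sp_def by (intro CollectI exI[of _ "\<lambda>c. a c + b c"])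
  next
    fix r f assume "f \<in> Sp"
    then obtain a where "f = (\<Sum>c\<in>B. a c * c)" by (auto simp: Sp_def)
    then have "r * f = (\<Sum>c\<in>B. (r * a c) * c)" by (simp add: sum_distrib_left mult.assoc)
    then show "r * f \<in> Sp" unfolding Sp_def by (intro CollectI exI[of _ "\<lambda>c. r * a c"])
  qed
  have BSp: "b \<in> Sp" if "b \<in> B" for b
  proof -
    have "(\<Sum>c\<in>B. (if c = b then 1 else 0) * c) = (\<Sum>c\<in>B. if c = b then c else 0)"
      by (intro sum.cong) auto
    also have "\<dots> = b" using that finB by simp
    finally show ?thesis unfolding Sp_def by (auto intro!: exI[of _ "\<lambda>c. if c = b then 1 else 0"])
  qed
  have top: "f \<in> Sp" if f: "f \<in> I" "ord N f" for f
  proof -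
    \<comment> \<open>\<open>Q\<close> describes the remainder after \<open>k\<close> corrections
      and \<open>T\<close> one correction, whose multipliers are scalars times
      \<open>fps_X ^ k\<close>.\<close>
    define Q where "Q k r \<longleftrightarrow> r \<in> I \<and> ord (N + k) r" for k r
    define T where "T k r r' \<longleftrightarrow> (\<exists>a. r' = r - (\<Sum>g\<in>G N. (fps_const (a g) * fps_X ^ k) * F N g))" for k r r'
    have "\<exists>r. (\<forall>k. Q k (r k)) \<and> (\<forall>k. T k (r k) (r (Suc k))) \<and> r 0 = f"
    proof -
      have step: "\<exists>r'. Q (Suc k) r' \<and> T k r r'" if r: "Q k r" for k r
      proof -
        have "fps_nth r (N + k) \<in> L N" using r N[of "N + k"] by (auto simp: L_def Q_def)
        then obtain a where a: "fps_nth r (N + k) = (\<Sum>g\<in>G N. a g * g)" using G(3) by blast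
        define r' where "r' = r - (\<Sum>g\<in>G N. (fps_const (a g) * fps_X ^ k) * F N g)"
        have "r' \<in> I" unfolding r'_def using r I F(1)
          by (intro type_ideal_diff type_ideal_sum type_ideal_mult) (auto simp: Q_def)
        have o: "fps_nth (fps_const (a g) * fps_X ^ k) i = 0" if "i < k" for g i using that by simp
        have t: "ord (N + k) ((fps_const (a g) * fps_X ^ k) * F N g)"
          "fps_nth ((fps_const (a g) * fps_X ^ k) * F N g) (N + k) = a g * g" if "g \<in> G N" for g
          using fps_nth_mult_order[of k "fps_const (a g) * fps_X ^ k" N "F N g"] o F(2,3)[OF that]
          by (auto simp: ord_def add.commute)
        have "ord (N + k) r'" unfolding r'_def using r t(1) by (intro ord_diff ord_sum) (auto simp: Q_def)
        moreover have "fps_nth r' (N + k) = 0"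
          unfolding r'_def using t(2) by (simp add: fps_sum_nth a)
        ultimately show ?thesis using \<open>r' \<in> I\<close> by (intro exI[of _ r']) (auto simp: Q_def T_def ordS r'_def)
      qed
      have "Q 0 f" using f by (simp add: Q_def)
      obtain r where r: "r 0 = f" "\<And>k. Q k (r k) \<Longrightarrow> Q (Suc k) (r (Suc k)) \<and> T k (r k) (r (Suc k))"
      proof
        define r where "r = rec_nat f (\<lambda>k r. SOME r'. Q (Suc k) r' \<and> T k r r')"
        show "r 0 = f" by (simp add: r_def)
        show "Q (Suc k) (r (Suc k)) \<and> T k (r k) (r (Suc k))" if "Q k (r k)" for k
          using someI_ex[OF step[OF that]] by (simp add: r_def)
      qed
      have "Q k (r k)" for k by (induction k) (use r \<open>Q 0 f\<close> in auto)
      then show ?thesis using r by blast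
    qed
    then obtain r where r: "\<And>k. Q k (r k)" "\<And>k. T k (r k) (r (Suc k))" "r 0 = f" by blast
    from r(2) obtain a where a: "\<And>k. r (Suc k) = r k - (\<Sum>g\<in>G N. (fps_const (a k g) * fps_X ^ k) * F N g)"
      unfolding T_def by metis
    \<comment> \<open>Stage \<open>k\<close> alters the multiplier of \<open>F N g\<close> only in
      degree \<open>k\<close>, so the stages assemble into a single power series.\<close>
    define h where "h g = Abs_fps (\<lambda>k. a k g)" for g
    have part: "f - r k = (\<Sum>g\<in>G N. (\<Sum>j<k. fps_const (a j g) * fps_X ^ j) * F N g)" for k
    proof (induction k)
      case (Suc k)
      have "f - r (Suc k) = (f - r k) + (\<Sum>g\<in>G N. (fps_const (a k g) * fps_X ^ k) * F N g)" unfolding a by simp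
      then show ?case unfolding Suc by (simp add: sum.distrib[symmetric] distrib_right)
    qed (simp add: r)
    have "f = (\<Sum>g\<in>G N. h g * F N g)"
    proof (rule fps_ext)
      fix n
      have "fps_nth (r (Suc n)) n = 0" using r(1)[of "Suc n"] by (simp add: Q_def ord_def)
      moreover have "f = (f - r (Suc n)) + r (Suc n)" by simp
      ultimately have "fps_nth f n = fps_nth (f - r (Suc n)) n" by (metis add.right_neutral fps_add_nth)
      also have "\<dots> = (\<Sum>g\<in>G N. fps_nth ((\<Sum>j<Suc n. fps_const (a j g) * fps_X ^ j) * F N g) n)"
        unfolding part by (simp add: fps_sum_nth)
      also have "\<dots> = (\<Sum>g\<in>G N. fps_nth (h g * F N g) n)"
      proof (rule sum.cong[OF refl])
        fix g
        have "fps_nth (\<Sum>j<Suc n. fps_const (a j g) * fps_X ^ j) i = a i g" if "i \<le> n" for i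
        proof -
          have "fps_nth (\<Sum>j<Suc n. fps_const (a j g) * fps_X ^ j) i = (\<Sum>j<Suc n. if j = i then a j g else 0)"
            unfolding fps_sum_nth by (intro sum.cong) auto
          then show ?thesis using that by simp
        qed
        then show "fps_nth ((\<Sum>j<Suc n. fps_const (a j g) * fps_X ^ j) * F N g) n = fps_nth (h g * F N g) n"
          unfolding fps_mult_nth by (intro sum.cong) (auto simp: h_def)
      qed
      finally show "fps_nth f n = fps_nth (\<Sum>g\<in>G N. h g * F N g) n" by (simp add: fps_sum_nth)
    qed
    moreover have "F N g \<in> Sp" if "g \<in> G N" for g using BSp that by (auto simp: B_def)
    ultimately show ?thesis using type_ideal_sum[OF Sp, of "G N" "\<lambda>g. h g * F N g"] type_ideal_mult[OF Sp] by simp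
  qed
  \<comment> \<open>Descent from order \<open>N\<close>: \<open>d\<close> bounds the number of
    coefficients below \<open>N\<close> that may be nonzero at or above the order. For
    \<open>d\<close> equal to \<open>N\<close> the condition on the order is empty.\<close>
  have "f \<in> Sp" if "f \<in> I" "ord (N - d) f" for d f
    using that
  proof (induction d arbitrary: f)
    case (Suc d)
    show ?case
    proof (cases "N \<le> d")
      case True then show ?thesis using Suc by simp
    next
      case False
      define n where "n = N - Suc d"
      have n: "N - d = Suc n" "n \<le> N" using False by (auto simp: n_def)
      have "fps_nth f n \<in> L n" using Suc.prems by (auto simp: L_def n_def)
      then obtain a where a: "fps_nth f n = (\<Sum>g\<in>G n. a g * g)" using G(3) by blast
      define b where "b = (\<Sum>g\<in>G n. fps_const (a g) * F n g)"
      have "F n g \<in> B" if "g \<in> G n" for g using that n(2) unfolding B_def by blast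
      then have "F n g \<in> Sp" if "g \<in> G n" for g using BSp that by blast
      then have b: "b \<in> Sp" "b \<in> I" unfolding b_def using F(1)
        by (auto intro!: type_ideal_sum type_ideal_mult Sp I)
      have "ord n b" unfolding b_def using F(2) by (intro ord_sum ord_mult) auto
      moreover have "fps_nth b n = fps_nth f n" unfolding b_def a using F(3) by (simp add: fps_sum_nth)
      ultimately have "ord (Suc n) (f - b)" using Suc.prems by (auto simp: ordS n_def intro: ord_diff)
      then have "f - b \<in> Sp" using Suc.IH[of "f - b"] type_ideal_diff[OF I Suc.prems(1) b(2)] n by simp
      then have "(f - b) + b \<in> Sp" by (rule type_ideal_add[OF Sp _ b(1)])
      then show ?thesis by simp
    qed
  qed (use top in simp)
  from this[of _ N] have "f \<in> Sp" if "f \<in> I" for f using that by (simp add: ord_def)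
  then show "\<exists>G. finite G \<and> G \<subseteq> I \<and> (\<forall>c\<in>I. \<exists>a. c = (\<Sum>g\<in>G. a g * g))"
    using finB BI unfolding Sp_def by blast
qed

section \<open>From type-class rings to rings with a carrier\<close>

lemma ring_of_type_algebra_simps [simp]:
  "carrier ring_of_type_algebra = UNIV" "\<zero>\<^bsub>ring_of_type_algebra\<^esub> = 0" "\<one>\<^bsub>ring_of_type_algebra\<^esub> = 1"
  "a \<oplus>\<^bsub>ring_of_type_algebra\<^esub> b = a + b" "a \<otimes>\<^bsub>ring_of_type_algebra\<^esub> b = a * b"
  by (simp_all add: ring_of_type_algebra_def)

lemma type_ideal_iff: "ideal I (ring_of_type_algebra :: 'a::comm_ring_1 ring) \<longleftrightarrow> type_ideal I"
proof -
  interpret cring "ring_of_type_algebra :: 'a ring" by (rule cring_from_type_algebra)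
  show ?thesis
  proof
    assume I: "ideal I (ring_of_type_algebra :: 'a ring)"
    show "type_ideal I" using ideal_closed[OF I] by (auto simp: type_ideal_def)
  next
    assume "type_ideal I"
    then show "ideal I (ring_of_type_algebra :: 'a ring)"
      by (intro cring_idealI) (auto simp: type_ideal_def)
  qed
qed

lemma noetherian_ring_of_type_algebra:
  assumes "type_noetherian TYPE('a::comm_ring_1)"
  shows "noetherian_ring (ring_of_type_algebra :: 'a ring)"
proof -
  interpret cring "ring_of_type_algebra :: 'a ring" by (rule cring_from_type_algebra)
  show ?thesis
  proof (rule noetherian_ringI)
    fix I assume I: "ideal I (ring_of_type_algebra :: 'a ring)"
    then obtain G where G: "finite G" "G \<subseteq> I" "\<And>c. c \<in> I \<Longrightarrow> \<exists>a. c = (\<Sum>g\<in>G. a g * g)"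
      using type_noetherianD[OF assms, of I] unfolding type_ideal_iff by metis
    have Gc: "G \<subseteq> carrier ring_of_type_algebra" by simp
    have t: "type_ideal (Idl\<^bsub>ring_of_type_algebra\<^esub> G)"
      using genideal_ideal[OF Gc] by (simp add: type_ideal_iff)
    have "I \<subseteq> Idl\<^bsub>ring_of_type_algebra\<^esub> G"
    proof
      fix c assume "c \<in> I"
      then obtain a where "c = (\<Sum>g\<in>G. a g * g)" using G(3) by blast
      then show "c \<in> Idl\<^bsub>ring_of_type_algebra\<^esub> G"
        using type_ideal_sum[OF t, of G "\<lambda>g. a g * g"] type_ideal_mult[OF t] genideal_self[OF Gc] by auto
    qed
    moreover have "Idl\<^bsub>ring_of_type_algebra\<^esub> G \<subseteq> I" by (rule genideal_minimal[OF I G(2)])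
    ultimately show "\<exists>A\<subseteq>carrier ring_of_type_algebra. finite A \<and> I = Idl\<^bsub>ring_of_type_algebra\<^esub> A"
      using G(1) Gc by blast
  qed
qed

section \<open>Semilinear maps, quotients and free modules\<close>

text \<open>One notion for linear maps, with \<open>\<phi>\<close> the identity, and for maps across
  a ring homomorphism, such as l -> l tensor 1 from a \<open>Q\<close>-module to its base
  change.\<close>

definition semilinear ::
    "('q, 'h) ring_scheme \<Rightarrow> ('q \<Rightarrow> 'r) \<Rightarrow> ('q, 'a, 'm) module_scheme \<Rightarrow> ('r, 'b, 'n) module_scheme \<Rightarrow> ('a \<Rightarrow> 'b) \<Rightarrow> bool" where
  "semilinear Q \<phi> M N f \<longleftrightarrow> f \<in> carrier M \<rightarrow> carrier N \<and>
     (\<forall>x\<in>carrier M. \<forall>y\<in>carrier M. f (x \<oplus>\<^bsub>M\<^esub> y) = f x \<oplus>\<^bsub>N\<^esub> f y) \<and>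
     (\<forall>q\<in>carrier Q. \<forall>x\<in>carrier M. f (q \<odot>\<^bsub>M\<^esub> x) = \<phi> q \<odot>\<^bsub>N\<^esub> f x)"

lemma module_hom_semilinear: "f \<in> module_hom R M N \<longleftrightarrow> semilinear R id M N f"
  by (simp add: module_hom_def semilinear_def)

lemma semilinearD:
  assumes "semilinear Q \<phi> M N f"
  shows "x \<in> carrier M \<Longrightarrow> f x \<in> carrier N"
    "x \<in> carrier M \<Longrightarrow> y \<in> carrier M \<Longrightarrow> f (x \<oplus>\<^bsub>M\<^esub> y) = f x \<oplus>\<^bsub>N\<^esub> f y"
    "q \<in> carrier Q \<Longrightarrow> x \<in> carrier M \<Longrightarrow> f (q \<odot>\<^bsub>M\<^esub> x) = \<phi> q \<odot>\<^bsub>N\<^esub> f x"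
  using assms by (auto simp: semilinear_def)

lemma semilinear_comp:
  assumes "semilinear Q \<phi> M N f" "semilinear R \<psi> N P g" "\<phi> \<in> carrier Q \<rightarrow> carrier R"
  shows "semilinear Q (\<psi> \<circ> \<phi>) M P (g \<circ> f)"
  using assms unfolding semilinear_def by (auto simp: Pi_def)

lemma semilinear_zero:
  assumes "semilinear Q \<phi> M N f" "abelian_group M" "abelian_group N"
  shows "f \<zero>\<^bsub>M\<^esub> = \<zero>\<^bsub>N\<^esub>"
proof -
  interpret M: abelian_group M by fact
  interpret N: abelian_group N by fact
  have "f \<zero>\<^bsub>M\<^esub> \<oplus>\<^bsub>N\<^esub> f \<zero>\<^bsub>M\<^esub> = f \<zero>\<^bsub>M\<^esub>"
    using semilinearD(2)[OF assms(1), of "\<zero>\<^bsub>M\<^esub>" "\<zero>\<^bsub>M\<^esub>"] by simp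
  then show ?thesis using semilinearD(1)[OF assms(1), of "\<zero>\<^bsub>M\<^esub>"] by (simp add: N.add.l_cancel_one)
qed

lemma semilinear_minus:
  assumes "semilinear Q \<phi> M N f" "abelian_group M" "abelian_group N" "x \<in> carrier M"
  shows "f (\<ominus>\<^bsub>M\<^esub> x) = \<ominus>\<^bsub>N\<^esub> f x"
proof -
  interpret M: abelian_group M by fact
  interpret N: abelian_group N by fact
  have "f (\<ominus>\<^bsub>M\<^esub> x) \<oplus>\<^bsub>N\<^esub> f x = f (\<ominus>\<^bsub>M\<^esub> x \<oplus>\<^bsub>M\<^esub> x)"
    using semilinearD(2)[OF assms(1)] assms(4) by simp
  also have "\<dots> = \<zero>\<^bsub>N\<^esub>" using assms(4) semilinear_zero[OF assms(1-3)] by (simp add: M.l_neg)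
  finally show ?thesis using semilinearD(1)[OF assms(1)] assms(4) by (intro N.minus_equality[symmetric]) auto
qed

lemma semilinear_diff:
  assumes "semilinear Q \<phi> M N f" "abelian_group M" "abelian_group N" "x \<in> carrier M" "y \<in> carrier M"
  shows "f (x \<ominus>\<^bsub>M\<^esub> y) = f x \<ominus>\<^bsub>N\<^esub> f y"
proof -
  interpret M: abelian_group M by fact
  show ?thesis using semilinear_minus[OF assms(1-3,5)] semilinearD(2)[OF assms(1,4), of "\<ominus>\<^bsub>M\<^esub> y"] assms(5)
    by (simp add: a_minus_def)
qed

section \<open>Submodules and spans\<close>

lemma (in Module.module) submoduleI':
  assumes "H \<subseteq> carrier M" "\<zero>\<^bsub>M\<^esub> \<in> H" "\<And>a b. a \<in> H \<Longrightarrow> b \<in> H \<Longrightarrow> a \<oplus>\<^bsub>M\<^esub> b \<in> H"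
    "\<And>a x. a \<in> carrier R \<Longrightarrow> x \<in> H \<Longrightarrow> a \<odot>\<^bsub>M\<^esub> x \<in> H"
  shows "submodule H R M"
proof (rule submoduleI)
  fix a assume a: "a \<in> H"
  then have "(\<ominus> \<one>) \<odot>\<^bsub>M\<^esub> a \<in> H" using assms(4) by simp
  moreover have "a \<in> carrier M" using a assms(1) by auto
  ultimately show "\<ominus>\<^bsub>M\<^esub> a \<in> H" by (simp add: smult_l_minus)
qed (use assms in auto)

lemma (in Module.module) submodule_closed:
  assumes "submodule H R M"
  shows "a \<in> H \<Longrightarrow> a \<in> carrier M" "\<zero>\<^bsub>M\<^esub> \<in> H" "a \<in> H \<Longrightarrow> b \<in> H \<Longrightarrow> a \<oplus>\<^bsub>M\<^esub> b \<in> H"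
    "r \<in> carrier R \<Longrightarrow> a \<in> H \<Longrightarrow> r \<odot>\<^bsub>M\<^esub> a \<in> H" "a \<in> H \<Longrightarrow> b \<in> H \<Longrightarrow> a \<ominus>\<^bsub>M\<^esub> b \<in> H"
proof -
  note E = submoduleE[OF assms]
  show "a \<in> H \<Longrightarrow> a \<in> carrier M" using E(1) by auto
  show "a \<in> H \<Longrightarrow> b \<in> H \<Longrightarrow> a \<oplus>\<^bsub>M\<^esub> b \<in> H" by (rule E(5))
  show "r \<in> carrier R \<Longrightarrow> a \<in> H \<Longrightarrow> r \<odot>\<^bsub>M\<^esub> a \<in> H" by (rule E(4))
  show "a \<in> H \<Longrightarrow> b \<in> H \<Longrightarrow> a \<ominus>\<^bsub>M\<^esub> b \<in> H" using E(3,5) by (simp add: a_minus_def)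
  obtain a where a: "a \<in> H" using E(2) by auto
  then have "\<zero> \<odot>\<^bsub>M\<^esub> a \<in> H" by (intro E(4)) auto
  then show "\<zero>\<^bsub>M\<^esub> \<in> H" using a E(1) by auto
qed

lemma (in Module.module) submodule_zero: "submodule {\<zero>\<^bsub>M\<^esub>} R M"
  by (rule submoduleI') auto

lemma (in Module.module) span_superset: "A \<subseteq> module_span R M A"
  by (auto simp: module_span_def)

lemma (in Module.module) span_minimal: "submodule H R M \<Longrightarrow> A \<subseteq> H \<Longrightarrow> module_span R M A \<subseteq> H"
  by (auto simp: module_span_def)

lemma (in Module.module) span_submodule:
  assumes "A \<subseteq> carrier M"
  shows "submodule (module_span R M A) R M"
proof (rule submoduleI')
  show "module_span R M A \<subseteq> carrier M" by (rule span_minimal[OF carrier_is_submodule assms])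
qed (auto simp: module_span_def submodule_closed)

lemma submodule_vimage:
  assumes "Module.module Q M" "Module.module R N" "\<phi> \<in> carrier Q \<rightarrow> carrier R" "semilinear Q \<phi> M N f" "submodule H R N"
  shows "submodule {x \<in> carrier M. f x \<in> H} Q M"
proof -
  interpret M: Module.module Q M by fact
  interpret N: Module.module R N by fact
  note H = N.submodule_closed[OF assms(5)] and f = semilinearD[OF assms(4)]
  show ?thesis
    by (rule M.submoduleI')
      (use H f assms(3) semilinear_zero[OF assms(4) M.abelian_group_axioms N.abelian_group_axioms] in \<open>auto simp: Pi_def\<close>)
qed

lemma submodule_image:
  assumes "Module.module Q M" "Module.module R N" "\<phi> ` carrier Q = carrier R" "semilinear Q \<phi> M N f"
  shows "submodule (f ` carrier M) R N"
proof -
  interpret M: Module.module Q M by fact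
  interpret N: Module.module R N by fact
  note f = semilinearD[OF assms(4)]
  show ?thesis
  proof (rule N.submoduleI')
    show "f ` carrier M \<subseteq> carrier N" using f by auto
    show "\<zero>\<^bsub>N\<^esub> \<in> f ` carrier M"
      using semilinear_zero[OF assms(4) M.abelian_group_axioms N.abelian_group_axioms] M.M.zero_closed by (metis image_eqI)
    show "a \<oplus>\<^bsub>N\<^esub> b \<in> f ` carrier M" if ab: "a \<in> f ` carrier M" "b \<in> f ` carrier M" for a b
    proof -
      obtain x y where "x \<in> carrier M" "y \<in> carrier M" "a = f x" "b = f y" using ab by auto
      then show ?thesis using f(2) by (auto intro!: image_eqI[of _ _ "x \<oplus>\<^bsub>M\<^esub> y"])
    qed
    show "r \<odot>\<^bsub>N\<^esub> a \<in> f ` carrier M" if ra: "r \<in> carrier R" "a \<in> f ` carrier M" for r a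
    proof -
      obtain q x where "x \<in> carrier M" "a = f x" "q \<in> carrier Q" "r = \<phi> q" using ra assms(3) by blast
      then show ?thesis using f(3) by (auto intro!: image_eqI[of _ _ "q \<odot>\<^bsub>M\<^esub> x"])
    qed
  qed
qed

text \<open>Serves to show that two semilinear maps on a free module agree once they agree on the
  basis.\<close>

lemma submodule_equalizer:
  assumes "Module.module Q M" "Module.module R N" "\<phi> \<in> carrier Q \<rightarrow> carrier R"
    "semilinear Q \<phi> M N f" "semilinear Q \<phi> M N g"
  shows "submodule {x \<in> carrier M. f x = g x} Q M"
proof -
  interpret M: Module.module Q M by fact
  interpret N: Module.module R N by fact
  note z = semilinear_zero[OF _ M.abelian_group_axioms N.abelian_group_axioms]
  show ?thesis
    by (rule M.submoduleI') (use semilinearD[OF assms(4)] semilinearD[OF assms(5)] z[OF assms(4)] z[OF assms(5)] in auto)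
qed

text \<open>The module axioms are identities and existence statements that pass along a surjection
  compatible with the operations. Quotient modules acquire their structure in this way, including
  quotients whose scalars are replaced by those of another ring.\<close>

lemma module_semilinear_image:
  assumes "Module.module Q M" "cring R" "\<phi> \<in> ring_hom Q R" "\<phi> ` carrier Q = carrier R"
    and car: "carrier N = p ` carrier M" and zero: "\<zero>\<^bsub>N\<^esub> = p \<zero>\<^bsub>M\<^esub>" and p: "semilinear Q \<phi> M N p"
  shows "Module.module R N"
proof -
  interpret M: Module.module Q M by fact
  interpret R: cring R by fact
  note P = semilinearD[OF p]
  have ph: "\<phi> (a \<oplus>\<^bsub>Q\<^esub> b) = \<phi> a \<oplus>\<^bsub>R\<^esub> \<phi> b" "\<phi> (a \<otimes>\<^bsub>Q\<^esub> b) = \<phi> a \<otimes>\<^bsub>R\<^esub> \<phi> b" "\<phi> \<one>\<^bsub>Q\<^esub> = \<one>\<^bsub>R\<^esub>"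
    if "a \<in> carrier Q" "b \<in> carrier Q" for a b
    using assms(3) that by (auto simp: ring_hom_def)
  have all: "(\<forall>n\<in>carrier N. Pr n) \<longleftrightarrow> (\<forall>x\<in>carrier M. Pr (p x))" for Pr using car by auto
  have allR: "(\<forall>r\<in>carrier R. Pr r) \<longleftrightarrow> (\<forall>q\<in>carrier Q. Pr (\<phi> q))" for Pr
    unfolding assms(4)[symmetric] by blast
  have ag: "abelian_group N"
  proof (rule abelian_groupI)
    have "\<forall>x\<in>carrier N. \<forall>y\<in>carrier N. x \<oplus>\<^bsub>N\<^esub> y \<in> carrier N"
      unfolding all by (metis P(1,2) M.M.add.m_closed)
    then show "\<And>x y. x \<in> carrier N \<Longrightarrow> y \<in> carrier N \<Longrightarrow> x \<oplus>\<^bsub>N\<^esub> y \<in> carrier N" by blast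
    show "\<zero>\<^bsub>N\<^esub> \<in> carrier N" using zero car by auto
    have "\<forall>x\<in>carrier N. \<forall>y\<in>carrier N. \<forall>z\<in>carrier N. x \<oplus>\<^bsub>N\<^esub> y \<oplus>\<^bsub>N\<^esub> z = x \<oplus>\<^bsub>N\<^esub> (y \<oplus>\<^bsub>N\<^esub> z)"
      unfolding all by (simp add: P(2)[symmetric] M.M.a_assoc)
    then show "\<And>x y z. x \<in> carrier N \<Longrightarrow> y \<in> carrier N \<Longrightarrow> z \<in> carrier N \<Longrightarrow> x \<oplus>\<^bsub>N\<^esub> y \<oplus>\<^bsub>N\<^esub> z = x \<oplus>\<^bsub>N\<^esub> (y \<oplus>\<^bsub>N\<^esub> z)"
      by blast
    have "\<forall>x\<in>carrier N. \<forall>y\<in>carrier N. x \<oplus>\<^bsub>N\<^esub> y = y \<oplus>\<^bsub>N\<^esub> x"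
      unfolding all by (simp add: P(2)[symmetric] M.M.a_comm)
    then show "\<And>x y. x \<in> carrier N \<Longrightarrow> y \<in> carrier N \<Longrightarrow> x \<oplus>\<^bsub>N\<^esub> y = y \<oplus>\<^bsub>N\<^esub> x" by blast
    have "\<forall>x\<in>carrier N. \<zero>\<^bsub>N\<^esub> \<oplus>\<^bsub>N\<^esub> x = x"
      unfolding all zero by (simp add: P(2)[symmetric])
    then show "\<And>x. x \<in> carrier N \<Longrightarrow> \<zero>\<^bsub>N\<^esub> \<oplus>\<^bsub>N\<^esub> x = x" by blast
    show "\<exists>y\<in>carrier N. y \<oplus>\<^bsub>N\<^esub> x = \<zero>\<^bsub>N\<^esub>" if x: "x \<in> carrier N" for x
    proof -
      obtain u where u: "u \<in> carrier M" "x = p u" using x car by auto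
      then have "p (\<ominus>\<^bsub>M\<^esub> u) \<oplus>\<^bsub>N\<^esub> x = \<zero>\<^bsub>N\<^esub>" unfolding zero by (simp add: P(2)[symmetric] M.M.l_neg)
      then show ?thesis using u P(1) M.M.a_inv_closed by blast
    qed
  qed
  show ?thesis
  proof (rule moduleI[OF assms(2) ag])
    have "\<forall>a\<in>carrier R. \<forall>x\<in>carrier N. a \<odot>\<^bsub>N\<^esub> x \<in> carrier N"
      unfolding all allR by (metis P(1,3) M.smult_closed)
    then show "\<And>a x. a \<in> carrier R \<Longrightarrow> x \<in> carrier N \<Longrightarrow> a \<odot>\<^bsub>N\<^esub> x \<in> carrier N" by blast
    have "\<forall>a\<in>carrier R. \<forall>b\<in>carrier R. \<forall>x\<in>carrier N. (a \<oplus>\<^bsub>R\<^esub> b) \<odot>\<^bsub>N\<^esub> x = a \<odot>\<^bsub>N\<^esub> x \<oplus>\<^bsub>N\<^esub> b \<odot>\<^bsub>N\<^esub> x"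
      unfolding all allR by (simp add: P(2,3)[symmetric] ph(1)[symmetric] M.smult_l_distr)
    then show "\<And>a b x. a \<in> carrier R \<Longrightarrow> b \<in> carrier R \<Longrightarrow> x \<in> carrier N \<Longrightarrow>
      (a \<oplus>\<^bsub>R\<^esub> b) \<odot>\<^bsub>N\<^esub> x = a \<odot>\<^bsub>N\<^esub> x \<oplus>\<^bsub>N\<^esub> b \<odot>\<^bsub>N\<^esub> x" by blast
    have "\<forall>a\<in>carrier R. \<forall>x\<in>carrier N. \<forall>y\<in>carrier N. a \<odot>\<^bsub>N\<^esub> (x \<oplus>\<^bsub>N\<^esub> y) = a \<odot>\<^bsub>N\<^esub> x \<oplus>\<^bsub>N\<^esub> a \<odot>\<^bsub>N\<^esub> y"
      unfolding all allR by (simp add: P(2,3)[symmetric] M.smult_r_distr)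
    then show "\<And>a x y. a \<in> carrier R \<Longrightarrow> x \<in> carrier N \<Longrightarrow> y \<in> carrier N \<Longrightarrow>
      a \<odot>\<^bsub>N\<^esub> (x \<oplus>\<^bsub>N\<^esub> y) = a \<odot>\<^bsub>N\<^esub> x \<oplus>\<^bsub>N\<^esub> a \<odot>\<^bsub>N\<^esub> y" by blast
    have "\<forall>a\<in>carrier R. \<forall>b\<in>carrier R. \<forall>x\<in>carrier N. (a \<otimes>\<^bsub>R\<^esub> b) \<odot>\<^bsub>N\<^esub> x = a \<odot>\<^bsub>N\<^esub> (b \<odot>\<^bsub>N\<^esub> x)"
      unfolding all allR by (simp add: P(3)[symmetric] ph(2)[symmetric] M.smult_assoc1)
    then show "\<And>a b x. a \<in> carrier R \<Longrightarrow> b \<in> carrier R \<Longrightarrow> x \<in> carrier N \<Longrightarrow>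
      (a \<otimes>\<^bsub>R\<^esub> b) \<odot>\<^bsub>N\<^esub> x = a \<odot>\<^bsub>N\<^esub> (b \<odot>\<^bsub>N\<^esub> x)" by blast
    have "\<forall>x\<in>carrier N. \<one>\<^bsub>R\<^esub> \<odot>\<^bsub>N\<^esub> x = x"
      unfolding all using ph(3)[OF M.R.one_closed M.R.one_closed] P(3)[of "\<one>\<^bsub>Q\<^esub>"] by auto
    then show "\<And>x. x \<in> carrier N \<Longrightarrow> \<one>\<^bsub>R\<^esub> \<odot>\<^bsub>N\<^esub> x = x" by blast
  qed
qed

section \<open>Quotient modules\<close>

context Module.module
begin

lemma submodule_abelian_subgroup:
  assumes "submodule H R M"
  shows "abelian_subgroup H M"
  using assms by (intro abelian_subgroupI3 additive_subgroupI) (auto simp: submodule_def M.abelian_group_axioms)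

lemma quot_module_simps:
  "zero (quot_module M H) = H" "carrier (quot_module M H) = (\<lambda>x. H +>\<^bsub>M\<^esub> x) ` carrier M"
  by (auto simp: quot_module_def A_RCOSETS_def')

lemma mem_coset_iff:
  assumes "submodule H R M" "x \<in> carrier M" "y \<in> carrier M"
  shows "y \<in> H +>\<^bsub>M\<^esub> x \<longleftrightarrow> y \<ominus>\<^bsub>M\<^esub> x \<in> H"
  using abelian_subgroup.a_rcos_module[OF submodule_abelian_subgroup[OF assms(1)] assms(2,3)]
  by (simp add: a_minus_def)

lemma coset_eq_iff:
  assumes "submodule H R M" "x \<in> carrier M" "y \<in> carrier M"
  shows "H +>\<^bsub>M\<^esub> x = H +>\<^bsub>M\<^esub> y \<longleftrightarrow> x \<ominus>\<^bsub>M\<^esub> y \<in> H"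
proof -
  note H = submodule_abelian_subgroup[OF assms(1)]
  have "H +>\<^bsub>M\<^esub> x = H +>\<^bsub>M\<^esub> y \<longleftrightarrow> x \<in> H +>\<^bsub>M\<^esub> y"
    using abelian_subgroup.a_repr_independence'[OF H] abelian_subgroup.a_rcos_self[OF H assms(2)] assms by blast
  then show ?thesis using mem_coset_iff[OF assms(1,3,2)] by simp
qed

lemma coset_subset: "submodule H R M \<Longrightarrow> x \<in> carrier M \<Longrightarrow> H +>\<^bsub>M\<^esub> x \<subseteq> carrier M"
  using submodule_closed(1) by (intro M.a_r_coset_subset_G) auto

lemma coset_zero: "submodule H R M \<Longrightarrow> H +>\<^bsub>M\<^esub> \<zero>\<^bsub>M\<^esub> = H"
  using submodule_closed(2) by (intro M.a_coset_join2) (auto simp: submodule_def)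

lemma coset_eq_zero_iff:
  assumes "submodule H R M" "x \<in> carrier M"
  shows "H +>\<^bsub>M\<^esub> x = H \<longleftrightarrow> x \<in> H"
  using coset_eq_iff[OF assms M.zero_closed] assms M.minus_equality[of "\<zero>\<^bsub>M\<^esub>" "\<zero>\<^bsub>M\<^esub>"]
  by (simp add: coset_zero[OF assms(1)] M.minus_eq)

lemma coset_semilinear:
  assumes H: "submodule H R M"
  shows "semilinear R id M (quot_module M H) (\<lambda>x. H +>\<^bsub>M\<^esub> x)"
  unfolding semilinear_def
proof (intro conjI ballI)
  show "(\<lambda>x. H +>\<^bsub>M\<^esub> x) \<in> carrier M \<rightarrow> carrier (quot_module M H)" by (auto simp: quot_module_simps)
  fix x y assume xy: "x \<in> carrier M" "y \<in> carrier M"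
  show "H +>\<^bsub>M\<^esub> (x \<oplus>\<^bsub>M\<^esub> y) = (H +>\<^bsub>M\<^esub> x) \<oplus>\<^bsub>quot_module M H\<^esub> (H +>\<^bsub>M\<^esub> y)"
    using abelian_subgroup.a_rcos_sum[OF submodule_abelian_subgroup[OF H] xy] by (simp add: quot_module_def)
next
  fix a x assume ax: "a \<in> carrier R" "x \<in> carrier M"
  \<comment> \<open>The scalar multiple of a coset is a union over its elements; because
    \<open>H\<close> is a submodule, each element contributes the same coset.\<close>
  have "H +>\<^bsub>M\<^esub> (a \<odot>\<^bsub>M\<^esub> y) = H +>\<^bsub>M\<^esub> (a \<odot>\<^bsub>M\<^esub> x)" if y: "y \<in> H +>\<^bsub>M\<^esub> x" for y
  proof -
    have yc: "y \<in> carrier M" using y coset_subset[OF H ax(2)] by auto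
    have "y \<ominus>\<^bsub>M\<^esub> x \<in> H" using y mem_coset_iff[OF H ax(2) yc] by simp
    then have "a \<odot>\<^bsub>M\<^esub> (y \<ominus>\<^bsub>M\<^esub> x) \<in> H" by (rule submodule_closed(4)[OF H ax(1)])
    then have "a \<odot>\<^bsub>M\<^esub> y \<ominus>\<^bsub>M\<^esub> a \<odot>\<^bsub>M\<^esub> x \<in> H"
      using ax yc by (simp add: a_minus_def smult_r_distr smult_r_minus)
    then show ?thesis using coset_eq_iff[OF H] ax yc by simp
  qed
  moreover have "x \<in> H +>\<^bsub>M\<^esub> x" by (rule abelian_subgroup.a_rcos_self[OF submodule_abelian_subgroup[OF H] ax(2)])
  ultimately have "(\<Union>y\<in>H +>\<^bsub>M\<^esub> x. H +>\<^bsub>M\<^esub> (a \<odot>\<^bsub>M\<^esub> y)) = H +>\<^bsub>M\<^esub> (a \<odot>\<^bsub>M\<^esub> x)" by blast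
  then show "H +>\<^bsub>M\<^esub> (a \<odot>\<^bsub>M\<^esub> x) = id a \<odot>\<^bsub>quot_module M H\<^esub> (H +>\<^bsub>M\<^esub> x)"
    by (simp add: quot_module_def)
qed

lemma quot_module_module:
  assumes H: "submodule H R M"
  shows "Module.module R (quot_module M H)"
proof (rule module_semilinear_image[OF _ R.is_cring _ _ _ _ coset_semilinear[OF H]])
  show "Module.module R M" by unfold_locales
qed (auto simp: quot_module_simps ring_hom_def coset_zero[OF H])

end

section \<open>Free modules and linear extension\<close>

lemma free_module_simps:
  "f \<in> carrier (free_module R B) \<longleftrightarrow> range f \<subseteq> carrier R \<and> finite {b. f b \<noteq> \<zero>\<^bsub>R\<^esub>} \<and> {b. f b \<noteq> \<zero>\<^bsub>R\<^esub>} \<subseteq> B"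
  "\<zero>\<^bsub>free_module R B\<^esub> = (\<lambda>_. \<zero>\<^bsub>R\<^esub>)" "f \<oplus>\<^bsub>free_module R B\<^esub> g = (\<lambda>b. f b \<oplus>\<^bsub>R\<^esub> g b)"
  "a \<odot>\<^bsub>free_module R B\<^esub> f = (\<lambda>b. a \<otimes>\<^bsub>R\<^esub> f b)"
  by (simp_all add: free_module_def)

lemma free_module_mono: "B \<subseteq> C \<Longrightarrow> carrier (free_module R B) \<subseteq> carrier (free_module R C)"
  unfolding subset_iff free_module_simps by blast

context cring
begin

lemma free_module_closed:
  assumes "f \<in> carrier (free_module R B)"
  shows "f b \<in> carrier R" "finite {b. f b \<noteq> \<zero>}" "b \<notin> B \<Longrightarrow> f b = \<zero>"
  using assms by (auto simp: free_module_simps)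

lemma free_module_add_closed:
  assumes "f \<in> carrier (free_module R B)" "g \<in> carrier (free_module R B)"
  shows "(\<lambda>b. f b \<oplus> g b) \<in> carrier (free_module R B)"
proof -
  have "{b. f b \<oplus> g b \<noteq> \<zero>} \<subseteq> {b. f b \<noteq> \<zero>} \<union> {b. g b \<noteq> \<zero>}" by auto
  then show ?thesis using assms free_module_closed(1)[OF assms(1)] free_module_closed(1)[OF assms(2)]
    unfolding free_module_simps by (auto intro: finite_subset)
qed

lemma free_module_map_closed:
  assumes "f \<in> carrier (free_module R B)" "\<And>a. a \<in> carrier R \<Longrightarrow> k a \<in> carrier R" "k \<zero> = \<zero>"
  shows "(\<lambda>b. k (f b)) \<in> carrier (free_module R B)"
proof -
  have "{b. k (f b) \<noteq> \<zero>} \<subseteq> {b. f b \<noteq> \<zero>}" using assms(3) by auto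
  then show ?thesis using assms free_module_closed(1)[OF assms(1)]
    unfolding free_module_simps by (auto intro: finite_subset)
qed

lemma free_module_module: "Module.module R (free_module R B)"
proof (rule moduleI[OF is_cring])
  note c = free_module_closed(1)
  show "abelian_group (free_module R B)"
  proof (rule abelian_groupI)
    fix f g h assume f: "f \<in> carrier (free_module R B)"
    show "\<exists>y\<in>carrier (free_module R B). y \<oplus>\<^bsub>free_module R B\<^esub> f = \<zero>\<^bsub>free_module R B\<^esub>"
      using free_module_map_closed[OF f, of "\<lambda>a. \<ominus> a"] c[OF f]
      by (intro bexI[of _ "\<lambda>b. \<ominus> f b"]) (auto simp: free_module_simps l_neg)
    assume g: "g \<in> carrier (free_module R B)"
    show "f \<oplus>\<^bsub>free_module R B\<^esub> g \<in> carrier (free_module R B)"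
      using free_module_add_closed[OF f g] by (simp add: free_module_simps(3))
    show "f \<oplus>\<^bsub>free_module R B\<^esub> g = g \<oplus>\<^bsub>free_module R B\<^esub> f"
      using c[OF f] c[OF g] by (auto simp: free_module_simps a_comm)
    assume h: "h \<in> carrier (free_module R B)"
    show "f \<oplus>\<^bsub>free_module R B\<^esub> g \<oplus>\<^bsub>free_module R B\<^esub> h = f \<oplus>\<^bsub>free_module R B\<^esub> (g \<oplus>\<^bsub>free_module R B\<^esub> h)"
      using c[OF f] c[OF g] c[OF h] by (auto simp: free_module_simps a_assoc)
    show "\<zero>\<^bsub>free_module R B\<^esub> \<oplus>\<^bsub>free_module R B\<^esub> f = f"
      using c[OF f] by (simp add: free_module_simps(2,3))
  qed (auto simp: free_module_simps)
  fix a x assume a: "a \<in> carrier R" and x: "x \<in> carrier (free_module R B)"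
  show "a \<odot>\<^bsub>free_module R B\<^esub> x \<in> carrier (free_module R B)"
    using free_module_map_closed[OF x, of "\<lambda>b. a \<otimes> b"] a by (auto simp: free_module_simps(4))
qed (simp_all add: free_module_simps(2-4) fun_eq_iff free_module_closed(1)[where B = B] l_distr r_distr m_assoc)

lemma basis_vec_closed: "b \<in> B \<Longrightarrow> basis_vec R b \<in> carrier (free_module R B)"
  by (auto simp: free_module_simps basis_vec_def intro: finite_subset[of _ "{b}"])

text \<open>Phrased for a set \<open>H\<close> closed under sums rather than for a submodule, so
  that it can also compare functions with values in the residue field. The induction runs over a
  finite set containing the support.\<close>

lemma free_module_induct:
  fixes f :: "'c \<Rightarrow> 'a"
  assumes I: "\<zero> \<in> I" and f: "f \<in> carrier (free_module R B)" "\<And>b. f b \<in> I"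
    and zero: "(\<lambda>_. \<zero>) \<in> H" and add: "\<And>f g. f \<in> H \<Longrightarrow> g \<in> H \<Longrightarrow> (\<lambda>b. f b \<oplus> g b) \<in> H"
    and bas: "\<And>i b. i \<in> I \<Longrightarrow> b \<in> B \<Longrightarrow> (\<lambda>c. i \<otimes> basis_vec R b c) \<in> H"
  shows "f \<in> H"
proof -
  have "\<forall>f. f \<in> carrier (free_module R B) \<and> (\<forall>b. f b \<in> I) \<and> {b. f b \<noteq> \<zero>} \<subseteq> S \<longrightarrow> f \<in> H" if "finite S" for S
    using that
  proof (induction S rule: finite_induct)
    case empty
    have "f = (\<lambda>_. \<zero>)" if "{b. f b \<noteq> \<zero>} \<subseteq> {}" for f :: "'c \<Rightarrow> 'a" using that by auto
    then show ?case using zero by auto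
  next
    case (insert s S)
    show ?case
    proof (intro allI impI, elim conjE)
      fix f :: "'c \<Rightarrow> 'a" assume f: "f \<in> carrier (free_module R B)" "\<forall>b. f b \<in> I" "{b. f b \<noteq> \<zero>} \<subseteq> insert s S"
      define g where "g = f(s := \<zero>)"
      have sub: "{b. g b \<noteq> \<zero>} \<subseteq> {b. f b \<noteq> \<zero>}" by (auto simp: g_def)
      have "g \<in> carrier (free_module R B)"
        unfolding free_module_simps
      proof (intro conjI)
        show "range g \<subseteq> carrier R" using free_module_closed(1)[OF f(1)] by (auto simp: g_def)
        show "finite {b. g b \<noteq> \<zero>}" using sub free_module_closed(2)[OF f(1)] by (rule finite_subset)
        show "{b. g b \<noteq> \<zero>} \<subseteq> B" using sub f(1) by (auto simp: free_module_simps)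
      qed
      moreover have "\<forall>b. g b \<in> I" using f(2) I by (auto simp: g_def)
      moreover have "{b. g b \<noteq> \<zero>} \<subseteq> S" using f(3) by (auto simp: g_def)
      ultimately have gH: "g \<in> H" using insert.IH by blast
      show "f \<in> H"
      proof (cases "s \<in> B")
        case True
        have "(\<lambda>b. g b \<oplus> f s \<otimes> basis_vec R s b) \<in> H" using add[OF gH bas[OF _ True]] f(2) by auto
        moreover have "(\<lambda>b. g b \<oplus> f s \<otimes> basis_vec R s b) = f"
          using free_module_closed(1)[OF f(1)] by (auto simp: g_def basis_vec_def)
        ultimately show ?thesis by simp
      next
        case False
        then have "g = f" using free_module_closed(3)[OF f(1)] by (auto simp: g_def)
        then show ?thesis using gH by simp
      qed
    qed
  qed
  then show ?thesis using f free_module_closed(2)[OF f(1)] by blast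
qed

text \<open>A condition that cuts out a submodule holds on all of the free module once it holds on
  the basis. Most linear identities below are verified in this form.\<close>

lemma free_module_span:
  assumes H: "submodule H R (free_module R B)" and "\<And>b. b \<in> B \<Longrightarrow> basis_vec R b \<in> H"
  shows "carrier (free_module R B) \<subseteq> H"
proof
  interpret F: Module.module R "free_module R B" by (rule free_module_module)
  note h = F.submodule_closed[OF H]
  fix f assume f: "f \<in> carrier (free_module R B)"
  show "f \<in> H"
    by (rule free_module_induct[of "carrier R", OF _ f])
      (use h(2) h(3) h(4) assms(2) free_module_closed(1)[OF f] in \<open>auto simp: free_module_simps\<close>)
qed

end

context Module.module
begin

text \<open>\<open>lin_ext\<close> sums over the support, which may shrink under addition; a common
  finite superset makes additivity visible.\<close>

lemma lin_ext_superset: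
  assumes f: "f \<in> carrier (free_module R B)" and h: "\<And>b. b \<in> B \<Longrightarrow> h b \<in> carrier M"
    and A: "finite A" "{b. f b \<noteq> \<zero>} \<subseteq> A" "A \<subseteq> B"
  shows "lin_ext R M h f = (\<Oplus>\<^bsub>M\<^esub> b \<in> A. f b \<odot>\<^bsub>M\<^esub> h b)"
  unfolding lin_ext_def
proof (rule M.add.finprod_mono_neutral_cong_left[OF A(1,2)])
  show "f i \<odot>\<^bsub>M\<^esub> h i = \<zero>\<^bsub>M\<^esub>" if "i \<in> A - {b. f b \<noteq> \<zero>}" for i using that h A(3) by auto
  show "(\<lambda>b. f b \<odot>\<^bsub>M\<^esub> h b) \<in> A \<rightarrow> carrier M"
    using h A(3) R.free_module_closed(1)[OF f] by auto
qed auto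

lemma lin_ext_semilinear:
  assumes h: "\<And>b. b \<in> B \<Longrightarrow> h b \<in> carrier M"
  shows "semilinear R id (free_module R B) M (lin_ext R M h)"
  unfolding semilinear_def
proof (intro conjI ballI)
  have cl: "(\<lambda>b. f b \<odot>\<^bsub>M\<^esub> h b) \<in> A \<rightarrow> carrier M" if "f \<in> carrier (free_module R B)" "A \<subseteq> B" for f A
    using h that R.free_module_closed(1)[OF that(1)] by auto
  have sup: "finite {b. f b \<noteq> \<zero>}" "{b. f b \<noteq> \<zero>} \<subseteq> B" if "f \<in> carrier (free_module R B)" for f
    using that by (auto simp: free_module_simps)
  show "lin_ext R M h \<in> carrier (free_module R B) \<rightarrow> carrier M"
    unfolding lin_ext_def using cl sup by (auto intro!: M.finsum_closed)
  fix f g assume f: "f \<in> carrier (free_module R B)" and g: "g \<in> carrier (free_module R B)"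
  define A where "A = {b. f b \<noteq> \<zero>} \<union> {b. g b \<noteq> \<zero>}"
  have A: "finite A" "A \<subseteq> B" using sup f g by (auto simp: A_def)
  have fg: "(\<lambda>b. f b \<oplus> g b) \<in> carrier (free_module R B)" by (rule R.free_module_add_closed[OF f g])
  have "lin_ext R M h (\<lambda>b. f b \<oplus> g b) = (\<Oplus>\<^bsub>M\<^esub> b \<in> A. (f b \<oplus> g b) \<odot>\<^bsub>M\<^esub> h b)"
    by (rule lin_ext_superset[OF fg h A(1) _ A(2)]) (auto simp: A_def)
  also have "\<dots> = (\<Oplus>\<^bsub>M\<^esub> b \<in> A. f b \<odot>\<^bsub>M\<^esub> h b \<oplus>\<^bsub>M\<^esub> g b \<odot>\<^bsub>M\<^esub> h b)"
    using R.free_module_closed(1)[OF f] R.free_module_closed(1)[OF g] h A(2)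
    by (intro M.finsum_cong') (auto simp: smult_l_distr)
  also have "\<dots> = (\<Oplus>\<^bsub>M\<^esub> b \<in> A. f b \<odot>\<^bsub>M\<^esub> h b) \<oplus>\<^bsub>M\<^esub> (\<Oplus>\<^bsub>M\<^esub> b \<in> A. g b \<odot>\<^bsub>M\<^esub> h b)"
    by (rule M.finsum_addf[OF cl[OF f A(2)] cl[OF g A(2)]])
  also have "(\<Oplus>\<^bsub>M\<^esub> b \<in> A. f b \<odot>\<^bsub>M\<^esub> h b) = lin_ext R M h f"
    by (rule lin_ext_superset[OF f h A(1) _ A(2), symmetric]) (auto simp: A_def)
  also have "(\<Oplus>\<^bsub>M\<^esub> b \<in> A. g b \<odot>\<^bsub>M\<^esub> h b) = lin_ext R M h g"
    by (rule lin_ext_superset[OF g h A(1) _ A(2), symmetric]) (auto simp: A_def)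
  finally show "lin_ext R M h (f \<oplus>\<^bsub>free_module R B\<^esub> g) = lin_ext R M h f \<oplus>\<^bsub>M\<^esub> lin_ext R M h g"
    by (simp add: free_module_simps)
next
  fix a f assume a: "a \<in> carrier R" and f: "f \<in> carrier (free_module R B)"
  define A where "A = {b. f b \<noteq> \<zero>}"
  have A: "finite A" "A \<subseteq> B" using f by (auto simp: A_def free_module_simps)
  note fc = R.free_module_closed(1)[OF f]
  have af: "(\<lambda>b. a \<otimes> f b) \<in> carrier (free_module R B)"
    by (rule R.free_module_map_closed[OF f, of "\<lambda>b. a \<otimes> b"]) (use a in auto)
  have "lin_ext R M h (\<lambda>b. a \<otimes> f b) = (\<Oplus>\<^bsub>M\<^esub> b \<in> A. (a \<otimes> f b) \<odot>\<^bsub>M\<^esub> h b)"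
    by (rule lin_ext_superset[OF af h A(1) _ A(2)]) (use a in \<open>auto simp: A_def\<close>)
  also have "\<dots> = (\<Oplus>\<^bsub>M\<^esub> b \<in> A. a \<odot>\<^bsub>M\<^esub> (f b \<odot>\<^bsub>M\<^esub> h b))"
    using fc h A(2) a by (intro M.finsum_cong') (auto simp: smult_assoc1)
  also have "\<dots> = a \<odot>\<^bsub>M\<^esub> (\<Oplus>\<^bsub>M\<^esub> b \<in> A. f b \<odot>\<^bsub>M\<^esub> h b)"
    using fc h A a by (intro finsum_smult_ldistr[symmetric]) auto
  finally show "lin_ext R M h (a \<odot>\<^bsub>free_module R B\<^esub> f) = id a \<odot>\<^bsub>M\<^esub> lin_ext R M h f"
    by (simp add: free_module_simps lin_ext_def A_def)
qed

lemma lin_ext_basis_vec: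
  assumes "b \<in> B" "h b \<in> carrier M"
  shows "lin_ext R M h (basis_vec R b) = h b"
proof -
  have "lin_ext R M h (basis_vec R b) = (\<Oplus>\<^bsub>M\<^esub> c \<in> {b}. basis_vec R b c \<odot>\<^bsub>M\<^esub> h c)"
    by (rule lin_ext_superset[of _ "{b}"]) (use assms R.basis_vec_closed[of b "{b}"] in \<open>auto simp: basis_vec_def\<close>)
  then show ?thesis using assms by (simp add: basis_vec_def)
qed

end

section \<open>Base change\<close>

lemma (in abelian_group) minus_eq_zero_iff:
  assumes "a \<in> carrier G" "b \<in> carrier G"
  shows "a \<ominus> b = \<zero> \<longleftrightarrow> a = b"
  using minus_equality[of a "\<ominus> b"] assms by (auto simp: minus_eq r_neg)

lemma (in cring) ring_module_module: "Module.module R (ring_module R)"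
proof (rule moduleI[OF is_cring])
  show "abelian_group (ring_module R)"
  proof (rule abelian_groupI)
    show "\<exists>y\<in>carrier (ring_module R). y \<oplus>\<^bsub>ring_module R\<^esub> x = \<zero>\<^bsub>ring_module R\<^esub>"
      if "x \<in> carrier (ring_module R)" for x
      using that l_neg[of x] by (auto simp: ring_module_def)
  qed (simp_all add: ring_module_def a_ac)
qed (auto simp: ring_module_def l_distr r_distr m_assoc)

definition pure_tensor ::
    "('q, 'h) ring_scheme \<Rightarrow> ('r, 'm) ring_scheme \<Rightarrow> ('q \<Rightarrow> 'r) \<Rightarrow> ('q, 'l, 'n) module_scheme \<Rightarrow> 'l \<Rightarrow> 'r \<Rightarrow> ('l \<times> 'r \<Rightarrow> 'r) set" where
  "pure_tensor Q R \<phi> L l n =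
     tensor_kernel Q R \<phi> L (ring_module R) +>\<^bsub>tensor_free R L (ring_module R)\<^esub> basis_vec R (l, n)"

definition unit_tensor ::
    "('q, 'h) ring_scheme \<Rightarrow> ('r, 'm) ring_scheme \<Rightarrow> ('q \<Rightarrow> 'r) \<Rightarrow> ('q, 'l, 'n) module_scheme \<Rightarrow> 'l \<Rightarrow> ('l \<times> 'r \<Rightarrow> 'r) set" where
  "unit_tensor Q R \<phi> L l = pure_tensor Q R \<phi> L l \<one>\<^bsub>R\<^esub>"

text \<open>The submodule I L, where I is the kernel of \<open>\<phi>\<close>.\<close>

definition kernel_mult ::
    "('q, 'h) ring_scheme \<Rightarrow> ('r, 'm) ring_scheme \<Rightarrow> ('q \<Rightarrow> 'r) \<Rightarrow> ('q, 'l, 'n) module_scheme \<Rightarrow> 'l set" where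
  "kernel_mult Q R \<phi> L =
     module_span Q L {i \<odot>\<^bsub>L\<^esub> l | i l. i \<in> carrier Q \<and> \<phi> i = \<zero>\<^bsub>R\<^esub> \<and> l \<in> carrier L}"

locale base_change = Q: cring Q + R: cring R
  for Q :: "('q, 'h) ring_scheme" and R :: "('r, 'm) ring_scheme" +
  fixes \<phi> :: "'q \<Rightarrow> 'r"
  assumes hom: "\<phi> \<in> ring_hom Q R" and surj: "\<phi> ` carrier Q = carrier R"
begin

lemma phi [simp]:
  "q \<in> carrier Q \<Longrightarrow> \<phi> q \<in> carrier R" "\<phi> \<one>\<^bsub>Q\<^esub> = \<one>\<^bsub>R\<^esub>"
  "q \<in> carrier Q \<Longrightarrow> q' \<in> carrier Q \<Longrightarrow> \<phi> (q \<oplus>\<^bsub>Q\<^esub> q') = \<phi> q \<oplus>\<^bsub>R\<^esub> \<phi> q'"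
  "q \<in> carrier Q \<Longrightarrow> q' \<in> carrier Q \<Longrightarrow> \<phi> (q \<otimes>\<^bsub>Q\<^esub> q') = \<phi> q \<otimes>\<^bsub>R\<^esub> \<phi> q'"
  using hom by (auto simp: ring_hom_def)

lemma phi_closed: "\<phi> \<in> carrier Q \<rightarrow> carrier R"
  using phi(1) by auto

lemma phi_zero [simp]: "\<phi> \<zero>\<^bsub>Q\<^esub> = \<zero>\<^bsub>R\<^esub>"
  and phi_uminus [simp]: "q \<in> carrier Q \<Longrightarrow> \<phi> (\<ominus>\<^bsub>Q\<^esub> q) = \<ominus>\<^bsub>R\<^esub> \<phi> q"
proof -
  interpret ring_hom_cring Q R \<phi> using hom by unfold_locales
  show "\<phi> \<zero>\<^bsub>Q\<^esub> = \<zero>\<^bsub>R\<^esub>" "q \<in> carrier Q \<Longrightarrow> \<phi> (\<ominus>\<^bsub>Q\<^esub> q) = \<ominus>\<^bsub>R\<^esub> \<phi> q" by simp_all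
qed

lemma phi_diff: "q \<in> carrier Q \<Longrightarrow> q' \<in> carrier Q \<Longrightarrow> \<phi> (q \<ominus>\<^bsub>Q\<^esub> q') = \<phi> q \<ominus>\<^bsub>R\<^esub> \<phi> q'"
  by (simp add: a_minus_def phi)

text \<open>A set-theoretic section of \<open>\<phi>\<close>, in general not additive. It enters
  only where a change by an element of the kernel has no effect.\<close>

definition section_of :: "'r \<Rightarrow> 'q" where "section_of r = (SOME q. q \<in> carrier Q \<and> \<phi> q = r)"

lemma section_of:
  assumes "r \<in> carrier R"
  shows "section_of r \<in> carrier Q" "\<phi> (section_of r) = r"
proof -
  have "r \<in> \<phi> ` carrier Q" using assms surj by simp
  then have "\<exists>q. q \<in> carrier Q \<and> \<phi> q = r" by (elim imageE) auto
  from someI_ex[OF this] show "section_of r \<in> carrier Q" "\<phi> (section_of r) = r"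
    unfolding section_of_def by (rule conjunct1, rule conjunct2)
qed

lemma tensor_free_module: "Module.module R (tensor_free R L (ring_module R))"
  unfolding tensor_free_def by (rule R.free_module_module)

lemma tensor_basis_closed:
  "l \<in> carrier L \<Longrightarrow> n \<in> carrier R \<Longrightarrow> basis_vec R (l, n) \<in> carrier (tensor_free R L (ring_module R))"
  unfolding tensor_free_def by (rule R.basis_vec_closed) (simp add: ring_module_def)

lemma tensor_relators_closed:
  assumes "Module.module Q L"
  shows "tensor_relators Q R \<phi> L (ring_module R) \<subseteq> carrier (tensor_free R L (ring_module R))"
proof -
  interpret L: Module.module Q L by fact
  interpret F: Module.module R "tensor_free R L (ring_module R)" by (rule tensor_free_module)
  note b = tensor_basis_closed
  show ?thesis
    unfolding tensor_relators_def Let_def ring_module_def[symmetric]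
    by (auto intro!: F.M.minus_closed F.M.a_closed b F.smult_closed simp: phi) (auto simp: ring_module_def phi)
qed

lemma tensor_kernel_submodule:
  assumes "Module.module Q L"
  shows "submodule (tensor_kernel Q R \<phi> L (ring_module R)) R (tensor_free R L (ring_module R))"
  unfolding tensor_kernel_def
  by (rule module.span_submodule[OF tensor_free_module tensor_relators_closed[OF assms]])

text \<open>The universal property of the tensor product in the form needed here: a balanced
  biadditive map that is \<open>R\<close>-linear in the second argument extends to the free module
  so as to kill the four kinds of relators, hence their span.\<close>

lemma tensor_kernel_subset_lin_ext_kernel:
  assumes L: "Module.module Q L" and P: "Module.module R P"
    and cl: "\<And>l n. l \<in> carrier L \<Longrightarrow> n \<in> carrier R \<Longrightarrow> k l n \<in> carrier P"
    and add1: "\<And>l l' n. l \<in> carrier L \<Longrightarrow> l' \<in> carrier L \<Longrightarrow> n \<in> carrier R \<Longrightarrow> k (l \<oplus>\<^bsub>L\<^esub> l') n = k l n \<oplus>\<^bsub>P\<^esub> k l' n"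
    and add2: "\<And>l n n'. l \<in> carrier L \<Longrightarrow> n \<in> carrier R \<Longrightarrow> n' \<in> carrier R \<Longrightarrow> k l (n \<oplus>\<^bsub>R\<^esub> n') = k l n \<oplus>\<^bsub>P\<^esub> k l n'"
    and bal: "\<And>q l n. q \<in> carrier Q \<Longrightarrow> l \<in> carrier L \<Longrightarrow> n \<in> carrier R \<Longrightarrow> k (q \<odot>\<^bsub>L\<^esub> l) n = k l (\<phi> q \<otimes>\<^bsub>R\<^esub> n)"
    and lin: "\<And>r l n. r \<in> carrier R \<Longrightarrow> l \<in> carrier L \<Longrightarrow> n \<in> carrier R \<Longrightarrow> k l (r \<otimes>\<^bsub>R\<^esub> n) = r \<odot>\<^bsub>P\<^esub> k l n"
  shows "tensor_kernel Q R \<phi> L (ring_module R) \<subseteq>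
    {c \<in> carrier (tensor_free R L (ring_module R)). lin_ext R P (\<lambda>(l, n). k l n) c = \<zero>\<^bsub>P\<^esub>}"
proof -
  interpret L: Module.module Q L by fact
  interpret P: Module.module R P by fact
  interpret F: Module.module R "tensor_free R L (ring_module R)" by (rule tensor_free_module)
  define D where "D = lin_ext R P (\<lambda>(l, n). k l n)"
  have D: "semilinear R id (tensor_free R L (ring_module R)) P D"
    unfolding D_def tensor_free_def by (rule P.lin_ext_semilinear) (auto simp: cl ring_module_def)
  have De: "D (basis_vec R (l, n)) = k l n" if "l \<in> carrier L" "n \<in> carrier R" for l n
    unfolding D_def using P.lin_ext_basis_vec[of "(l, n)" "carrier L \<times> carrier R" "\<lambda>(l, n). k l n"] that cl by simp
  note b = tensor_basis_closed and Da = semilinearD[OF D]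
    and Dd = semilinear_diff[OF D F.abelian_group_axioms P.abelian_group_axioms]
  have "submodule {c \<in> carrier (tensor_free R L (ring_module R)). D c \<in> {\<zero>\<^bsub>P\<^esub>}} R (tensor_free R L (ring_module R))"
    by (rule submodule_vimage[OF tensor_free_module P _ D P.submodule_zero]) simp
  then have sub: "submodule {c \<in> carrier (tensor_free R L (ring_module R)). D c = \<zero>\<^bsub>P\<^esub>} R (tensor_free R L (ring_module R))"
    by simp
  have rc: "carrier (ring_module R) = carrier R" "\<And>a b. a \<oplus>\<^bsub>ring_module R\<^esub> b = a \<oplus>\<^bsub>R\<^esub> b"
    "\<And>a b. a \<odot>\<^bsub>ring_module R\<^esub> b = a \<otimes>\<^bsub>R\<^esub> b" by (auto simp: ring_module_def)
  have "D c = \<zero>\<^bsub>P\<^esub>" if "c \<in> tensor_relators Q R \<phi> L (ring_module R)" for c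
    using that unfolding tensor_relators_def Let_def rc
    by (elim UnE CollectE exE conjE)
      (simp_all add: Dd Da b De cl add1 add2 bal lin phi P.M.r_neg P.M.minus_eq)
  then show ?thesis
    unfolding tensor_kernel_def D_def[symmetric]
    using tensor_relators_closed[OF L] by (intro F.span_minimal[OF sub]) auto
qed

end

locale base_change_module = base_change Q R \<phi> + L: Module.module Q L
  for Q :: "('q, 'h) ring_scheme" and R :: "('r, 'm) ring_scheme" and \<phi> :: "'q \<Rightarrow> 'r"
    and L :: "('q, 'l, 'n) module_scheme"
begin

abbreviation "F \<equiv> tensor_free R L (ring_module R)"
abbreviation "K \<equiv> tensor_kernel Q R \<phi> L (ring_module R)"
abbreviation "T \<equiv> tensor Q R \<phi> L (ring_module R)"

lemma L_module: "Module.module Q L" by unfold_locales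

lemma K: "submodule K R F" by (rule tensor_kernel_submodule[OF L_module])

lemma T_module: "Module.module R T"
  unfolding tensor_def by (rule module.quot_module_module[OF tensor_free_module K])

lemma proj_semilinear: "semilinear R id F T (\<lambda>c. K +>\<^bsub>F\<^esub> c)"
  unfolding tensor_def by (rule module.coset_semilinear[OF tensor_free_module K])

lemma T_simps: "\<zero>\<^bsub>T\<^esub> = K" "carrier T = (\<lambda>c. K +>\<^bsub>F\<^esub> c) ` carrier F"
  unfolding tensor_def module.quot_module_simps[OF tensor_free_module] by auto

lemma proj_eqI:
  assumes "x \<ominus>\<^bsub>F\<^esub> y \<in> tensor_relators Q R \<phi> L (ring_module R)" "x \<in> carrier F" "y \<in> carrier F"
  shows "K +>\<^bsub>F\<^esub> x = K +>\<^bsub>F\<^esub> y"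
  using subsetD[OF module.span_superset[OF tensor_free_module] assms(1), of L]
    module.coset_eq_iff[OF tensor_free_module K assms(2,3)]
  by (simp add: tensor_kernel_def)

lemma pure_tensor_closed: "l \<in> carrier L \<Longrightarrow> n \<in> carrier R \<Longrightarrow> pure_tensor Q R \<phi> L l n \<in> carrier T"
  unfolding pure_tensor_def by (intro semilinearD(1)[OF proj_semilinear] tensor_basis_closed)

lemma pure_tensor_simps:
  "l \<in> carrier L \<Longrightarrow> l' \<in> carrier L \<Longrightarrow> n \<in> carrier R \<Longrightarrow>
    pure_tensor Q R \<phi> L (l \<oplus>\<^bsub>L\<^esub> l') n = pure_tensor Q R \<phi> L l n \<oplus>\<^bsub>T\<^esub> pure_tensor Q R \<phi> L l' n"
  "l \<in> carrier L \<Longrightarrow> n \<in> carrier R \<Longrightarrow> n' \<in> carrier R \<Longrightarrow>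
    pure_tensor Q R \<phi> L l (n \<oplus>\<^bsub>R\<^esub> n') = pure_tensor Q R \<phi> L l n \<oplus>\<^bsub>T\<^esub> pure_tensor Q R \<phi> L l n'"
  "q \<in> carrier Q \<Longrightarrow> l \<in> carrier L \<Longrightarrow> n \<in> carrier R \<Longrightarrow>
    pure_tensor Q R \<phi> L (q \<odot>\<^bsub>L\<^esub> l) n = pure_tensor Q R \<phi> L l (\<phi> q \<otimes>\<^bsub>R\<^esub> n)"
  "r \<in> carrier R \<Longrightarrow> l \<in> carrier L \<Longrightarrow> n \<in> carrier R \<Longrightarrow>
    pure_tensor Q R \<phi> L l (r \<otimes>\<^bsub>R\<^esub> n) = r \<odot>\<^bsub>T\<^esub> pure_tensor Q R \<phi> L l n"
proof -
  interpret F: Module.module R F by (rule tensor_free_module)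
  note b = tensor_basis_closed[of _ L] and p = semilinearD[OF proj_semilinear]
  have rc: "carrier (ring_module R) = carrier R" "\<And>a b. a \<oplus>\<^bsub>ring_module R\<^esub> b = a \<oplus>\<^bsub>R\<^esub> b"
    "\<And>a b. a \<odot>\<^bsub>ring_module R\<^esub> b = a \<otimes>\<^bsub>R\<^esub> b" by (auto simp: ring_module_def)
  note rel = tensor_relators_def[of Q R \<phi> L "ring_module R", unfolded Let_def rc]
  show "pure_tensor Q R \<phi> L (l \<oplus>\<^bsub>L\<^esub> l') n = pure_tensor Q R \<phi> L l n \<oplus>\<^bsub>T\<^esub> pure_tensor Q R \<phi> L l' n"
    if a: "l \<in> carrier L" "l' \<in> carrier L" "n \<in> carrier R"
  proof -
    have "basis_vec R (l \<oplus>\<^bsub>L\<^esub> l', n) \<ominus>\<^bsub>F\<^esub> (basis_vec R (l, n) \<oplus>\<^bsub>F\<^esub> basis_vec R (l', n))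
      \<in> tensor_relators Q R \<phi> L (ring_module R)"
      unfolding rel using a by blast
    from proj_eqI[OF this] show ?thesis unfolding pure_tensor_def using a b p(2) by simp
  qed
  show "pure_tensor Q R \<phi> L l (n \<oplus>\<^bsub>R\<^esub> n') = pure_tensor Q R \<phi> L l n \<oplus>\<^bsub>T\<^esub> pure_tensor Q R \<phi> L l n'"
    if a: "l \<in> carrier L" "n \<in> carrier R" "n' \<in> carrier R"
  proof -
    have "basis_vec R (l, n \<oplus>\<^bsub>R\<^esub> n') \<ominus>\<^bsub>F\<^esub> (basis_vec R (l, n) \<oplus>\<^bsub>F\<^esub> basis_vec R (l, n'))
      \<in> tensor_relators Q R \<phi> L (ring_module R)"
      unfolding rel using a by blast
    from proj_eqI[OF this] show ?thesis unfolding pure_tensor_def using a b p(2) by simp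
  qed
  show "pure_tensor Q R \<phi> L (q \<odot>\<^bsub>L\<^esub> l) n = pure_tensor Q R \<phi> L l (\<phi> q \<otimes>\<^bsub>R\<^esub> n)"
    if a: "q \<in> carrier Q" "l \<in> carrier L" "n \<in> carrier R"
  proof -
    have "basis_vec R (q \<odot>\<^bsub>L\<^esub> l, n) \<ominus>\<^bsub>F\<^esub> basis_vec R (l, \<phi> q \<otimes>\<^bsub>R\<^esub> n)
      \<in> tensor_relators Q R \<phi> L (ring_module R)"
      unfolding rel using a by blast
    from proj_eqI[OF this] show ?thesis unfolding pure_tensor_def using a b by simp
  qed
  show "pure_tensor Q R \<phi> L l (r \<otimes>\<^bsub>R\<^esub> n) = r \<odot>\<^bsub>T\<^esub> pure_tensor Q R \<phi> L l n"
    if a: "r \<in> carrier R" "l \<in> carrier L" "n \<in> carrier R"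
  proof -
    have "basis_vec R (l, r \<otimes>\<^bsub>R\<^esub> n) \<ominus>\<^bsub>F\<^esub> r \<odot>\<^bsub>F\<^esub> basis_vec R (l, n)
      \<in> tensor_relators Q R \<phi> L (ring_module R)"
      unfolding rel using a by blast
    from proj_eqI[OF this] show ?thesis unfolding pure_tensor_def using a b p(3) by simp
  qed
qed

lemma unit_tensor_semilinear: "semilinear Q \<phi> L T (unit_tensor Q R \<phi> L)"
  unfolding semilinear_def unit_tensor_def
proof (intro conjI ballI funcsetI)
  fix q l assume ql: "q \<in> carrier Q" "l \<in> carrier L"
  then show "pure_tensor Q R \<phi> L (q \<odot>\<^bsub>L\<^esub> l) \<one>\<^bsub>R\<^esub> = \<phi> q \<odot>\<^bsub>T\<^esub> pure_tensor Q R \<phi> L l \<one>\<^bsub>R\<^esub>"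
    using pure_tensor_simps(3)[OF ql R.one_closed] pure_tensor_simps(4)[of "\<phi> q" l "\<one>\<^bsub>R\<^esub>"] by simp
qed (auto simp: pure_tensor_closed pure_tensor_simps)

text \<open>Surjectivity of \<open>\<phi>\<close> lets every scalar move to the left factor. It
  follows that every element of the base change has the form l tensor 1.\<close>

lemma pure_tensor_eq_unit_tensor:
  assumes "l \<in> carrier L" "n \<in> carrier R"
  shows "pure_tensor Q R \<phi> L l n = unit_tensor Q R \<phi> L (section_of n \<odot>\<^bsub>L\<^esub> l)"
  unfolding unit_tensor_def using assms section_of[OF assms(2)]
  by (simp add: pure_tensor_simps(3))

lemma unit_tensor_surj: "unit_tensor Q R \<phi> L ` carrier L = carrier T"
proof
  show "unit_tensor Q R \<phi> L ` carrier L \<subseteq> carrier T" using semilinearD(1)[OF unit_tensor_semilinear] by blast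
  have im: "submodule (unit_tensor Q R \<phi> L ` carrier L) R T"
    by (rule submodule_image[OF L_module T_module surj unit_tensor_semilinear])
  have "submodule {c \<in> carrier F. K +>\<^bsub>F\<^esub> c \<in> unit_tensor Q R \<phi> L ` carrier L} R F"
    by (rule submodule_vimage[OF tensor_free_module T_module _ proj_semilinear im]) simp
  then have "carrier F \<subseteq> {c \<in> carrier F. K +>\<^bsub>F\<^esub> c \<in> unit_tensor Q R \<phi> L ` carrier L}"
    unfolding tensor_free_def
  proof (rule R.free_module_span, clarify)
    fix l n assume "l \<in> carrier L" "n \<in> carrier (ring_module R)"
    then have ln: "l \<in> carrier L" "n \<in> carrier R" by (auto simp: ring_module_def)
    have "pure_tensor Q R \<phi> L l n \<in> unit_tensor Q R \<phi> L ` carrier L"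
      unfolding pure_tensor_eq_unit_tensor[OF ln] using ln section_of(1) by auto
    then show "basis_vec R (l, n) \<in> carrier (free_module R (carrier L \<times> carrier (ring_module R))) \<and>
      tensor_kernel Q R \<phi> L (ring_module R) +>\<^bsub>free_module R (carrier L \<times> carrier (ring_module R))\<^esub> basis_vec R (l, n)
        \<in> unit_tensor Q R \<phi> L ` carrier L"
      using tensor_basis_closed[OF ln] unfolding pure_tensor_def tensor_free_def by simp
  qed
  then show "carrier T \<subseteq> unit_tensor Q R \<phi> L ` carrier L" unfolding T_simps by blast
qed

lemma kernel_mult_submodule: "submodule (kernel_mult Q R \<phi> L) Q L"
  unfolding kernel_mult_def by (rule L.span_submodule) auto

lemma kernel_multI: "i \<in> carrier Q \<Longrightarrow> \<phi> i = \<zero>\<^bsub>R\<^esub> \<Longrightarrow> l \<in> carrier L \<Longrightarrow> i \<odot>\<^bsub>L\<^esub> l \<in> kernel_mult Q R \<phi> L"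
  unfolding kernel_mult_def by (rule subsetD[OF L.span_superset]) auto

text \<open>This is the identification of L tensor R with L / I L. That I L dies is balancedness.
  Conversely, L / I L carries an \<open>R\<close>-module structure, and the map induced by (x, n) ->
  n p(x) sends l tensor 1 to the class of \<open>l\<close>, so it detects the elements outside I
  L.\<close>

lemma unit_tensor_eq_zero_iff:
  assumes l: "l \<in> carrier L"
  shows "unit_tensor Q R \<phi> L l = \<zero>\<^bsub>T\<^esub> \<longleftrightarrow> l \<in> kernel_mult Q R \<phi> L"
proof
  interpret T: Module.module R T by (rule T_module)
  have "submodule {l \<in> carrier L. unit_tensor Q R \<phi> L l \<in> {\<zero>\<^bsub>T\<^esub>}} Q L"
    by (rule submodule_vimage[OF L_module T_module phi_closed unit_tensor_semilinear T.submodule_zero])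
  moreover have "{i \<odot>\<^bsub>L\<^esub> l | i l. i \<in> carrier Q \<and> \<phi> i = \<zero>\<^bsub>R\<^esub> \<and> l \<in> carrier L}
      \<subseteq> {l \<in> carrier L. unit_tensor Q R \<phi> L l \<in> {\<zero>\<^bsub>T\<^esub>}}"
    using semilinearD[OF unit_tensor_semilinear] by auto
  ultimately have "kernel_mult Q R \<phi> L \<subseteq> {l \<in> carrier L. unit_tensor Q R \<phi> L l \<in> {\<zero>\<^bsub>T\<^esub>}}"
    unfolding kernel_mult_def by (rule L.span_minimal)
  then show "unit_tensor Q R \<phi> L l = \<zero>\<^bsub>T\<^esub>" if "l \<in> kernel_mult Q R \<phi> L" using that by auto
next
  define H where "H = kernel_mult Q R \<phi> L"
  have H: "submodule H Q L" unfolding H_def by (rule kernel_mult_submodule)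
  define V where "V = quot_module L H"
  \<comment> \<open>Scalars of \<open>R\<close> act on L / I L through chosen preimages in
    \<open>Q\<close>. The fact \<open>cong\<close> shows that the choice does not matter, because
    the kernel of \<open>\<phi>\<close> kills L / I L.\<close>
  define P :: "('r, 'l set) module" where
    "P = \<lparr>carrier = carrier V, monoid.mult = undefined, one = undefined,
      zero = \<zero>\<^bsub>V\<^esub>, add = (\<lambda>x y. x \<oplus>\<^bsub>V\<^esub> y), module.smult = (\<lambda>r x. section_of r \<odot>\<^bsub>V\<^esub> x)\<rparr>"
  define p where "p x = H +>\<^bsub>L\<^esub> x" for x
  have V: "Module.module Q V" unfolding V_def by (rule L.quot_module_module[OF H])
  have pV: "semilinear Q id L V p" unfolding V_def p_def by (rule L.coset_semilinear[OF H])
  have P_simps: "carrier P = carrier V" "\<zero>\<^bsub>P\<^esub> = \<zero>\<^bsub>V\<^esub>" "\<And>x y. x \<oplus>\<^bsub>P\<^esub> y = x \<oplus>\<^bsub>V\<^esub> y"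
    "\<And>r x. r \<odot>\<^bsub>P\<^esub> x = section_of r \<odot>\<^bsub>V\<^esub> x" by (simp_all add: P_def)
  have cong: "p (q \<odot>\<^bsub>L\<^esub> x) = p (q' \<odot>\<^bsub>L\<^esub> x)"
    if "q \<in> carrier Q" "q' \<in> carrier Q" "\<phi> q = \<phi> q'" "x \<in> carrier L" for q q' x
  proof -
    have "(q \<ominus>\<^bsub>Q\<^esub> q') \<odot>\<^bsub>L\<^esub> x \<in> H" unfolding H_def using that
      by (intro kernel_multI) (simp_all add: phi_diff a_minus_def R.r_neg)
    then have "q \<odot>\<^bsub>L\<^esub> x \<ominus>\<^bsub>L\<^esub> q' \<odot>\<^bsub>L\<^esub> x \<in> H"
      using that by (simp add: a_minus_def L.smult_l_distr L.smult_l_minus)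
    then show ?thesis unfolding p_def using L.coset_eq_iff[OF H] that by simp
  qed
  have pP: "semilinear Q \<phi> L P p"
    unfolding semilinear_def P_simps
  proof (intro conjI ballI)
    fix q x assume qx: "q \<in> carrier Q" "x \<in> carrier L"
    have s: "section_of (\<phi> q) \<in> carrier Q" "\<phi> (section_of (\<phi> q)) = \<phi> q" using section_of phi(1) qx by auto
    have "section_of (\<phi> q) \<odot>\<^bsub>V\<^esub> p x = p (section_of (\<phi> q) \<odot>\<^bsub>L\<^esub> x)"
      using semilinearD(3)[OF pV s(1) qx(2)] by simp
    also have "\<dots> = p (q \<odot>\<^bsub>L\<^esub> x)" using s qx by (intro cong)
    finally show "p (q \<odot>\<^bsub>L\<^esub> x) = section_of (\<phi> q) \<odot>\<^bsub>V\<^esub> p x" ..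
  qed (use semilinearD[OF pV] in auto)
  have p_im: "carrier V = p ` carrier L" unfolding V_def p_def by (rule L.quot_module_simps(2))
  have p0: "\<zero>\<^bsub>V\<^esub> = p \<zero>\<^bsub>L\<^esub>" unfolding V_def p_def using L.quot_module_simps(1) L.coset_zero[OF H] by auto
  have P: "Module.module R P"
    by (rule module_semilinear_image[OF L_module R.is_cring hom surj _ _ pP]) (simp_all only: P_simps p_im p0)
  define k where "k x n = n \<odot>\<^bsub>P\<^esub> p x" for x n
  interpret P: Module.module R P by (rule P)
  have pc: "x \<in> carrier L \<Longrightarrow> p x \<in> carrier P" for x using semilinearD(1)[OF pP] .
  have "K \<subseteq> {c \<in> carrier F. lin_ext R P (\<lambda>(l, n). k l n) c = \<zero>\<^bsub>P\<^esub>}"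
    by (rule tensor_kernel_subset_lin_ext_kernel[OF L_module P])
      (simp_all add: k_def pc semilinearD(2,3)[OF pP] P.smult_l_distr P.smult_r_distr P.smult_assoc1 phi
        flip: P.smult_assoc1, simp_all add: R.m_comm phi)
  moreover assume "unit_tensor Q R \<phi> L l = \<zero>\<^bsub>T\<^esub>"
  then have "basis_vec R (l, \<one>\<^bsub>R\<^esub>) \<in> K"
    using module.coset_eq_zero_iff[OF tensor_free_module K tensor_basis_closed[OF l R.one_closed]]
    by (simp add: unit_tensor_def pure_tensor_def T_simps)
  ultimately have "lin_ext R P (\<lambda>(l, n). k l n) (basis_vec R (l, \<one>\<^bsub>R\<^esub>)) = \<zero>\<^bsub>P\<^esub>" by blast
  then have "k l \<one>\<^bsub>R\<^esub> = \<zero>\<^bsub>P\<^esub>"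
    using P.lin_ext_basis_vec[of "(l, \<one>\<^bsub>R\<^esub>)" "carrier L \<times> carrier R" "\<lambda>(l, n). k l n"] l pc by (simp add: k_def)
  then have "p l = \<zero>\<^bsub>V\<^esub>" using pc[OF l] by (simp add: k_def P_simps(2))
  then show "l \<in> kernel_mult Q R \<phi> L"
    using L.coset_eq_zero_iff[OF H l] by (simp add: p_def V_def L.quot_module_simps H_def)
qed

end

text \<open>\<open>tensor_map\<close> is a union over all representatives of a class. The family is
  constant: pushing a representative forward and projecting agrees with the linear extension of (x,
  n) -> h x tensor n, which kills the tensor kernel. The representative given by the basis vector of
  (l, 1) then determines the value.\<close>

lemma (in base_change) tensor_map_unit_tensor:
  assumes L: "Module.module Q L" and L': "Module.module Q L'" and h: "semilinear Q id L L' h" and l: "l \<in> carrier L"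
  shows "tensor_map Q R \<phi> L' (ring_module R) h (unit_tensor Q R \<phi> L l) = unit_tensor Q R \<phi> L' (h l)"
proof -
  interpret L: base_change_module Q R \<phi> L by (intro base_change_module.intro base_change_axioms L)
  interpret L': base_change_module Q R \<phi> L' by (intro base_change_module.intro base_change_axioms L')
  interpret F: Module.module R L.F by (rule tensor_free_module)
  interpret T': Module.module R L'.T by (rule L'.T_module)
  interpret F': Module.module R L'.F by (rule tensor_free_module)
  note hD = semilinearD[OF h]
  define g where "g = (\<lambda>(l, n :: 'r). basis_vec R (h l, n))"
  define k where "k x n = pure_tensor Q R \<phi> L' (h x) n" for x n
  have kc: "k x n \<in> carrier L'.T" if "x \<in> carrier L" "n \<in> carrier R" for x n
    unfolding k_def using that hD(1) L'.pure_tensor_closed by blast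
  have cR: "carrier (ring_module R) = carrier R" by (simp add: ring_module_def)
  have gs: "semilinear R id L.F L'.F (lin_ext R L'.F g)"
    unfolding tensor_free_def[of R L] cR
    by (rule F'.lin_ext_semilinear) (use hD(1) tensor_basis_closed[of _ L'] in \<open>auto simp: g_def\<close>)
  have ks: "semilinear R id L.F L'.T (lin_ext R L'.T (\<lambda>(x, n). k x n))"
    unfolding tensor_free_def[of R L] cR by (rule T'.lin_ext_semilinear) (use kc in auto)
  have comp: "semilinear R id L.F L'.T ((\<lambda>c. L'.K +>\<^bsub>L'.F\<^esub> c) \<circ> lin_ext R L'.F g)"
    using semilinear_comp[OF gs L'.proj_semilinear] by simp
  have "submodule {c \<in> carrier L.F. ((\<lambda>c. L'.K +>\<^bsub>L'.F\<^esub> c) \<circ> lin_ext R L'.F g) c = lin_ext R L'.T (\<lambda>(x, n). k x n) c} R L.F"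
    by (rule submodule_equalizer[OF tensor_free_module L'.T_module _ comp ks]) simp
  then have "carrier L.F \<subseteq> {c \<in> carrier L.F. ((\<lambda>c. L'.K +>\<^bsub>L'.F\<^esub> c) \<circ> lin_ext R L'.F g) c = lin_ext R L'.T (\<lambda>(x, n). k x n) c}"
    unfolding tensor_free_def[of R L] cR
  proof (rule R.free_module_span, clarify)
    fix x n assume xn: "x \<in> carrier L" "n \<in> carrier R"
    have "lin_ext R L'.F g (basis_vec R (x, n)) = basis_vec R (h x, n)"
      using F'.lin_ext_basis_vec[of "(x, n)" "carrier L \<times> carrier R" g] xn hD(1) tensor_basis_closed[of "h x" L' n]
      by (simp add: g_def)
    moreover have "lin_ext R L'.T (\<lambda>(x, n). k x n) (basis_vec R (x, n)) = k x n"
      using T'.lin_ext_basis_vec[of "(x, n)" "carrier L \<times> carrier R" "\<lambda>(x, n). k x n"] xn kc by simp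
    ultimately show "basis_vec R (x, n) \<in> carrier (free_module R (carrier L \<times> carrier R)) \<and>
      ((\<lambda>c. L'.K +>\<^bsub>L'.F\<^esub> c) \<circ> lin_ext R L'.F g) (basis_vec R (x, n)) = lin_ext R L'.T (\<lambda>(x, n). k x n) (basis_vec R (x, n))"
      using xn R.basis_vec_closed[of "(x, n)" "carrier L \<times> carrier R"] by (simp add: k_def pure_tensor_def)
  qed
  then have pg: "L'.K +>\<^bsub>L'.F\<^esub> lin_ext R L'.F g c = lin_ext R L'.T (\<lambda>(x, n). k x n) c" if "c \<in> carrier L.F" for c
    using that by auto
  have Kk: "L.K \<subseteq> {c \<in> carrier L.F. lin_ext R L'.T (\<lambda>(x, n). k x n) c = \<zero>\<^bsub>L'.T\<^esub>}"
  proof (rule tensor_kernel_subset_lin_ext_kernel[OF L L'.T_module])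
    show "k (x \<oplus>\<^bsub>L\<^esub> y) n = k x n \<oplus>\<^bsub>L'.T\<^esub> k y n" if "x \<in> carrier L" "y \<in> carrier L" "n \<in> carrier R" for x y n
      using that by (simp add: k_def hD L'.pure_tensor_simps(1))
    show "k x (n \<oplus>\<^bsub>R\<^esub> n') = k x n \<oplus>\<^bsub>L'.T\<^esub> k x n'" if "x \<in> carrier L" "n \<in> carrier R" "n' \<in> carrier R" for x n n'
      using that by (simp add: k_def hD L'.pure_tensor_simps(2))
    show "k (q \<odot>\<^bsub>L\<^esub> x) n = k x (\<phi> q \<otimes>\<^bsub>R\<^esub> n)" if "q \<in> carrier Q" "x \<in> carrier L" "n \<in> carrier R" for q x n
      using that by (simp add: k_def hD L'.pure_tensor_simps(3))
    show "k x (r \<otimes>\<^bsub>R\<^esub> n) = r \<odot>\<^bsub>L'.T\<^esub> k x n" if "r \<in> carrier R" "x \<in> carrier L" "n \<in> carrier R" for r x n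
      using that by (simp add: k_def hD L'.pure_tensor_simps(4))
  qed (rule kc)
  define c0 where "c0 = basis_vec R (l, \<one>\<^bsub>R\<^esub>)"
  have c0: "c0 \<in> carrier L.F" unfolding c0_def by (rule tensor_basis_closed[OF l R.one_closed])
  have kc0: "lin_ext R L'.T (\<lambda>(x, n). k x n) c0 = unit_tensor Q R \<phi> L' (h l)"
    unfolding c0_def unit_tensor_def using T'.lin_ext_basis_vec[of "(l, \<one>\<^bsub>R\<^esub>)" "carrier L \<times> carrier R" "\<lambda>(x, n). k x n"] l kc
    by (simp add: k_def)
  have const: "L'.K +>\<^bsub>L'.F\<^esub> lin_ext R L'.F g c = unit_tensor Q R \<phi> L' (h l)" if c: "c \<in> L.K +>\<^bsub>L.F\<^esub> c0" for c
  proof -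
    have cc: "c \<in> carrier L.F" using F.coset_subset[OF L.K c0] c by blast
    have "c \<ominus>\<^bsub>L.F\<^esub> c0 \<in> L.K" using F.mem_coset_iff[OF L.K c0 cc] c by simp
    then have "lin_ext R L'.T (\<lambda>(x, n). k x n) (c \<ominus>\<^bsub>L.F\<^esub> c0) = \<zero>\<^bsub>L'.T\<^esub>" using Kk by blast
    then have "lin_ext R L'.T (\<lambda>(x, n). k x n) c = lin_ext R L'.T (\<lambda>(x, n). k x n) c0"
      using semilinear_diff[OF ks F.abelian_group_axioms T'.abelian_group_axioms cc c0]
        semilinearD(1)[OF ks cc] semilinearD(1)[OF ks c0] T'.M.minus_eq_zero_iff by simp
    then show ?thesis using pg[OF cc] kc0 by simp
  qed
  have "c0 \<in> L.K +>\<^bsub>L.F\<^esub> c0"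
    by (rule abelian_subgroup.a_rcos_self[OF F.submodule_abelian_subgroup[OF L.K] c0])
  then have "(\<Union>c\<in>L.K +>\<^bsub>L.F\<^esub> c0. L'.K +>\<^bsub>L'.F\<^esub> lin_ext R L'.F g c) = unit_tensor Q R \<phi> L' (h l)"
    using const by blast
  then show ?thesis
    unfolding tensor_map_def unit_tensor_def[of Q R \<phi> L] pure_tensor_def[of Q R \<phi> L] g_def c0_def .
qed

section \<open>The standard resolution and Tor\<close>

context cring
begin

lemma lin_comb_simps:
  "lin_comb R [] = (\<lambda>_. \<zero>)"
  "lin_comb R ((b, q) # xs) = (\<lambda>c. q \<otimes> basis_vec R b c \<oplus> lin_comb R xs c)"
  by (simp_all add: lin_comb_def free_module_simps)

lemma lin_comb_closed:
  "set xs \<subseteq> B \<times> carrier R \<Longrightarrow> lin_comb R xs \<in> carrier (free_module R B)"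
proof (induction xs)
  case Nil
  then show ?case by (simp add: lin_comb_simps free_module_simps)
next
  case (Cons x xs)
  obtain b q where x: "x = (b, q)" by force
  have "(\<lambda>c. q \<otimes> basis_vec R b c) \<in> carrier (free_module R B)"
    using Cons.prems by (intro free_module_map_closed[of _ B "\<lambda>a. q \<otimes> a"] basis_vec_closed) (auto simp: x)
  then show ?case using Cons unfolding x lin_comb_simps by (intro free_module_add_closed) auto
qed

lemma lin_comb_append:
  "set xs \<subseteq> B \<times> carrier R \<Longrightarrow> set ys \<subseteq> B \<times> carrier R \<Longrightarrow>
    lin_comb R (xs @ ys) = (\<lambda>c. lin_comb R xs c \<oplus> lin_comb R ys c)"
proof (induction xs)
  case Nil
  then show ?case using free_module_closed(1)[OF lin_comb_closed[OF Nil(2)]] by (simp add: lin_comb_simps)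
next
  case (Cons x xs)
  obtain b q where x: "x = (b, q)" by force
  have "basis_vec R b c \<in> carrier R" for c by (simp add: basis_vec_def)
  moreover have "lin_comb R xs c \<in> carrier R" "lin_comb R ys c \<in> carrier R" for c
    using free_module_closed(1)[OF lin_comb_closed[of xs B]] free_module_closed(1)[OF lin_comb_closed[of ys B]] Cons.prems
    by auto
  ultimately show ?case using Cons by (simp add: x lin_comb_simps a_assoc)
qed

text \<open>Guarantees that every cycle is named by some list and is therefore the image of a basis
  symbol of the resolution.\<close>

lemma lin_comb_exists:
  assumes v: "v \<in> carrier (free_module R B)"
  shows "\<exists>xs. set xs \<subseteq> B \<times> carrier R \<and> lin_comb R xs = v"
proof -
  have "v \<in> {v. \<exists>xs. set xs \<subseteq> B \<times> carrier R \<and> lin_comb R xs = v}"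
  proof (rule free_module_induct[of "carrier R", OF zero_closed v free_module_closed(1)[OF v]])
    show "(\<lambda>_. \<zero>) \<in> {v. \<exists>xs. set xs \<subseteq> B \<times> carrier R \<and> lin_comb R xs = v}"
      by (auto intro!: exI[of _ "[]"] simp: lin_comb_simps)
    fix f g assume "f \<in> {v. \<exists>xs. set xs \<subseteq> B \<times> carrier R \<and> lin_comb R xs = v}"
      "g \<in> {v. \<exists>xs. set xs \<subseteq> B \<times> carrier R \<and> lin_comb R xs = v}"
    then obtain xs ys where "set xs \<subseteq> B \<times> carrier R" "lin_comb R xs = f"
      "set ys \<subseteq> B \<times> carrier R" "lin_comb R ys = g" by auto
    then show "(\<lambda>b. f b \<oplus> g b) \<in> {v. \<exists>xs. set xs \<subseteq> B \<times> carrier R \<and> lin_comb R xs = v}"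
      using lin_comb_append[of xs B ys] by (intro CollectI exI[of _ "xs @ ys"]) simp
  next
    fix i b assume "i \<in> carrier R" "b \<in> B"
    then show "(\<lambda>c. i \<otimes> basis_vec R b c) \<in> {v. \<exists>xs. set xs \<subseteq> B \<times> carrier R \<and> lin_comb R xs = v}"
      by (intro CollectI exI[of _ "[(b, i)]"]) (auto simp: lin_comb_simps basis_vec_def)
  qed
  then show ?thesis by simp
qed

text \<open>The differential is defined with values in the free module on all symbols; the terms of
  the resolution are regarded as submodules of it.\<close>

lemma free_module_submodule:
  assumes "B \<subseteq> C"
  shows "submodule (carrier (free_module R B)) R (free_module R C)"
proof -
  interpret B: Module.module R "free_module R B" by (rule free_module_module)
  interpret C: Module.module R "free_module R C" by (rule free_module_module)
  show ?thesis
  proof (rule C.submoduleI')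
    show "\<zero>\<^bsub>free_module R C\<^esub> \<in> carrier (free_module R B)"
      using B.M.zero_closed by (simp add: free_module_simps(2))
    show "a \<oplus>\<^bsub>free_module R C\<^esub> b \<in> carrier (free_module R B)"
      if "a \<in> carrier (free_module R B)" "b \<in> carrier (free_module R B)" for a b
      using B.M.a_closed[OF that] by (simp add: free_module_simps(3))
    show "a \<odot>\<^bsub>free_module R C\<^esub> b \<in> carrier (free_module R B)"
      if "a \<in> carrier R" "b \<in> carrier (free_module R B)" for a b
      using B.smult_closed[OF that] by (simp add: free_module_simps(4))
  qed (rule free_module_mono[OF assms])
qed

end

context Module.module
begin

lemma res_module_module: "Module.module R (res_module R M n)"
  unfolding res_module_def by (rule R.free_module_module)

lemma res_module_zero: "\<zero>\<^bsub>res_module R M n\<^esub> = (\<lambda>_. \<zero>)"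
  by (simp add: res_module_def free_module_simps)

lemma res_aug_semilinear: "semilinear R id (res_module R M 0) M (res_aug R M)"
  unfolding res_aug_def res_module_def by (rule lin_ext_semilinear) auto

lemma res_aug_Gen: "l \<in> carrier M \<Longrightarrow> res_aug R M (basis_vec R (Gen l)) = l"
  unfolding res_aug_def by (subst lin_ext_basis_vec[of _ "Gen ` carrier M"]) auto

lemma Gen_closed: "l \<in> carrier M \<Longrightarrow> basis_vec R (Gen l) \<in> carrier (res_module R M 0)"
  unfolding res_module_def by (rule R.basis_vec_closed) simp

lemma res_diff_basis:
  assumes "Syz xs \<in> res_basis R M (Suc n)"
  shows "res_diff R (basis_vec R (Syz xs)) = lin_comb R xs" "lin_comb R xs \<in> carrier (res_module R M n)"
proof -
  have xs: "set xs \<subseteq> res_basis R M n \<times> carrier R" using assms by auto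
  show c: "lin_comb R xs \<in> carrier (res_module R M n)" unfolding res_module_def by (rule R.lin_comb_closed[OF xs])
  have U: "Module.module R (free_module R (UNIV :: ('c, 'a) syz set))" by (rule R.free_module_module)
  have "lin_comb R xs \<in> carrier (free_module R UNIV)" using xs by (intro R.lin_comb_closed) auto
  then show "res_diff R (basis_vec R (Syz xs)) = lin_comb R xs"
    unfolding res_diff_def by (subst module.lin_ext_basis_vec[OF U, of _ UNIV]) simp_all
qed

lemma res_diff_semilinear: "semilinear R id (res_module R M (Suc n)) (res_module R M n) (res_diff R)"
proof -
  let ?U = "free_module R (UNIV :: ('c, 'a) syz set)"
  have U: "Module.module R ?U" by (rule R.free_module_module)
  define k where "k g = (case g of Gen (l :: 'c) \<Rightarrow> \<zero>\<^bsub>?U\<^esub> | Syz xs \<Rightarrow> lin_comb R xs)" for g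
  have kc: "k g \<in> carrier ?U" if "g \<in> res_basis R M (Suc n)" for g
    using that by (auto simp: k_def intro!: R.lin_comb_closed)
  have d: "semilinear R id (res_module R M (Suc n)) ?U (res_diff R)"
    unfolding res_module_def res_diff_def k_def[symmetric] by (rule module.lin_ext_semilinear[OF U kc])
  have "submodule {v \<in> carrier (res_module R M (Suc n)). res_diff R v \<in> carrier (res_module R M n)} R (res_module R M (Suc n))"
    by (rule submodule_vimage[OF res_module_module U _ d])
      (auto simp: res_module_def intro!: R.free_module_submodule)
  then have "carrier (res_module R M (Suc n)) \<subseteq> {v \<in> carrier (res_module R M (Suc n)). res_diff R v \<in> carrier (res_module R M n)}"
    unfolding res_module_def[of R M "Suc n"]
  proof (rule R.free_module_span)
    fix b assume b: "b \<in> res_basis R M (Suc n)"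
    then obtain xs where xs: "b = Syz xs" by auto
    show "basis_vec R b \<in> {v \<in> carrier (free_module R (res_basis R M (Suc n))). res_diff R v \<in> carrier (res_module R M n)}"
      using res_diff_basis[of xs n] b R.basis_vec_closed[OF b] by (simp add: xs)
  qed
  then have "res_diff R v \<in> carrier (res_module R M n)" if "v \<in> carrier (res_module R M (Suc n))" for v
    using that by blast
  then show ?thesis
    using semilinearD(2,3)[OF d] unfolding semilinear_def
    by (simp add: Pi_iff res_module_def free_module_simps(3,4) del: res_basis.simps)
qed

lemma res_aug_diff:
  assumes "v \<in> carrier (res_module R M (Suc 0))"
  shows "res_aug R M (res_diff R v) = \<zero>\<^bsub>M\<^esub>"
proof -
  have M: "Module.module R M" by unfold_locales
  have c: "semilinear R id (res_module R M (Suc 0)) M (res_aug R M \<circ> res_diff R)"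
    using semilinear_comp[OF res_diff_semilinear[of 0] res_aug_semilinear] by simp
  have "submodule {v \<in> carrier (res_module R M (Suc 0)). (res_aug R M \<circ> res_diff R) v \<in> {\<zero>\<^bsub>M\<^esub>}} R (res_module R M (Suc 0))"
    by (rule submodule_vimage[OF res_module_module M _ c submodule_zero]) simp
  then have "carrier (res_module R M (Suc 0)) \<subseteq> {v \<in> carrier (res_module R M (Suc 0)). (res_aug R M \<circ> res_diff R) v \<in> {\<zero>\<^bsub>M\<^esub>}}"
    unfolding res_module_def
  proof (rule R.free_module_span)
    fix b assume b: "b \<in> res_basis R M (Suc 0)"
    then obtain xs where xs: "b = Syz xs" "res_aug R M (lin_comb R xs) = \<zero>\<^bsub>M\<^esub>" by auto
    show "basis_vec R b \<in> {v \<in> carrier (free_module R (res_basis R M (Suc 0))). (res_aug R M \<circ> res_diff R) v \<in> {\<zero>\<^bsub>M\<^esub>}}"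
      using res_diff_basis[of xs 0] b R.basis_vec_closed[OF b] xs by (simp del: res_basis.simps)
  qed
  then show ?thesis using assms by auto
qed

lemma res_diff_diff:
  assumes "v \<in> carrier (res_module R M (Suc (Suc n)))"
  shows "res_diff R (res_diff R v) = (\<lambda>_. \<zero>)"
proof -
  let ?F = "res_module R M n"
  interpret F: Module.module R ?F by (rule res_module_module)
  have c: "semilinear R id (res_module R M (Suc (Suc n))) ?F (res_diff R \<circ> res_diff R)"
    using semilinear_comp[OF res_diff_semilinear[of "Suc n"] res_diff_semilinear[of n]] by simp
  have "submodule {v \<in> carrier (res_module R M (Suc (Suc n))). (res_diff R \<circ> res_diff R) v \<in> {\<zero>\<^bsub>?F\<^esub>}} R (res_module R M (Suc (Suc n)))"
    by (rule submodule_vimage[OF res_module_module res_module_module _ c F.submodule_zero]) simp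
  then have "carrier (res_module R M (Suc (Suc n))) \<subseteq> {v \<in> carrier (res_module R M (Suc (Suc n))). (res_diff R \<circ> res_diff R) v \<in> {\<zero>\<^bsub>?F\<^esub>}}"
    unfolding res_module_def
  proof (rule R.free_module_span)
    fix b assume b: "b \<in> res_basis R M (Suc (Suc n))"
    then obtain xs where xs: "b = Syz xs" "res_diff R (lin_comb R xs) = (\<lambda>_. \<zero>)" by (auto simp: free_module_simps)
    show "basis_vec R b \<in> {v \<in> carrier (free_module R (res_basis R M (Suc (Suc n)))).
        (res_diff R \<circ> res_diff R) v \<in> {\<zero>\<^bsub>free_module R (res_basis R M n)\<^esub>}}"
      using res_diff_basis[of xs "Suc n"] b R.basis_vec_closed[OF b] xs by (simp add: free_module_simps(2) del: res_basis.simps)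
  qed
  then have "(res_diff R \<circ> res_diff R) v \<in> {\<zero>\<^bsub>?F\<^esub>}" using assms by blast
  then show ?thesis by (simp add: res_module_zero)
qed

text \<open>Exactness at F_0 is built into the construction: a list \<open>xs\<close> that
  represents the cycle gives the symbol \<open>Syz xs\<close>, which maps to it.\<close>

lemma res_exact:
  assumes v: "v \<in> carrier (res_module R M 0)" "res_aug R M v = \<zero>\<^bsub>M\<^esub>"
  shows "\<exists>p\<in>carrier (res_module R M (Suc 0)). res_diff R p = v"
proof -
  obtain xs where xs: "set xs \<subseteq> res_basis R M 0 \<times> carrier R" "lin_comb R xs = v"
    using R.lin_comb_exists v(1) unfolding res_module_def by metis
  then have b: "Syz xs \<in> res_basis R M (Suc 0)" using v(2) by auto
  show ?thesis
    using res_diff_basis(1)[OF b] xs(2) R.basis_vec_closed[OF b]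
    by (intro bexI[of _ "basis_vec R (Syz xs)"]) (auto simp: res_module_def)
qed

end

section \<open>Consequences of the vanishing of Tor\<close>

context base_change_module
begin

lemma Tor_diff_unit_tensor:
  assumes "u \<in> carrier (res_module Q L (Suc n))"
  shows "Tor_diff Q R \<phi> L (ring_module R) n (unit_tensor Q R \<phi> (res_module Q L (Suc n)) u)
    = unit_tensor Q R \<phi> (res_module Q L n) (res_diff Q u)"
  unfolding Tor_diff_def
  by (rule tensor_map_unit_tensor[OF L.res_module_module L.res_module_module L.res_diff_semilinear assms])

text \<open>The complex F tensor R is F / I F, and each of its elements is represented by some u
  tensor 1. Vanishing homology therefore says that an element with differential in I F_n is a
  boundary up to I F_(n+1).\<close>

lemma Tor_trivial_imp_exact:
  assumes Tor: "carrier (Tor Q R \<phi> L (ring_module R) (Suc n)) = {\<zero>\<^bsub>Tor Q R \<phi> L (ring_module R) (Suc n)\<^esub>}"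
    and u: "u \<in> carrier (res_module Q L (Suc n))"
    and du: "res_diff Q u \<in> kernel_mult Q R \<phi> (res_module Q L n)"
  shows "\<exists>s\<in>carrier (res_module Q L (Suc (Suc n))).
    u \<ominus>\<^bsub>res_module Q L (Suc n)\<^esub> res_diff Q s \<in> kernel_mult Q R \<phi> (res_module Q L (Suc n))"
proof -
  have bc: "base_change_module Q R \<phi> (res_module Q L k)" for k
    by (intro base_change_module.intro base_change_axioms L.res_module_module)
  interpret F0: base_change_module Q R \<phi> "res_module Q L n" by (rule bc)
  interpret F1: base_change_module Q R \<phi> "res_module Q L (Suc n)" by (rule bc)
  interpret F2: base_change_module Q R \<phi> "res_module Q L (Suc (Suc n))" by (rule bc)
  interpret T1: Module.module R F1.T by (rule F1.T_module)
  let ?t1 = "unit_tensor Q R \<phi> (res_module Q L (Suc n))"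
  let ?t2 = "unit_tensor Q R \<phi> (res_module Q L (Suc (Suc n)))"
  define H where "H = Tor_diff Q R \<phi> L (ring_module R) (Suc n) ` carrier (Tor_chain Q R \<phi> L (ring_module R) (Suc (Suc n)))"
  have "res_diff Q u \<in> carrier (res_module Q L n)" using semilinearD(1)[OF L.res_diff_semilinear u] .
  then have "Tor_diff Q R \<phi> L (ring_module R) n (?t1 u) = \<zero>\<^bsub>F0.T\<^esub>"
    using Tor_diff_unit_tensor[OF u] F0.unit_tensor_eq_zero_iff du by simp
  then have cyc: "?t1 u \<in> Tor_cycles Q R \<phi> L (ring_module R) (Suc n)"
    using semilinearD(1)[OF F1.unit_tensor_semilinear u] by (simp add: Tor_cycles_def Tor_chain_def)
  define N where "N = (Tor_chain Q R \<phi> L (ring_module R) (Suc n))\<lparr>carrier := Tor_cycles Q R \<phi> L (ring_module R) (Suc n)\<rparr>"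
  have Tq: "Tor Q R \<phi> L (ring_module R) (Suc n) = quot_module N H" by (simp add: Tor_def N_def H_def)
  have "H +>\<^bsub>N\<^esub> ?t1 u \<in> carrier (quot_module N H)"
    using cyc by (auto simp: quot_module_def A_RCOSETS_def' N_def)
  then have coset: "H +>\<^bsub>N\<^esub> ?t1 u = H" using Tor unfolding Tq by (simp add: quot_module_def)
  have t1c: "?t1 u \<in> carrier F1.T" using semilinearD(1)[OF F1.unit_tensor_semilinear u] .
  have Hdef: "H = (\<lambda>s. ?t1 (res_diff Q s)) ` carrier (res_module Q L (Suc (Suc n)))"
    unfolding H_def Tor_chain_def F2.unit_tensor_surj[symmetric] image_image
    by (intro image_cong refl) (rule Tor_diff_unit_tensor)
  have "\<zero>\<^bsub>F1.T\<^esub> \<in> H"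
  proof -
    have z: "\<zero>\<^bsub>res_module Q L (Suc (Suc n))\<^esub> \<in> carrier (res_module Q L (Suc (Suc n)))" by (rule F2.L.M.zero_closed)
    have "?t1 (res_diff Q \<zero>\<^bsub>res_module Q L (Suc (Suc n))\<^esub>) = \<zero>\<^bsub>F1.T\<^esub>"
      using semilinear_zero[OF L.res_diff_semilinear F2.L.abelian_group_axioms F1.L.abelian_group_axioms]
        semilinear_zero[OF F1.unit_tensor_semilinear F1.L.abelian_group_axioms T1.abelian_group_axioms] by simp
    then show ?thesis unfolding Hdef using z by (metis (no_types, lifting) image_eqI)
  qed
  \<comment> \<open>As \<open>H\<close> contains zero, the coset of the cycle contains the cycle;
    since this coset is \<open>H\<close>, the cycle is a boundary.\<close>
  then have "\<zero>\<^bsub>F1.T\<^esub> \<oplus>\<^bsub>F1.T\<^esub> ?t1 u \<in> H +>\<^bsub>N\<^esub> ?t1 u"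
    by (auto simp: a_r_coset_def' N_def Tor_chain_def)
  then have "?t1 u \<in> H" unfolding coset using t1c by simp
  then obtain s where s: "s \<in> carrier (res_module Q L (Suc (Suc n)))" "?t1 u = ?t1 (res_diff Q s)"
    unfolding Hdef by blast
  have ds: "res_diff Q s \<in> carrier (res_module Q L (Suc n))" using semilinearD(1)[OF L.res_diff_semilinear s(1)] .
  have "?t1 (u \<ominus>\<^bsub>res_module Q L (Suc n)\<^esub> res_diff Q s) = ?t1 u \<ominus>\<^bsub>F1.T\<^esub> ?t1 (res_diff Q s)"
    by (rule semilinear_diff[OF F1.unit_tensor_semilinear F1.L.abelian_group_axioms T1.abelian_group_axioms u ds])
  also have "\<dots> = \<zero>\<^bsub>F1.T\<^esub>" using s(2)[symmetric] t1c by (simp add: T1.M.minus_eq T1.M.r_neg)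
  finally show ?thesis
    using F1.unit_tensor_eq_zero_iff u ds s(1) by (intro bexI[of _ s]) auto
qed

text \<open>The augmentation sends i times the symbol of \<open>l\<close> to i l, so I F_0 covers I
  L. A relation that holds in \<open>L\<close> only modulo I L can thus be corrected to a cycle of
  F_0.\<close>

lemma kernel_mult_subset_aug:
  assumes "l \<in> kernel_mult Q R \<phi> L"
  shows "\<exists>v\<in>kernel_mult Q R \<phi> (res_module Q L 0). res_aug Q L v = l"
proof -
  interpret F0: base_change_module Q R \<phi> "res_module Q L 0"
    by (intro base_change_module.intro base_change_axioms L.res_module_module)
  note K = F0.L.submodule_closed[OF F0.kernel_mult_submodule] and a = semilinearD[OF L.res_aug_semilinear]
  have "submodule (res_aug Q L ` kernel_mult Q R \<phi> (res_module Q L 0)) Q L"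
  proof (rule L.submoduleI')
    show "res_aug Q L ` kernel_mult Q R \<phi> (res_module Q L 0) \<subseteq> carrier L" using K(1) a(1) by auto
    show "\<zero>\<^bsub>L\<^esub> \<in> res_aug Q L ` kernel_mult Q R \<phi> (res_module Q L 0)"
      using K(2) semilinear_zero[OF L.res_aug_semilinear F0.L.abelian_group_axioms L.abelian_group_axioms]
      by (metis image_eqI)
    show "x \<oplus>\<^bsub>L\<^esub> y \<in> res_aug Q L ` kernel_mult Q R \<phi> (res_module Q L 0)"
      if xy: "x \<in> res_aug Q L ` kernel_mult Q R \<phi> (res_module Q L 0)"
        "y \<in> res_aug Q L ` kernel_mult Q R \<phi> (res_module Q L 0)" for x y
    proof -
      obtain v w where vw: "v \<in> kernel_mult Q R \<phi> (res_module Q L 0)" "x = res_aug Q L v"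
        "w \<in> kernel_mult Q R \<phi> (res_module Q L 0)" "y = res_aug Q L w" using xy by blast
      show ?thesis unfolding vw a(2)[OF K(1)[OF vw(1)] K(1)[OF vw(3)], symmetric]
        using K(3)[OF vw(1,3)] by (rule imageI)
    qed
    show "q \<odot>\<^bsub>L\<^esub> x \<in> res_aug Q L ` kernel_mult Q R \<phi> (res_module Q L 0)"
      if qx: "q \<in> carrier Q" "x \<in> res_aug Q L ` kernel_mult Q R \<phi> (res_module Q L 0)" for q x
    proof -
      obtain v where v: "v \<in> kernel_mult Q R \<phi> (res_module Q L 0)" "x = res_aug Q L v" using qx by blast
      show ?thesis unfolding v using a(3)[OF qx(1) K(1)[OF v(1)]] K(4)[OF qx(1) v(1)]
        by (metis id_apply imageI)
    qed
  qed
  moreover have "{i \<odot>\<^bsub>L\<^esub> l | i l. i \<in> carrier Q \<and> \<phi> i = \<zero>\<^bsub>R\<^esub> \<and> l \<in> carrier L}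
    \<subseteq> res_aug Q L ` kernel_mult Q R \<phi> (res_module Q L 0)"
  proof clarify
    fix i l assume i: "i \<in> carrier Q" "\<phi> i = \<zero>\<^bsub>R\<^esub>" and l: "l \<in> carrier L"
    have "res_aug Q L (i \<odot>\<^bsub>res_module Q L 0\<^esub> basis_vec Q (Gen l)) = i \<odot>\<^bsub>L\<^esub> l"
      using a(3)[OF i(1) L.Gen_closed[OF l]] L.res_aug_Gen[OF l] by simp
    then show "i \<odot>\<^bsub>L\<^esub> l \<in> res_aug Q L ` kernel_mult Q R \<phi> (res_module Q L 0)"
      using F0.kernel_multI[OF i L.Gen_closed[OF l]] by (metis image_eqI)
  qed
  ultimately have "kernel_mult Q R \<phi> L \<subseteq> res_aug Q L ` kernel_mult Q R \<phi> (res_module Q L 0)"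
    unfolding kernel_mult_def[of Q R \<phi> L] by (rule L.span_minimal)
  then show ?thesis using assms by blast
qed

text \<open>Lifting the relations of \<open>M\<close> to \<open>L\<close> shows that \<open>z\<^sup>2 - x y\<close>, times a generator of \<open>L\<close>, is a
  boundary modulo \<open>m\<close> times the kernel. Here \<open>(- z, - y, x + z, - x)\<close> is the relation between
  the columns of the presentation matrix that only holds modulo \<open>z\<^sup>2 - x y\<close>; it maps to
  \<open>(z\<^sup>2 - x y, 0)\<close>.\<close>

lemma quadric_in_mult_of_lift:
  fixes eps :: "'r \<Rightarrow> 'k::field" and chi :: "'b \<Rightarrow> 'k" and M :: "('r, 'b, 'p) module_scheme"
  assumes Tor: "carrier (Tor Q R \<phi> L (ring_module R) (Suc 0)) = {\<zero>\<^bsub>Tor Q R \<phi> L (ring_module R) (Suc 0)\<^esub>}"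
    and M: "Module.module R M" and nu: "semilinear Q \<phi> L M nu" "nu ` carrier L = carrier M"
      "\<And>l. l \<in> carrier L \<Longrightarrow> nu l = \<zero>\<^bsub>M\<^esub> \<Longrightarrow> l \<in> kernel_mult Q R \<phi> L"
    and eps: "\<And>a b. a \<in> carrier R \<Longrightarrow> b \<in> carrier R \<Longrightarrow> eps (a \<oplus>\<^bsub>R\<^esub> b) = eps a + eps b"
      "\<And>a b. a \<in> carrier R \<Longrightarrow> b \<in> carrier R \<Longrightarrow> eps (a \<otimes>\<^bsub>R\<^esub> b) = eps a * eps b"
      "\<And>c. \<exists>a\<in>carrier R. eps a = c"
    and chi: "\<And>a b. a \<in> carrier M \<Longrightarrow> b \<in> carrier M \<Longrightarrow> chi (a \<oplus>\<^bsub>M\<^esub> b) = chi a + chi b"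
      "\<And>r a. r \<in> carrier R \<Longrightarrow> a \<in> carrier M \<Longrightarrow> chi (r \<odot>\<^bsub>M\<^esub> a) = eps r * chi a"
    and m: "ideal m Q" "m = {q \<in> carrier Q. eps (\<phi> q) = 0}"
      "\<And>q. q \<in> carrier Q - m \<Longrightarrow> \<exists>d\<in>carrier Q. d \<otimes>\<^bsub>Q\<^esub> q = \<one>\<^bsub>Q\<^esub>"
    and xyz: "x \<in> m" "y \<in> m" "z \<in> m" and f0: "\<phi> (z \<otimes>\<^bsub>Q\<^esub> z \<ominus>\<^bsub>Q\<^esub> x \<otimes>\<^bsub>Q\<^esub> y) = \<zero>\<^bsub>R\<^esub>"
    and m12: "m1 \<in> carrier M" "m2 \<in> carrier M" "chi m1 \<noteq> 0"
    and rel: "\<phi> x \<odot>\<^bsub>M\<^esub> m1 \<oplus>\<^bsub>M\<^esub> \<phi> y \<odot>\<^bsub>M\<^esub> m2 = \<zero>\<^bsub>M\<^esub>" "\<phi> x \<odot>\<^bsub>M\<^esub> m2 = \<zero>\<^bsub>M\<^esub>"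
      "\<phi> z \<odot>\<^bsub>M\<^esub> m1 \<oplus>\<^bsub>M\<^esub> \<phi> y \<odot>\<^bsub>M\<^esub> m2 = \<zero>\<^bsub>M\<^esub>" "\<phi> y \<odot>\<^bsub>M\<^esub> m1 = \<zero>\<^bsub>M\<^esub>"
  shows "z \<otimes>\<^bsub>Q\<^esub> z \<ominus>\<^bsub>Q\<^esub> x \<otimes>\<^bsub>Q\<^esub> y \<in> Idl\<^bsub>Q\<^esub> {a \<otimes>\<^bsub>Q\<^esub> i | a i. a \<in> m \<and> i \<in> {q \<in> carrier Q. \<phi> q = \<zero>\<^bsub>R\<^esub>}}"
proof -
  interpret M: Module.module R M by fact
  let ?F0 = "res_module Q L 0" and ?F1 = "res_module Q L (Suc 0)"
  let ?f = "z \<otimes>\<^bsub>Q\<^esub> z \<ominus>\<^bsub>Q\<^esub> x \<otimes>\<^bsub>Q\<^esub> y"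
  interpret F0: base_change_module Q R \<phi> ?F0 by (intro base_change_module.intro base_change_axioms L.res_module_module)
  interpret F1: base_change_module Q R \<phi> ?F1 by (intro base_change_module.intro base_change_axioms L.res_module_module)
  note mD = Q.ideal_closed[OF m(1)]
  have xyzc: "x \<in> carrier Q" "y \<in> carrier Q" "z \<in> carrier Q" using xyz mD(1) by auto
  define ker where "ker = {q \<in> carrier Q. \<phi> q = \<zero>\<^bsub>R\<^esub>}"
  define gens where "gens = {a \<otimes>\<^bsub>Q\<^esub> i | a i. a \<in> m \<and> i \<in> ker}"
  have gens_c: "gens \<subseteq> carrier Q" using mD(1) by (auto simp: gens_def ker_def)
  define J where "J = Idl\<^bsub>Q\<^esub> gens"
  have J: "ideal J Q" unfolding J_def by (rule Q.genideal_ideal[OF gens_c])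
  note JD = Q.ideal_closed[OF J]
  have JI: "a \<otimes>\<^bsub>Q\<^esub> i \<in> J" if "a \<in> m" "i \<in> ker" for a i
    unfolding J_def using Q.genideal_self[OF gens_c] that by (auto simp: gens_def)
  have aug: "semilinear Q id ?F0 L (res_aug Q L)" by (rule L.res_aug_semilinear)
  have dif: "semilinear Q id ?F1 ?F0 (res_diff Q)" using L.res_diff_semilinear[of 0] by simp
  note augD = semilinearD[OF aug] and difD = semilinearD[OF dif] and nuD = semilinearD[OF nu(1)]

  have "\<exists>q\<in>carrier Q. eps (\<phi> q) = c" for c
    using eps(3)[of c] surj by (metis imageE)
  then have "\<forall>l. \<exists>q. q \<in> carrier Q \<and> eps (\<phi> q) = chi (nu l)" by blast
  then obtain r where r: "\<And>l. r l \<in> carrier Q" "\<And>l. eps (\<phi> (r l)) = chi (nu l)" by metis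
  let ?QM = "ring_module Q"
  have QM: "Module.module Q ?QM" by (rule Q.ring_module_module)
  have QMs: "carrier ?QM = carrier Q" "\<And>a b. a \<oplus>\<^bsub>?QM\<^esub> b = a \<oplus>\<^bsub>Q\<^esub> b" "\<And>a b. a \<odot>\<^bsub>?QM\<^esub> b = a \<otimes>\<^bsub>Q\<^esub> b"
    "\<zero>\<^bsub>?QM\<^esub> = \<zero>\<^bsub>Q\<^esub>" by (simp_all add: ring_module_def)
  define k where "k g = (case g of Gen l \<Rightarrow> r l | Syz (xs :: (('l, 'q) syz \<times> 'q) list) \<Rightarrow> \<zero>\<^bsub>Q\<^esub>)" for g
  have kc: "k g \<in> carrier ?QM" for g by (cases g) (auto simp: k_def QMs r(1))
  define rho where "rho = lin_ext Q ?QM k"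
  have rho: "semilinear Q id ?F0 ?QM rho"
    unfolding rho_def res_module_def by (rule module.lin_ext_semilinear[OF QM kc])
  note rhoD = semilinearD[OF rho, unfolded QMs id_apply]
  have rho_basis: "rho (basis_vec Q (Gen l)) = r l" if "l \<in> carrier L" for l
    unfolding rho_def using module.lin_ext_basis_vec[OF QM, of "Gen l" UNIV k, OF UNIV_I kc] by (simp add: k_def)
  have ker_sub: "submodule I Q ?QM" if I: "ideal I Q" for I
    by (rule module.submoduleI'[OF QM]) (use Q.ideal_closed[OF I] in \<open>auto simp: QMs\<close>)
  have ker_id: "ideal ker Q"
    unfolding ker_def by (rule Q.cring_idealI) (auto simp: phi)
  have rho_ker: "rho v \<in> ker" if "v \<in> kernel_mult Q R \<phi> ?F0" for v
  proof -
    have "submodule {v \<in> carrier ?F0. rho v \<in> ker} Q ?F0"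
      by (rule submodule_vimage[OF L.res_module_module QM _ rho ker_sub[OF ker_id]]) simp
    moreover have "{i \<odot>\<^bsub>?F0\<^esub> v | i v. i \<in> carrier Q \<and> \<phi> i = \<zero>\<^bsub>R\<^esub> \<and> v \<in> carrier ?F0} \<subseteq> {v \<in> carrier ?F0. rho v \<in> ker}"
      using rhoD(1,3) by (auto simp: ker_def phi)
    ultimately show ?thesis using F0.L.span_minimal that unfolding kernel_mult_def by blast
  qed
  have chi0: "chi \<zero>\<^bsub>M\<^esub> = 0" using chi(1)[of "\<zero>\<^bsub>M\<^esub>" "\<zero>\<^bsub>M\<^esub>"] by (metis M.M.r_zero M.M.zero_closed add_cancel_right_right)
  have nu0: "nu \<zero>\<^bsub>L\<^esub> = \<zero>\<^bsub>M\<^esub>" by (rule semilinear_zero[OF nu(1) L.abelian_group_axioms M.abelian_group_axioms])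
  have eps_rho: "eps (\<phi> (rho v)) = chi (nu (res_aug Q L v))" if v: "v \<in> carrier ?F0" for v
  proof -
    let ?H = "{v \<in> carrier ?F0. eps (\<phi> (rho v)) = chi (nu (res_aug Q L v))}"
    have eps0: "eps \<zero>\<^bsub>R\<^esub> = 0" using eps(2)[of "\<zero>\<^bsub>R\<^esub>" "\<zero>\<^bsub>R\<^esub>"] eps(1)[of "\<zero>\<^bsub>R\<^esub>" "\<zero>\<^bsub>R\<^esub>"]
      by (metis R.r_zero R.zero_closed add_cancel_right_right)
    have smul: "q \<odot>\<^bsub>?F0\<^esub> v \<in> ?H" if "q \<in> carrier Q" "v \<in> carrier ?F0" "eps (\<phi> (rho v)) = chi (nu (res_aug Q L v))" for q v
      using that by (simp add: rhoD augD nuD phi eps chi)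
    have v': "v \<in> carrier (free_module Q (res_basis Q L 0))" using v by (simp add: res_module_def)
    have "v \<in> ?H"
    proof (rule Q.free_module_induct[OF Q.zero_closed v' Q.free_module_closed(1)[OF v']])
      have "\<zero>\<^bsub>Q\<^esub> \<odot>\<^bsub>?F0\<^esub> v \<in> ?H"
        using v by (simp add: rhoD augD nuD phi eps chi eps0 chi0 nu0 del: F0.L.smult_l_null)
      then show "(\<lambda>_. \<zero>\<^bsub>Q\<^esub>) \<in> ?H" using v by (simp add: L.res_module_zero)
      fix f g assume "f \<in> ?H" "g \<in> ?H"
      then have "f \<oplus>\<^bsub>?F0\<^esub> g \<in> ?H" by (simp add: rhoD augD nuD phi eps chi)
      then show "(\<lambda>b. f b \<oplus>\<^bsub>Q\<^esub> g b) \<in> ?H" by (simp add: res_module_def free_module_simps(3))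
    next
      fix i b assume i: "i \<in> carrier Q" and "b \<in> res_basis Q L 0"
      then obtain l where l: "l \<in> carrier L" "b = Gen l" by auto
      have "i \<odot>\<^bsub>?F0\<^esub> basis_vec Q b \<in> ?H"
        by (rule smul[OF i]) (simp_all add: l L.Gen_closed L.res_aug_Gen rho_basis r(2))
      then show "(\<lambda>c. i \<otimes>\<^bsub>Q\<^esub> basis_vec Q b c) \<in> ?H" by (simp add: res_module_def free_module_simps(4))
    qed
    then show ?thesis by simp
  qed
  \<comment> \<open>The augmentation kills boundaries, so by \<open>eps_rho\<close> the map
    \<open>rho\<close> sends them into \<open>m\<close>; multiplication by an element of the kernel
    then lands in \<open>J\<close>.\<close>
  have rho_dif: "rho (res_diff Q w) \<in> J" if "w \<in> kernel_mult Q R \<phi> ?F1" for w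
  proof -
    have rd: "semilinear Q id ?F1 ?QM (rho \<circ> res_diff Q)" using semilinear_comp[OF dif rho] by simp
    have "submodule {w \<in> carrier ?F1. (rho \<circ> res_diff Q) w \<in> J} Q ?F1"
      by (rule submodule_vimage[OF L.res_module_module QM _ rd ker_sub[OF J]]) simp
    moreover have "{i \<odot>\<^bsub>?F1\<^esub> w | i w. i \<in> carrier Q \<and> \<phi> i = \<zero>\<^bsub>R\<^esub> \<and> w \<in> carrier ?F1} \<subseteq> {w \<in> carrier ?F1. (rho \<circ> res_diff Q) w \<in> J}"
    proof clarify
      fix i w assume i: "i \<in> carrier Q" "\<phi> i = \<zero>\<^bsub>R\<^esub>" and w: "w \<in> carrier ?F1"
      have dw: "res_diff Q w \<in> carrier ?F0" by (rule difD(1)[OF w])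
      have "eps (\<phi> (rho (res_diff Q w))) = 0" using eps_rho[OF dw] L.res_aug_diff[OF w] nu0 chi0 by simp
      then have "rho (res_diff Q w) \<in> m" using rhoD(1)[OF dw] m(2) by simp
      then have "rho (res_diff Q w) \<otimes>\<^bsub>Q\<^esub> i \<in> J" using JI i by (simp add: ker_def)
      then show "i \<odot>\<^bsub>?F1\<^esub> w \<in> carrier ?F1 \<and> (rho \<circ> res_diff Q) (i \<odot>\<^bsub>?F1\<^esub> w) \<in> J"
        using i w dw rhoD(1)[OF dw] by (simp add: difD rhoD Q.m_comm)
    qed
    ultimately have "kernel_mult Q R \<phi> ?F1 \<subseteq> {w \<in> carrier ?F1. (rho \<circ> res_diff Q) w \<in> J}"
      unfolding kernel_mult_def by (rule F1.L.span_minimal)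
    then show ?thesis using that by auto
  qed

  obtain l1 l2 where l: "l1 \<in> carrier L" "nu l1 = m1" "l2 \<in> carrier L" "nu l2 = m2"
    using nu(2) m12(1,2) by (metis imageE)
  let ?g1 = "basis_vec Q (Gen l1)" and ?g2 = "basis_vec Q (Gen l2)"
  have g: "?g1 \<in> carrier ?F0" "?g2 \<in> carrier ?F0" using l L.Gen_closed by auto
  \<comment> \<open>A relation a m1 + b m2 = 0 in \<open>M\<close> holds in \<open>L\<close> modulo
    I L. After subtracting a correction from I F_0 its lift to F_0 is a cycle, hence a
    boundary.\<close>
  have lift: "\<exists>i\<in>kernel_mult Q R \<phi> ?F0. \<exists>p\<in>carrier ?F1.
      res_diff Q p = a \<odot>\<^bsub>?F0\<^esub> ?g1 \<oplus>\<^bsub>?F0\<^esub> b \<odot>\<^bsub>?F0\<^esub> ?g2 \<ominus>\<^bsub>?F0\<^esub> i"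
    if ab: "a \<in> carrier Q" "b \<in> carrier Q" and e: "\<phi> a \<odot>\<^bsub>M\<^esub> m1 \<oplus>\<^bsub>M\<^esub> \<phi> b \<odot>\<^bsub>M\<^esub> m2 = \<zero>\<^bsub>M\<^esub>" for a b
  proof -
    let ?h = "a \<odot>\<^bsub>L\<^esub> l1 \<oplus>\<^bsub>L\<^esub> b \<odot>\<^bsub>L\<^esub> l2"
    have "nu ?h = \<zero>\<^bsub>M\<^esub>" using ab l e by (simp add: nuD)
    then have "?h \<in> kernel_mult Q R \<phi> L" using ab l by (intro nu(3)) auto
    then obtain i where i: "i \<in> kernel_mult Q R \<phi> ?F0" "res_aug Q L i = ?h" using kernel_mult_subset_aug by blast
    have ic: "i \<in> carrier ?F0" using F0.L.submodule_closed(1)[OF F0.kernel_mult_submodule i(1)] .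
    let ?v = "a \<odot>\<^bsub>?F0\<^esub> ?g1 \<oplus>\<^bsub>?F0\<^esub> b \<odot>\<^bsub>?F0\<^esub> ?g2"
    have vc: "?v \<in> carrier ?F0" using ab g by simp
    have "res_aug Q L ?v = ?h" using ab g l by (simp add: augD L.res_aug_Gen)
    then have "res_aug Q L (?v \<ominus>\<^bsub>?F0\<^esub> i) = \<zero>\<^bsub>L\<^esub>"
      using semilinear_diff[OF aug F0.L.abelian_group_axioms L.abelian_group_axioms vc ic] i(2) ab l
      by (simp add: L.M.minus_eq L.M.r_neg)
    moreover have "?v \<ominus>\<^bsub>?F0\<^esub> i \<in> carrier ?F0" using vc ic by (rule F0.L.M.minus_closed)
    ultimately show ?thesis using L.res_exact i(1) by blast
  qed
  have M0: "\<zero>\<^bsub>R\<^esub> \<odot>\<^bsub>M\<^esub> m1 = \<zero>\<^bsub>M\<^esub>" "\<zero>\<^bsub>R\<^esub> \<odot>\<^bsub>M\<^esub> m2 = \<zero>\<^bsub>M\<^esub>" using m12 by auto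
  have xm: "\<phi> x \<odot>\<^bsub>M\<^esub> m2 \<in> carrier M" "\<phi> y \<odot>\<^bsub>M\<^esub> m1 \<in> carrier M" using xyzc m12 phi(1) by auto
  obtain i1 p1 where ip1: "i1 \<in> kernel_mult Q R \<phi> ?F0" "p1 \<in> carrier ?F1"
    "res_diff Q p1 = x \<odot>\<^bsub>?F0\<^esub> ?g1 \<oplus>\<^bsub>?F0\<^esub> y \<odot>\<^bsub>?F0\<^esub> ?g2 \<ominus>\<^bsub>?F0\<^esub> i1"
    using lift[OF xyzc(1,2) rel(1)] by blast
  obtain i2 p2 where ip2: "i2 \<in> kernel_mult Q R \<phi> ?F0" "p2 \<in> carrier ?F1"
    "res_diff Q p2 = \<zero>\<^bsub>Q\<^esub> \<odot>\<^bsub>?F0\<^esub> ?g1 \<oplus>\<^bsub>?F0\<^esub> x \<odot>\<^bsub>?F0\<^esub> ?g2 \<ominus>\<^bsub>?F0\<^esub> i2"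
    using lift[OF Q.zero_closed xyzc(1)] rel(2) M0 xm by auto
  obtain i3 p3 where ip3: "i3 \<in> kernel_mult Q R \<phi> ?F0" "p3 \<in> carrier ?F1"
    "res_diff Q p3 = z \<odot>\<^bsub>?F0\<^esub> ?g1 \<oplus>\<^bsub>?F0\<^esub> y \<odot>\<^bsub>?F0\<^esub> ?g2 \<ominus>\<^bsub>?F0\<^esub> i3"
    using lift[OF xyzc(3,2) rel(3)] by blast
  obtain i4 p4 where ip4: "i4 \<in> kernel_mult Q R \<phi> ?F0" "p4 \<in> carrier ?F1"
    "res_diff Q p4 = y \<odot>\<^bsub>?F0\<^esub> ?g1 \<oplus>\<^bsub>?F0\<^esub> \<zero>\<^bsub>Q\<^esub> \<odot>\<^bsub>?F0\<^esub> ?g2 \<ominus>\<^bsub>?F0\<^esub> i4"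
    using lift[OF xyzc(2) Q.zero_closed] rel(4) M0 xm by auto
  note ic = ip1(1)[THEN F0.L.submodule_closed(1)[OF F0.kernel_mult_submodule]]
    ip2(1)[THEN F0.L.submodule_closed(1)[OF F0.kernel_mult_submodule]]
    ip3(1)[THEN F0.L.submodule_closed(1)[OF F0.kernel_mult_submodule]]
    ip4(1)[THEN F0.L.submodule_closed(1)[OF F0.kernel_mult_submodule]]
  \<comment> \<open>The four chains are combined with the entries of b, so the differential of
    \<open>u\<close> has A b as its coefficients at \<open>?g1\<close> and \<open>?g2\<close>, apart
    from the corrections collected in \<open>j\<close>.\<close>
  define u where "u = (\<ominus>\<^bsub>Q\<^esub> z) \<odot>\<^bsub>?F1\<^esub> p1 \<oplus>\<^bsub>?F1\<^esub> (\<ominus>\<^bsub>Q\<^esub> y) \<odot>\<^bsub>?F1\<^esub> p2 \<oplus>\<^bsub>?F1\<^esub> (x \<oplus>\<^bsub>Q\<^esub> z) \<odot>\<^bsub>?F1\<^esub> p3 \<oplus>\<^bsub>?F1\<^esub> (\<ominus>\<^bsub>Q\<^esub> x) \<odot>\<^bsub>?F1\<^esub> p4"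
  have u: "u \<in> carrier ?F1" unfolding u_def using ip1(2) ip2(2) ip3(2) ip4(2) xyzc by simp
  define j where "j = z \<odot>\<^bsub>?F0\<^esub> i1 \<oplus>\<^bsub>?F0\<^esub> y \<odot>\<^bsub>?F0\<^esub> i2 \<oplus>\<^bsub>?F0\<^esub> (\<ominus>\<^bsub>Q\<^esub> (x \<oplus>\<^bsub>Q\<^esub> z)) \<odot>\<^bsub>?F0\<^esub> i3 \<oplus>\<^bsub>?F0\<^esub> x \<odot>\<^bsub>?F0\<^esub> i4"
  have fc: "?f \<in> carrier Q" using xyzc by simp
  have jc: "j \<in> carrier ?F0" unfolding j_def using ic xyzc by simp
  have du: "res_diff Q u = ?f \<odot>\<^bsub>?F0\<^esub> ?g1 \<oplus>\<^bsub>?F0\<^esub> j"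
  proof -
    have "res_diff Q u = (\<ominus>\<^bsub>Q\<^esub> z) \<odot>\<^bsub>?F0\<^esub> res_diff Q p1 \<oplus>\<^bsub>?F0\<^esub> (\<ominus>\<^bsub>Q\<^esub> y) \<odot>\<^bsub>?F0\<^esub> res_diff Q p2
      \<oplus>\<^bsub>?F0\<^esub> (x \<oplus>\<^bsub>Q\<^esub> z) \<odot>\<^bsub>?F0\<^esub> res_diff Q p3 \<oplus>\<^bsub>?F0\<^esub> (\<ominus>\<^bsub>Q\<^esub> x) \<odot>\<^bsub>?F0\<^esub> res_diff Q p4"
      unfolding u_def using ip1(2) ip2(2) ip3(2) ip4(2) xyzc by (simp add: difD)
    also have "\<dots> = ?f \<odot>\<^bsub>?F0\<^esub> ?g1 \<oplus>\<^bsub>?F0\<^esub> j"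
    proof
      fix b
      have c: "v b \<in> carrier Q" if "v \<in> carrier ?F0" for v using Q.free_module_closed(1) that by (auto simp: res_module_def)
      have mi: "(v \<ominus>\<^bsub>?F0\<^esub> w) b = v b \<ominus>\<^bsub>Q\<^esub> w b" if "v \<in> carrier ?F0" "w \<in> carrier ?F0" for v w
      proof -
        have "v = (v \<ominus>\<^bsub>?F0\<^esub> w) \<oplus>\<^bsub>?F0\<^esub> w" using that by (simp add: F0.L.M.minus_eq F0.L.M.a_assoc F0.L.M.l_neg)
        then have "v b = (v \<ominus>\<^bsub>?F0\<^esub> w) b \<oplus>\<^bsub>Q\<^esub> w b"
          by (metis (no_types, lifting) free_module_simps(3) res_module_def)
        moreover have "(v \<ominus>\<^bsub>?F0\<^esub> w) b \<in> carrier Q" using c[OF F0.L.M.minus_closed[OF that]] .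
        ultimately show ?thesis using c[OF that(2)] by (simp add: Q.minus_eq Q.a_assoc Q.r_neg)
      qed
      have pt: "(v \<oplus>\<^bsub>?F0\<^esub> w) b = v b \<oplus>\<^bsub>Q\<^esub> w b" "(a \<odot>\<^bsub>?F0\<^esub> v) b = a \<otimes>\<^bsub>Q\<^esub> v b" for v w a
        by (simp_all add: res_module_def free_module_simps(3,4))
      have "((\<ominus>\<^bsub>Q\<^esub> z) \<odot>\<^bsub>?F0\<^esub> res_diff Q p1 \<oplus>\<^bsub>?F0\<^esub> (\<ominus>\<^bsub>Q\<^esub> y) \<odot>\<^bsub>?F0\<^esub> res_diff Q p2
          \<oplus>\<^bsub>?F0\<^esub> (x \<oplus>\<^bsub>Q\<^esub> z) \<odot>\<^bsub>?F0\<^esub> res_diff Q p3 \<oplus>\<^bsub>?F0\<^esub> (\<ominus>\<^bsub>Q\<^esub> x) \<odot>\<^bsub>?F0\<^esub> res_diff Q p4) b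
        = (\<ominus>\<^bsub>Q\<^esub> z) \<otimes>\<^bsub>Q\<^esub> (x \<otimes>\<^bsub>Q\<^esub> ?g1 b \<oplus>\<^bsub>Q\<^esub> y \<otimes>\<^bsub>Q\<^esub> ?g2 b \<ominus>\<^bsub>Q\<^esub> i1 b)
          \<oplus>\<^bsub>Q\<^esub> (\<ominus>\<^bsub>Q\<^esub> y) \<otimes>\<^bsub>Q\<^esub> (\<zero>\<^bsub>Q\<^esub> \<otimes>\<^bsub>Q\<^esub> ?g1 b \<oplus>\<^bsub>Q\<^esub> x \<otimes>\<^bsub>Q\<^esub> ?g2 b \<ominus>\<^bsub>Q\<^esub> i2 b)
          \<oplus>\<^bsub>Q\<^esub> (x \<oplus>\<^bsub>Q\<^esub> z) \<otimes>\<^bsub>Q\<^esub> (z \<otimes>\<^bsub>Q\<^esub> ?g1 b \<oplus>\<^bsub>Q\<^esub> y \<otimes>\<^bsub>Q\<^esub> ?g2 b \<ominus>\<^bsub>Q\<^esub> i3 b)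
          \<oplus>\<^bsub>Q\<^esub> (\<ominus>\<^bsub>Q\<^esub> x) \<otimes>\<^bsub>Q\<^esub> (y \<otimes>\<^bsub>Q\<^esub> ?g1 b \<oplus>\<^bsub>Q\<^esub> \<zero>\<^bsub>Q\<^esub> \<otimes>\<^bsub>Q\<^esub> ?g2 b \<ominus>\<^bsub>Q\<^esub> i4 b)"
        unfolding pt ip1(3) ip2(3) ip3(3) ip4(3) using ic g xyzc by (simp only: mi pt F0.L.smult_closed F0.L.M.a_closed Q.zero_closed)
      \<comment> \<open>The coefficient of \<open>?g1\<close> is - z x + (x + z) z - x y, and that
        of \<open>?g2\<close> is - z y - y x + (x + z) y = 0.\<close>
      also have "\<dots> = ?f \<otimes>\<^bsub>Q\<^esub> ?g1 b \<oplus>\<^bsub>Q\<^esub> (z \<otimes>\<^bsub>Q\<^esub> i1 b \<oplus>\<^bsub>Q\<^esub> y \<otimes>\<^bsub>Q\<^esub> i2 b \<oplus>\<^bsub>Q\<^esub> (\<ominus>\<^bsub>Q\<^esub> (x \<oplus>\<^bsub>Q\<^esub> z)) \<otimes>\<^bsub>Q\<^esub> i3 b \<oplus>\<^bsub>Q\<^esub> x \<otimes>\<^bsub>Q\<^esub> i4 b)"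
        using xyzc c[OF g(1)] c[OF g(2)] c[OF ic(1)] c[OF ic(2)] c[OF ic(3)] c[OF ic(4)] by algebra
      finally show "((\<ominus>\<^bsub>Q\<^esub> z) \<odot>\<^bsub>?F0\<^esub> res_diff Q p1 \<oplus>\<^bsub>?F0\<^esub> (\<ominus>\<^bsub>Q\<^esub> y) \<odot>\<^bsub>?F0\<^esub> res_diff Q p2
          \<oplus>\<^bsub>?F0\<^esub> (x \<oplus>\<^bsub>Q\<^esub> z) \<odot>\<^bsub>?F0\<^esub> res_diff Q p3 \<oplus>\<^bsub>?F0\<^esub> (\<ominus>\<^bsub>Q\<^esub> x) \<odot>\<^bsub>?F0\<^esub> res_diff Q p4) b
        = (?f \<odot>\<^bsub>?F0\<^esub> ?g1 \<oplus>\<^bsub>?F0\<^esub> j) b"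
        by (simp only: j_def pt)
    qed
    finally show ?thesis .
  qed
  note K0 = F0.L.submodule_closed[OF F0.kernel_mult_submodule]
  have "res_diff Q u \<in> kernel_mult Q R \<phi> ?F0"
    unfolding du
  proof (rule K0(3)[OF F0.kernel_multI[OF fc f0 g(1)]])
    show "j \<in> kernel_mult Q R \<phi> ?F0"
      unfolding j_def using ip1(1) ip2(1) ip3(1) ip4(1) xyzc by (intro K0(3) K0(4)) simp_all
  qed
  \<comment> \<open>Subtracting the boundary of \<open>s\<close> moves \<open>u\<close> into I F_1
    without changing its differential, so \<open>rho_dif\<close> applies to the differential of
    \<open>u\<close>.\<close>
  then obtain s where s: "s \<in> carrier (res_module Q L (Suc (Suc 0)))"
    "u \<ominus>\<^bsub>?F1\<^esub> res_diff Q s \<in> kernel_mult Q R \<phi> ?F1"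
    using Tor_trivial_imp_exact[of 0 u] Tor u by auto
  have ds: "res_diff Q s \<in> carrier ?F1" using semilinearD(1)[OF L.res_diff_semilinear s(1)] by simp
  have dds: "res_diff Q (res_diff Q s) = \<zero>\<^bsub>?F0\<^esub>" using L.res_diff_diff[OF s(1)] by (simp add: L.res_module_zero)
  have duc: "res_diff Q u \<in> carrier ?F0" by (rule difD(1)[OF u])
  have "res_diff Q (u \<ominus>\<^bsub>?F1\<^esub> res_diff Q s) = res_diff Q u \<ominus>\<^bsub>?F0\<^esub> res_diff Q (res_diff Q s)"
    by (rule semilinear_diff[OF dif F1.L.abelian_group_axioms F0.L.abelian_group_axioms u ds])
  also have "\<dots> = res_diff Q u"
    unfolding dds using duc F0.L.M.minus_equality[of "\<zero>\<^bsub>?F0\<^esub>" "\<zero>\<^bsub>?F0\<^esub>"] by (simp add: F0.L.M.minus_eq)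
  finally have "rho (res_diff Q u) \<in> J" using rho_dif[OF s(2)] by simp
  moreover have "rho (res_diff Q u) = ?f \<otimes>\<^bsub>Q\<^esub> r l1 \<oplus>\<^bsub>Q\<^esub> rho j"
    unfolding du using fc g jc l by (simp add: rhoD rho_basis)
  \<comment> \<open>The entries of b lie in \<open>m\<close> and \<open>rho\<close> sends I F_0 into
    the kernel of \<open>\<phi>\<close>, so the corrections contribute only elements of
    \<open>J\<close>.\<close>
  moreover have "rho j \<in> J"
  proof -
    have "rho j = z \<otimes>\<^bsub>Q\<^esub> rho i1 \<oplus>\<^bsub>Q\<^esub> y \<otimes>\<^bsub>Q\<^esub> rho i2 \<oplus>\<^bsub>Q\<^esub> (\<ominus>\<^bsub>Q\<^esub> (x \<oplus>\<^bsub>Q\<^esub> z)) \<otimes>\<^bsub>Q\<^esub> rho i3 \<oplus>\<^bsub>Q\<^esub> x \<otimes>\<^bsub>Q\<^esub> rho i4"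
      unfolding j_def using ic xyzc by (simp add: rhoD)
    moreover have "\<ominus>\<^bsub>Q\<^esub> (x \<oplus>\<^bsub>Q\<^esub> z) \<in> m" using mD(3,6) xyz by auto
    ultimately show ?thesis
      using JI rho_ker ip1(1) ip2(1) ip3(1) ip4(1) xyz by (simp add: JD(3))
  qed
  ultimately have frJ: "?f \<otimes>\<^bsub>Q\<^esub> r l1 \<in> J"
    using Q.ideal_add_cancel[OF J, of "?f \<otimes>\<^bsub>Q\<^esub> r l1" "rho j"] fc r(1)[of l1] by simp
  \<comment> \<open>Since \<open>chi m1\<close> is nonzero, the value of \<open>rho\<close> on the
    first generator is a unit and can be divided out.\<close>
  have "eps (\<phi> (r l1)) \<noteq> 0" using r(2)[of l1] l(2) m12(3) by simp
  then have "r l1 \<in> carrier Q - m" using r(1) m(2) by simp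
  then obtain d where d: "d \<in> carrier Q" "d \<otimes>\<^bsub>Q\<^esub> r l1 = \<one>\<^bsub>Q\<^esub>" using m(3) by blast
  have "d \<otimes>\<^bsub>Q\<^esub> (?f \<otimes>\<^bsub>Q\<^esub> r l1) = ?f \<otimes>\<^bsub>Q\<^esub> (d \<otimes>\<^bsub>Q\<^esub> r l1)" using d(1) fc r(1)[of l1] by (rule Q.m_lcomm)
  then have "d \<otimes>\<^bsub>Q\<^esub> (?f \<otimes>\<^bsub>Q\<^esub> r l1) = ?f" using d(2) fc by simp
  then have "?f \<in> J" using JD(4)[OF d(1) frJ] by simp
  then show ?thesis unfolding J_def gens_def ker_def .
qed

end

section \<open>The rings \<open>S\<close> and \<open>R\<close>\<close>

lemma S_ring_cring: "cring (S_ring :: 'k::field fps3 ring)"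
  unfolding S_ring_def by (rule cring_from_type_algebra)

interpretation S: cring "S_ring :: 'k::field fps3 ring"
  by (rule S_ring_cring)

lemma S_ring_simps [simp]:
  "carrier (S_ring :: 'k::field fps3 ring) = UNIV" "\<zero>\<^bsub>S_ring :: 'k fps3 ring\<^esub> = 0" "\<one>\<^bsub>S_ring :: 'k fps3 ring\<^esub> = 1"
  "(a :: 'k fps3) \<oplus>\<^bsub>S_ring\<^esub> b = a + b" "(a :: 'k fps3) \<otimes>\<^bsub>S_ring\<^esub> b = a * b"
  by (simp_all add: S_ring_def)

lemma S_ring_uminus [simp]: "\<ominus>\<^bsub>S_ring\<^esub> (a :: 'k::field fps3) = - a"
  by (rule S.minus_equality) simp_all

lemma S_ring_minus [simp]: "(a :: 'k::field fps3) \<ominus>\<^bsub>S_ring\<^esub> b = a - b"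
  by (simp add: a_minus_def)

lemma S_ring_noetherian: "noetherian_ring (S_ring :: 'k::field fps3 ring)"
  unfolding S_ring_def
  by (intro noetherian_ring_of_type_algebra type_noetherian_fps type_noetherian_field)

section \<open>Residue and linear coefficients of power series\<close>

definition quadric :: "'k::field fps3" where "quadric = var_z ^ 2 - var_x * var_y"

text \<open>Indices refer to powers of z, y and x, from the outside in. The three linear
  coefficients behave like derivations over the residue map \<open>coeff_one\<close>; since the
  quadric has no constant or linear part, all four functions descend to R.\<close>

definition coeff_one :: "'k::field fps3 \<Rightarrow> 'k" where "coeff_one s = fps_nth (fps_nth (fps_nth s 0) 0) 0"
definition coeff_x :: "'k::field fps3 \<Rightarrow> 'k" where "coeff_x s = fps_nth (fps_nth (fps_nth s 0) 0) 1"
definition coeff_y :: "'k::field fps3 \<Rightarrow> 'k" where "coeff_y s = fps_nth (fps_nth (fps_nth s 0) 1) 0"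
definition coeff_z :: "'k::field fps3 \<Rightarrow> 'k" where "coeff_z s = fps_nth (fps_nth (fps_nth s 1) 0) 0"

lemmas coeff_defs = coeff_one_def coeff_x_def coeff_y_def coeff_z_def

lemma coeff_add:
  "coeff_one (s + t) = coeff_one s + coeff_one t" "coeff_x (s + t) = coeff_x s + coeff_x t"
  "coeff_y (s + t) = coeff_y s + coeff_y t" "coeff_z (s + t) = coeff_z s + coeff_z t"
  by (simp_all add: coeff_defs)

lemma coeff_mult:
  "coeff_one (s * t) = coeff_one s * coeff_one t"
  "coeff_x (s * t) = coeff_one s * coeff_x t + coeff_one t * coeff_x s"
  "coeff_y (s * t) = coeff_one s * coeff_y t + coeff_one t * coeff_y s"
  "coeff_z (s * t) = coeff_one s * coeff_z t + coeff_one t * coeff_z s"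
  by (simp_all add: coeff_defs fps_mult_nth_1 mult.commute)

lemma coeff_var:
  "coeff_one var_x = 0" "coeff_one var_y = 0" "coeff_one var_z = 0" "coeff_one 1 = 1" "coeff_one 0 = 0"
  "coeff_x var_x = 1" "coeff_x var_y = 0" "coeff_x var_z = 0"
  "coeff_y var_x = 0" "coeff_y var_y = 1" "coeff_y var_z = 0"
  "coeff_z var_x = 0" "coeff_z var_y = 0" "coeff_z var_z = 1"
  by (simp_all add: coeff_defs var_x_def var_y_def var_z_def)

lemma coeff_diff:
  "coeff_one (s - t) = coeff_one s - coeff_one t" "coeff_x (s - t) = coeff_x s - coeff_x t"
  "coeff_y (s - t) = coeff_y s - coeff_y t" "coeff_z (s - t) = coeff_z s - coeff_z t"
  by (simp_all add: coeff_defs)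

lemma coeff_quadric:
  "coeff_one quadric = 0" "coeff_x quadric = 0" "coeff_y quadric = 0" "coeff_z quadric = 0"
  by (simp_all add: quadric_def power2_eq_square coeff_diff coeff_mult coeff_var)

text \<open>Inverses are lifted layer by layer, from k to k[[x]], to k[[x]][[y]] and to S.\<close>

lemma S_unit:
  assumes "coeff_one (s :: 'k::field fps3) \<noteq> 0"
  shows "\<exists>t. t * s = 1"
proof -
  have "inverse (coeff_one s) * fps_nth (fps_nth (fps_nth s 0) 0) 0 = 1"
    using assms by (simp add: coeff_one_def)
  from fps_left_inverse[OF this] have "\<exists>t. t * fps_nth (fps_nth s 0) 0 = 1" ..
  then obtain t where "t * fps_nth (fps_nth s 0) 0 = 1" ..
  from fps_left_inverse[OF this] have "\<exists>t. t * fps_nth s 0 = 1" ..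
  then obtain t where "t * fps_nth s 0 = 1" ..
  from fps_left_inverse[OF this] show ?thesis ..
qed

lemma fps_eq_const_plus: "(f :: 'a::comm_ring_1 fps) = fps_const (fps_nth f 0) + fps_X * fps_shift 1 f"
proof (rule fps_ext)
  show "fps_nth f n = fps_nth (fps_const (fps_nth f 0) + fps_X * fps_shift 1 f) n" for n
    by (cases n) simp_all
qed

lemma S_decomp_z: "(s :: 'k::field fps3) = fps_const (fps_nth s 0) + var_z * fps_shift 1 s"
  unfolding var_z_def by (rule fps_eq_const_plus)

lemma S_decomp_y: "fps_const (t :: 'k::field fps fps) = fps_const (fps_const (fps_nth t 0)) + var_y * fps_const (fps_shift 1 t)"
  by (subst fps_eq_const_plus[of t]) (simp add: var_y_def)

lemma S_decomp_x: "fps_const (fps_const (u :: 'k::field fps)) =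
    fps_const (fps_const (fps_const (fps_nth u 0))) + var_x * fps_const (fps_const (fps_shift 1 u))"
  by (subst fps_eq_const_plus[of u]) (simp add: var_x_def)

lemma S_decomp:
  assumes "coeff_one (s :: 'k::field fps3) = 0"
  shows "\<exists>a b c. s = var_x * a + var_y * b + var_z * c"
proof -
  have "s = var_x * fps_const (fps_const (fps_shift 1 (fps_nth (fps_nth s 0) 0)))
    + var_y * fps_const (fps_shift 1 (fps_nth s 0)) + var_z * fps_shift 1 s"
    using S_decomp_z[of s] S_decomp_y[of "fps_nth s 0"] S_decomp_x[of "fps_nth (fps_nth s 0) 0"] assms
    by (simp add: coeff_one_def algebra_simps)
  then show ?thesis by blast
qed

lemma R_ideal: "ideal (R_ideal :: 'k::field fps3 set) S_ring"
  unfolding R_ideal_def by (rule S.genideal_ideal) simp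

lemma R_ideal_iff: "(s :: 'k::field fps3) \<in> R_ideal \<longleftrightarrow> (\<exists>a. s = a * quadric)"
proof -
  have "R_ideal = PIdl\<^bsub>S_ring\<^esub> (quadric :: 'k fps3)"
    unfolding R_ideal_def quadric_def by (rule S.cgenideal_eq_genideal[symmetric]) simp
  then show ?thesis by (auto simp: cgenideal_def)
qed

lemma coeff_R_ideal:
  assumes "s \<in> R_ideal"
  shows "coeff_one s = 0" "coeff_x s = 0" "coeff_y s = 0" "coeff_z s = 0"
  using assms by (auto simp: R_ideal_iff coeff_mult coeff_quadric)

lemma base_change_R: "base_change (S_ring :: 'k::field fps3 ring) R_ring R_proj"
proof -
  have eq: "(+>\<^bsub>S_ring\<^esub>) (R_ideal :: 'k fps3 set) = R_proj" by (auto simp: R_proj_def)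
  interpret surj_ring_hom "S_ring :: 'k fps3 ring" R_ring R_proj
    unfolding R_ring_def eq[symmetric] by (rule S.surj_ring_hom_quot[OF R_ideal])
  show ?thesis using surj homh by unfold_locales
qed

interpretation R: base_change "S_ring :: 'k::field fps3 ring" R_ring R_proj
  by (rule base_change_R)

lemma carrier_R: "carrier (R_ring :: 'k::field fps3 set ring) = range R_proj"
  by (simp flip: R.surj)

lemma R_proj_closed [simp]: "R_proj (s :: 'k::field fps3) \<in> carrier R_ring"
  by (simp add: carrier_R)

lemma R_proj_simps:
  "R_proj (s + t) = R_proj s \<oplus>\<^bsub>R_ring\<^esub> R_proj (t :: 'k::field fps3)"
  "R_proj (s * t) = R_proj s \<otimes>\<^bsub>R_ring\<^esub> R_proj (t :: 'k::field fps3)"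
  "R_proj (0 :: 'k::field fps3) = \<zero>\<^bsub>R_ring\<^esub>" "R_proj (1 :: 'k::field fps3) = \<one>\<^bsub>R_ring\<^esub>"
proof -
  have "R_proj (\<zero>\<^bsub>S_ring\<^esub> :: 'k fps3) = \<zero>\<^bsub>R_ring\<^esub>" "R_proj (\<one>\<^bsub>S_ring\<^esub> :: 'k fps3) = \<one>\<^bsub>R_ring\<^esub>"
    by (rule R.phi_zero, rule R.phi(2))
  then show "R_proj (0 :: 'k fps3) = \<zero>\<^bsub>R_ring\<^esub>" "R_proj (1 :: 'k fps3) = \<one>\<^bsub>R_ring\<^esub>" by simp_all
  show "R_proj (s + t) = R_proj s \<oplus>\<^bsub>R_ring\<^esub> R_proj t" "R_proj (s * t) = R_proj s \<otimes>\<^bsub>R_ring\<^esub> R_proj t"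
    using R.phi(3)[of s t] R.phi(4)[of s t] by simp_all
qed

lemma R_proj_diff: "R_proj (s - t) = R_proj s \<ominus>\<^bsub>R_ring\<^esub> R_proj (t :: 'k::field fps3)"
  using R.phi_diff[of s t] by simp

lemma R_proj_zero_iff: "R_proj (s :: 'k::field fps3) = \<zero>\<^bsub>R_ring\<^esub> \<longleftrightarrow> s \<in> R_ideal"
  using S.coset_eq_self_iff[OF R_ideal, of s] by (simp add: R_proj_def R_ring_def FactRing_def)

lemma R_proj_eq_iff: "R_proj (s :: 'k::field fps3) = R_proj t \<longleftrightarrow> s - t \<in> R_ideal"
  using R_proj_zero_iff[of "s - t"] R.R.minus_eq_zero_iff[of "R_proj s" "R_proj t"] by (simp add: R_proj_diff)

text \<open>Evaluates \<open>g\<close> at a chosen representative. For the four coefficient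
  functions the choice is immaterial, because they are additive and vanish on
  \<open>R_ideal\<close>.\<close>

definition on_R :: "('k::field fps3 \<Rightarrow> 'k) \<Rightarrow> 'k fps3 set \<Rightarrow> 'k" where
  "on_R g r = g (base_change.section_of S_ring R_proj r)"

lemma on_R_proj:
  assumes "g \<in> {coeff_one, coeff_x, coeff_y, coeff_z}"
  shows "on_R g (R_proj s) = g (s :: 'k::field fps3)"
proof -
  have "R_proj (R.section_of (R_proj s)) = R_proj s" by (rule R.section_of(2)) simp
  then have "R.section_of (R_proj s) - s \<in> R_ideal" by (simp add: R_proj_eq_iff)
  from coeff_R_ideal[OF this] show ?thesis
    using assms by (auto simp: on_R_def coeff_diff)
qed

lemma on_R_simps:
  "a \<in> carrier R_ring \<Longrightarrow> b \<in> carrier R_ring \<Longrightarrow> g \<in> {coeff_one, coeff_x, coeff_y, coeff_z} \<Longrightarrow>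
    on_R g (a \<oplus>\<^bsub>R_ring\<^esub> b) = on_R g a + on_R g (b :: 'k::field fps3 set)"
  "a \<in> carrier R_ring \<Longrightarrow> b \<in> carrier R_ring \<Longrightarrow>
    on_R coeff_one (a \<otimes>\<^bsub>R_ring\<^esub> b) = on_R coeff_one a * on_R coeff_one (b :: 'k::field fps3 set)"
  "a \<in> carrier R_ring \<Longrightarrow> b \<in> carrier R_ring \<Longrightarrow> g \<in> {coeff_x, coeff_y, coeff_z} \<Longrightarrow>
    on_R g (a \<otimes>\<^bsub>R_ring\<^esub> b) = on_R coeff_one a * on_R g b + on_R coeff_one (b :: 'k::field fps3 set) * on_R g a"
  unfolding carrier_R
  by (auto simp flip: R_proj_simps simp: on_R_proj coeff_add coeff_mult)

lemma on_R_surj: "\<exists>a\<in>carrier R_ring. on_R coeff_one (a :: 'k::field fps3 set) = c"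
  by (rule bexI[of _ "R_proj (fps_const (fps_const (fps_const c)))"]) (simp_all add: on_R_proj coeff_one_def)

text \<open>The coordinates on \<open>Q\<close> are those of R pulled back along
  \<open>\<phi>\<close>, and \<open>m\<close> is the preimage of the maximal ideal of R; no
  structure of \<open>Q\<close> over k is involved.\<close>

lemma quadric_notin_mult_kernel:
  fixes Q :: "'q ring" and \<phi> :: "'q \<Rightarrow> 'k::field fps3 set"
  assumes reg: "regular_local_ring Q" and bc: "base_change Q R_ring \<phi>"
    and m_def: "m = {q \<in> carrier Q. on_R coeff_one (\<phi> q) = 0}"
    and x: "x \<in> carrier Q" "\<phi> x = R_proj var_x" and y: "y \<in> carrier Q" "\<phi> y = R_proj var_y"
    and z: "z \<in> carrier Q" "\<phi> z = R_proj var_z"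
  shows "maximalideal m Q"
    "z \<otimes>\<^bsub>Q\<^esub> z \<ominus>\<^bsub>Q\<^esub> x \<otimes>\<^bsub>Q\<^esub> y \<notin> Idl\<^bsub>Q\<^esub> {a \<otimes>\<^bsub>Q\<^esub> i | a i. a \<in> m \<and> i \<in> {q \<in> carrier Q. \<phi> q = \<zero>\<^bsub>R_ring\<^esub>}}"
proof -
  interpret Q: base_change Q R_ring \<phi> by (rule bc)
  have loc: "noetherian_local_ring Q" using reg by (simp add: regular_local_ring_def)
  then obtain n where n: "maximalideal n Q" by (auto simp: noetherian_local_ring_def)
  note nD = Q.Q.ideal_closed[OF maximalideal.axioms(1)[OF n]]
  have rep: "\<exists>s. \<phi> q = R_proj s" if "q \<in> carrier Q" for q
    using Q.phi(1)[OF that] by (auto simp: carrier_R)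
  have lift: "\<exists>q\<in>carrier Q. \<phi> q = R_proj s" for s
    using Q.surj R_proj_closed[of s] by (metis imageE)
  have one: "coeff_one \<in> {coeff_one, coeff_x, coeff_y, coeff_z :: 'k fps3 \<Rightarrow> 'k}" by simp
  define I where "I = {q \<in> carrier Q. \<phi> q = \<zero>\<^bsub>R_ring\<^esub>}"
  have I: "ideal I Q" unfolding I_def by (rule Q.Q.cring_idealI) (auto simp: Q.phi)
  have zero_on: "on_R g \<zero>\<^bsub>R_ring\<^esub> = 0" if "g \<in> {coeff_one, coeff_x, coeff_y, coeff_z}" for g :: "'k fps3 \<Rightarrow> 'k"
    using on_R_proj[OF that, of 0] coeff_R_ideal[of 0] that by (auto simp: R_proj_simps(3) coeff_defs)
  have m_id: "ideal m Q" unfolding m_def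
    by (rule Q.Q.cring_idealI) (auto simp: Q.phi on_R_simps zero_on)
  have "\<one>\<^bsub>Q\<^esub> \<notin> m" unfolding m_def using on_R_proj[OF one, of 1] by (simp add: Q.phi R_proj_simps(4) coeff_var)
  then have mn: "m \<subseteq> n" by (rule Q.Q.proper_ideal_in_local[OF loc n m_id])
  have Im: "I \<subseteq> m" by (auto simp: I_def m_def zero_on)
  have "n \<subseteq> m"
  proof
    fix a assume a: "a \<in> n"
    then have ac: "a \<in> carrier Q" by (rule nD(1))
    show "a \<in> m"
    proof (rule ccontr)
      assume "a \<notin> m"
      obtain s where s: "\<phi> a = R_proj s" using rep[OF ac] ..
      have "coeff_one s \<noteq> 0" using \<open>a \<notin> m\<close> ac s on_R_proj[OF one, of s] by (simp add: m_def)
      then obtain t where t: "t * s = 1" using S_unit by blast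
      obtain q where q: "q \<in> carrier Q" "\<phi> q = R_proj t" using lift by blast
      \<comment> \<open>The image of \<open>a\<close> is a unit of R, so q a is 1 modulo
        \<open>I\<close>. As \<open>I\<close> lies in \<open>n\<close>, this would put 1 into
        \<open>n\<close>.\<close>
      have "\<phi> (q \<otimes>\<^bsub>Q\<^esub> a) = \<one>\<^bsub>R_ring\<^esub>" using q ac s t by (simp add: Q.phi flip: R_proj_simps)
      then have "\<one>\<^bsub>Q\<^esub> \<ominus>\<^bsub>Q\<^esub> q \<otimes>\<^bsub>Q\<^esub> a \<in> I" using q ac by (simp add: I_def Q.phi_diff Q.phi(2) R.R.minus_eq_zero_iff)
      then have "\<one>\<^bsub>Q\<^esub> \<oplus>\<^bsub>Q\<^esub> \<ominus>\<^bsub>Q\<^esub> (q \<otimes>\<^bsub>Q\<^esub> a) \<in> n" using Im mn by (auto simp: a_minus_def)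
      then have "\<one>\<^bsub>Q\<^esub> \<in> n"
        using Q.Q.ideal_add_cancel[OF maximalideal.axioms(1)[OF n] Q.Q.one_closed] nD(4)[OF q(1) a] nD(6) by blast
      then show False using Q.Q.one_notin_prime[OF Q.Q.maximalideal_prime[OF n]] by simp
    qed
  qed
  then have "m = n" using mn by simp
  then show mx: "maximalideal m Q" using n by simp
  let ?L = "\<lambda>g q. on_R g (\<phi> q)"
  show "z \<otimes>\<^bsub>Q\<^esub> z \<ominus>\<^bsub>Q\<^esub> x \<otimes>\<^bsub>Q\<^esub> y \<notin> Idl\<^bsub>Q\<^esub> {a \<otimes>\<^bsub>Q\<^esub> i | a i. a \<in> m \<and> i \<in> {q \<in> carrier Q. \<phi> q = \<zero>\<^bsub>R_ring\<^esub>}}"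
    unfolding I_def[symmetric]
  proof (rule Q.Q.quadric_notin_mult[OF reg mx m_def, where lx = "?L coeff_x" and ly = "?L coeff_y" and lz = "?L coeff_z"])
    show "?L coeff_one (a \<otimes>\<^bsub>Q\<^esub> b) = ?L coeff_one a * ?L coeff_one b" if "a \<in> carrier Q" "b \<in> carrier Q" for a b
      using that by (simp add: Q.phi on_R_simps(2))
    show "l (a \<oplus>\<^bsub>Q\<^esub> b) = l a + l b"
      if "l \<in> {?L coeff_x, ?L coeff_y, ?L coeff_z}" "a \<in> carrier Q" "b \<in> carrier Q" for l a b
      using that by (auto simp: Q.phi on_R_simps(1))
    show "l (a \<otimes>\<^bsub>Q\<^esub> b) = ?L coeff_one a * l b + ?L coeff_one b * l a"
      if "l \<in> {?L coeff_x, ?L coeff_y, ?L coeff_z}" "a \<in> carrier Q" "b \<in> carrier Q" for l a b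
      using that by (auto simp: Q.phi on_R_simps(3))
    show "x \<in> m" "y \<in> m" "z \<in> m" using x y z by (simp_all add: m_def on_R_proj coeff_var)
    show "ideal I Q" "I \<subseteq> m" by (rule I, rule Im)
    show "l i = 0" if "l \<in> {?L coeff_x, ?L coeff_y, ?L coeff_z}" "i \<in> I" for l i
      using that zero_on by (auto simp: I_def)
    fix a assume a: "a \<in> m"
    then have ac: "a \<in> carrier Q" by (simp add: m_def)
    obtain s where s: "\<phi> a = R_proj s" using rep[OF ac] ..
    have "coeff_one s = 0" using a s on_R_proj[OF one, of s] by (simp add: m_def)
    then obtain u v w where uvw: "s = var_x * u + var_y * v + var_z * w" using S_decomp by blast
    obtain u' v' w' where q: "u' \<in> carrier Q" "\<phi> u' = R_proj u" "v' \<in> carrier Q" "\<phi> v' = R_proj v"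
      "w' \<in> carrier Q" "\<phi> w' = R_proj w" using lift by metis
    let ?b = "u' \<otimes>\<^bsub>Q\<^esub> x \<oplus>\<^bsub>Q\<^esub> v' \<otimes>\<^bsub>Q\<^esub> y \<oplus>\<^bsub>Q\<^esub> w' \<otimes>\<^bsub>Q\<^esub> z"
    have bc: "?b \<in> carrier Q" using q x y z by simp
    have "\<phi> ?b = R_proj s"
      using q x y z unfolding uvw by (simp add: Q.phi mult.commute flip: R_proj_simps)
    then have "a \<ominus>\<^bsub>Q\<^esub> ?b \<in> I" using ac bc s by (simp add: I_def Q.phi_diff R.R.minus_eq_zero_iff)
    moreover have "a = ?b \<oplus>\<^bsub>Q\<^esub> (a \<ominus>\<^bsub>Q\<^esub> ?b)" using ac bc by (simp add: Q.Q.minus_eq Q.Q.a_lcomm Q.Q.r_neg)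
    ultimately show "\<exists>u\<in>carrier Q. \<exists>v\<in>carrier Q. \<exists>w\<in>carrier Q. \<exists>i\<in>I.
        a = u \<otimes>\<^bsub>Q\<^esub> x \<oplus>\<^bsub>Q\<^esub> v \<otimes>\<^bsub>Q\<^esub> y \<oplus>\<^bsub>Q\<^esub> w \<otimes>\<^bsub>Q\<^esub> z \<oplus>\<^bsub>Q\<^esub> i"
      using q by blast
  qed (use x y z in \<open>simp_all add: on_R_proj coeff_var\<close>)
qed

section \<open>The module \<open>M\<close> has no lift\<close>

definition matrix_map ::
    "('a, 'm) ring_scheme \<Rightarrow> nat \<Rightarrow> nat \<Rightarrow> (nat \<Rightarrow> nat \<Rightarrow> 'a) \<Rightarrow> (nat \<Rightarrow> 'a) \<Rightarrow> nat \<Rightarrow> 'a" where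
  "matrix_map R m n A v i = (if i < m then \<Oplus>\<^bsub>R\<^esub> j \<in> {..<n}. A i j \<otimes>\<^bsub>R\<^esub> v j else \<zero>\<^bsub>R\<^esub>)"

lemma matrix_coker_eq:
  "matrix_coker R m n A = quot_module (free_module R {..<m}) (matrix_map R m n A ` carrier (free_module R {..<n}))"
proof -
  have "(\<lambda>v i. if i < m then \<Oplus>\<^bsub>R\<^esub> j \<in> {..<n}. A i j \<otimes>\<^bsub>R\<^esub> v j else \<zero>\<^bsub>R\<^esub>) = matrix_map R m n A"
    by (auto simp: matrix_map_def fun_eq_iff)
  then show ?thesis
    unfolding matrix_coker_def
    by (rule arg_cong[where f = "\<lambda>g. quot_module (free_module R {..<m}) (g ` carrier (free_module R {..<n}))"])
qed

context cring
begin

lemma free_module_lessThanI: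
  assumes "\<And>i. i < m \<Longrightarrow> w i \<in> carrier R" "\<And>i. \<not> i < m \<Longrightarrow> w i = \<zero>"
  shows "w \<in> carrier (free_module R {..<m :: nat})"
proof -
  have "{b. w b \<noteq> \<zero>} \<subseteq> {..<m}" using assms(2) by force
  moreover have "w i \<in> carrier R" for i using assms by (cases "i < m") auto
  ultimately show ?thesis unfolding free_module_simps by (auto intro: finite_subset)
qed

lemma matrix_map_semilinear:
  assumes A: "\<And>i j. i < m \<Longrightarrow> j < n \<Longrightarrow> A i j \<in> carrier R"
  shows "semilinear R id (free_module R {..<n}) (free_module R {..<m}) (matrix_map R m n A)"
  unfolding semilinear_def
proof (intro conjI ballI funcsetI)
  note c = free_module_closed(1)[where B = "{..<n}"]
  show "matrix_map R m n A v \<in> carrier (free_module R {..<m})" if v: "v \<in> carrier (free_module R {..<n})" for v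
    by (rule free_module_lessThanI) (use A c[OF v] in \<open>auto simp: matrix_map_def intro!: finsum_closed\<close>)
  fix v w assume v: "v \<in> carrier (free_module R {..<n})" and w: "w \<in> carrier (free_module R {..<n})"
  have "(\<Oplus>j\<in>{..<n}. A i j \<otimes> (v j \<oplus> w j)) = (\<Oplus>j\<in>{..<n}. A i j \<otimes> v j) \<oplus> (\<Oplus>j\<in>{..<n}. A i j \<otimes> w j)" if i: "i < m" for i
  proof -
    have "(\<Oplus>j\<in>{..<n}. A i j \<otimes> (v j \<oplus> w j)) = (\<Oplus>j\<in>{..<n}. A i j \<otimes> v j \<oplus> A i j \<otimes> w j)"
      using A[OF i] c[OF v] c[OF w] by (intro finsum_cong') (auto simp: r_distr)
    also have "\<dots> = (\<Oplus>j\<in>{..<n}. A i j \<otimes> v j) \<oplus> (\<Oplus>j\<in>{..<n}. A i j \<otimes> w j)"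
      using A[OF i] c[OF v] c[OF w] by (intro finsum_addf) auto
    finally show ?thesis .
  qed
  then show "matrix_map R m n A (v \<oplus>\<^bsub>free_module R {..<n}\<^esub> w)
      = matrix_map R m n A v \<oplus>\<^bsub>free_module R {..<m}\<^esub> matrix_map R m n A w"
    by (auto simp: matrix_map_def free_module_simps fun_eq_iff)
next
  note c = free_module_closed(1)[where B = "{..<n}"]
  fix a v assume a: "a \<in> carrier R" and v: "v \<in> carrier (free_module R {..<n})"
  have "(\<Oplus>j\<in>{..<n}. A i j \<otimes> (a \<otimes> v j)) = a \<otimes> (\<Oplus>j\<in>{..<n}. A i j \<otimes> v j)" if i: "i < m" for i
  proof -
    have "(\<Oplus>j\<in>{..<n}. A i j \<otimes> (a \<otimes> v j)) = (\<Oplus>j\<in>{..<n}. a \<otimes> (A i j \<otimes> v j))"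
      using A[OF i] c[OF v] a by (intro finsum_cong') (auto simp: m_lcomm)
    also have "\<dots> = a \<otimes> (\<Oplus>j\<in>{..<n}. A i j \<otimes> v j)"
      using A[OF i] c[OF v] a by (intro finsum_rdistr[symmetric]) auto
    finally show ?thesis .
  qed
  then show "matrix_map R m n A (a \<odot>\<^bsub>free_module R {..<n}\<^esub> v) = id a \<odot>\<^bsub>free_module R {..<m}\<^esub> matrix_map R m n A v"
    using a by (auto simp: matrix_map_def free_module_simps fun_eq_iff)
qed

lemma matrix_image_submodule:
  assumes "\<And>i j. i < m \<Longrightarrow> j < n \<Longrightarrow> A i j \<in> carrier R"
  shows "submodule (matrix_map R m n A ` carrier (free_module R {..<n})) R (free_module R {..<m})"
  by (rule submodule_image[OF free_module_module free_module_module _ matrix_map_semilinear[OF assms]]) auto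

lemma matrix_map_4:
  assumes "\<And>j. j < 4 \<Longrightarrow> A i j \<in> carrier R" "\<And>j. v j \<in> carrier R" "i < m"
  shows "matrix_map R m 4 A v i = A i 0 \<otimes> v 0 \<oplus> A i 1 \<otimes> v 1 \<oplus> A i 2 \<otimes> v 2 \<oplus> A i 3 \<otimes> v 3"
proof -
  have "{..<4 :: nat} = {0, 1, 2, 3}" by auto
  moreover have "A i 0 \<in> carrier R" "A i 1 \<in> carrier R" "A i 2 \<in> carrier R" "A i 3 \<in> carrier R"
    using assms(1)[of 0] assms(1)[of 1] assms(1)[of 2] assms(1)[of 3] by simp_all
  ultimately show ?thesis using assms(2,3) by (simp add: matrix_map_def a_ac)
qed

end

definition S_matrix :: "nat \<Rightarrow> nat \<Rightarrow> 'k::field fps3" where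
  "S_matrix i j = [[var_x, 0, var_z, var_y], [var_y, var_x, var_y, 0]] ! i ! j"

lemma S_matrix_simps [simp]:
  "S_matrix 0 0 = var_x" "S_matrix 0 1 = 0" "S_matrix 0 2 = var_z" "S_matrix 0 3 = var_y"
  "S_matrix 1 0 = var_y" "S_matrix 1 1 = var_x" "S_matrix 1 2 = var_y" "S_matrix 1 3 = 0"
  by (simp_all add: S_matrix_def numeral_2_eq_2 numeral_3_eq_3)

lemma M_matrix_eq: "M_matrix i j = R_proj (S_matrix i j)"
  by (simp add: M_matrix_def S_matrix_def)

definition R_relations :: "(nat \<Rightarrow> 'k::field fps3 set) set" where
  "R_relations = matrix_map R_ring 2 4 M_matrix ` carrier (free_module R_ring {..<4})"

lemma M_module_eq: "(M_module :: ('k::field fps3 set, _) module) = quot_module (free_module R_ring {..<2}) R_relations"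
  by (simp add: M_module_def matrix_coker_eq R_relations_def)

lemma R_relations_submodule: "submodule (R_relations :: (nat \<Rightarrow> 'k::field fps3 set) set) R_ring (free_module R_ring {..<2})"
  unfolding R_relations_def by (rule R.R.matrix_image_submodule) (simp add: M_matrix_eq)

interpretation RF: Module.module "R_ring :: 'k::field fps3 set ring" "free_module R_ring B :: ('k fps3 set, 'b \<Rightarrow> 'k fps3 set) module"
  for B by (rule R.R.free_module_module)

lemma M_module_module: "Module.module R_ring (M_module :: ('k::field fps3 set, _) module)"
  unfolding M_module_eq by (rule RF.quot_module_module[OF R_relations_submodule])

definition M_class :: "(nat \<Rightarrow> 'k::field fps3 set) \<Rightarrow> (nat \<Rightarrow> 'k fps3 set) set" where
  "M_class w = R_relations +>\<^bsub>free_module R_ring {..<2}\<^esub> w"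

lemma M_class_semilinear: "semilinear R_ring id (free_module R_ring {..<2}) (M_module :: ('k::field fps3 set, _) module) M_class"
  unfolding M_module_eq M_class_def by (rule RF.coset_semilinear[OF R_relations_submodule])

lemma M_class_surj: "carrier (M_module :: ('k::field fps3 set, _) module) = M_class ` carrier (free_module R_ring {..<2})"
  unfolding M_module_eq M_class_def by (rule RF.quot_module_simps(2))

lemma M_class_eq_zero_iff:
  "w \<in> carrier (free_module R_ring {..<2}) \<Longrightarrow> M_class w = \<zero>\<^bsub>M_module\<^esub> \<longleftrightarrow> (w :: nat \<Rightarrow> 'k::field fps3 set) \<in> R_relations"
  unfolding M_module_eq M_class_def RF.quot_module_simps(1)
  by (rule RF.coset_eq_zero_iff[OF R_relations_submodule])

text \<open>\<open>a\<close>, \<open>b\<close>, \<open>c\<close>, \<open>d\<close> are the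
  coefficients of the four columns; the products with the zero entries of the matrix are left
  out.\<close>

lemma R_relationsI:
  fixes w :: "nat \<Rightarrow> 'k::field fps3 set"
  assumes w: "w \<in> carrier (free_module R_ring {..<2})" and abcd: "a \<in> carrier R_ring" "b \<in> carrier R_ring" "c \<in> carrier R_ring" "d \<in> carrier R_ring"
    and "w 0 = R_proj var_x \<otimes>\<^bsub>R_ring\<^esub> a \<oplus>\<^bsub>R_ring\<^esub> R_proj var_z \<otimes>\<^bsub>R_ring\<^esub> c \<oplus>\<^bsub>R_ring\<^esub> R_proj var_y \<otimes>\<^bsub>R_ring\<^esub> d"
    and "w 1 = R_proj var_y \<otimes>\<^bsub>R_ring\<^esub> a \<oplus>\<^bsub>R_ring\<^esub> R_proj var_x \<otimes>\<^bsub>R_ring\<^esub> b \<oplus>\<^bsub>R_ring\<^esub> R_proj var_y \<otimes>\<^bsub>R_ring\<^esub> c"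
  shows "w \<in> R_relations"
proof -
  define v where "v i = (if i = 0 then a else if i = 1 then b else if i = 2 then c else if i = 3 then d else \<zero>\<^bsub>R_ring\<^esub>)" for i :: nat
  have vc: "v i \<in> carrier R_ring" for i using abcd by (simp add: v_def)
  have v: "v \<in> carrier (free_module R_ring {..<4})"
    by (rule R.R.free_module_lessThanI) (use abcd in \<open>auto simp: v_def\<close>)
  have "matrix_map R_ring 2 4 M_matrix v i = w i" for i
  proof -
    consider "i = 0" | "i = 1" | "\<not> i < 2" by linarith
    then show ?thesis
    proof cases
      case 3
      then show ?thesis using R.R.free_module_closed(3)[OF w, of i] by (simp add: matrix_map_def)
    qed (use assms(6,7) abcd in \<open>simp_all add: R.R.matrix_map_4[OF _ vc] M_matrix_eq R_proj_simps(3) v_def R.R.m_closed del: One_nat_def\<close>)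
  qed
  then have "w = matrix_map R_ring 2 4 M_matrix v" by auto
  then show ?thesis unfolding R_relations_def using v by (rule image_eqI)
qed

lemma R_relationsE:
  fixes w :: "nat \<Rightarrow> 'k::field fps3 set"
  assumes "w \<in> R_relations"
  obtains a b c d where "a \<in> carrier R_ring" "b \<in> carrier R_ring" "c \<in> carrier R_ring" "d \<in> carrier R_ring"
    "w 0 = R_proj var_x \<otimes>\<^bsub>R_ring\<^esub> a \<oplus>\<^bsub>R_ring\<^esub> R_proj var_z \<otimes>\<^bsub>R_ring\<^esub> c \<oplus>\<^bsub>R_ring\<^esub> R_proj var_y \<otimes>\<^bsub>R_ring\<^esub> d"
    "w 1 = R_proj var_y \<otimes>\<^bsub>R_ring\<^esub> a \<oplus>\<^bsub>R_ring\<^esub> R_proj var_x \<otimes>\<^bsub>R_ring\<^esub> b \<oplus>\<^bsub>R_ring\<^esub> R_proj var_y \<otimes>\<^bsub>R_ring\<^esub> c"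
proof -
  obtain v where v: "v \<in> carrier (free_module R_ring {..<4})" "w = matrix_map R_ring 2 4 M_matrix v"
    using assms by (auto simp: R_relations_def)
  note vc = R.R.free_module_closed(1)[OF v(1)]
  show ?thesis
    by (rule that[of "v 0" "v 1" "v 2" "v 3"])
      (simp_all add: v(2) R.R.matrix_map_4[OF _ vc] M_matrix_eq R_proj_simps(3) vc R.R.m_closed del: One_nat_def)
qed

lemma coeff_one_R_relations:
  assumes "(w :: nat \<Rightarrow> 'k::field fps3 set) \<in> R_relations"
  shows "on_R coeff_one (w 0) = 0"
  using assms
  by (elim R_relationsE) (simp add: on_R_simps(1,2) on_R_proj coeff_var)

text \<open>The functional M -> k that takes the residue of the first coordinate. It is well defined
  because the first row of the presentation matrix has entries in the maximal ideal, and it plays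
  the role of \<open>chi\<close>.\<close>

definition M_coeff :: "(nat \<Rightarrow> 'k::field fps3 set) set \<Rightarrow> 'k" where
  "M_coeff C = on_R coeff_one ((SOME w. w \<in> carrier (free_module R_ring {..<2}) \<and> M_class w = C) 0)"

lemma M_coeff_class:
  assumes w: "(w :: nat \<Rightarrow> 'k::field fps3 set) \<in> carrier (free_module R_ring {..<2})"
  shows "M_coeff (M_class w) = on_R coeff_one (w 0)"
proof -
  let ?F = "free_module R_ring {..<2} :: ('k fps3 set, nat \<Rightarrow> 'k fps3 set) module"
  define v where "v = (SOME v. v \<in> carrier ?F \<and> M_class v = M_class w)"
  have v: "v \<in> carrier ?F" "M_class v = M_class w"
    using someI[of "\<lambda>v. v \<in> carrier ?F \<and> M_class v = M_class w" w] w unfolding v_def by auto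
  then have d: "v \<ominus>\<^bsub>?F\<^esub> w \<in> R_relations" using w RF.coset_eq_iff[OF R_relations_submodule v(1) w] by (simp add: M_class_def)
  have dc: "v \<ominus>\<^bsub>?F\<^esub> w \<in> carrier ?F" by (rule RF.M.minus_closed[OF v(1) w])
  have "v = (v \<ominus>\<^bsub>?F\<^esub> w) \<oplus>\<^bsub>?F\<^esub> w" using v(1) w by (simp add: RF.M.minus_eq RF.M.a_assoc RF.M.l_neg)
  then have "v 0 = (v \<ominus>\<^bsub>?F\<^esub> w) 0 \<oplus>\<^bsub>R_ring\<^esub> w 0" by (metis free_module_simps(3))
  then have "on_R coeff_one (v 0) = on_R coeff_one (w 0)"
    using coeff_one_R_relations[OF d] R.R.free_module_closed(1)[OF dc, of 0] R.R.free_module_closed(1)[OF w, of 0]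
    by (simp add: on_R_simps(1))
  then show ?thesis by (simp add: M_coeff_def v_def)
qed

lemma M_coeff_simps:
  "a \<in> carrier M_module \<Longrightarrow> b \<in> carrier M_module \<Longrightarrow> M_coeff (a \<oplus>\<^bsub>M_module\<^esub> b) = M_coeff a + M_coeff (b :: (nat \<Rightarrow> 'k::field fps3 set) set)"
  "r \<in> carrier R_ring \<Longrightarrow> a \<in> carrier M_module \<Longrightarrow> M_coeff (r \<odot>\<^bsub>M_module\<^esub> a) = on_R coeff_one r * M_coeff (a :: (nat \<Rightarrow> 'k::field fps3 set) set)"
proof -
  let ?F = "free_module R_ring {..<2} :: ('k fps3 set, nat \<Rightarrow> 'k fps3 set) module"
  note c = R.R.free_module_closed(1)[where B = "{..<2 :: nat}"] and s = semilinearD[OF M_class_semilinear]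
  show "M_coeff (a \<oplus>\<^bsub>M_module\<^esub> b) = M_coeff a + M_coeff b" if ab: "a \<in> carrier M_module" "b \<in> carrier M_module"
  proof -
    obtain v w where vw: "v \<in> carrier ?F" "a = M_class v" "w \<in> carrier ?F" "b = M_class w" using ab unfolding M_class_surj by blast
    have "M_coeff (M_class (v \<oplus>\<^bsub>?F\<^esub> w)) = M_coeff (M_class v) + M_coeff (M_class w)"
      using vw c[OF vw(1), of 0] c[OF vw(3), of 0] RF.M.a_closed[OF vw(1,3)] by (simp add: M_coeff_class free_module_simps(3) on_R_simps(1))
    then show ?thesis using vw by (simp add: s)
  qed
  show "M_coeff (r \<odot>\<^bsub>M_module\<^esub> a) = on_R coeff_one r * M_coeff a" if ra: "r \<in> carrier R_ring" "a \<in> carrier M_module"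
  proof -
    obtain v where v: "v \<in> carrier ?F" "a = M_class v" using ra unfolding M_class_surj by blast
    have "M_coeff (M_class (r \<odot>\<^bsub>?F\<^esub> v)) = on_R coeff_one r * M_coeff (M_class v)"
      using v ra c[OF v(1), of 0] RF.smult_closed[OF ra(1) v(1)] by (simp add: M_coeff_class free_module_simps(4) on_R_simps(2))
    then show ?thesis using v ra s(3)[OF ra(1) v(1)] by simp
  qed
qed

lemma M_relation:
  assumes "a \<in> carrier R_ring" "b \<in> carrier (R_ring :: 'k::field fps3 set ring)"
    and "(\<lambda>i. if i = 0 then a else if i = 1 then b else \<zero>\<^bsub>R_ring\<^esub>) \<in> (R_relations :: (nat \<Rightarrow> 'k fps3 set) set)"
  shows "a \<odot>\<^bsub>M_module\<^esub> M_class (basis_vec R_ring 0) \<oplus>\<^bsub>M_module\<^esub> b \<odot>\<^bsub>M_module\<^esub> M_class (basis_vec R_ring 1) = \<zero>\<^bsub>M_module\<^esub>"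
proof -
  let ?F = "free_module R_ring {..<2} :: ('k fps3 set, nat \<Rightarrow> 'k fps3 set) module"
  have e: "basis_vec R_ring 0 \<in> carrier ?F" "basis_vec R_ring 1 \<in> carrier ?F"
    by (intro R.R.basis_vec_closed; simp)+
  note s = semilinearD[OF M_class_semilinear]
  let ?w = "a \<odot>\<^bsub>?F\<^esub> basis_vec R_ring 0 \<oplus>\<^bsub>?F\<^esub> b \<odot>\<^bsub>?F\<^esub> basis_vec R_ring 1"
  have w: "?w = (\<lambda>i. if i = 0 then a else if i = 1 then b else \<zero>\<^bsub>R_ring\<^esub>)"
    using assms(1,2) by (auto simp: free_module_simps basis_vec_def fun_eq_iff)
  have wc: "?w \<in> carrier ?F" using assms(1,2) e by (intro RF.M.a_closed RF.smult_closed)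
  have "M_class ?w = \<zero>\<^bsub>M_module\<^esub>" using M_class_eq_zero_iff[OF wc] assms(3) unfolding w by simp
  moreover have "M_class ?w = a \<odot>\<^bsub>M_module\<^esub> M_class (basis_vec R_ring 0) \<oplus>\<^bsub>M_module\<^esub> b \<odot>\<^bsub>M_module\<^esub> M_class (basis_vec R_ring 1)"
    using s(2)[OF RF.smult_closed[OF assms(1) e(1)] RF.smult_closed[OF assms(2) e(2)]] s(3)[OF assms(1) e(1)] s(3)[OF assms(2) e(2)]
    by simp
  ultimately show ?thesis by simp
qed

lemma M_relations:
  fixes m1 m2 :: "(nat \<Rightarrow> 'k::field fps3 set) set"
  defines "m1 \<equiv> M_class (basis_vec R_ring 0)" and "m2 \<equiv> M_class (basis_vec R_ring 1)"
  shows "R_proj var_x \<odot>\<^bsub>M_module\<^esub> m1 \<oplus>\<^bsub>M_module\<^esub> R_proj var_y \<odot>\<^bsub>M_module\<^esub> m2 = \<zero>\<^bsub>M_module\<^esub>"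
    "R_proj var_x \<odot>\<^bsub>M_module\<^esub> m2 = \<zero>\<^bsub>M_module\<^esub>"
    "R_proj var_z \<odot>\<^bsub>M_module\<^esub> m1 \<oplus>\<^bsub>M_module\<^esub> R_proj var_y \<odot>\<^bsub>M_module\<^esub> m2 = \<zero>\<^bsub>M_module\<^esub>"
    "R_proj var_y \<odot>\<^bsub>M_module\<^esub> m1 = \<zero>\<^bsub>M_module\<^esub>"
proof -
  interpret M: Module.module "R_ring :: 'k fps3 set ring" M_module by (rule M_module_module)
  have mc: "m1 \<in> carrier M_module" "m2 \<in> carrier M_module"
    unfolding m1_def m2_def M_class_surj by (intro imageI R.R.basis_vec_closed; simp)+
  \<comment> \<open>\<open>r\<close>, \<open>s\<close>, \<open>t\<close>, \<open>u\<close> are the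
    coefficients of the columns; each relation below uses a single column.\<close>
  have rel: "(\<lambda>i. if i = 0 then a else if i = 1 then b else \<zero>\<^bsub>R_ring\<^esub>) \<in> R_relations"
    if "r \<in> carrier R_ring" "s \<in> carrier R_ring" "t \<in> carrier R_ring" "u \<in> carrier R_ring"
      "a = R_proj var_x \<otimes>\<^bsub>R_ring\<^esub> r \<oplus>\<^bsub>R_ring\<^esub> R_proj var_z \<otimes>\<^bsub>R_ring\<^esub> t \<oplus>\<^bsub>R_ring\<^esub> R_proj var_y \<otimes>\<^bsub>R_ring\<^esub> u"
      "b = R_proj var_y \<otimes>\<^bsub>R_ring\<^esub> r \<oplus>\<^bsub>R_ring\<^esub> R_proj var_x \<otimes>\<^bsub>R_ring\<^esub> s \<oplus>\<^bsub>R_ring\<^esub> R_proj var_y \<otimes>\<^bsub>R_ring\<^esub> t"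
    for r s t u a b :: "'k fps3 set"
    by (rule R_relationsI[OF _ that(1-4)]) (use that in \<open>auto intro!: R.R.free_module_lessThanI\<close>)
  note o = R.R.one_closed and z = R.R.zero_closed
  show "R_proj var_x \<odot>\<^bsub>M_module\<^esub> m1 \<oplus>\<^bsub>M_module\<^esub> R_proj var_y \<odot>\<^bsub>M_module\<^esub> m2 = \<zero>\<^bsub>M_module\<^esub>"
    unfolding m1_def m2_def by (rule M_relation) (auto intro!: rel[OF o z z z])
  show "R_proj var_z \<odot>\<^bsub>M_module\<^esub> m1 \<oplus>\<^bsub>M_module\<^esub> R_proj var_y \<odot>\<^bsub>M_module\<^esub> m2 = \<zero>\<^bsub>M_module\<^esub>"
    unfolding m1_def m2_def by (rule M_relation) (auto intro!: rel[OF z z o z])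
  have "\<zero>\<^bsub>R_ring\<^esub> \<odot>\<^bsub>M_module\<^esub> m1 \<oplus>\<^bsub>M_module\<^esub> R_proj var_x \<odot>\<^bsub>M_module\<^esub> m2 = \<zero>\<^bsub>M_module\<^esub>"
    unfolding m1_def m2_def by (rule M_relation) (auto intro!: rel[OF z o z z])
  then show "R_proj var_x \<odot>\<^bsub>M_module\<^esub> m2 = \<zero>\<^bsub>M_module\<^esub>" using mc by simp
  have "R_proj var_y \<odot>\<^bsub>M_module\<^esub> m1 \<oplus>\<^bsub>M_module\<^esub> \<zero>\<^bsub>R_ring\<^esub> \<odot>\<^bsub>M_module\<^esub> m2 = \<zero>\<^bsub>M_module\<^esub>"
    unfolding m1_def m2_def by (rule M_relation) (auto intro!: rel[OF z z z o])
  then show "R_proj var_y \<odot>\<^bsub>M_module\<^esub> m1 = \<zero>\<^bsub>M_module\<^esub>" using mc by simp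
qed

theorem M_module_not_liftable:
  fixes Q :: "'q ring" and \<phi> :: "'q \<Rightarrow> 'k::field fps3 set" and L :: "('q, 'l) module"
  assumes reg: "regular_local_ring Q" and hom: "\<phi> \<in> ring_hom Q R_ring" and surj: "\<phi> ` carrier Q = carrier R_ring"
  shows "\<not> is_lift Q R_ring \<phi> M_module L"
proof
  assume lift: "is_lift Q R_ring \<phi> M_module L"
  have "cring Q" using reg by (simp add: regular_local_ring_def noetherian_local_ring_def)
  then have bc: "base_change Q R_ring \<phi>"
    using hom surj R.R.is_cring by (simp add: base_change_def base_change_axioms_def)
  have L: "Module.module Q L" using lift by (simp add: is_lift_def)
  interpret L: base_change_module Q R_ring \<phi> L by (intro base_change_module.intro bc L)
  interpret M: Module.module "R_ring :: 'k fps3 set ring" M_module by (rule M_module_module)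
  interpret T: Module.module R_ring L.T by (rule L.T_module)
  obtain g where g: "g \<in> module_hom R_ring L.T M_module" "bij_betw g (carrier L.T) (carrier M_module)"
    using lift by (auto simp: is_lift_def module_isomorphic_def)
  have gs: "semilinear R_ring id L.T M_module g" using g(1) by (simp add: module_hom_semilinear)
  \<comment> \<open>The map l -> l tensor 1 followed by the isomorphism onto M. It is onto, and its
    kernel is I L.\<close>
  define nu where "nu = g \<circ> unit_tensor Q R_ring \<phi> L"
  have nu: "semilinear Q \<phi> L M_module nu"
    using semilinear_comp[OF L.unit_tensor_semilinear gs L.phi_closed] by (simp add: nu_def)
  have nu_im: "nu ` carrier L = carrier M_module"
    unfolding nu_def image_comp[symmetric] L.unit_tensor_surj using g(2) by (rule bij_betw_imp_surj_on)
  have nu_ker: "l \<in> kernel_mult Q R_ring \<phi> L" if l: "l \<in> carrier L" "nu l = \<zero>\<^bsub>M_module\<^esub>" for l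
  proof -
    have "g \<zero>\<^bsub>L.T\<^esub> = \<zero>\<^bsub>M_module\<^esub>" by (rule semilinear_zero[OF gs T.abelian_group_axioms M.abelian_group_axioms])
    then have "g (unit_tensor Q R_ring \<phi> L l) = g \<zero>\<^bsub>L.T\<^esub>" using l(2) by (simp add: nu_def)
    then have "unit_tensor Q R_ring \<phi> L l = \<zero>\<^bsub>L.T\<^esub>"
      using inj_onD[OF bij_betw_imp_inj_on[OF g(2)]] semilinearD(1)[OF L.unit_tensor_semilinear l(1)] T.M.zero_closed by blast
    then show ?thesis using L.unit_tensor_eq_zero_iff[OF l(1)] by simp
  qed
  have "\<exists>q\<in>carrier Q. \<phi> q = R_proj s" for s using surj R_proj_closed[of s] by (metis imageE)
  then obtain x y z where x: "x \<in> carrier Q" "\<phi> x = R_proj var_x" and y: "y \<in> carrier Q" "\<phi> y = R_proj var_y"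
    and z: "z \<in> carrier Q" "\<phi> z = R_proj var_z" by metis
  define m where "m = {q \<in> carrier Q. on_R coeff_one (\<phi> q) = 0}"
  note Qf = quadric_notin_mult_kernel[OF reg bc m_def x y z]
  have e: "basis_vec R_ring 0 \<in> carrier (free_module (R_ring :: 'k fps3 set ring) {..<2 :: nat})"
    "basis_vec R_ring 1 \<in> carrier (free_module (R_ring :: 'k fps3 set ring) {..<2 :: nat})"
    by (intro R.R.basis_vec_closed; simp)+
  define m1 :: "(nat \<Rightarrow> 'k fps3 set) set" where "m1 = M_class (basis_vec R_ring 0)"
  define m2 :: "(nat \<Rightarrow> 'k fps3 set) set" where "m2 = M_class (basis_vec R_ring 1)"
  have "z \<otimes>\<^bsub>Q\<^esub> z \<ominus>\<^bsub>Q\<^esub> x \<otimes>\<^bsub>Q\<^esub> y \<in> Idl\<^bsub>Q\<^esub> {a \<otimes>\<^bsub>Q\<^esub> i | a i. a \<in> m \<and> i \<in> {q \<in> carrier Q. \<phi> q = \<zero>\<^bsub>R_ring\<^esub>}}"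
  proof (rule L.quadric_in_mult_of_lift[where eps = "on_R coeff_one" and chi = M_coeff and nu = nu and M = M_module
        and ?m1.0 = m1 and ?m2.0 = m2])
    show "carrier (Tor Q R_ring \<phi> L (ring_module R_ring) (Suc 0)) = {\<zero>\<^bsub>Tor Q R_ring \<phi> L (ring_module R_ring) (Suc 0)\<^esub>}"
      using lift by (simp add: is_lift_def)
    show "ideal m Q" using Qf(1) by (rule maximalideal.axioms)
    show "\<exists>d\<in>carrier Q. d \<otimes>\<^bsub>Q\<^esub> q = \<one>\<^bsub>Q\<^esub>" if "q \<in> carrier Q - m" for q
      using L.Q.local_unit[OF _ Qf(1) that] reg by (metis regular_local_ring_def)
    show "x \<in> m" "y \<in> m" "z \<in> m" using x y z by (simp_all add: m_def on_R_proj coeff_var)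
    have "\<phi> (z \<otimes>\<^bsub>Q\<^esub> z \<ominus>\<^bsub>Q\<^esub> x \<otimes>\<^bsub>Q\<^esub> y) = R_proj quadric"
      using x y z by (simp add: L.phi_diff quadric_def power2_eq_square R_proj_simps R_proj_diff)
    moreover have "(quadric :: 'k fps3) \<in> R_ideal" unfolding R_ideal_iff by (rule exI[of _ 1]) simp
    ultimately show "\<phi> (z \<otimes>\<^bsub>Q\<^esub> z \<ominus>\<^bsub>Q\<^esub> x \<otimes>\<^bsub>Q\<^esub> y) = \<zero>\<^bsub>R_ring\<^esub>"
      by (simp add: R_proj_zero_iff)
    show "m1 \<in> carrier M_module" unfolding M_class_surj m1_def by (rule imageI[OF e(1)])
    show "m2 \<in> carrier M_module" unfolding M_class_surj m2_def by (rule imageI[OF e(2)])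
    have "M_coeff m1 = on_R coeff_one (R_proj 1 :: 'k fps3 set)"
      unfolding m1_def M_coeff_class[OF e(1)] by (simp add: basis_vec_def R_proj_simps(4))
    then show "M_coeff m1 \<noteq> 0" by (simp add: on_R_proj coeff_var)
    show "on_R coeff_one (a \<oplus>\<^bsub>R_ring\<^esub> b) = on_R coeff_one a + on_R coeff_one b"
      if "a \<in> carrier R_ring" "b \<in> carrier R_ring" for a b :: "'k fps3 set"
      using that by (simp add: on_R_simps(1))
  qed ((fact M_module_module nu nu_im nu_ker on_R_simps(2) on_R_surj M_coeff_simps m_def)+,
      unfold x(2) y(2) z(2) m1_def m2_def, (rule M_relations)+)
  then show False using Qf(2) by simp
qed

section \<open>The Serre lift\<close>

text \<open>Both modules are \<open>V\<close> modulo the same kernel. The isomorphism applies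
  \<open>\<beta>\<close> to an arbitrary preimage under \<open>\<alpha>\<close>, and equality of the
  kernels makes the choice immaterial.\<close>

lemma module_isomorphic_of_same_kernel:
  assumes V: "Module.module Q V" and A: "Module.module R A" and B: "Module.module R B"
    and phi: "\<phi> ` carrier Q = carrier R"
    and \<alpha>: "semilinear Q \<phi> V A \<alpha>" "\<alpha> ` carrier V = carrier A" and \<beta>: "semilinear Q \<phi> V B \<beta>" "\<beta> ` carrier V = carrier B"
    and ker: "\<And>v. v \<in> carrier V \<Longrightarrow> \<alpha> v = \<zero>\<^bsub>A\<^esub> \<longleftrightarrow> \<beta> v = \<zero>\<^bsub>B\<^esub>"
  shows "module_isomorphic R A B"
proof -
  interpret V: Module.module Q V by fact
  interpret A: Module.module R A by fact
  interpret B: Module.module R B by fact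
  note a = semilinearD[OF \<alpha>(1)] and b = semilinearD[OF \<beta>(1)]
  have eq: "\<alpha> v = \<alpha> w \<longleftrightarrow> \<beta> v = \<beta> w" if "v \<in> carrier V" "w \<in> carrier V" for v w
    using ker[OF V.M.minus_closed[OF that]] a(1)[OF that(1)] a(1)[OF that(2)] b(1)[OF that(1)] b(1)[OF that(2)]
      semilinear_diff[OF \<alpha>(1) V.abelian_group_axioms A.abelian_group_axioms that]
      semilinear_diff[OF \<beta>(1) V.abelian_group_axioms B.abelian_group_axioms that]
    by (simp add: A.M.minus_eq_zero_iff B.M.minus_eq_zero_iff)
  define f where "f c = \<beta> (SOME v. v \<in> carrier V \<and> \<alpha> v = c)" for c
  have f: "f (\<alpha> v) = \<beta> v" if v: "v \<in> carrier V" for v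
  proof -
    define w where "w = (SOME w. w \<in> carrier V \<and> \<alpha> w = \<alpha> v)"
    have "w \<in> carrier V \<and> \<alpha> w = \<alpha> v" unfolding w_def by (rule someI[of _ v]) (simp add: v)
    then show ?thesis using eq[of w v] v by (simp add: f_def w_def)
  qed
  have all: "(\<forall>c\<in>carrier A. P c) \<longleftrightarrow> (\<forall>v\<in>carrier V. P (\<alpha> v))" for P unfolding \<alpha>(2)[symmetric] by blast
  have allR: "(\<forall>r\<in>carrier R. P r) \<longleftrightarrow> (\<forall>q\<in>carrier Q. P (\<phi> q))" for P unfolding phi[symmetric] by blast
  have "\<forall>c\<in>carrier A. f c \<in> carrier B" unfolding all by (simp add: f b(1))
  moreover have "\<forall>c\<in>carrier A. \<forall>d\<in>carrier A. f (c \<oplus>\<^bsub>A\<^esub> d) = f c \<oplus>\<^bsub>B\<^esub> f d"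
    unfolding all by (simp add: f b(2) flip: a(2))
  moreover have "\<forall>r\<in>carrier R. \<forall>c\<in>carrier A. f (r \<odot>\<^bsub>A\<^esub> c) = r \<odot>\<^bsub>B\<^esub> f c"
    unfolding all allR by (simp add: f b(3) flip: a(3))
  ultimately have "f \<in> module_hom R A B" by (simp add: module_hom_def)
  moreover have "bij_betw f (carrier A) (carrier B)"
  proof -
    have "\<forall>c\<in>carrier A. \<forall>d\<in>carrier A. f c = f d \<longrightarrow> c = d" unfolding all by (simp add: f eq)
    then have "inj_on f (carrier A)" by (simp add: inj_on_def)
    moreover have "f ` carrier A = carrier B"
      unfolding \<alpha>(2)[symmetric] \<beta>(2)[symmetric] image_image by (rule image_cong) (simp_all add: f)
    ultimately show ?thesis by (simp add: bij_betw_def)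
  qed
  ultimately show ?thesis by (auto simp: module_isomorphic_def)
qed

lemma (in Module.module) annihilator_ideal: "ideal (annihilator R M) R"
  by (rule R.cring_idealI) (auto simp: annihilator_def smult_l_distr smult_assoc1)

text \<open>The elements killed by \<open>a\<close> form a submodule, so it suffices to test
  generators.\<close>

lemma annihilatorI:
  assumes M: "Module.module R M" and p: "semilinear R id (free_module R B) M p" "p ` carrier (free_module R B) = carrier M"
    and a: "a \<in> carrier R" and z: "\<And>b. b \<in> B \<Longrightarrow> a \<odot>\<^bsub>M\<^esub> p (basis_vec R b) = \<zero>\<^bsub>M\<^esub>"
  shows "a \<in> annihilator R M"
proof -
  interpret M: Module.module R M by fact
  have "submodule {x \<in> carrier M. a \<odot>\<^bsub>M\<^esub> x = \<zero>\<^bsub>M\<^esub>} R M"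
  proof (rule M.submoduleI')
    show "r \<odot>\<^bsub>M\<^esub> x \<in> {x \<in> carrier M. a \<odot>\<^bsub>M\<^esub> x = \<zero>\<^bsub>M\<^esub>}"
      if "r \<in> carrier R" "x \<in> {x \<in> carrier M. a \<odot>\<^bsub>M\<^esub> x = \<zero>\<^bsub>M\<^esub>}" for r x
    proof -
      have "a \<odot>\<^bsub>M\<^esub> (r \<odot>\<^bsub>M\<^esub> x) = r \<odot>\<^bsub>M\<^esub> (a \<odot>\<^bsub>M\<^esub> x)"
        using that a by (metis (lifting) M.R.m_comm M.smult_assoc1 mem_Collect_eq)
      then show ?thesis using that by simp
    qed
  qed (use a in \<open>auto simp: M.smult_r_distr\<close>)
  from submodule_vimage[OF M.R.free_module_module M _ p(1) this]
  have "submodule {v \<in> carrier (free_module R B). p v \<in> {x \<in> carrier M. a \<odot>\<^bsub>M\<^esub> x = \<zero>\<^bsub>M\<^esub>}} R (free_module R B)" by simp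
  then have "carrier (free_module R B) \<subseteq> {v \<in> carrier (free_module R B). p v \<in> {x \<in> carrier M. a \<odot>\<^bsub>M\<^esub> x = \<zero>\<^bsub>M\<^esub>}}"
    by (rule M.R.free_module_span) (simp add: M.R.basis_vec_closed semilinearD(1)[OF p(1)] z)
  then show ?thesis unfolding annihilator_def p(2)[symmetric] using a by auto
qed

interpretation SF: Module.module "S_ring :: 'k::field fps3 ring" "free_module S_ring B :: ('k fps3, 'b \<Rightarrow> 'k fps3) module"
  for B by (rule S.free_module_module)

definition S_relations :: "(nat \<Rightarrow> 'k::field fps3) set" where
  "S_relations = matrix_map S_ring 2 4 S_matrix ` carrier (free_module S_ring {..<4})"

definition L_module :: "('k::field fps3, (nat \<Rightarrow> 'k fps3) set) module" where
  "L_module = quot_module (free_module S_ring {..<2}) S_relations"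

definition L_class :: "(nat \<Rightarrow> 'k::field fps3) \<Rightarrow> (nat \<Rightarrow> 'k fps3) set" where
  "L_class w = S_relations +>\<^bsub>free_module S_ring {..<2}\<^esub> w"

lemma S_relations_submodule: "submodule (S_relations :: (nat \<Rightarrow> 'k::field fps3) set) S_ring (free_module S_ring {..<2})"
  unfolding S_relations_def by (rule S.matrix_image_submodule) simp

lemma L_module_module: "Module.module S_ring (L_module :: ('k::field fps3, _) module)"
  unfolding L_module_def by (rule SF.quot_module_module[OF S_relations_submodule])

lemma L_class_semilinear: "semilinear S_ring id (free_module S_ring {..<2}) (L_module :: ('k::field fps3, _) module) L_class"
  unfolding L_module_def L_class_def by (rule SF.coset_semilinear[OF S_relations_submodule])

lemma L_class_surj: "L_class ` carrier (free_module S_ring {..<2}) = carrier (L_module :: ('k::field fps3, _) module)"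
  unfolding L_module_def L_class_def by (rule SF.quot_module_simps(2)[symmetric])

lemma L_class_eq_zero_iff:
  "w \<in> carrier (free_module S_ring {..<2}) \<Longrightarrow> L_class w = \<zero>\<^bsub>L_module\<^esub> \<longleftrightarrow> (w :: nat \<Rightarrow> 'k::field fps3) \<in> S_relations"
  unfolding L_module_def L_class_def SF.quot_module_simps(1)
  by (rule SF.coset_eq_zero_iff[OF S_relations_submodule])

lemma S_relationsI:
  fixes w :: "nat \<Rightarrow> 'k::field fps3"
  assumes w: "w \<in> carrier (free_module S_ring {..<2})"
    and "w 0 = var_x * a + var_z * c + var_y * d" "w 1 = var_y * a + var_x * b + var_y * c"
  shows "w \<in> S_relations"
proof -
  define v where "v i = (if i = 0 then a else if i = 1 then b else if i = 2 then c else if i = 3 then d else 0)" for i :: nat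
  have v: "v \<in> carrier (free_module S_ring {..<4})" by (rule S.free_module_lessThanI) (auto simp: v_def)
  have "matrix_map S_ring 2 4 S_matrix v i = w i" for i
  proof -
    consider "i = 0" | "i = 1" | "\<not> i < 2" by linarith
    then show ?thesis
    proof cases
      case 3
      then show ?thesis using S.free_module_closed(3)[OF w, of i] by (simp add: matrix_map_def)
    qed (simp_all add: S.matrix_map_4 v_def assms(2,3) del: One_nat_def)
  qed
  then have "w = matrix_map S_ring 2 4 S_matrix v" by auto
  then show ?thesis unfolding S_relations_def using v by (rule image_eqI)
qed

lemma S_relationsE:
  fixes w :: "nat \<Rightarrow> 'k::field fps3"
  assumes "w \<in> S_relations"
  obtains a b c d where "w 0 = var_x * a + var_z * c + var_y * d" "w 1 = var_y * a + var_x * b + var_y * c"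
proof -
  obtain v where v: "w = matrix_map S_ring 2 4 S_matrix v" using assms by (auto simp: S_relations_def)
  show ?thesis
    \<comment> \<open>The coefficients are listed in the order a, c, d, b in which they occur in the
      two equations; hence \<open>v 1\<close> comes last.\<close>
    by (rule that[of "v 0" "v 2" "v 3" "v 1"]) (simp_all add: v S.matrix_map_4 del: One_nat_def)
qed

section \<open>The base change of L is M\<close>

definition proj_vec :: "(nat \<Rightarrow> 'k::field fps3) \<Rightarrow> nat \<Rightarrow> 'k fps3 set" where
  "proj_vec s i = R_proj (s i)"

lemma proj_vec_semilinear:
  "semilinear S_ring R_proj (free_module S_ring {..<2}) (free_module R_ring {..<2}) (proj_vec :: (nat \<Rightarrow> 'k::field fps3) \<Rightarrow> _)"
  unfolding semilinear_def
proof (intro conjI ballI funcsetI)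
  show "proj_vec s \<in> carrier (free_module R_ring {..<2})" if "s \<in> carrier (free_module S_ring {..<2})" for s :: "nat \<Rightarrow> 'k fps3"
    by (rule R.R.free_module_lessThanI) (use S.free_module_closed(3)[OF that] in \<open>simp_all add: proj_vec_def R_proj_simps\<close>)
qed (simp_all add: proj_vec_def free_module_simps(3,4) R_proj_simps fun_eq_iff)

lemma proj_vec_surj:
  "proj_vec ` carrier (free_module S_ring {..<2}) = carrier (free_module (R_ring :: 'k::field fps3 set ring) {..<2})"
proof
  show "proj_vec ` carrier (free_module S_ring {..<2}) \<subseteq> carrier (free_module (R_ring :: 'k fps3 set ring) {..<2})"
    using semilinearD(1)[OF proj_vec_semilinear] by (rule image_subsetI)
  show "carrier (free_module R_ring {..<2}) \<subseteq> proj_vec ` carrier (free_module (S_ring :: 'k fps3 ring) {..<2})"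
  proof
    fix w assume w: "w \<in> carrier (free_module (R_ring :: 'k fps3 set ring) {..<2 :: nat})"
    define s where "s i = (if i < 2 then R.section_of (w i) else 0)" for i
    have "proj_vec s i = w i" for i
      using R.section_of(2)[OF R.R.free_module_closed(1)[OF w, of i]] R.R.free_module_closed(3)[OF w, of i]
      by (simp add: proj_vec_def s_def R_proj_simps(3))
    then have "w = proj_vec s" by auto
    moreover have "s \<in> carrier (free_module S_ring {..<2})" by (rule S.free_module_lessThanI) (simp_all add: s_def)
    ultimately show "w \<in> proj_vec ` carrier (free_module S_ring {..<2})" by (rule image_eqI)
  qed
qed

lemma proj_vec_S_relations:
  assumes "(s :: nat \<Rightarrow> 'k::field fps3) \<in> S_relations"
  shows "proj_vec s \<in> R_relations"
proof -
  have sc: "s \<in> carrier (free_module S_ring {..<2})" by (rule SF.submodule_closed(1)[OF S_relations_submodule assms])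
  obtain a b c d where *: "s 0 = var_x * a + var_z * c + var_y * d" "s 1 = var_y * a + var_x * b + var_y * c"
    using assms by (rule S_relationsE)
  show ?thesis
    by (rule R_relationsI[of _ "R_proj a" "R_proj b" "R_proj c" "R_proj d"])
      (use semilinearD(1)[OF proj_vec_semilinear sc] * in \<open>simp_all add: proj_vec_def R_proj_simps\<close>)
qed

interpretation LB: base_change_module "S_ring :: 'k::field fps3 ring" R_ring R_proj L_module
  by (intro base_change_module.intro base_change_R L_module_module)

text \<open>Both sides say that \<open>s\<close> is a relation over S up to a vector with entries in
  \<open>R_ideal\<close>: lifting the coefficients of a relation over R to S changes it only by such
  a vector.\<close>

lemma kernel_mult_L_class:
  assumes s: "(s :: nat \<Rightarrow> 'k::field fps3) \<in> carrier (free_module S_ring {..<2})"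
  shows "L_class s \<in> kernel_mult S_ring R_ring R_proj L_module \<longleftrightarrow> proj_vec s \<in> R_relations"
proof
  let ?F = "free_module S_ring {..<2} :: ('k fps3, nat \<Rightarrow> 'k fps3) module"
  note lc = semilinearD[OF L_class_semilinear] and pc = semilinearD[OF proj_vec_semilinear]
  note K = LB.L.submodule_closed[OF LB.kernel_mult_submodule] and RD = RF.submodule_closed[OF R_relations_submodule]
  {
    assume "proj_vec s \<in> R_relations"
    then obtain a b c d where abcd: "a \<in> carrier R_ring" "b \<in> carrier R_ring" "c \<in> carrier R_ring" "d \<in> carrier R_ring"
      and e: "proj_vec s 0 = R_proj var_x \<otimes>\<^bsub>R_ring\<^esub> a \<oplus>\<^bsub>R_ring\<^esub> R_proj var_z \<otimes>\<^bsub>R_ring\<^esub> c \<oplus>\<^bsub>R_ring\<^esub> R_proj var_y \<otimes>\<^bsub>R_ring\<^esub> d"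
        "proj_vec s 1 = R_proj var_y \<otimes>\<^bsub>R_ring\<^esub> a \<oplus>\<^bsub>R_ring\<^esub> R_proj var_x \<otimes>\<^bsub>R_ring\<^esub> b \<oplus>\<^bsub>R_ring\<^esub> R_proj var_y \<otimes>\<^bsub>R_ring\<^esub> c"
      by (rule R_relationsE)
    obtain a' b' c' d' where r: "a = R_proj a'" "b = R_proj b'" "c = R_proj c'" "d = R_proj d'"
      using abcd unfolding carrier_R by blast
    \<comment> \<open>The relation over S with lifted coefficients. It agrees with \<open>s\<close>
      modulo \<open>R_ideal\<close>, and \<open>i0\<close>, \<open>i1\<close> are the differences of
      the entries.\<close>
    define v where "v i = (if i = 0 then var_x * a' + var_z * c' + var_y * d' else if i = 1 then var_y * a' + var_x * b' + var_y * c' else 0)" for i :: nat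
    have v: "v \<in> carrier ?F" by (rule S.free_module_lessThanI) (auto simp: v_def)
    have vr: "v \<in> S_relations" by (rule S_relationsI[OF v, of a' c' d' b']) (simp_all add: v_def)
    define i0 i1 where "i0 = s 0 - v 0" and "i1 = s 1 - v 1"
    have i: "R_proj i0 = \<zero>\<^bsub>R_ring\<^esub>" "R_proj i1 = \<zero>\<^bsub>R_ring\<^esub>"
      using e unfolding i0_def i1_def R_proj_zero_iff R_proj_eq_iff[symmetric] proj_vec_def r v_def by (simp_all add: R_proj_simps)
    let ?b0 = "basis_vec S_ring 0 :: nat \<Rightarrow> 'k fps3" and ?b1 = "basis_vec S_ring 1 :: nat \<Rightarrow> 'k fps3"
    have b: "?b0 \<in> carrier ?F" "?b1 \<in> carrier ?F" by (intro S.basis_vec_closed; simp)+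
    have ic: "i0 \<in> carrier S_ring" "i1 \<in> carrier S_ring" by simp_all
    have "s = v \<oplus>\<^bsub>?F\<^esub> (i0 \<odot>\<^bsub>?F\<^esub> ?b0 \<oplus>\<^bsub>?F\<^esub> i1 \<odot>\<^bsub>?F\<^esub> ?b1)"
    proof
      fix n :: nat
      consider "n = 0" | "n = 1" | "\<not> n < 2" by linarith
      then show "s n = (v \<oplus>\<^bsub>?F\<^esub> (i0 \<odot>\<^bsub>?F\<^esub> ?b0 \<oplus>\<^bsub>?F\<^esub> i1 \<odot>\<^bsub>?F\<^esub> ?b1)) n"
        using S.free_module_closed(3)[OF s, of n]
        by cases (auto simp: free_module_simps(3,4) basis_vec_def v_def i0_def i1_def)
    qed
    moreover have "L_class (v \<oplus>\<^bsub>?F\<^esub> (i0 \<odot>\<^bsub>?F\<^esub> ?b0 \<oplus>\<^bsub>?F\<^esub> i1 \<odot>\<^bsub>?F\<^esub> ?b1))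
      = L_class v \<oplus>\<^bsub>L_module\<^esub> (i0 \<odot>\<^bsub>L_module\<^esub> L_class ?b0 \<oplus>\<^bsub>L_module\<^esub> i1 \<odot>\<^bsub>L_module\<^esub> L_class ?b1)"
      using lc(2)[OF v SF.M.a_closed[OF SF.smult_closed[OF ic(1) b(1)] SF.smult_closed[OF ic(2) b(2)]]]
        lc(2)[OF SF.smult_closed[OF ic(1) b(1)] SF.smult_closed[OF ic(2) b(2)]] lc(3)[OF ic(1) b(1)] lc(3)[OF ic(2) b(2)]
      by simp
    moreover have "L_class v = \<zero>\<^bsub>L_module\<^esub>" using L_class_eq_zero_iff[OF v] vr by simp
    ultimately show "L_class s \<in> kernel_mult S_ring R_ring R_proj L_module"
      using K(3)[OF K(2) K(3)[OF LB.kernel_multI[OF ic(1) i(1) lc(1)[OF b(1)]] LB.kernel_multI[OF ic(2) i(2) lc(1)[OF b(2)]]]]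
      by simp
  next
    \<comment> \<open>For the converse, the image in L of the vectors that become relations over R
      is a submodule, and it contains all products of an element of the ideal with an element of L.
      Hence \<open>s\<close> differs from a member of \<open>V\<close> by a relation over S.\<close>
    define V where "V = {w \<in> carrier ?F. proj_vec w \<in> R_relations}"
    have V: "submodule V S_ring ?F"
      unfolding V_def by (rule submodule_vimage[OF S.free_module_module R.R.free_module_module _ proj_vec_semilinear R_relations_submodule]) simp
    note VD = SF.submodule_closed[OF V]
    have "submodule (L_class ` V) S_ring L_module"
    proof (rule LB.L.submoduleI')
      show "L_class ` V \<subseteq> carrier L_module" using VD(1) lc(1) by blast
      have "L_class \<zero>\<^bsub>?F\<^esub> = \<zero>\<^bsub>L_module\<^esub>"
        by (rule semilinear_zero[OF L_class_semilinear SF.abelian_group_axioms LB.L.abelian_group_axioms])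
      then show "\<zero>\<^bsub>L_module\<^esub> \<in> L_class ` V" using VD(2) by (metis image_eqI)
      fix x y assume "x \<in> L_class ` V" "y \<in> L_class ` V"
      then obtain v w where vw: "v \<in> V" "x = L_class v" "w \<in> V" "y = L_class w" by blast
      show "x \<oplus>\<^bsub>L_module\<^esub> y \<in> L_class ` V"
        unfolding vw lc(2)[OF VD(1)[OF vw(1)] VD(1)[OF vw(3)], symmetric] by (rule imageI[OF VD(3)[OF vw(1,3)]])
    next
      fix q :: "'k fps3" and x :: "(nat \<Rightarrow> 'k fps3) set" assume q: "q \<in> carrier S_ring" and "x \<in> L_class ` V"
      then obtain v where v: "v \<in> V" "x = L_class v" by blast
      have "q \<odot>\<^bsub>L_module\<^esub> L_class v = L_class (q \<odot>\<^bsub>?F\<^esub> v)" using lc(3)[OF q VD(1)[OF v(1)]] by simp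
      then show "q \<odot>\<^bsub>L_module\<^esub> x \<in> L_class ` V" unfolding v using imageI[OF VD(4)[OF q v(1)]] by simp
    qed
    moreover have "{i \<odot>\<^bsub>L_module\<^esub> l | i l. i \<in> carrier S_ring \<and> R_proj i = \<zero>\<^bsub>R_ring\<^esub> \<and> l \<in> carrier L_module} \<subseteq> L_class ` V"
    proof clarify
      fix i :: "'k fps3" and l :: "(nat \<Rightarrow> 'k fps3) set"
      assume i: "i \<in> carrier S_ring" "R_proj i = \<zero>\<^bsub>R_ring\<^esub>" and "l \<in> carrier L_module"
      then obtain w where w: "w \<in> carrier ?F" "l = L_class w" unfolding L_class_surj[symmetric] by blast
      have "proj_vec (i \<odot>\<^bsub>?F\<^esub> w) = \<zero>\<^bsub>free_module R_ring {..<2}\<^esub>"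
        using pc(3)[OF i(1) w(1)] i(2) RF.smult_l_null[OF pc(1)[OF w(1)]] by simp
      then have "i \<odot>\<^bsub>?F\<^esub> w \<in> V" unfolding V_def using SF.smult_closed[OF i(1) w(1)] RD(2) by simp
      moreover have "i \<odot>\<^bsub>L_module\<^esub> l = L_class (i \<odot>\<^bsub>?F\<^esub> w)" using lc(3)[OF i(1) w(1)] w(2) by simp
      ultimately show "i \<odot>\<^bsub>L_module\<^esub> l \<in> L_class ` V" by simp
    qed
    ultimately have "kernel_mult S_ring R_ring R_proj L_module \<subseteq> L_class ` V"
      unfolding kernel_mult_def by (rule LB.L.span_minimal)
    moreover assume "L_class s \<in> kernel_mult S_ring R_ring R_proj L_module"
    ultimately obtain w where w: "w \<in> V" "L_class s = L_class w" by blast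
    have wc: "w \<in> carrier ?F" using VD(1)[OF w(1)] .
    have d: "s \<ominus>\<^bsub>?F\<^esub> w \<in> S_relations"
      using SF.coset_eq_iff[OF S_relations_submodule s wc] w(2) by (simp add: L_class_def)
    have "proj_vec (s \<ominus>\<^bsub>?F\<^esub> w) \<oplus>\<^bsub>free_module R_ring {..<2}\<^esub> proj_vec w = proj_vec ((s \<ominus>\<^bsub>?F\<^esub> w) \<oplus>\<^bsub>?F\<^esub> w)"
      using pc(2)[OF SF.M.minus_closed[OF s wc] wc] by simp
    also have "(s \<ominus>\<^bsub>?F\<^esub> w) \<oplus>\<^bsub>?F\<^esub> w = s" using s wc by (simp add: SF.M.minus_eq SF.M.a_assoc SF.M.l_neg)
    finally show "proj_vec s \<in> R_relations"
      using RD(3)[OF proj_vec_S_relations[OF d], of "proj_vec w"] w(1) by (simp add: V_def)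
  }
qed

lemma M_isomorphic_base_change:
  "module_isomorphic R_ring (M_module :: ('k::field fps3 set, _) module) (tensor S_ring R_ring R_proj L_module (ring_module R_ring))"
proof (rule module_isomorphic_of_same_kernel[OF S.free_module_module M_module_module LB.T_module R.surj])
  have "semilinear S_ring (id \<circ> R_proj) (free_module S_ring {..<2}) M_module (M_class \<circ> proj_vec :: _ \<Rightarrow> (nat \<Rightarrow> 'k fps3 set) set)"
    by (rule semilinear_comp[OF proj_vec_semilinear M_class_semilinear R.phi_closed])
  then show "semilinear S_ring R_proj (free_module S_ring {..<2}) M_module (M_class \<circ> proj_vec :: _ \<Rightarrow> (nat \<Rightarrow> 'k fps3 set) set)" by simp
  show "(M_class \<circ> proj_vec) ` carrier (free_module S_ring {..<2}) = carrier (M_module :: ('k fps3 set, _) module)"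
    by (simp only: image_comp[symmetric] proj_vec_surj M_class_surj)
  have "semilinear S_ring (R_proj \<circ> id) (free_module S_ring {..<2}) LB.T (unit_tensor S_ring R_ring R_proj (L_module :: ('k fps3, _) module) \<circ> L_class)"
    by (rule semilinear_comp[OF L_class_semilinear LB.unit_tensor_semilinear]) simp
  then show "semilinear S_ring R_proj (free_module S_ring {..<2}) LB.T (unit_tensor S_ring R_ring R_proj (L_module :: ('k fps3, _) module) \<circ> L_class)" by simp
  show "(unit_tensor S_ring R_ring R_proj (L_module :: ('k fps3, _) module) \<circ> L_class) ` carrier (free_module S_ring {..<2}) = carrier LB.T"
    by (simp only: image_comp[symmetric] L_class_surj LB.unit_tensor_surj)
  fix s :: "nat \<Rightarrow> 'k fps3" assume s: "s \<in> carrier (free_module S_ring {..<2})"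
  have "(M_class \<circ> proj_vec) s = \<zero>\<^bsub>M_module\<^esub> \<longleftrightarrow> proj_vec s \<in> R_relations"
    using M_class_eq_zero_iff[OF semilinearD(1)[OF proj_vec_semilinear s]] by simp
  also have "\<dots> \<longleftrightarrow> (unit_tensor S_ring R_ring R_proj L_module \<circ> L_class) s = \<zero>\<^bsub>LB.T\<^esub>"
    using LB.unit_tensor_eq_zero_iff[OF semilinearD(1)[OF L_class_semilinear s]] kernel_mult_L_class[OF s] by simp
  finally show "(M_class \<circ> proj_vec) s = \<zero>\<^bsub>M_module\<^esub> \<longleftrightarrow> (unit_tensor S_ring R_ring R_proj L_module \<circ> L_class) s = \<zero>\<^bsub>LB.T\<^esub>" .
qed

lemma L_module_fin_gen: "fin_gen_module S_ring (L_module :: ('k::field fps3, _) module)"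
proof -
  let ?F = "free_module S_ring {..<2} :: ('k fps3, nat \<Rightarrow> 'k fps3) module"
  define A :: "(nat \<Rightarrow> 'k fps3) set set" where "A = (\<lambda>i. L_class (basis_vec S_ring i)) ` {..<2}"
  note lc = semilinearD[OF L_class_semilinear]
  have A: "A \<subseteq> carrier L_module" unfolding A_def using lc(1)[OF S.basis_vec_closed] by blast
  have sp: "submodule (module_span S_ring L_module A) S_ring L_module" by (rule LB.L.span_submodule[OF A])
  have "submodule {w \<in> carrier ?F. L_class w \<in> module_span S_ring L_module A} S_ring ?F"
    by (rule submodule_vimage[OF S.free_module_module L_module_module _ L_class_semilinear sp]) simp
  then have "carrier ?F \<subseteq> {w \<in> carrier ?F. L_class w \<in> module_span S_ring L_module A}"
  proof (rule S.free_module_span)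
    fix b :: nat assume b: "b \<in> {..<2}"
    then have "L_class (basis_vec S_ring b) \<in> A" unfolding A_def by (rule imageI)
    then show "basis_vec S_ring b \<in> {w \<in> carrier ?F. L_class w \<in> module_span S_ring L_module A}"
      using S.basis_vec_closed[OF b] subsetD[OF LB.L.span_superset, of _ A] by simp
  qed
  then have "L_class ` carrier ?F \<subseteq> module_span S_ring L_module A" by blast
  then have "module_span S_ring L_module A = carrier L_module"
    using LB.L.submodule_closed(1)[OF sp] unfolding L_class_surj by blast
  moreover have "finite A" by (simp add: A_def)
  ultimately show ?thesis using A by (auto simp: fin_gen_module_def)
qed

section \<open>Prime ideals of S\<close>

definition S_max :: "'k::field fps3 set" where "S_max = {s. coeff_one s = 0}"

text \<open>The ideal (x, y), described as the kernel of restriction to the z-axis, so that its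
  primality comes from the domain k[[z]].\<close>

definition S_axis :: "'k::field fps3 set" where "S_axis = {s. \<forall>n. fps_nth (fps_nth (fps_nth s n) 0) 0 = 0}"

lemma S_idealI:
  assumes "0 \<in> I" "\<And>a b. a \<in> I \<Longrightarrow> b \<in> I \<Longrightarrow> a + b \<in> I" "\<And>r a. a \<in> I \<Longrightarrow> r * a \<in> I"
  shows "ideal (I :: 'k::field fps3 set) S_ring"
  by (rule S.cring_idealI) (use assms in auto)

lemma S_primeI:
  assumes "ideal I S_ring" "1 \<notin> I" "\<And>a b. a * b \<in> I \<Longrightarrow> a \<in> I \<or> b \<in> I"
  shows "primeideal (I :: 'k::field fps3 set) S_ring"
  by (rule primeidealI[OF assms(1) S_ring_cring]) (use assms(2,3) in auto)

lemma S_primeD: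
  assumes "primeideal (P :: 'k::field fps3 set) S_ring"
  shows "a \<in> P \<Longrightarrow> b \<in> P \<Longrightarrow> a + b \<in> P" "a \<in> P \<Longrightarrow> r * a \<in> P" "1 \<notin> P" "a * b \<in> P \<Longrightarrow> a \<in> P \<or> b \<in> P" "0 \<in> P"
  using S.ideal_closed[OF primeideal.axioms(1)[OF assms]] S.one_notin_prime[OF assms] primeideal.I_prime[OF assms, of a b]
  by auto

lemma S_max_prime: "primeideal (S_max :: 'k::field fps3 set) S_ring"
  by (rule S_primeI, rule S_idealI) (auto simp: S_max_def coeff_add coeff_mult coeff_var)

lemma S_prime_subset_max:
  assumes "primeideal (P :: 'k::field fps3 set) S_ring"
  shows "P \<subseteq> S_max"
proof
  fix s assume s: "s \<in> P"
  show "s \<in> S_max"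
  proof (rule ccontr)
    assume "s \<notin> S_max"
    then obtain t where "t * s = 1" using S_unit[of s] by (auto simp: S_max_def)
    then show False using S_primeD(2)[OF assms s, of t] S_primeD(3)[OF assms] by simp
  qed
qed

lemma S_max_subset_prime:
  assumes P: "primeideal (P :: 'k::field fps3 set) S_ring" and v: "var_x \<in> P" "var_y \<in> P" "var_z \<in> P"
  shows "S_max \<subseteq> P"
proof
  fix s :: "'k fps3" assume "s \<in> S_max"
  then obtain a b c where s: "s = var_x * a + var_y * b + var_z * c" using S_decomp[of s] by (auto simp: S_max_def)
  have "a * var_x + b * var_y + c * var_z \<in> P" by (intro S_primeD(1)[OF P] S_primeD(2)[OF P] v)
  then show "s \<in> P" unfolding s by (simp add: mult.commute)
qed

definition on_axis :: "'k::field fps3 \<Rightarrow> 'k fps" where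
  "on_axis s = Abs_fps (\<lambda>n. fps_nth (fps_nth (fps_nth s n) 0) 0)"

lemma on_axis_simps:
  "on_axis (s + t) = on_axis s + on_axis t" "on_axis (s * t) = on_axis s * on_axis (t :: 'k::field fps3)"
  "on_axis (1 :: 'k fps3) = 1"
  by (auto intro!: fps_ext simp: on_axis_def fps_mult_nth fps_sum_nth fps_one_nth)

lemma S_axis_iff: "s \<in> S_axis \<longleftrightarrow> on_axis s = 0"
  by (auto simp: S_axis_def on_axis_def fps_eq_iff)

lemma S_axis_prime: "primeideal (S_axis :: 'k::field fps3 set) S_ring"
proof (rule S_primeI, rule S_idealI)
  have "on_axis 0 = (0 :: 'k fps)" by (auto intro!: fps_ext simp: on_axis_def)
  then show "0 \<in> (S_axis :: 'k fps3 set)" by (simp add: S_axis_iff)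
qed (auto simp: S_axis_iff on_axis_simps)

text \<open>In each power of z, the terms divisible by y are split off first, then the terms free of
  y that are divisible by x; the rest is the restriction to the z-axis.\<close>

lemma S_decomp_axis:
  fixes s :: "'k::field fps3"
  obtains a b where "s = var_x * a + var_y * b + Abs_fps (\<lambda>n. fps_const (fps_const (fps_nth (on_axis s) n)))"
proof
  show "s = var_x * Abs_fps (\<lambda>n. fps_const (fps_shift 1 (fps_nth (fps_nth s n) 0))) + var_y * Abs_fps (\<lambda>n. fps_shift 1 (fps_nth s n))
    + Abs_fps (\<lambda>n. fps_const (fps_const (fps_nth (on_axis s) n)))"
  proof (rule fps_ext)
    fix n
    let ?t = "fps_nth s n"
    have "?t = fps_const (fps_nth ?t 0) + fps_X * fps_shift 1 ?t" by (rule fps_eq_const_plus)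
    also have "fps_nth ?t 0 = fps_const (fps_nth (fps_nth ?t 0) 0) + fps_X * fps_shift 1 (fps_nth ?t 0)"
      by (rule fps_eq_const_plus)
    finally show "fps_nth s n = fps_nth (var_x * Abs_fps (\<lambda>n. fps_const (fps_shift 1 (fps_nth (fps_nth s n) 0)))
        + var_y * Abs_fps (\<lambda>n. fps_shift 1 (fps_nth s n)) + Abs_fps (\<lambda>n. fps_const (fps_const (fps_nth (on_axis s) n)))) n"
      by (simp add: var_x_def var_y_def on_axis_def add_ac flip: fps_const_add fps_const_mult)
  qed
qed

text \<open>The primes containing \<open>x\<close> and \<open>y\<close> come from the discrete valuation ring \<open>k[[z]]\<close>.\<close>

lemma S_primes_over_xy:
  assumes P: "primeideal (P :: 'k::field fps3 set) S_ring" and v: "var_x \<in> P" "var_y \<in> P"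
  shows "P = S_axis \<or> P = S_max"
proof -
  have xy: "var_x * a + var_y * b \<in> P" for a b
    using S_primeD(1)[OF P S_primeD(2)[OF P v(1), of a] S_primeD(2)[OF P v(2), of b]] by (simp add: mult.commute)
  have "S_axis \<subseteq> P"
  proof
    fix s :: "'k fps3" assume "s \<in> S_axis"
    moreover obtain a b where "s = var_x * a + var_y * b + Abs_fps (\<lambda>n. fps_const (fps_const (fps_nth (on_axis s) n)))"
      by (rule S_decomp_axis)
    moreover have "Abs_fps (\<lambda>n. fps_const (fps_const (0 :: 'k))) = 0" by (rule fps_ext) simp
    ultimately show "s \<in> P" using xy[of a b] by (simp add: S_axis_iff)
  qed
  moreover have "S_max \<subseteq> P" if "s \<in> P" "s \<notin> S_axis" for s
  proof -
    obtain a b where s: "s = var_x * a + var_y * b + Abs_fps (\<lambda>n. fps_const (fps_const (fps_nth (on_axis s) n)))"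
      by (rule S_decomp_axis)
    \<comment> \<open>The restriction of \<open>s\<close> to the z-axis, viewed in S. It lies in
      \<open>P\<close> and equals \<open>var_z ^ k\<close> times a unit, where \<open>k\<close> is
      its order; so \<open>P\<close> contains z.\<close>
    define t where "t = Abs_fps (\<lambda>n. fps_const (fps_const (fps_nth (on_axis s) n)))"
    define k where "k = subdegree (on_axis s)"
    have nz: "on_axis s \<noteq> 0" using that(2) by (simp add: S_axis_iff)
    define u where "u = fps_shift k t"
    have t: "t = var_z ^ k * u"
    proof (rule fps_ext)
      fix n
      show "fps_nth t n = fps_nth (var_z ^ k * u) n"
        using nth_less_subdegree_zero[of n "on_axis s"]
        by (simp add: var_z_def u_def t_def k_def fps_X_power_mult_nth)
    qed
    have "coeff_one u \<noteq> 0" using nz nth_subdegree_nonzero[OF nz] by (simp add: u_def t_def k_def coeff_one_def)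
    then obtain w where w: "w * u = 1" using S_unit by blast
    have "s + (- 1) * (var_x * a + var_y * b) \<in> P" by (intro S_primeD(1)[OF P that(1)] S_primeD(2)[OF P] xy)
    moreover have "s + (- 1) * (var_x * a + var_y * b) = t" using s unfolding t_def by (simp add: algebra_simps)
    ultimately have "w * t \<in> P" using S_primeD(2)[OF P] by simp
    moreover have "w * t = var_z ^ k" using w by (simp add: t mult.left_commute)
    ultimately have "var_z ^ k \<in> P" by simp
    then have "var_z \<in> P" by (induction k) (use S_primeD(3,4)[OF P] in auto)
    then show ?thesis using S_max_subset_prime[OF P v] by blast
  qed
  ultimately show ?thesis using S_prime_subset_max[OF P] by blast
qed

section \<open>Dimensions of S and R\<close>

lemma zero_le_Sup_chain:
  assumes "primeideal P R" "I \<subseteq> P"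
  shows "0 \<le> Sup {ereal (real n) | n. \<exists>P. prime_chain R n P \<and> I \<subseteq> P 0}"
proof -
  have "prime_chain R 0 (\<lambda>_. P)" using assms(1) by (simp add: prime_chain_def)
  then have "ereal (real 0) \<in> {ereal (real n) | n. \<exists>P. prime_chain R n P \<and> I \<subseteq> P 0}" using assms(2) by blast
  from Sup_upper[OF this] show ?thesis by (simp add: zero_ereal_def)
qed

lemma R_ideal_subset:
  assumes P: "ideal P S_ring" and q: "(quadric :: 'k::field fps3) \<in> P"
  shows "R_ideal \<subseteq> P"
  using S.ideal_closed(4)[OF P _ q] by (auto simp: R_ideal_iff)

lemma krull_dim_R: "krull_dim (R_ring :: 'k::field fps3 set ring) =
    Sup {ereal (real n) | n. \<exists>P. prime_chain (S_ring :: 'k fps3 ring) n P \<and> R_ideal \<subseteq> P 0}"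
  unfolding R_ring_def by (rule S.krull_dim_quot[OF R_ideal])

lemma krull_dim_R_nonneg: "0 \<le> krull_dim (R_ring :: 'k::field fps3 set ring)"
  unfolding krull_dim_R
  by (rule zero_le_Sup_chain[OF S_max_prime]) (auto simp: S_max_def dest: coeff_R_ideal)

text \<open>With its top raised to the maximal ideal, a chain in S can be rerouted so that all its
  primes contain the quadric, at the cost of one step; what remains is a chain for R.\<close>

lemma krull_dim_S_le: "krull_dim (S_ring :: 'k::field fps3 ring) \<le> krull_dim (R_ring :: 'k fps3 set ring) + 1"
  unfolding krull_dim_prime_chain[of S_ring]
proof (rule Sup_least, clarify)
  fix n and P :: "nat \<Rightarrow> 'k fps3 set" assume P: "prime_chain S_ring n P"
  show "ereal (real n) \<le> krull_dim (R_ring :: 'k fps3 set ring) + 1"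
  proof (cases n)
    case 0
    then show ?thesis using add_mono[OF krull_dim_R_nonneg, of 0 1] by (simp add: zero_ereal_def)
  next
    case (Suc k)
    have "primeideal (P n) S_ring" using P by (simp add: prime_chain_def)
    then have c: "prime_chain S_ring (Suc k) (P(Suc k := S_max))"
      using prime_chain_raise_top[OF P S_max_prime] S_prime_subset_max unfolding Suc by blast
    have "quadric \<in> (P(Suc k := S_max)) (Suc k)" by (simp add: S_max_def coeff_quadric)
    from S.prime_chain_through[OF S_ring_noetherian c this]
    obtain P' :: "nat \<Rightarrow> 'k fps3 set" where P': "prime_chain S_ring k P'" "quadric \<in> P' 0" by blast
    then have "R_ideal \<subseteq> P' 0" by (intro R_ideal_subset primeideal.axioms(1)) (auto simp: prime_chain_def)
    then have "ereal (real k) \<le> krull_dim (R_ring :: 'k fps3 set ring)"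
      unfolding krull_dim_R using P'(1) by (intro Sup_upper) blast
    then have "ereal (real k) + 1 \<le> krull_dim (R_ring :: 'k fps3 set ring) + 1" by (rule add_right_mono)
    then show ?thesis by (simp add: Suc one_ereal_def add.commute)
  qed
qed

lemma quadric_nonzero: "(quadric :: 'k::field fps3) \<noteq> 0"
proof
  assume "(quadric :: 'k fps3) = 0"
  then have "on_axis (var_z ^ 2 :: 'k fps3) = on_axis (var_x * var_y :: 'k fps3)" by (simp add: quadric_def)
  moreover have "on_axis (var_x :: 'k fps3) = 0" by (auto intro!: fps_ext simp: on_axis_def var_x_def)
  moreover have "on_axis (var_z :: 'k fps3) = fps_X" by (auto intro!: fps_ext simp: on_axis_def var_z_def)
  ultimately show False by (simp add: on_axis_simps power2_eq_square)
qed

lemma prime_chain_cons: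
  assumes P: "prime_chain R n P" and q: "primeideal q R" "q \<subset> P 0"
  shows "prime_chain R (Suc n) (\<lambda>i. case i of 0 \<Rightarrow> q | Suc j \<Rightarrow> P j)"
  using assms unfolding prime_chain_def by (auto split: nat.split)

text \<open>S is a domain and the quadric is nonzero, so a chain above \<open>R_ideal\<close>
  extends downwards by the zero ideal. The Serre condition involves only the difference of the two
  dimensions, so neither value is computed.\<close>

lemma krull_dim_S: "krull_dim (S_ring :: 'k::field fps3 ring) = krull_dim (R_ring :: 'k fps3 set ring) + 1"
proof (rule antisym[OF krull_dim_S_le])
  have zp: "primeideal {0 :: 'k fps3} S_ring"
    by (rule S_primeI, rule S_idealI) auto
  have step: "ereal (real n) + 1 \<le> krull_dim (S_ring :: 'k fps3 ring)"
    if P: "prime_chain S_ring n P" "R_ideal \<subseteq> P 0" for n and P :: "nat \<Rightarrow> 'k fps3 set"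
  proof -
    have "(quadric :: 'k fps3) \<in> R_ideal" unfolding R_ideal_iff by (rule exI[of _ 1]) simp
    then have "quadric \<in> P 0" using P(2) by blast
    moreover have "0 \<in> P 0" using P(1) by (intro S_primeD(5)) (simp add: prime_chain_def)
    ultimately have "{0} \<subset> P 0" using quadric_nonzero by auto
    from prime_chain_cons[OF P(1) zp this] have "ereal (real (Suc n)) \<le> krull_dim (S_ring :: 'k fps3 ring)"
      unfolding krull_dim_prime_chain by (intro Sup_upper) blast
    then show ?thesis by (simp add: one_ereal_def add.commute)
  qed
  show "krull_dim (R_ring :: 'k fps3 set ring) + 1 \<le> krull_dim (S_ring :: 'k fps3 ring)"
  \<comment> \<open>For finite dimension the bound on each chain can be rewritten with 1 subtracted
    and passed to the supremum. Dimension minus infinity is excluded by the one-element chain at the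
    maximal ideal.\<close>
  proof (cases "krull_dim (S_ring :: 'k fps3 ring)")
    case (real d)
    have "krull_dim (R_ring :: 'k fps3 set ring) \<le> ereal (d - 1)"
      unfolding krull_dim_R
    proof (rule Sup_least, clarify)
      fix n and P :: "nat \<Rightarrow> 'k fps3 set" assume "prime_chain S_ring n P" "R_ideal \<subseteq> P 0"
      from step[OF this] show "ereal (real n) \<le> ereal (d - 1)" unfolding real by (simp add: one_ereal_def)
    qed
    then have "krull_dim (R_ring :: 'k fps3 set ring) + 1 \<le> ereal (d - 1) + 1" by (rule add_right_mono)
    then show ?thesis unfolding real by (simp add: one_ereal_def)
  next
    case MInf
    then show ?thesis using krull_dim_S_le[where 'k = 'k] step[of 0 "\<lambda>_. S_max"] S_max_prime
      by (auto simp: prime_chain_def S_max_def one_ereal_def dest: coeff_R_ideal)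
  qed simp
qed

section \<open>Annihilators and dimensions of L and M\<close>

lemma L_relations:
  fixes l1 l2 :: "(nat \<Rightarrow> 'k::field fps3) set"
  defines "l1 \<equiv> L_class (basis_vec S_ring 0)" and "l2 \<equiv> L_class (basis_vec S_ring 1)"
  assumes a: "a \<in> {var_x, var_y}"
  shows "a * a \<odot>\<^bsub>L_module\<^esub> l1 = \<zero>\<^bsub>L_module\<^esub>" "a * a \<odot>\<^bsub>L_module\<^esub> l2 = \<zero>\<^bsub>L_module\<^esub>"
proof -
  let ?F = "free_module S_ring {..<2} :: ('k fps3, nat \<Rightarrow> 'k fps3) module"
  have e: "basis_vec S_ring i \<in> carrier ?F" if "i < 2" for i using that by (intro S.basis_vec_closed) simp
  have s: "c \<odot>\<^bsub>L_module\<^esub> L_class (basis_vec S_ring i) = \<zero>\<^bsub>L_module\<^esub>"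
    if "i < 2" "(\<lambda>j. if j = i then c else 0) \<in> S_relations" for i and c :: "'k fps3"
  proof -
    have w: "c \<odot>\<^bsub>?F\<^esub> basis_vec S_ring i = (\<lambda>j. if j = i then c else 0)" by (auto simp: free_module_simps basis_vec_def)
    have "L_class (c \<odot>\<^bsub>?F\<^esub> basis_vec S_ring i) = \<zero>\<^bsub>L_module\<^esub>"
      using L_class_eq_zero_iff[OF SF.smult_closed[OF _ e[OF that(1)], of c]] that(2) unfolding w by simp
    then show ?thesis using semilinearD(3)[OF L_class_semilinear _ e[OF that(1)], of c] by simp
  qed
  have c: "(\<lambda>j. if j = i then c else 0) \<in> carrier ?F" if "i < 2" for i and c :: "'k fps3"
    using that by (intro S.free_module_lessThanI) auto
  \<comment> \<open>The witnesses are combinations of columns: x times the first minus y times the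
    second is (x^2, 0), x times the second is (0, x^2), y times the fourth is (y^2, 0), and y times
    the third minus z times the fourth is (0, y^2).\<close>
  have "(\<lambda>j. if j = 0 then var_x * var_x else 0) \<in> (S_relations :: (nat \<Rightarrow> 'k fps3) set)"
    by (rule S_relationsI[OF c, where a = var_x and b = "- var_y" and c = 0 and d = 0]) simp_all
  moreover have "(\<lambda>j. if j = 1 then var_x * var_x else 0) \<in> (S_relations :: (nat \<Rightarrow> 'k fps3) set)"
    by (rule S_relationsI[OF c, where a = 0 and b = "var_x" and c = 0 and d = 0]) simp_all
  moreover have "(\<lambda>j. if j = 0 then var_y * var_y else 0) \<in> (S_relations :: (nat \<Rightarrow> 'k fps3) set)"
    by (rule S_relationsI[OF c, where a = 0 and b = 0 and c = 0 and d = var_y]) simp_all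
  moreover have "(\<lambda>j. if j = 1 then var_y * var_y else 0) \<in> (S_relations :: (nat \<Rightarrow> 'k fps3) set)"
    by (rule S_relationsI[OF c, where a = 0 and b = 0 and c = var_y and d = "- var_z"]) (simp_all add: algebra_simps)
  ultimately show "a * a \<odot>\<^bsub>L_module\<^esub> l1 = \<zero>\<^bsub>L_module\<^esub>" "a * a \<odot>\<^bsub>L_module\<^esub> l2 = \<zero>\<^bsub>L_module\<^esub>"
    using a s[of 0] s[of 1] unfolding l1_def l2_def by auto
qed

lemma square_in_annihilator_L:
  assumes "a \<in> {var_x, var_y}"
  shows "a * a \<in> annihilator S_ring (L_module :: ('k::field fps3, _) module)"
proof (rule annihilatorI[OF L_module_module L_class_semilinear L_class_surj])
  fix i :: nat assume "i \<in> {..<2}"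
  then have "i = 0 \<or> i = 1" by auto
  then show "a * a \<odot>\<^bsub>L_module\<^esub> L_class (basis_vec S_ring i) = \<zero>\<^bsub>L_module\<^esub>"
    using L_relations[OF assms] by auto
qed simp

text \<open>The second row of the matrix has its entries in (x, y), so a multiple of the second
  basis vector can be a relation only if the factor lies in (x, y).\<close>

lemma annihilator_L_subset: "annihilator S_ring (L_module :: ('k::field fps3, _) module) \<subseteq> S_axis"
proof
  let ?F = "free_module S_ring {..<2} :: ('k fps3, nat \<Rightarrow> 'k fps3) module"
  fix s :: "'k fps3" assume s: "s \<in> annihilator S_ring L_module"
  have e: "basis_vec S_ring 1 \<in> carrier ?F" by (intro S.basis_vec_closed) simp
  have "L_class (basis_vec S_ring 1 :: nat \<Rightarrow> 'k fps3) \<in> carrier L_module" using semilinearD(1)[OF L_class_semilinear e] .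
  then have "s \<odot>\<^bsub>L_module\<^esub> L_class (basis_vec S_ring 1) = \<zero>\<^bsub>L_module\<^esub>" using s by (simp add: annihilator_def)
  then have "s \<odot>\<^bsub>?F\<^esub> basis_vec S_ring 1 \<in> S_relations"
    using L_class_eq_zero_iff[OF SF.smult_closed[OF _ e, of s]] semilinearD(3)[OF L_class_semilinear _ e, of s] by simp
  then obtain a b c where "(s \<odot>\<^bsub>?F\<^esub> basis_vec S_ring 1) 1 = var_y * a + var_x * b + var_y * c" by (rule S_relationsE)
  then have "s = var_y * a + var_x * b + var_y * c" by (simp add: free_module_simps(4) basis_vec_def)
  moreover have "on_axis (var_x :: 'k fps3) = 0" "on_axis (var_y :: 'k fps3) = 0"
    by (auto intro!: fps_ext simp: on_axis_def var_x_def var_y_def)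
  ultimately show "s \<in> S_axis" by (simp add: S_axis_iff on_axis_simps)
qed

lemma S_axis_less_max: "(S_axis :: 'k::field fps3 set) \<subset> S_max"
proof -
  have "(var_z :: 'k fps3) \<in> S_max" by (simp add: S_max_def coeff_var)
  moreover have "(var_z :: 'k fps3) \<notin> S_axis" by (auto simp: S_axis_def var_z_def intro!: exI[of _ 1])
  ultimately show ?thesis using S_prime_subset_max[OF S_axis_prime] by blast
qed

lemma module_dim_L: "module_dim S_ring (L_module :: ('k::field fps3, _) module) = 1"
proof -
  let ?A = "annihilator S_ring (L_module :: ('k fps3, _) module)"
  have pr: "P = S_axis \<or> P = S_max" if P: "primeideal P S_ring" "?A \<subseteq> P" for P :: "'k fps3 set"
  proof (rule S_primes_over_xy[OF P(1)])
    show "var_x \<in> P" using S_primeD(4)[OF P(1), of var_x var_x] square_in_annihilator_L[of var_x] P(2) by auto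
    show "var_y \<in> P" using S_primeD(4)[OF P(1), of var_y var_y] square_in_annihilator_L[of var_y] P(2) by auto
  qed
  have "krull_dim (S_ring Quot ?A) = Sup {ereal (real n) | n. \<exists>P. prime_chain S_ring n P \<and> ?A \<subseteq> P 0}"
    by (rule S.krull_dim_quot[OF LB.L.annihilator_ideal])
  also have "\<dots> = 1"
  proof (rule antisym)
    show "Sup {ereal (real n) | n. \<exists>P. prime_chain S_ring n P \<and> ?A \<subseteq> P 0} \<le> 1"
    proof (rule Sup_least, clarify)
      fix n P assume P: "prime_chain S_ring n P" "?A \<subseteq> P 0"
      have "n < 2"
      proof (rule ccontr)
        assume "\<not> n < 2"
        then have lt: "P 0 \<subset> P 1" "P 1 \<subset> P 2" and p: "primeideal (P 0) S_ring" "primeideal (P 1) S_ring" "primeideal (P 2) S_ring"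
          using P(1) by (auto simp: prime_chain_def numeral_2_eq_2)
        then have "?A \<subseteq> P 1" "?A \<subseteq> P 2" using P(2) by auto
        then show False using pr[OF p(1) P(2)] pr[OF p(2)] pr[OF p(3)] lt S_axis_less_max by auto
      qed
      then show "ereal (real n) \<le> 1" by (simp add: one_ereal_def)
    qed
    have "prime_chain S_ring 1 (\<lambda>i. if i = 0 then S_axis else S_max :: 'k fps3 set)"
      using S_axis_prime S_max_prime S_axis_less_max by (auto simp: prime_chain_def)
    then have "ereal (real 1) \<in> {ereal (real n) | n. \<exists>P. prime_chain S_ring n P \<and> ?A \<subseteq> P 0}"
      using annihilator_L_subset by (intro CollectI exI[of _ 1] conjI refl exI[of _ "\<lambda>i. if i = 0 then S_axis else S_max"]) auto
    from Sup_upper[OF this] show "1 \<le> Sup {ereal (real n) | n. \<exists>P. prime_chain S_ring n P \<and> ?A \<subseteq> P 0}"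
      by (simp add: one_ereal_def)
  qed
  finally show ?thesis by (simp add: module_dim_def)
qed

definition R_max :: "'k::field fps3 set set" where "R_max = {r \<in> carrier R_ring. on_R coeff_one r = 0}"

lemma R_proj_R_max: "R_proj s \<in> R_max \<longleftrightarrow> (s :: 'k::field fps3) \<in> S_max"
  by (simp add: R_max_def S_max_def on_R_proj)

lemma R_max_prime: "primeideal (R_max :: 'k::field fps3 set set) R_ring"
proof -
  have "R_max = R_proj ` (S_max :: 'k fps3 set)"
    using R_proj_R_max by (auto simp: R_max_def carrier_R)
  moreover interpret surj_ring_hom "S_ring :: 'k fps3 ring" R_ring R_proj
    using R.surj R.hom by unfold_locales
  have "{r \<in> carrier S_ring. R_proj r = \<zero>\<^bsub>R_ring\<^esub>} \<subseteq> (S_max :: 'k fps3 set)"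
    using coeff_R_ideal(1) by (auto simp: R_proj_zero_iff S_max_def)
  then have "primeideal (R_proj ` (S_max :: 'k fps3 set)) R_ring" by (rule image_prime[OF S_max_prime])
  ultimately show ?thesis by simp
qed

lemma annihilator_MI:
  "(\<And>i. i < 2 \<Longrightarrow> r \<odot>\<^bsub>M_module\<^esub> M_class (basis_vec R_ring i) = \<zero>\<^bsub>M_module\<^esub>) \<Longrightarrow> r \<in> carrier R_ring \<Longrightarrow>
    r \<in> annihilator R_ring (M_module :: ('k::field fps3 set, _) module)"
  by (rule annihilatorI[OF M_module_module M_class_semilinear M_class_surj[symmetric]]) auto

lemma square_in_annihilator_M:
  "R_proj (var_x * var_x) \<in> annihilator R_ring (M_module :: ('k::field fps3 set, _) module)"
  "R_proj (var_y * var_y) \<in> annihilator R_ring (M_module :: ('k::field fps3 set, _) module)"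
proof -
  interpret M: Module.module "R_ring :: 'k fps3 set ring" M_module by (rule M_module_module)
  define m1 :: "(nat \<Rightarrow> 'k fps3 set) set" where "m1 = M_class (basis_vec R_ring 0)"
  define m2 :: "(nat \<Rightarrow> 'k fps3 set) set" where "m2 = M_class (basis_vec R_ring 1)"
  have mc: "m1 \<in> carrier M_module" "m2 \<in> carrier M_module"
    unfolding m1_def m2_def M_class_surj by (intro imageI R.R.basis_vec_closed; simp)+
  have rel: "R_proj var_x \<odot>\<^bsub>M_module\<^esub> m1 \<oplus>\<^bsub>M_module\<^esub> R_proj var_y \<odot>\<^bsub>M_module\<^esub> m2 = \<zero>\<^bsub>M_module\<^esub>"
    "R_proj var_x \<odot>\<^bsub>M_module\<^esub> m2 = \<zero>\<^bsub>M_module\<^esub>"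
    "R_proj var_z \<odot>\<^bsub>M_module\<^esub> m1 \<oplus>\<^bsub>M_module\<^esub> R_proj var_y \<odot>\<^bsub>M_module\<^esub> m2 = \<zero>\<^bsub>M_module\<^esub>"
    "R_proj var_y \<odot>\<^bsub>M_module\<^esub> m1 = \<zero>\<^bsub>M_module\<^esub>"
    unfolding m1_def m2_def by (rule M_relations)+
  have mult: "R_proj (s * t) \<odot>\<^bsub>M_module\<^esub> m = R_proj s \<odot>\<^bsub>M_module\<^esub> (R_proj t \<odot>\<^bsub>M_module\<^esub> m)" if "m \<in> carrier M_module" for s t :: "'k fps3" and m
    using that by (simp add: R_proj_simps M.smult_assoc1)
  have mult0: "R_proj (s * t) \<odot>\<^bsub>M_module\<^esub> m = \<zero>\<^bsub>M_module\<^esub>"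
    if "m \<in> carrier M_module" "R_proj t \<odot>\<^bsub>M_module\<^esub> m = \<zero>\<^bsub>M_module\<^esub>" for s t :: "'k fps3" and m
    using that by (simp add: mult)
  have dist: "R_proj s \<odot>\<^bsub>M_module\<^esub> (R_proj a \<odot>\<^bsub>M_module\<^esub> m1 \<oplus>\<^bsub>M_module\<^esub> R_proj b \<odot>\<^bsub>M_module\<^esub> m2)
      = R_proj (s * a) \<odot>\<^bsub>M_module\<^esub> m1 \<oplus>\<^bsub>M_module\<^esub> R_proj (s * b) \<odot>\<^bsub>M_module\<^esub> m2" for s a b :: "'k fps3"
    using mc by (simp add: M.smult_r_distr mult)
  have yx: "R_proj (var_x * var_y) \<odot>\<^bsub>M_module\<^esub> m2 = \<zero>\<^bsub>M_module\<^esub>" using mult0[OF mc(2) rel(2), of var_y] by (simp add: mult.commute)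
  have zy: "R_proj (var_y * var_z) \<odot>\<^bsub>M_module\<^esub> m1 = \<zero>\<^bsub>M_module\<^esub>" using mult0[OF mc(1) rel(4), of var_z] by (simp add: mult.commute)
  \<comment> \<open>Multiplying the first relation by x turns its second term into y (x m2), which
    is zero. Multiplying the third by y likewise leaves y^2 m2.\<close>
  have x1: "R_proj (var_x * var_x) \<odot>\<^bsub>M_module\<^esub> m1 = \<zero>\<^bsub>M_module\<^esub>" using dist[of var_x var_x var_y] rel(1) yx mc by simp
  have y2: "R_proj (var_y * var_y) \<odot>\<^bsub>M_module\<^esub> m2 = \<zero>\<^bsub>M_module\<^esub>" using dist[of var_y var_z var_y] rel(3) zy mc by simp
  have i2: "i < 2 \<Longrightarrow> i = 0 \<or> i = (1 :: nat)" for i by auto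
  show "R_proj (var_x * var_x) \<in> annihilator R_ring (M_module :: ('k::field fps3 set, _) module)"
    by (rule annihilator_MI) (use x1 mult0[OF mc(2) rel(2)] i2 in \<open>auto simp: m1_def m2_def\<close>)
  show "R_proj (var_y * var_y) \<in> annihilator R_ring (M_module :: ('k::field fps3 set, _) module)"
    by (rule annihilator_MI) (use y2 mult0[OF mc(1) rel(4)] i2 in \<open>auto simp: m1_def m2_def\<close>)
qed

text \<open>Applying \<open>M_coeff\<close> to r m1 = 0 leaves the residue of \<open>r\<close>,
  since \<open>M_coeff\<close> is 1 at the first generator.\<close>

lemma annihilator_M_subset: "annihilator R_ring (M_module :: ('k::field fps3 set, _) module) \<subseteq> R_max"
proof
  fix r :: "'k fps3 set" assume r: "r \<in> annihilator R_ring M_module"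
  interpret M: Module.module "R_ring :: 'k fps3 set ring" M_module by (rule M_module_module)
  have e: "basis_vec R_ring 0 \<in> carrier (free_module (R_ring :: 'k fps3 set ring) {..<2 :: nat})"
    by (intro R.R.basis_vec_closed) simp
  define m1 :: "(nat \<Rightarrow> 'k fps3 set) set" where "m1 = M_class (basis_vec R_ring 0)"
  have m1: "m1 \<in> carrier M_module" unfolding m1_def M_class_surj using e by (rule imageI)
  have c1: "M_coeff m1 = 1"
    unfolding m1_def M_coeff_class[OF e] by (simp add: basis_vec_def on_R_proj coeff_var flip: R_proj_simps(4))
  have rc: "r \<in> carrier R_ring" and r0: "r \<odot>\<^bsub>M_module\<^esub> m1 = \<zero>\<^bsub>M_module\<^esub>" using r m1 by (auto simp: annihilator_def)
  have "M_coeff (\<zero>\<^bsub>M_module\<^esub> :: (nat \<Rightarrow> 'k fps3 set) set) = on_R coeff_one (R_proj 0 :: 'k fps3 set) * M_coeff m1"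
    using M_coeff_simps(2)[OF _ m1, of "R_proj 0"] m1 by (simp add: R_proj_simps(3))
  then have "M_coeff (\<zero>\<^bsub>M_module\<^esub> :: (nat \<Rightarrow> 'k fps3 set) set) = 0" by (simp add: on_R_proj coeff_var)
  then have "on_R coeff_one r = 0" using M_coeff_simps(2)[OF rc m1] r0 c1 by simp
  then show "r \<in> R_max" using rc by (simp add: R_max_def)
qed

lemma module_dim_M: "module_dim R_ring (M_module :: ('k::field fps3 set, _) module) = 0"
proof -
  let ?A = "annihilator R_ring (M_module :: ('k fps3 set, _) module)"
  interpret M: Module.module "R_ring :: 'k fps3 set ring" M_module by (rule M_module_module)
  interpret h: surj_ring_hom "S_ring :: 'k fps3 ring" R_ring R_proj
    using R.surj R.hom by unfold_locales
  have pr: "P = R_max" if P: "primeideal P R_ring" "?A \<subseteq> P" for P :: "'k fps3 set set"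
  proof -
    define P' where "P' = {s :: 'k fps3. R_proj s \<in> P}"
    have P': "primeideal P' S_ring" using h.vimage_prime[OF P(1)] by (simp add: P'_def)
    have x: "var_x \<in> P'" using S_primeD(4)[OF P', of var_x var_x] square_in_annihilator_M(1) P(2) by (auto simp: P'_def)
    have y: "var_y \<in> P'" using S_primeD(4)[OF P', of var_y var_y] square_in_annihilator_M(2) P(2) by (auto simp: P'_def)
    \<comment> \<open>In R the equation z^2 = x y forces z into the prime as well. The prime (x, y)
      of S, which accounts for the dimension of L, therefore has no counterpart over the annihilator
      of M.\<close>
    have "R_proj (var_z * var_z :: 'k fps3) = R_proj (var_x * var_y)"
      unfolding R_proj_eq_iff R_ideal_iff by (rule exI[of _ 1]) (simp add: quadric_def power2_eq_square)
    then have "var_z * var_z \<in> P'" using S_primeD(2)[OF P' y, of var_x] by (simp add: P'_def)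
    then have z: "var_z \<in> P'" using S_primeD(4)[OF P'] by blast
    have "P' = S_max" using S_max_subset_prime[OF P' x y z] S_prime_subset_max[OF P'] by blast
    moreover have "P \<subseteq> carrier R_ring" using R.R.ideal_closed(1)[OF primeideal.axioms(1)[OF P(1)]] by blast
    then have "P = R_proj ` P'" unfolding P'_def carrier_R by blast
    moreover have "R_max = R_proj ` (S_max :: 'k fps3 set)" using R_proj_R_max by (auto simp: R_max_def carrier_R)
    ultimately show ?thesis by simp
  qed
  have "krull_dim (R_ring Quot ?A) = Sup {ereal (real n) | n. \<exists>P. prime_chain R_ring n P \<and> ?A \<subseteq> P 0}"
    by (rule R.R.krull_dim_quot[OF M.annihilator_ideal])
  also have "\<dots> = 0"
  proof (rule antisym)
    show "Sup {ereal (real n) | n. \<exists>P. prime_chain R_ring n P \<and> ?A \<subseteq> P 0} \<le> 0"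
    proof (rule Sup_least, clarify)
      fix n P assume P: "prime_chain R_ring n P" "?A \<subseteq> P 0"
      have "n = 0"
      proof (rule ccontr)
        assume "n \<noteq> 0"
        then have lt: "P 0 \<subset> P 1" and p: "primeideal (P 0) R_ring" "primeideal (P 1) R_ring"
          using P(1) by (auto simp: prime_chain_def)
        then have "?A \<subseteq> P 1" using P(2) by auto
        then show False using pr[OF p(1) P(2)] pr[OF p(2)] lt by auto
      qed
      then show "ereal (real n) \<le> 0" by (simp add: zero_ereal_def)
    qed
  qed (rule zero_le_Sup_chain[OF R_max_prime annihilator_M_subset])
  finally show ?thesis by (simp add: module_dim_def)
qed

lemma M_module_Serre_liftable:
  "Serre_liftable (S_ring :: 'k::field fps3 ring) R_ring R_proj M_module"
  unfolding Serre_liftable_def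
proof (rule exI[of _ L_module])
  have "krull_dim (S_ring :: 'k fps3 ring) - 1 = krull_dim (R_ring :: 'k fps3 set ring) - 0"
    unfolding krull_dim_S using krull_dim_R_nonneg[where 'k = 'k]
    by (cases "krull_dim (R_ring :: 'k fps3 set ring)") (simp_all add: one_ereal_def zero_ereal_def)
  then show "is_Serre_lift (S_ring :: 'k fps3 ring) R_ring R_proj M_module L_module"
    by (simp add: is_Serre_lift_def L_module_module L_module_fin_gen M_isomorphic_base_change module_dim_L module_dim_M)
qed

theorem proposition3p3:
  shows "Serre_liftable (S_ring :: 'k::field fps3 ring) R_ring R_proj M_module \<and>
    (\<forall>(Q :: 'q ring) (\<phi> :: 'q \<Rightarrow> 'k fps3 set).
       regular_local_ring Q \<and> \<phi> \<in> ring_hom Q R_ring \<and> \<phi> ` carrier Q = carrier R_ring \<longrightarrow>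
       \<not> (\<exists>L :: ('q, 'l) module. is_lift Q R_ring \<phi> M_module L))"
  using M_module_Serre_liftable M_module_not_liftable by blast

end
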